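(* Let $E$ be a row-finite directed graph with no sources. Let $(H,U)$ be an ideal pair for $E$, let $T$ be a maximal tail of $E$ and take $z\in\{w^{\operatorname{Per}(T)}:w\in\mathbb{T}\}$. Then $J_{H,U}\subseteq I_{T,z}$ if and only if both of the following hold: (a) $H\subseteq E^0\setminus T$; and (b) if $T$ is cyclic and the cycle $\mu$ with no entrance in $T$ belongs to $\mathcal{C}(H)$, then $z\notin U(\mu)$. In particular, $\{v\in E^0:p_v\in J_{H,U}\}=H$.
   Context: A row-finite directed graph $E$ with no sources consists of countable sets $E^0$ (vertices), $E^1$ (edges) and maps $r,s:E^1\to E^0$ with $r$ surjective and finite-to-one. Write $vE^1=\{e\in E^1: r(e)=v\}$. A path of length $n>0$ is a string $\mu=e_1\cdots e_n$ of edges with $s(e_i)=r(e_{i+1})$; $r(\mu)=r(e_1)$, $s(\mu)=s(e_n)$, $|\mu|=n$; vertices are paths of length $0$. $E^*$ is the set of finite paths, $vE^*=\{\mu\in E^*:r(\mu)=v\}$. $C^*(E)$ is the universal $C^*$-algebra generated by projections $p_v$ ($v\in E^0$), mutually orthogonal, and partial isometries $s_e$ ($e\in E^1$) with $s_e^*s_e=p_{s(e)}$ and $p_v=\sum_{r(e)=v}s_es_e^*$; for a path $\mu=e_1\cdots e_n$, $s_\mu:=s_{e_1}\cdots s_{e_n}$. "Ideal" means closed two-sided ideal. $\mathbb{T}$ is the unit circle in $\mathbb{C}$. A maximal tail is a nonempty set $T\subseteq E^0$ such that: (T1) if $e\in E^1$ and $s(e)\in T$ then $r(e)\in T$; (T2)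 if $v\in T$ there is $e\in vE^1$ with $s(e)\in T$; (T3) if $v,w\in T$ there are $\mu\in vE^*$, $\nu\in wE^*$ with $s(\mu)=s(\nu)\in T$. A set $H\subseteq E^0$ is hereditary if $r(e)\in H$ implies $s(e)\in H$ for $e\in E^1$, and saturated if $v\in H$ whenever $s(e)\in H$ for all $e\in vE^1$. A cycle is a path $\mu=\mu_1\cdots\mu_n$ ($n\ge1$) with $r(\mu_1)=s(\mu_n)$ and $s(\mu_i)\neq s(\mu_j)$ for $i\ne j$. If $A\subseteq E^0$ contains all $r(\mu_i)$, then $\mu$ is a cycle with no entrance in $A$ if $\{e\in r(\mu_i)E^1: s(e)\in A\}=\{\mu_i\}$ for each $i$. A maximal tail $T$ is cyclic if there is a cycle $\mu$ with no entrance in $T$ (such $\mu$ is unique up to cyclic permutation of its edges), and then $\operatorname{Per}(T):=|\mu|$; otherwise $T$ is aperiodic and $\operatorname{Per}(T):=0$. For $H$ saturated hereditary, $\mathcal{C}(H):=\{\mu:\mu\text{ is a cycle with no entrance in }E^0\setminus H\}$. An infinite path is a string $x=x_1x_2\cdots$ of edges with $s(x_i)=r(x_{i+1})$ for all $i$, with $r(x)=r(x_1)$; $E^\infty$ is the set of infinite paths. For a cycle $\mu$, $\mu^\infty:=\mu\mu\mu\cdots$. Infinite paths $x,y$ are shift-tail equivalent if there are $m,n\in\mathbb{N}$ with $x_{i+m}=y_{i+n}$ for all $i\in\mathbb{N}$; $[x]$ is the class of $x$, and $[x]^0:=\{r(y):y\in[x]\}$. Every maximal tail equals $[x]^0$ for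 some $x\in E^\infty$, and every $[x]^0$ is a maximal tail. For $x\in E^\infty$, $w\in\mathbb{T}$, $\pi_{x,w}:C^*(E)\to\mathcal{B}(\ell^2([x]))$ is the irreducible representation with $\pi_{x,w}(p_v)\delta_y=\delta_y$ if $r(y)=v$ and $0$ otherwise, and $\pi_{x,w}(s_e)\delta_y=w\,\delta_{ey}$ if $r(y)=s(e)$ and $0$ otherwise. For a maximal tail $T$ and $z\in\{w^{\operatorname{Per}(T)}:w\in\mathbb{T}\}$, $I_{T,z}:=\ker\pi_{x,w}$ for any $(x,w)\in E^\infty\times\mathbb{T}$ with $[x]^0=T$ and $w^{\operatorname{Per}(T)}=z$ (this is independent of the choice). An ideal pair for $E$ is a pair $(H,U)$ where $H\subseteq E^0$ is saturated and hereditary and $U$ is a function assigning to each $\mu\in\mathcal{C}(H)$ a proper open subset $U(\mu)$ of $\mathbb{T}$ (possibly empty), with $U(\mu)=U(\nu)$ whenever $[\mu^\infty]=[\nu^\infty]$. If $\mathcal{C}(H)=\emptyset$ then $U$ is the unique function on the empty set. For each proper open $V\subsetneq\mathbb{T}$ fix a function $h_V\in C(\mathbb{T})$ with $\{z\in\mathbb{T}:h_V(z)\neq0\}=V$ (e.g. $h_V(z)=\inf\{|z-w|:w\notin V\}$). Let $\mathcal{T}\subseteq\mathcal{B}(\ell^2(\mathbb{N}))$ be the Toeplitz algebra generated by the unilateral shift $S$, and for $f\in C(\mathbb{T})$ let $T_f\in\mathcal{T}$ be the Toeplitz operator $P_+\pi(f)P_+$, where $\pi:C(\mathbb{T})\to\mathcal{B}(\ell^2(\mathbb{Z}))$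 is the representation carrying $z\mapsto z$ to the bilateral shift $e_n\mapsto e_{n+1}$ and $P_+$ is the projection onto $\overline{\operatorname{span}}\{e_n:n\ge0\}\cong\ell^2(\mathbb{N})$. For an ideal pair $(H,U)$ and $\mu\in\mathcal{C}(H)$, define $\tau^U_\mu\in C^*(s_\mu)\subseteq p_{r(\mu)}C^*(E)p_{r(\mu)}$ as follows. If $\mu$ has no entrance in $E^0$, then $s_\mu$ is unitary in $p_{r(\mu)}C^*(E)p_{r(\mu)}$ and $\tau^U_\mu:=h_{U(\mu)}(s_\mu)$ (functional calculus in that corner). Otherwise $s_\mu s_\mu^*<s_\mu^*s_\mu=p_{r(\mu)}$, so by Coburn's theorem there is an isomorphism $\psi:\mathcal{T}\to C^*(s_\mu)$ with $\psi(S)=s_\mu$, and $\tau^U_\mu:=\psi(T_{h_{U(\mu)}})$. Then $J_{H,U}$ is the ideal of $C^*(E)$ generated by $\{p_v:v\in H\}\cup\{\tau^U_\mu:\mu\in\mathcal{C}(H)\}$. *)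

theory Defs
  imports
    "HOL-Analysis.Analysis"
    "HOL-Algebra.Module"
    "Graph_Theory.Digraph"
begin

section \<open>C*-algebras\<close>

text \<open>C*-algebras are given by carriers, because the universal property of a graph algebra
  quantifies over them. They need not be unital: the record field \<^term>\<open>one\<close> inherited from
  the library's rings is not constrained for a general C*-algebra.\<close>

record 'a cstar = "(complex, 'a) module" +
  adj :: "'a \<Rightarrow> 'a"
  cnorm :: "'a \<Rightarrow> real"

definition complex_ring :: "complex ring" where
  "complex_ring = \<lparr>carrier = UNIV, monoid.mult = (*), one = 1, ring.zero = 0, add = (+)\<rparr>"

text \<open>The value off the carrier is a dummy, needed because \<^locale>\<open>Metric_space\<close> asks for
  nonnegativity and symmetry on the whole type.\<close>

definition cdist :: "('a, 'm) cstar_scheme \<Rightarrow> 'a \<Rightarrow> 'a \<Rightarrow> real" where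
  "cdist A x y = (if x \<in> carrier A \<and> y \<in> carrier A then cnorm A (x \<ominus>\<^bsub>A\<^esub> y) else 0)"

locale cstar_algebra = module complex_ring A for A :: "('a, 'm) cstar_scheme" (structure) +
  assumes mult_closed: "\<lbrakk>x \<in> carrier A; y \<in> carrier A\<rbrakk> \<Longrightarrow> x \<otimes> y \<in> carrier A"
    and mult_assoc: "\<lbrakk>x \<in> carrier A; y \<in> carrier A; z \<in> carrier A\<rbrakk>
      \<Longrightarrow> (x \<otimes> y) \<otimes> z = x \<otimes> (y \<otimes> z)"
    and mult_add_left: "\<lbrakk>x \<in> carrier A; y \<in> carrier A; z \<in> carrier A\<rbrakk>
      \<Longrightarrow> (x \<oplus> y) \<otimes> z = x \<otimes> z \<oplus> y \<otimes> z"
    and mult_add_right: "\<lbrakk>x \<in> carrier A; y \<in> carrier A; z \<in> carrier A\<rbrakk>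
      \<Longrightarrow> x \<otimes> (y \<oplus> z) = x \<otimes> y \<oplus> x \<otimes> z"
    and mult_smult_left: "\<lbrakk>x \<in> carrier A; y \<in> carrier A\<rbrakk>
      \<Longrightarrow> (c \<odot> x) \<otimes> y = c \<odot> (x \<otimes> y)"
    and mult_smult_right: "\<lbrakk>x \<in> carrier A; y \<in> carrier A\<rbrakk>
      \<Longrightarrow> x \<otimes> (c \<odot> y) = c \<odot> (x \<otimes> y)"
    and adj_closed: "x \<in> carrier A \<Longrightarrow> adj A x \<in> carrier A"
    and adj_adj: "x \<in> carrier A \<Longrightarrow> adj A (adj A x) = x"
    and adj_add: "\<lbrakk>x \<in> carrier A; y \<in> carrier A\<rbrakk> \<Longrightarrow> adj A (x \<oplus> y) = adj A x \<oplus> adj A y"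
    and adj_smult: "x \<in> carrier A \<Longrightarrow> adj A (c \<odot> x) = cnj c \<odot> adj A x"
    and adj_mult: "\<lbrakk>x \<in> carrier A; y \<in> carrier A\<rbrakk> \<Longrightarrow> adj A (x \<otimes> y) = adj A y \<otimes> adj A x"
    and cnorm_nonneg: "x \<in> carrier A \<Longrightarrow> 0 \<le> cnorm A x"
    and cnorm_eq_0: "x \<in> carrier A \<Longrightarrow> cnorm A x = 0 \<longleftrightarrow> x = \<zero>"
    and cnorm_add: "\<lbrakk>x \<in> carrier A; y \<in> carrier A\<rbrakk> \<Longrightarrow> cnorm A (x \<oplus> y) \<le> cnorm A x + cnorm A y"
    and cnorm_smult: "x \<in> carrier A \<Longrightarrow> cnorm A (c \<odot> x) = cmod c * cnorm A x"
    and cnorm_mult: "\<lbrakk>x \<in> carrier A; y \<in> carrier A\<rbrakk> \<Longrightarrow> cnorm A (x \<otimes> y) \<le> cnorm A x * cnorm A y"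
    and cstar_identity: "x \<in> carrier A \<Longrightarrow> cnorm A (adj A x \<otimes> x) = (cnorm A x)\<^sup>2"
    and complete: "Metric_space.mcomplete (carrier A) (cdist A)"

definition star_hom :: "('a, 'm) cstar_scheme \<Rightarrow> ('b, 'n) cstar_scheme \<Rightarrow> ('a \<Rightarrow> 'b) \<Rightarrow> bool" where
  "star_hom A B \<phi> \<longleftrightarrow>
     \<phi> \<in> carrier A \<rightarrow> carrier B \<and>
     (\<forall>x\<in>carrier A. \<forall>y\<in>carrier A. \<phi> (x \<oplus>\<^bsub>A\<^esub> y) = \<phi> x \<oplus>\<^bsub>B\<^esub> \<phi> y) \<and>
     (\<forall>c. \<forall>x\<in>carrier A. \<phi> (c \<odot>\<^bsub>A\<^esub> x) = c \<odot>\<^bsub>B\<^esub> \<phi> x) \<and>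
     (\<forall>x\<in>carrier A. \<forall>y\<in>carrier A. \<phi> (x \<otimes>\<^bsub>A\<^esub> y) = \<phi> x \<otimes>\<^bsub>B\<^esub> \<phi> y) \<and>
     (\<forall>x\<in>carrier A. \<phi> (adj A x) = adj B (\<phi> x))"

definition star_iso :: "('a, 'm) cstar_scheme \<Rightarrow> ('b, 'n) cstar_scheme \<Rightarrow> ('a \<Rightarrow> 'b) \<Rightarrow> bool" where
  "star_iso A B \<phi> \<longleftrightarrow> star_hom A B \<phi> \<and> bij_betw \<phi> (carrier A) (carrier B)"

definition star_kernel :: "('a, 'm) cstar_scheme \<Rightarrow> ('b, 'n) cstar_scheme \<Rightarrow> ('a \<Rightarrow> 'b) \<Rightarrow> 'a set" where
  "star_kernel A B \<phi> = {x \<in> carrier A. \<phi> x = \<zero>\<^bsub>B\<^esub>}"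

definition norm_closed :: "('a, 'm) cstar_scheme \<Rightarrow> 'a set \<Rightarrow> bool" where
  "norm_closed A X \<longleftrightarrow> closedin (Metric_space.mtopology (carrier A) (cdist A)) X"

definition linear_subspace :: "('a, 'm) cstar_scheme \<Rightarrow> 'a set \<Rightarrow> bool" where
  "linear_subspace A X \<longleftrightarrow> X \<subseteq> carrier A \<and> \<zero>\<^bsub>A\<^esub> \<in> X \<and>
     (\<forall>x\<in>X. \<forall>y\<in>X. x \<oplus>\<^bsub>A\<^esub> y \<in> X) \<and> (\<forall>c. \<forall>x\<in>X. c \<odot>\<^bsub>A\<^esub> x \<in> X)"

definition cstar_subalgebra :: "('a, 'm) cstar_scheme \<Rightarrow> 'a set \<Rightarrow> bool" where
  "cstar_subalgebra A X \<longleftrightarrow> linear_subspace A X \<and> norm_closed A X \<and>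
     (\<forall>x\<in>X. \<forall>y\<in>X. x \<otimes>\<^bsub>A\<^esub> y \<in> X) \<and> (\<forall>x\<in>X. adj A x \<in> X)"

definition closed_ideal :: "('a, 'm) cstar_scheme \<Rightarrow> 'a set \<Rightarrow> bool" where
  "closed_ideal A X \<longleftrightarrow> linear_subspace A X \<and> norm_closed A X \<and>
     (\<forall>a\<in>carrier A. \<forall>x\<in>X. a \<otimes>\<^bsub>A\<^esub> x \<in> X \<and> x \<otimes>\<^bsub>A\<^esub> a \<in> X)"

definition cstar_generated :: "('a, 'm) cstar_scheme \<Rightarrow> 'a set \<Rightarrow> 'a set" where
  "cstar_generated A X = \<Inter>{B. cstar_subalgebra A B \<and> X \<subseteq> B}"

definition ideal_generated :: "('a, 'm) cstar_scheme \<Rightarrow> 'a set \<Rightarrow> 'a set" where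
  "ideal_generated A X = \<Inter>{I. closed_ideal A I \<and> X \<subseteq> I}"

definition Cstar_of :: "('a, 'm) cstar_scheme \<Rightarrow> 'a set \<Rightarrow> ('a, 'm) cstar_scheme" where
  "Cstar_of A X = A\<lparr>carrier := cstar_generated A X\<rparr>"

definition corner :: "('a, 'm) cstar_scheme \<Rightarrow> 'a \<Rightarrow> ('a, 'm) cstar_scheme" where
  "corner A q = A\<lparr>carrier := {q \<otimes>\<^bsub>A\<^esub> a \<otimes>\<^bsub>A\<^esub> q | a. a \<in> carrier A}, one := q\<rparr>"


section \<open>Bounded operators on the Hilbert space of square-summable families\<close>

text \<open>The Hilbert space over an index set \<open>X\<close> consists of functions on the whole index type that
  vanish off \<open>X\<close>; operators are \<^const>\<open>undefined\<close> off this space.\<close>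

definition ell2 :: "'i set \<Rightarrow> ('i \<Rightarrow> complex) set" where
  "ell2 X = {\<xi>. (\<forall>i. i \<notin> X \<longrightarrow> \<xi> i = 0) \<and> (\<lambda>i. (cmod (\<xi> i))\<^sup>2) summable_on UNIV}"

definition ell2_norm :: "('i \<Rightarrow> complex) \<Rightarrow> real" where
  "ell2_norm \<xi> = sqrt (\<Sum>\<^sub>\<infinity>i. (cmod (\<xi> i))\<^sup>2)"

definition ell2_inner :: "('i \<Rightarrow> complex) \<Rightarrow> ('i \<Rightarrow> complex) \<Rightarrow> complex" where
  "ell2_inner \<xi> \<eta> = (\<Sum>\<^sub>\<infinity>i. \<xi> i * cnj (\<eta> i))"

definition delta :: "'i \<Rightarrow> 'i \<Rightarrow> complex" where
  "delta i = (\<lambda>j. if j = i then 1 else 0)"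

type_synonym 'i operator = "('i \<Rightarrow> complex) \<Rightarrow> ('i \<Rightarrow> complex)"

definition bounded_operators :: "'i set \<Rightarrow> 'i operator set" where
  "bounded_operators X = {R \<in> ell2 X \<rightarrow>\<^sub>E ell2 X.
     (\<forall>\<xi>\<in>ell2 X. \<forall>\<eta>\<in>ell2 X. R (\<lambda>i. \<xi> i + \<eta> i) = (\<lambda>i. R \<xi> i + R \<eta> i)) \<and>
     (\<forall>c. \<forall>\<xi>\<in>ell2 X. R (\<lambda>i. c * \<xi> i) = (\<lambda>i. c * R \<xi> i)) \<and>
     (\<exists>K. \<forall>\<xi>\<in>ell2 X. ell2_norm (R \<xi>) \<le> K * ell2_norm \<xi>)}"

definition B_ell2 :: "'i set \<Rightarrow> 'i operator cstar" where
  "B_ell2 X = \<lparr>carrier = bounded_operators X,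
     monoid.mult = (\<lambda>R Q. compose (ell2 X) R Q),
     one = (\<lambda>\<xi>\<in>ell2 X. \<xi>),
     ring.zero = (\<lambda>\<xi>\<in>ell2 X. (\<lambda>i. 0)),
     add = (\<lambda>R Q. \<lambda>\<xi>\<in>ell2 X. (\<lambda>i. R \<xi> i + Q \<xi> i)),
     smult = (\<lambda>c R. \<lambda>\<xi>\<in>ell2 X. (\<lambda>i. c * R \<xi> i)),
     adj = (\<lambda>R. THE Q. Q \<in> bounded_operators X \<and>
       (\<forall>\<xi>\<in>ell2 X. \<forall>\<eta>\<in>ell2 X. ell2_inner (R \<xi>) \<eta> = ell2_inner \<xi> (Q \<eta>))),
     cnorm = (\<lambda>R. Inf {K. 0 \<le> K \<and> (\<forall>\<xi>\<in>ell2 X. ell2_norm (R \<xi>) \<le> K * ell2_norm \<xi>)})\<rparr>"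


section \<open>Continuous functions on the circle, functional calculus and Toeplitz operators\<close>

abbreviation circle :: "complex set" where
  "circle \<equiv> sphere 0 1"

definition C_circle :: "(complex \<Rightarrow> complex) cstar" where
  "C_circle = \<lparr>carrier = {f \<in> extensional circle. continuous_on circle f},
     monoid.mult = (\<lambda>f g. \<lambda>z\<in>circle. f z * g z),
     one = (\<lambda>z\<in>circle. 1),
     ring.zero = (\<lambda>z\<in>circle. 0),
     add = (\<lambda>f g. \<lambda>z\<in>circle. f z + g z),
     smult = (\<lambda>c f. \<lambda>z\<in>circle. c * f z),
     adj = (\<lambda>f. \<lambda>z\<in>circle. cnj (f z)),
     cnorm = (\<lambda>f. SUP z\<in>circle. cmod (f z))\<rparr>"

text \<open>For a unitary \<open>u\<close> of a unital C*-algebra \<open>B\<close> this is the *-homomorphism from the continuous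
  functions on the circle to \<open>B\<close> that carries the identity function to \<open>u\<close>; it is automatically
  unital, as \<open>u\<close> times its adjoint is the unit.\<close>

definition circle_calculus ::
    "('a, 'm) cstar_scheme \<Rightarrow> 'a \<Rightarrow> (complex \<Rightarrow> complex) \<Rightarrow> 'a" where
  "circle_calculus B u = (THE \<phi>. \<phi> \<in> extensional (carrier C_circle) \<and>
     star_hom C_circle B \<phi> \<and> \<phi> (\<lambda>z\<in>circle. z) = u)"

definition functional_calculus ::
    "('a, 'm) cstar_scheme \<Rightarrow> 'a \<Rightarrow> (complex \<Rightarrow> complex) \<Rightarrow> 'a" where
  "functional_calculus B u f = circle_calculus B u (restrict f circle)"

definition bilateral_shift :: "int operator" where
  "bilateral_shift = (\<lambda>\<xi>\<in>ell2 UNIV. (\<lambda>k. \<xi> (k - 1)))"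

definition unilateral_shift :: "nat operator" where
  "unilateral_shift = (\<lambda>\<xi>\<in>ell2 UNIV. (\<lambda>k. if k = 0 then 0 else \<xi> (k - 1)))"

text \<open>The compression to the nonnegative coordinates, identified with the functions on \<^typ>\<open>nat\<close>,
  of the multiplication operator with symbol \<open>f\<close>.\<close>

definition toeplitz_operator :: "(complex \<Rightarrow> complex) \<Rightarrow> nat operator" where
  "toeplitz_operator f = (\<lambda>\<xi>\<in>ell2 UNIV. (\<lambda>n.
     functional_calculus (B_ell2 UNIV) bilateral_shift f
       (\<lambda>k. if 0 \<le> k then \<xi> (nat k) else 0) (int n)))"

definition toeplitz_algebra :: "nat operator cstar" where
  "toeplitz_algebra = Cstar_of (B_ell2 UNIV) {unilateral_shift}"

definition coburn_iso :: "('a, 'm) cstar_scheme \<Rightarrow> 'a \<Rightarrow> nat operator \<Rightarrow> 'a" where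
  "coburn_iso A u = (THE \<psi>. \<psi> \<in> extensional (carrier toeplitz_algebra) \<and>
     star_iso toeplitz_algebra (Cstar_of A {u}) \<psi> \<and> \<psi> unilateral_shift = u)"


section \<open>Row-finite graphs with no sources\<close>

text \<open>The range map is \<^const>\<open>head\<close> and the source map is \<^const>\<open>tail\<close>. Paths run against the
  edges (the source of an edge is the range of the next one), so the library's walks are not used.\<close>

locale row_finite_no_sources = wf_digraph E for E :: "('v, 'e) pre_digraph" (structure) +
  assumes countable_verts: "countable (verts E)"
    and countable_arcs: "countable (arcs E)"
    and no_sources: "head E ` arcs E = verts E"
    and row_finite: "v \<in> verts E \<Longrightarrow> finite (in_arcs E v)"

text \<open>\<open>is_path E v \<mu> w\<close>: the edge list \<open>\<mu>\<close> is a path with range \<open>v\<close> and source \<open>w\<close>; the empty list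
  stands for the vertex \<open>v = w\<close>.\<close>

fun is_path :: "('v, 'e) pre_digraph \<Rightarrow> 'v \<Rightarrow> 'e list \<Rightarrow> 'v \<Rightarrow> bool" where
  "is_path E v [] w \<longleftrightarrow> v \<in> verts E \<and> v = w"
| "is_path E v (e # \<mu>) w \<longleftrightarrow> e \<in> in_arcs E v \<and> is_path E (tail E e) \<mu> w"

definition maximal_tail :: "('v, 'e) pre_digraph \<Rightarrow> 'v set \<Rightarrow> bool" where
  "maximal_tail E T \<longleftrightarrow> T \<subseteq> verts E \<and> T \<noteq> {} \<and>
     (\<forall>e\<in>arcs E. tail E e \<in> T \<longrightarrow> head E e \<in> T) \<and>
     (\<forall>v\<in>T. \<exists>e\<in>in_arcs E v. tail E e \<in> T) \<and>
     (\<forall>v\<in>T. \<forall>w\<in>T. \<exists>\<mu> \<nu>. \<exists>u\<in>T. is_path E v \<mu> u \<and> is_path E w \<nu> u)"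

definition hereditary :: "('v, 'e) pre_digraph \<Rightarrow> 'v set \<Rightarrow> bool" where
  "hereditary E H \<longleftrightarrow> (\<forall>e\<in>arcs E. head E e \<in> H \<longrightarrow> tail E e \<in> H)"

definition saturated :: "('v, 'e) pre_digraph \<Rightarrow> 'v set \<Rightarrow> bool" where
  "saturated E H \<longleftrightarrow> (\<forall>v\<in>verts E. (\<forall>e\<in>in_arcs E v. tail E e \<in> H) \<longrightarrow> v \<in> H)"

definition is_cycle :: "('v, 'e) pre_digraph \<Rightarrow> 'e list \<Rightarrow> bool" where
  "is_cycle E \<mu> \<longleftrightarrow> \<mu> \<noteq> [] \<and> is_path E (head E (hd \<mu>)) \<mu> (head E (hd \<mu>)) \<and>
     distinct (map (tail E) \<mu>)"

definition cycle_no_entrance :: "('v, 'e) pre_digraph \<Rightarrow> 'v set \<Rightarrow> 'e list \<Rightarrow> bool" where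
  "cycle_no_entrance E X \<mu> \<longleftrightarrow> is_cycle E \<mu> \<and>
     (\<forall>e\<in>set \<mu>. head E e \<in> X \<and> {f \<in> in_arcs E (head E e). tail E f \<in> X} = {e})"

definition cyclic_tail :: "('v, 'e) pre_digraph \<Rightarrow> 'v set \<Rightarrow> bool" where
  "cyclic_tail E T \<longleftrightarrow> (\<exists>\<mu>. cycle_no_entrance E T \<mu>)"

definition Per :: "('v, 'e) pre_digraph \<Rightarrow> 'v set \<Rightarrow> nat" where
  "Per E T = (if cyclic_tail E T then length (SOME \<mu>. cycle_no_entrance E T \<mu>) else 0)"

definition cycles_off :: "('v, 'e) pre_digraph \<Rightarrow> 'v set \<Rightarrow> 'e list set" where
  "cycles_off E H = {\<mu>. cycle_no_entrance E (verts E - H) \<mu>}"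

definition infinite_paths :: "('v, 'e) pre_digraph \<Rightarrow> (nat \<Rightarrow> 'e) set" where
  "infinite_paths E = {x. \<forall>i. x i \<in> arcs E \<and> tail E (x i) = head E (x (Suc i))}"

definition cycle_power :: "'e list \<Rightarrow> nat \<Rightarrow> 'e" where
  "cycle_power \<mu> = (\<lambda>i. \<mu> ! (i mod length \<mu>))"

definition tail_class :: "('v, 'e) pre_digraph \<Rightarrow> (nat \<Rightarrow> 'e) \<Rightarrow> (nat \<Rightarrow> 'e) set" where
  "tail_class E x = {y \<in> infinite_paths E. \<exists>m n. \<forall>i. x (i + m) = y (i + n)}"

definition class_verts :: "('v, 'e) pre_digraph \<Rightarrow> (nat \<Rightarrow> 'e) \<Rightarrow> 'v set" where
  "class_verts E x = {head E (y 0) | y. y \<in> tail_class E x}"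

definition ideal_pair :: "('v, 'e) pre_digraph \<Rightarrow> 'v set \<Rightarrow> ('e list \<Rightarrow> complex set) \<Rightarrow> bool" where
  "ideal_pair E H U \<longleftrightarrow> H \<subseteq> verts E \<and> saturated E H \<and> hereditary E H \<and>
     (\<forall>\<mu>\<in>cycles_off E H. openin (top_of_set circle) (U \<mu>) \<and> U \<mu> \<noteq> circle) \<and>
     (\<forall>\<mu>\<in>cycles_off E H. \<forall>\<nu>\<in>cycles_off E H.
        tail_class E (cycle_power \<mu>) = tail_class E (cycle_power \<nu>) \<longrightarrow> U \<mu> = U \<nu>)"


section \<open>The graph C*-algebra\<close>

definition ck_family ::
    "('v, 'e) pre_digraph \<Rightarrow> ('a, 'm) cstar_scheme \<Rightarrow> ('v \<Rightarrow> 'a) \<Rightarrow> ('e \<Rightarrow> 'a) \<Rightarrow> bool" where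
  "ck_family E A p s \<longleftrightarrow>
     (\<forall>v\<in>verts E. p v \<in> carrier A \<and> p v \<otimes>\<^bsub>A\<^esub> p v = p v \<and> adj A (p v) = p v) \<and>
     (\<forall>v\<in>verts E. \<forall>w\<in>verts E. v \<noteq> w \<longrightarrow> p v \<otimes>\<^bsub>A\<^esub> p w = \<zero>\<^bsub>A\<^esub>) \<and>
     (\<forall>e\<in>arcs E. s e \<in> carrier A \<and> s e \<otimes>\<^bsub>A\<^esub> adj A (s e) \<otimes>\<^bsub>A\<^esub> s e = s e \<and>
        adj A (s e) \<otimes>\<^bsub>A\<^esub> s e = p (tail E e)) \<and>
     (\<forall>v\<in>verts E. p v = finsum A (\<lambda>e. s e \<otimes>\<^bsub>A\<^esub> adj A (s e)) (in_arcs E v))"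

text \<open>The universal property is tested on all C*-algebras carried by the type of operators on the
  functions on edge sequences. This is no restriction: a family is contained in the C*-subalgebra
  that it generates, which has at most the cardinality of the continuum since the graph is
  countable, whereas this type has at least that cardinality for every type of edges. The
  homomorphism is unique since the family generates \<open>A\<close>.\<close>

definition graph_cstar_algebra ::
    "('v, 'e) pre_digraph \<Rightarrow> ('a, 'm) cstar_scheme \<Rightarrow> ('v \<Rightarrow> 'a) \<Rightarrow> ('e \<Rightarrow> 'a) \<Rightarrow> bool" where
  "graph_cstar_algebra E A p s \<longleftrightarrow>
     cstar_algebra A \<and> ck_family E A p s \<and>
     cstar_generated A (p ` verts E \<union> s ` arcs E) = carrier A \<and>
     (\<forall>(B :: (nat \<Rightarrow> 'e) operator cstar) q t. cstar_algebra B \<and> ck_family E B q t \<longrightarrow>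
        (\<exists>\<phi>. star_hom A B \<phi> \<and> (\<forall>v\<in>verts E. \<phi> (p v) = q v) \<and> (\<forall>e\<in>arcs E. \<phi> (s e) = t e)))"

definition path_rep ::
    "('v, 'e) pre_digraph \<Rightarrow> ('a, 'm) cstar_scheme \<Rightarrow> ('v \<Rightarrow> 'a) \<Rightarrow> ('e \<Rightarrow> 'a) \<Rightarrow>
      (nat \<Rightarrow> 'e) \<Rightarrow> complex \<Rightarrow> 'a \<Rightarrow> (nat \<Rightarrow> 'e) operator" where
  "path_rep E A p s x w = (THE \<pi>. \<pi> \<in> extensional (carrier A) \<and>
     star_hom A (B_ell2 (tail_class E x)) \<pi> \<and>
     (\<forall>v\<in>verts E. \<forall>y\<in>tail_class E x.
        \<pi> (p v) (delta y) = (if head E (y 0) = v then delta y else (\<lambda>_. 0))) \<and>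
     (\<forall>e\<in>arcs E. \<forall>y\<in>tail_class E x.
        \<pi> (s e) (delta y) =
          (if head E (y 0) = tail E e then (\<lambda>i. w * delta (case_nat e y) i) else (\<lambda>_. 0))))"

text \<open>The kernel does not depend on the choice of \<open>(x, w)\<close>.\<close>

definition tail_ideal ::
    "('v, 'e) pre_digraph \<Rightarrow> ('a, 'm) cstar_scheme \<Rightarrow> ('v \<Rightarrow> 'a) \<Rightarrow> ('e \<Rightarrow> 'a) \<Rightarrow>
      'v set \<Rightarrow> complex \<Rightarrow> 'a set" where
  "tail_ideal E A p s T z =
     (let (x, w) = (SOME (x, w). x \<in> infinite_paths E \<and> w \<in> circle \<and>
        class_verts E x = T \<and> w ^ Per E T = z)
      in star_kernel A (B_ell2 (tail_class E x)) (path_rep E A p s x w))"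

text \<open>Only nonempty paths occur here; there is no unit to serve as the empty product.\<close>

fun path_elem :: "('a, 'm) cstar_scheme \<Rightarrow> ('e \<Rightarrow> 'a) \<Rightarrow> 'e list \<Rightarrow> 'a" where
  "path_elem A s [e] = s e"
| "path_elem A s (e # \<mu>) = s e \<otimes>\<^bsub>A\<^esub> path_elem A s \<mu>"

definition tau_elem ::
    "('v, 'e) pre_digraph \<Rightarrow> ('a, 'm) cstar_scheme \<Rightarrow> ('v \<Rightarrow> 'a) \<Rightarrow> ('e \<Rightarrow> 'a) \<Rightarrow>
      (complex set \<Rightarrow> complex \<Rightarrow> complex) \<Rightarrow> ('e list \<Rightarrow> complex set) \<Rightarrow> 'e list \<Rightarrow> 'a" where
  "tau_elem E A p s h U \<mu> =
     (if cycle_no_entrance E (verts E) \<mu>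
      then functional_calculus (corner A (p (head E (hd \<mu>)))) (path_elem A s \<mu>) (h (U \<mu>))
      else coburn_iso A (path_elem A s \<mu>) (toeplitz_operator (h (U \<mu>))))"

definition pair_ideal ::
    "('v, 'e) pre_digraph \<Rightarrow> ('a, 'm) cstar_scheme \<Rightarrow> ('v \<Rightarrow> 'a) \<Rightarrow> ('e \<Rightarrow> 'a) \<Rightarrow>
      (complex set \<Rightarrow> complex \<Rightarrow> complex) \<Rightarrow> 'v set \<Rightarrow> ('e list \<Rightarrow> complex set) \<Rightarrow> 'a set" where
  "pair_ideal E A p s h H U =
     ideal_generated A (p ` H \<union> tau_elem E A p s h U ` cycles_off E H)"

end

theory Submission
  imports Defs
begin

text \<open>The kernel of a representation is a closed ideal, so the ideal of a pair \<open>(H, U)\<close> lies in the kernel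
  of a path representation if and only if its generators do. Fix an infinite path \<open>x\<close>, a scalar \<open>w\<close> of
  modulus one, and let \<open>T\<close> be the set of ranges of the paths that are tail equivalent to \<open>x\<close>. The vertex
  projection at \<open>v\<close> acts as the projection onto the paths with range \<open>v\<close>, so it is killed exactly if \<open>v\<close> is
  not in \<open>T\<close>; this gives the condition on \<open>H\<close>. Let now \<open>H\<close> be disjoint from \<open>T\<close> and let \<open>\<mu>\<close> be a cycle
  without entrance off \<open>H\<close>. If \<open>\<mu>\<close> does not meet \<open>T\<close>, its element acts as zero. If it does, it has no
  entrance in \<open>T\<close>, and the only path of the class that starts at its vertex is \<open>\<mu> \<mu> \<mu> \<dots>\<close>. So \<open>s\<^sub>\<mu>\<close> acts
  as \<open>z = w ^ length \<mu>\<close> times a rank-one projection, and the generator attached to \<open>\<mu>\<close> acts as \<open>h z\<close> times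
  this projection, where \<open>h\<close> is the function that vanishes exactly off \<open>U \<mu>\<close> (\<open>tau_elem_rep\<close>,
  \<open>tau_in_ker_iff\<close>). Since \<open>length \<mu>\<close> is the period of \<open>T\<close>, this gives the condition on \<open>z\<close>.

  For the last claim a vertex \<open>v\<close> outside \<open>H\<close> has to be separated from the ideal. By saturation an infinite
  path starts at \<open>v\<close> and avoids \<open>H\<close>; by heredity so does its whole class. The open sets of the pair are
  proper, so a scalar can be chosen that satisfies the second condition (\<open>ex_path_class_avoiding\<close>), and the
  kernel for these data contains the ideal but not the projection at \<open>v\<close>.

  The remaining parts supply the operator algebra. Homomorphisms of C*-algebras are contractive, which
  is shown without spectra by means of a quadratic relation (\<open>contractive\<close>). The functional calculus of a unitary
  and the theorem of Coburn are two instances of one extension principle: a map between families of monomials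
  extends to the closed spans as soon as coefficients are bounded by norms, because norms of large powers
  absorb a polynomial loss (\<open>comparable_families\<close>). In the first instance the coefficients are Fourier
  coefficients, in the second they are read off from matrix entries (\<open>coburn\<close>). Finally, that \<open>p\<^bsub>r(e)\<^esub> s\<^sub>e = s\<^sub>e\<close>
  holds in every Cuntz--Krieger family is not an axiom: it rests on the fact that projections whose sum is a
  projection lie below the sum (\<open>projection_mult_summand\<close>).\<close>


section \<open>Norms and limits in C*-algebras\<close>

lemma complex_ring_simps [simp]:
  "carrier complex_ring = UNIV" "x \<otimes>\<^bsub>complex_ring\<^esub> y = x * y" "\<one>\<^bsub>complex_ring\<^esub> = 1"
  "\<zero>\<^bsub>complex_ring\<^esub> = 0" "x \<oplus>\<^bsub>complex_ring\<^esub> y = x + y"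
  by (simp_all add: complex_ring_def)

lemma cring_complex_ring: "cring complex_ring"
proof (rule cringI)
  show "abelian_group complex_ring"
  proof (rule abelian_groupI)
    fix x show "\<exists>y\<in>carrier complex_ring. y \<oplus>\<^bsub>complex_ring\<^esub> x = \<zero>\<^bsub>complex_ring\<^esub>"
      by (rule bexI [of _ "- x"]) simp_all
  qed (simp_all add: add.assoc add.commute)
  show "comm_monoid complex_ring"
    by (rule comm_monoidI) (simp_all add: mult.assoc mult.commute)
  fix x y z
  show "(x \<oplus>\<^bsub>complex_ring\<^esub> y) \<otimes>\<^bsub>complex_ring\<^esub> z
      = x \<otimes>\<^bsub>complex_ring\<^esub> z \<oplus>\<^bsub>complex_ring\<^esub> y \<otimes>\<^bsub>complex_ring\<^esub> z"
    by (simp add: distrib_right)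
qed

text \<open>The part of the structure that needs no product. It is stated separately because it is already
  available, with its metric and its sequential limits, while an algebra is still being shown complete.\<close>

locale normed_cmodule = module complex_ring A for A :: "('a, 'm) cstar_scheme" (structure) +
  assumes cnorm_ge_zero: "x \<in> carrier A \<Longrightarrow> 0 \<le> cnorm A x"
    and cnorm_eq_zero: "x \<in> carrier A \<Longrightarrow> cnorm A x = 0 \<longleftrightarrow> x = \<zero>"
    and cnorm_triangle: "\<lbrakk>x \<in> carrier A; y \<in> carrier A\<rbrakk> \<Longrightarrow> cnorm A (x \<oplus> y) \<le> cnorm A x + cnorm A y"
    and cnorm_scale: "x \<in> carrier A \<Longrightarrow> cnorm A (c \<odot> x) = cmod c * cnorm A x"
begin

lemma scale_closed [simp, intro]: "x \<in> carrier A \<Longrightarrow> c \<odot> x \<in> carrier A"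
  by (rule smult_closed) auto

lemma scale_add_left: "x \<in> carrier A \<Longrightarrow> (c + d) \<odot> x = c \<odot> x \<oplus> d \<odot> x"
  using smult_l_distr [of c d x] by simp

lemma scale_add_right: "\<lbrakk>x \<in> carrier A; y \<in> carrier A\<rbrakk> \<Longrightarrow> c \<odot> (x \<oplus> y) = c \<odot> x \<oplus> c \<odot> y"
  using smult_r_distr [of c x y] by simp

lemma scale_scale [simp]: "x \<in> carrier A \<Longrightarrow> c \<odot> (d \<odot> x) = (c * d) \<odot> x"
  using smult_assoc1 [of c d x] by simp

lemma scale_one [simp]: "x \<in> carrier A \<Longrightarrow> 1 \<odot> x = x"
  using smult_one [of x] by simp

lemma scale_0 [simp]: "x \<in> carrier A \<Longrightarrow> 0 \<odot> x = \<zero>"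
  using cnorm_scale [of x 0] cnorm_eq_zero [of "0 \<odot> x"] by simp

lemma scale_zero [simp]: "c \<odot> \<zero> = \<zero>"
  using cnorm_scale [of \<zero> c] cnorm_eq_zero [of "c \<odot> \<zero>"] cnorm_eq_zero [of \<zero>] by simp

lemma minus_eq_scale: "x \<in> carrier A \<Longrightarrow> \<ominus> x = (-1) \<odot> x"
proof -
  assume x: "x \<in> carrier A"
  have "x \<oplus> (-1) \<odot> x = (1 + (-1)) \<odot> x"
    using x by (subst scale_add_left) simp_all
  also have "\<dots> = \<zero>" using x by simp
  finally show ?thesis
    using x by (metis M.add.inv_equality M.add.m_comm scale_closed)
qed

lemma diff_eq: "\<lbrakk>x \<in> carrier A; y \<in> carrier A\<rbrakk> \<Longrightarrow> x \<ominus> y = x \<oplus> (-1) \<odot> y"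
  by (simp add: a_minus_def minus_eq_scale)

lemma diff_closed [simp, intro]: "\<lbrakk>x \<in> carrier A; y \<in> carrier A\<rbrakk> \<Longrightarrow> x \<ominus> y \<in> carrier A"
  by (rule M.minus_closed)

lemma scale_cancel: "x \<in> carrier A \<Longrightarrow> c \<odot> x \<oplus> d \<odot> x = (c + d) \<odot> x"
  by (simp add: scale_add_left)

lemma cnorm_zero [simp]: "cnorm A \<zero> = 0"
  using cnorm_eq_zero by simp

lemma diff_self [simp]: "x \<in> carrier A \<Longrightarrow> x \<ominus> x = \<zero>"
  by (simp add: M.r_neg a_minus_def)

lemma diff_zero [simp]: "x \<in> carrier A \<Longrightarrow> x \<ominus> \<zero> = x"
  by (simp add: diff_eq)

lemma diff_add_cancel: "\<lbrakk>x \<in> carrier A; y \<in> carrier A\<rbrakk> \<Longrightarrow> (x \<ominus> y) \<oplus> y = x"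
  by (simp add: a_minus_def M.a_assoc M.l_neg)

lemma diff_eq_zero_iff: "\<lbrakk>x \<in> carrier A; y \<in> carrier A\<rbrakk> \<Longrightarrow> x \<ominus> y = \<zero> \<longleftrightarrow> x = y"
  using diff_add_cancel [of x y] by auto

lemma diff_telescope:
  "\<lbrakk>x \<in> carrier A; y \<in> carrier A; z \<in> carrier A\<rbrakk> \<Longrightarrow> (x \<ominus> y) \<oplus> (y \<ominus> z) = x \<ominus> z"
  by (simp add: a_minus_def M.a_assoc M.r_neg2 M.r_neg1)

lemma scale_diff: "\<lbrakk>x \<in> carrier A; y \<in> carrier A\<rbrakk> \<Longrightarrow> c \<odot> (x \<ominus> y) = c \<odot> x \<ominus> c \<odot> y"
  by (simp add: diff_eq scale_add_right)

lemma diff_add_diff: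
  "\<lbrakk>x \<in> carrier A; y \<in> carrier A; x' \<in> carrier A; y' \<in> carrier A\<rbrakk>
   \<Longrightarrow> (x \<oplus> y) \<ominus> (x' \<oplus> y') = (x \<ominus> x') \<oplus> (y \<ominus> y')"
  by (simp add: diff_eq scale_add_right M.a_ac)

lemma cnorm_uminus: "x \<in> carrier A \<Longrightarrow> cnorm A ((-1) \<odot> x) = cnorm A x"
  by (simp add: cnorm_scale)

lemma cnorm_diff_commute:
  "\<lbrakk>x \<in> carrier A; y \<in> carrier A\<rbrakk> \<Longrightarrow> cnorm A (x \<ominus> y) = cnorm A (y \<ominus> x)"
  using cnorm_uminus [of "y \<ominus> x"] by (simp add: diff_eq scale_add_right M.a_comm)

lemma cnorm_diff_triangle:
  "\<lbrakk>x \<in> carrier A; y \<in> carrier A; z \<in> carrier A\<rbrakk>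
   \<Longrightarrow> cnorm A (x \<ominus> z) \<le> cnorm A (x \<ominus> y) + cnorm A (y \<ominus> z)"
  using cnorm_triangle [of "x \<ominus> y" "y \<ominus> z"] by (simp add: diff_telescope)

lemma cnorm_diff_le:
  "\<lbrakk>x \<in> carrier A; y \<in> carrier A\<rbrakk> \<Longrightarrow> cnorm A (x \<ominus> y) \<le> cnorm A x + cnorm A y"
  using cnorm_triangle [of x "(-1) \<odot> y"] by (simp add: diff_eq cnorm_uminus)

lemma cnorm_diff_norms:
  assumes "x \<in> carrier A" "y \<in> carrier A"
  shows "\<bar>cnorm A x - cnorm A y\<bar> \<le> cnorm A (x \<ominus> y)"
  using cnorm_triangle [of "x \<ominus> y" y] cnorm_triangle [of "y \<ominus> x" x] assms
  by (simp add: diff_add_cancel cnorm_diff_commute)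

sublocale metric: Metric_space "carrier A" "cdist A"
proof
  fix x y z
  show "0 \<le> cdist A x y" by (auto simp: cdist_def cnorm_ge_zero)
  show "cdist A x y = cdist A y x" by (auto simp: cdist_def cnorm_diff_commute)
  assume x: "x \<in> carrier A" and y: "y \<in> carrier A"
  show "(cdist A x y = 0) = (x = y)"
    using x y by (simp add: cdist_def cnorm_eq_zero diff_eq_zero_iff)
  assume "z \<in> carrier A"
  with x y show "cdist A x z \<le> cdist A x y + cdist A y z"
    by (simp add: cdist_def cnorm_diff_triangle)
qed

definition conv :: "(nat \<Rightarrow> 'a) \<Rightarrow> 'a \<Rightarrow> bool" where
  "conv \<sigma> x \<longleftrightarrow> (\<forall>n. \<sigma> n \<in> carrier A) \<and> x \<in> carrier A \<and> (\<lambda>n. cnorm A (\<sigma> n \<ominus> x)) \<longlonglongrightarrow> 0"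

definition cauchy :: "(nat \<Rightarrow> 'a) \<Rightarrow> bool" where
  "cauchy \<sigma> \<longleftrightarrow> (\<forall>n. \<sigma> n \<in> carrier A) \<and>
     (\<forall>\<epsilon>>0. \<exists>N. \<forall>m\<ge>N. \<forall>n\<ge>N. cnorm A (\<sigma> m \<ominus> \<sigma> n) < \<epsilon>)"

lemma convI:
  assumes "\<And>n. \<sigma> n \<in> carrier A" "x \<in> carrier A" "\<And>n. cnorm A (\<sigma> n \<ominus> x) \<le> g n" "g \<longlonglongrightarrow> 0"
  shows "conv \<sigma> x"
proof -
  have "(\<lambda>n. cnorm A (\<sigma> n \<ominus> x)) \<longlonglongrightarrow> 0"
    using assms by (intro tendsto_sandwich [OF _ _ tendsto_const assms(4)]) (auto simp: cnorm_ge_zero)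
  then show ?thesis using assms by (simp add: conv_def)
qed

lemma conv_closed: "conv \<sigma> x \<Longrightarrow> \<sigma> n \<in> carrier A" "conv \<sigma> x \<Longrightarrow> x \<in> carrier A"
  by (simp_all add: conv_def)

lemma convD: "conv \<sigma> x \<Longrightarrow> (\<lambda>n. cnorm A (\<sigma> n \<ominus> x)) \<longlonglongrightarrow> 0"
  by (simp add: conv_def)

lemma limitin_iff_conv:
  assumes "\<And>n. \<sigma> n \<in> carrier A"
  shows "limitin metric.mtopology \<sigma> x sequentially \<longleftrightarrow> conv \<sigma> x"
proof -
  have "cdist A (\<sigma> n) x = cnorm A (\<sigma> n \<ominus> x)" if "x \<in> carrier A" for n
    using that assms by (simp add: cdist_def)
  then show ?thesis
    using assms by (auto simp: metric.limitin_metric_dist_null conv_def)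
qed

lemma norm_closed_iff:
  "norm_closed A X \<longleftrightarrow> X \<subseteq> carrier A \<and> (\<forall>\<sigma> x. (\<forall>n. \<sigma> n \<in> X) \<and> conv \<sigma> x \<longrightarrow> x \<in> X)"
proof -
  have "(range \<sigma> \<subseteq> X \<and> limitin metric.mtopology \<sigma> x sequentially) \<longleftrightarrow> (\<forall>n. \<sigma> n \<in> X) \<and> conv \<sigma> x"
    if "X \<subseteq> carrier A" for \<sigma> x
    using limitin_iff_conv [of \<sigma> x] that by blast
  then show ?thesis
    unfolding norm_closed_def metric.metric_closedin_iff_sequentially_closed by blast
qed

lemma norm_closedD: "\<lbrakk>norm_closed A X; \<And>n. \<sigma> n \<in> X; conv \<sigma> x\<rbrakk> \<Longrightarrow> x \<in> X"
  unfolding norm_closed_iff by blast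

lemma MCauchy_iff_cauchy: "metric.MCauchy \<sigma> \<longleftrightarrow> cauchy \<sigma>"
proof -
  have "cdist A (\<sigma> m) (\<sigma> n) = cnorm A (\<sigma> m \<ominus> \<sigma> n)" if "\<And>n. \<sigma> n \<in> carrier A" for m n
    using that by (simp add: cdist_def)
  then show ?thesis
    unfolding metric.MCauchy_def cauchy_def image_subset_iff by simp metis
qed

lemma mcomplete_iff: "metric.mcomplete \<longleftrightarrow> (\<forall>\<sigma>. cauchy \<sigma> \<longrightarrow> (\<exists>x. conv \<sigma> x))"
  unfolding metric.mcomplete_def MCauchy_iff_cauchy
  using limitin_iff_conv unfolding cauchy_def by metis

lemma conv_imp_cauchy:
  assumes "conv \<sigma> x" shows "cauchy \<sigma>"
  using assms limitin_iff_conv metric.convergent_imp_MCauchy [of \<sigma> x]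
  by (metis MCauchy_iff_cauchy conv_def image_subset_iff)

lemma conv_const: "x \<in> carrier A \<Longrightarrow> conv (\<lambda>_. x) x"
  by (simp add: conv_def)

lemma conv_add:
  assumes "conv \<sigma> x" "conv \<tau> y" shows "conv (\<lambda>n. \<sigma> n \<oplus> \<tau> n) (x \<oplus> y)"
proof (rule convI)
  show "(\<lambda>n. cnorm A (\<sigma> n \<ominus> x) + cnorm A (\<tau> n \<ominus> y)) \<longlonglongrightarrow> 0"
    using tendsto_add [OF convD convD, OF assms] by simp
qed (use assms in \<open>auto simp: conv_def diff_add_diff cnorm_triangle\<close>)

lemma conv_scale:
  assumes "conv \<sigma> x" shows "conv (\<lambda>n. c \<odot> \<sigma> n) (c \<odot> x)"
proof (rule convI)
  show "(\<lambda>n. cmod c * cnorm A (\<sigma> n \<ominus> x)) \<longlonglongrightarrow> 0"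
    using tendsto_mult_left [OF convD [OF assms], of "cmod c"] by simp
  show "cnorm A (c \<odot> \<sigma> n \<ominus> c \<odot> x) \<le> cmod c * cnorm A (\<sigma> n \<ominus> x)" for n
    using assms by (simp add: conv_def flip: scale_diff cnorm_scale)
qed (use assms in \<open>auto simp: conv_def\<close>)

lemma conv_diff:
  assumes "conv \<sigma> x" "conv \<tau> y" shows "conv (\<lambda>n. \<sigma> n \<ominus> \<tau> n) (x \<ominus> y)"
  using conv_add [OF assms(1) conv_scale [OF assms(2), of "-1"]] assms by (simp add: conv_def diff_eq)

lemma conv_cnorm:
  assumes "conv \<sigma> x" shows "(\<lambda>n. cnorm A (\<sigma> n)) \<longlonglongrightarrow> cnorm A x"
proof -
  have "(\<lambda>n. cnorm A (\<sigma> n) - cnorm A x) \<longlonglongrightarrow> 0"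
  proof (rule Lim_null_comparison)
    show "(\<lambda>n. cnorm A (\<sigma> n \<ominus> x)) \<longlonglongrightarrow> 0" using assms by (rule convD)
  qed (use assms in \<open>auto simp: conv_def cnorm_diff_norms\<close>)
  then show ?thesis by (rule LIM_zero_cancel)
qed

lemma conv_unique:
  assumes "conv \<sigma> x" "conv \<sigma> y" shows "x = y"
proof -
  have "conv (\<lambda>n. \<zero>) (x \<ominus> y)"
    using conv_diff [OF assms] assms by (simp add: conv_def)
  then have "(\<lambda>n. 0) \<longlonglongrightarrow> cnorm A (x \<ominus> y)"
    using conv_cnorm by fastforce
  then have "cnorm A (x \<ominus> y) = 0" by (simp add: LIMSEQ_const_iff)
  then show ?thesis using assms by (simp add: conv_def cnorm_eq_zero diff_eq_zero_iff)
qed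

lemma conv_of_close:
  assumes "conv \<sigma> x" "\<And>n. \<tau> n \<in> carrier A" "\<And>n. cnorm A (\<tau> n \<ominus> \<sigma> n) \<le> g n" "g \<longlonglongrightarrow> 0"
  shows "conv \<tau> x"
proof (rule convI)
  show "(\<lambda>n. g n + cnorm A (\<sigma> n \<ominus> x)) \<longlonglongrightarrow> 0"
    using tendsto_add [OF assms(4) convD, OF assms(1)] by simp
  show "cnorm A (\<tau> n \<ominus> x) \<le> g n + cnorm A (\<sigma> n \<ominus> x)" for n
    using cnorm_diff_triangle [of "\<tau> n" "\<sigma> n" x] assms(1,2) assms(3) [of n] by (simp add: conv_def)
qed (use assms in \<open>auto simp: conv_def\<close>)

text \<open>A limit of limits is a limit of suitably chosen approximants.\<close>

lemma conv_diagonal: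
  assumes "conv \<sigma> x" "\<And>k. \<exists>\<tau>. conv \<tau> (\<sigma> k) \<and> (\<forall>n. P (\<tau> n))"
  obtains \<rho> where "conv \<rho> x" "\<And>k. P (\<rho> k)" "\<And>k. cnorm A (\<rho> k \<ominus> \<sigma> k) \<le> inverse (real (Suc k))"
proof -
  have "\<exists>r. r \<in> carrier A \<and> P r \<and> cnorm A (r \<ominus> \<sigma> k) \<le> inverse (real (Suc k))" for k
  proof -
    obtain \<tau> where \<tau>: "conv \<tau> (\<sigma> k)" "\<And>n. P (\<tau> n)" using assms(2) by blast
    have "\<forall>\<^sub>F n in sequentially. cnorm A (\<tau> n \<ominus> \<sigma> k) < inverse (real (Suc k))"
      using order_tendstoD(2) [OF convD [OF \<tau>(1)]] by simp
    then obtain n where "cnorm A (\<tau> n \<ominus> \<sigma> k) < inverse (real (Suc k))"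
      using eventually_happens by fastforce
    then show ?thesis using \<tau> by (intro exI [of _ "\<tau> n"]) (auto simp: conv_def)
  qed
  then obtain \<rho> where \<rho>: "\<And>k. \<rho> k \<in> carrier A" "\<And>k. P (\<rho> k)"
      "\<And>k. cnorm A (\<rho> k \<ominus> \<sigma> k) \<le> inverse (real (Suc k))" by metis
  show thesis
    using that [of \<rho>] \<rho> conv_of_close [OF assms(1) \<rho>(1) \<rho>(3)] LIMSEQ_inverse_real_of_nat by blast
qed

end

context cstar_algebra
begin

sublocale normed_cmodule A
  by unfold_locales (rule cnorm_nonneg cnorm_eq_0 cnorm_add cnorm_smult; assumption)+

declare mult_closed [simp, intro] adj_closed [simp, intro] adj_adj [simp]

lemma cauchy_conv: "cauchy \<sigma> \<Longrightarrow> \<exists>x. conv \<sigma> x"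
  using complete mcomplete_iff by blast

lemma mult_zero [simp]: "x \<in> carrier A \<Longrightarrow> x \<otimes> \<zero> = \<zero>" "x \<in> carrier A \<Longrightarrow> \<zero> \<otimes> x = \<zero>"
  using mult_smult_right [of x \<zero> 0] mult_smult_left [of \<zero> x 0] by simp_all

lemma adj_zero [simp]: "adj A \<zero> = \<zero>"
  using adj_smult [of \<zero> 0] by simp

lemma adj_diff: "\<lbrakk>x \<in> carrier A; y \<in> carrier A\<rbrakk> \<Longrightarrow> adj A (x \<ominus> y) = adj A x \<ominus> adj A y"
  by (simp add: diff_eq adj_add adj_smult)

lemma mult_diff_right:
  "\<lbrakk>x \<in> carrier A; y \<in> carrier A; z \<in> carrier A\<rbrakk> \<Longrightarrow> x \<otimes> (y \<ominus> z) = x \<otimes> y \<ominus> x \<otimes> z"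
  by (simp add: diff_eq mult_add_right mult_smult_right)

lemma mult_diff_left:
  "\<lbrakk>x \<in> carrier A; y \<in> carrier A; z \<in> carrier A\<rbrakk> \<Longrightarrow> (y \<ominus> z) \<otimes> x = y \<otimes> x \<ominus> z \<otimes> x"
  by (simp add: diff_eq mult_add_left mult_smult_left)

lemma cnorm_adj [simp]: assumes x: "x \<in> carrier A" shows "cnorm A (adj A x) = cnorm A x"
proof -
  have le: "cnorm A y \<le> cnorm A (adj A y)" if y: "y \<in> carrier A" for y
  proof (cases "cnorm A y = 0")
    case False
    have "cnorm A y * cnorm A y \<le> cnorm A (adj A y) * cnorm A y"
      using cnorm_mult [of "adj A y" y] cstar_identity [of y] y by (simp add: power2_eq_square)
    then show ?thesis using False cnorm_nonneg [OF y] by simp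
  qed (simp add: cnorm_nonneg y)
  show ?thesis using le [OF x] le [of "adj A x"] x by simp
qed

lemma mult_conv:
  assumes "conv \<sigma> x" "conv \<tau> y" shows "conv (\<lambda>n. \<sigma> n \<otimes> \<tau> n) (x \<otimes> y)"
proof (rule convI)
  have c: "\<sigma> n \<in> carrier A" "\<tau> n \<in> carrier A" "x \<in> carrier A" "y \<in> carrier A" for n
    using assms by (auto simp: conv_def)
  have "(\<lambda>n. cnorm A (\<sigma> n) * cnorm A (\<tau> n \<ominus> y) + cnorm A (\<sigma> n \<ominus> x) * cnorm A y)
      \<longlonglongrightarrow> cnorm A x * 0 + 0 * cnorm A y"
    by (intro tendsto_intros conv_cnorm convD assms)
  then show "(\<lambda>n. cnorm A (\<sigma> n) * cnorm A (\<tau> n \<ominus> y) + cnorm A (\<sigma> n \<ominus> x) * cnorm A y) \<longlonglongrightarrow> 0"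
    by simp
  show "cnorm A (\<sigma> n \<otimes> \<tau> n \<ominus> x \<otimes> y)
      \<le> cnorm A (\<sigma> n) * cnorm A (\<tau> n \<ominus> y) + cnorm A (\<sigma> n \<ominus> x) * cnorm A y" for n
  proof -
    have "\<sigma> n \<otimes> \<tau> n \<ominus> x \<otimes> y = \<sigma> n \<otimes> (\<tau> n \<ominus> y) \<oplus> (\<sigma> n \<ominus> x) \<otimes> y"
      using c by (simp add: mult_diff_right mult_diff_left diff_telescope)
    also have "cnorm A \<dots> \<le> cnorm A (\<sigma> n \<otimes> (\<tau> n \<ominus> y)) + cnorm A ((\<sigma> n \<ominus> x) \<otimes> y)"
      using c by (intro cnorm_add) auto
    also have "\<dots> \<le> cnorm A (\<sigma> n) * cnorm A (\<tau> n \<ominus> y) + cnorm A (\<sigma> n \<ominus> x) * cnorm A y"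
      using c by (intro add_mono cnorm_mult) auto
    finally show ?thesis .
  qed
qed (use assms in \<open>auto simp: conv_def\<close>)

lemma adj_conv:
  assumes "conv \<sigma> x" shows "conv (\<lambda>n. adj A (\<sigma> n)) (adj A x)"
proof (rule convI)
  show "(\<lambda>n. cnorm A (\<sigma> n \<ominus> x)) \<longlonglongrightarrow> 0" using assms by (rule convD)
  show "cnorm A (adj A (\<sigma> n) \<ominus> adj A x) \<le> cnorm A (\<sigma> n \<ominus> x)" for n
    using assms by (simp add: conv_def flip: adj_diff)
qed (use assms in \<open>auto simp: conv_def\<close>)

lemma adj_mult_self_eq_zero: "x \<in> carrier A \<Longrightarrow> adj A x \<otimes> x = \<zero> \<Longrightarrow> x = \<zero>"
  using cstar_identity [of x] cnorm_eq_0 [of x] by simp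

end

section \<open>Star homomorphisms are contractive\<close>

context cstar_algebra
begin

text \<open>The element \<open>f\<close> plays the role of \<open>1 - sqrt (1 - a^2)\<close>, which makes sense without a unit.
  The map \<open>f \<mapsto> (a^2 + f^2) / 2\<close>, whose fixed points satisfy the required equation, is a contraction
  of the ball of radius \<open>\<parallel>a\<parallel>\<close>.\<close>

lemma ex_complementary_root:
  assumes a: "a \<in> carrier A" "adj A a = a" and small: "cnorm A a < 1"
  obtains f where "f \<in> carrier A" "adj A f = f" "f \<otimes> a = a \<otimes> f" "f \<oplus> f = a \<otimes> a \<oplus> f \<otimes> f"
proof -
  define r where "r = cnorm A a"
  have r: "0 \<le> r" "r < 1" using a small by (auto simp: r_def cnorm_nonneg)
  define S where "S = {f \<in> carrier A. adj A f = f \<and> f \<otimes> a = a \<otimes> f \<and> cnorm A f \<le> r}"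
  define g where "g f = (1/2) \<odot> (a \<otimes> a \<oplus> f \<otimes> f)" for f
  have S: "f \<in> carrier A" "adj A f = f" "f \<otimes> a = a \<otimes> f" "cnorm A f \<le> r" if "f \<in> S" for f
    using that by (auto simp: S_def)
  have "norm_closed A S"
    unfolding norm_closed_iff
  proof (intro conjI allI impI)
    fix \<sigma> x assume "(\<forall>n. \<sigma> n \<in> S) \<and> conv \<sigma> x"
    then have \<sigma>: "\<And>n. \<sigma> n \<in> S" and x: "conv \<sigma> x" by auto
    have "adj A x = x"
      using adj_conv [OF x] x S(2) [OF \<sigma>] conv_unique by simp
    moreover have "x \<otimes> a = a \<otimes> x"
      using mult_conv [OF x conv_const [OF a(1)]] mult_conv [OF conv_const [OF a(1)] x] S(3) [OF \<sigma>]
        conv_unique by simp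
    moreover have "cnorm A x \<le> r"
      using LIMSEQ_le_const2 [OF conv_cnorm [OF x]] S(4) [OF \<sigma>] by blast
    ultimately show "x \<in> S" using conv_closed(2) [OF x] by (simp add: S_def)
  qed (auto simp: S_def)
  then have cl: "closedin metric.mtopology S" by (simp add: norm_closed_def)
  have sub: "Submetric (carrier A) (cdist A) S"
    using metric.Metric_space_axioms by (auto simp: Submetric_def Submetric_axioms_def S_def)
  interpret S: Metric_space S "cdist A"
    by (rule metric.subspace) (auto simp: S_def)
  have "S.mcomplete"
    using Submetric.closedin_mcomplete_imp_mcomplete [OF sub cl complete] .
  moreover have "S \<noteq> {}"
  proof -
    have "\<zero> \<in> S" using a r by (simp add: S_def)
    then show ?thesis by blast
  qed
  moreover have "g \<in> S \<rightarrow> S"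
  proof
    fix f assume f: "f \<in> S"
    have "cnorm A (a \<otimes> a \<oplus> f \<otimes> f) \<le> r * r + r * r"
    proof -
      have "cnorm A (a \<otimes> a) \<le> r * r" using cnorm_mult a by (simp add: r_def)
      moreover have "cnorm A (f \<otimes> f) \<le> r * r"
        using cnorm_mult [of f f] S [OF f] mult_mono [of "cnorm A f" r "cnorm A f" r] cnorm_nonneg r
        by fastforce
      ultimately show ?thesis using cnorm_add [of "a \<otimes> a" "f \<otimes> f"] a S [OF f] by simp
    qed
    then have "cnorm A (g f) \<le> r * r"
      using a S [OF f] by (simp add: g_def cnorm_smult)
    also have "\<dots> \<le> r" using r by (simp add: mult_left_le)
    finally have "cnorm A (g f) \<le> r" .
    moreover have "g f \<otimes> a = a \<otimes> g f"
    proof -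
      have "(f \<otimes> f) \<otimes> a = a \<otimes> (f \<otimes> f)"
        using S [OF f] a mult_assoc by metis
      then show ?thesis
        using S [OF f] a
        by (simp add: g_def mult_smult_left mult_smult_right mult_add_left mult_add_right mult_assoc)
    qed
    ultimately show "g f \<in> S"
      using S [OF f] a by (simp add: S_def g_def adj_smult adj_add adj_mult)
  qed
  moreover have "cdist A (g x) (g y) \<le> r * cdist A x y" if x: "x \<in> S" and y: "y \<in> S" for x y
  proof -
    note c = S(1) [OF x] S(1) [OF y] a(1)
    have "g x \<ominus> g y = (1/2) \<odot> (x \<otimes> x \<ominus> y \<otimes> y)"
      using c by (simp add: g_def diff_add_diff flip: scale_diff)
    also have "x \<otimes> x \<ominus> y \<otimes> y = x \<otimes> (x \<ominus> y) \<oplus> (x \<ominus> y) \<otimes> y"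
      using c by (simp add: mult_diff_left mult_diff_right diff_telescope)
    finally have "cnorm A (g x \<ominus> g y) = (1/2) * cnorm A (x \<otimes> (x \<ominus> y) \<oplus> (x \<ominus> y) \<otimes> y)"
      using c by (simp add: cnorm_smult)
    also have "cnorm A (x \<otimes> (x \<ominus> y) \<oplus> (x \<ominus> y) \<otimes> y)
        \<le> cnorm A (x \<otimes> (x \<ominus> y)) + cnorm A ((x \<ominus> y) \<otimes> y)"
      using c by (intro cnorm_add) auto
    also have "\<dots> \<le> cnorm A x * cnorm A (x \<ominus> y) + cnorm A (x \<ominus> y) * cnorm A y"
      using c by (intro add_mono cnorm_mult) auto
    also have "\<dots> \<le> r * cnorm A (x \<ominus> y) + cnorm A (x \<ominus> y) * r"
      using c S(4) [OF x] S(4) [OF y] by (intro add_mono mult_right_mono mult_left_mono cnorm_nonneg) auto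
    finally have "cnorm A (g x \<ominus> g y) \<le> r * cnorm A (x \<ominus> y)" by (simp add: mult.commute)
    then show ?thesis using c by (simp add: cdist_def g_def)
  qed
  ultimately obtain f where f: "f \<in> S" "g f = f"
    using S.Banach_fixedpoint_thm r(2) by metis
  have "f \<oplus> f = 2 \<odot> f"
    using S(1) [OF f(1)] scale_add_left [of f 1 1] by simp
  also have "\<dots> = 2 \<odot> g f" using f by simp
  also have "\<dots> = a \<otimes> a \<oplus> f \<otimes> f"
    using S(1) [OF f(1)] a by (simp add: g_def)
  finally show thesis using that S [OF f(1)] by blast
qed

text \<open>Put \<open>u = x + \<i> (1 - f)\<close>. The relations make \<open>u\<close> a unitary multiplier, so \<open>u x\<close> and \<open>u\<^sup>* x\<close>
  have the norm of \<open>x\<close>; their sum is \<open>2 x^2\<close>.\<close>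

lemma cnorm_le_one_if_complementary_root:
  assumes x: "x \<in> carrier A" "adj A x = x" and f: "f \<in> carrier A" "adj A f = f"
    and comm: "f \<otimes> x = x \<otimes> f" and root: "f \<oplus> f = x \<otimes> x \<oplus> f \<otimes> f"
  shows "cnorm A x \<le> 1"
proof -
  define w where "w = f \<otimes> (x \<otimes> x)"
  define y where "y = x \<otimes> x"
  define k where "k = f \<otimes> x"
  define g where "g = x \<ominus> k"
  define u where "u = y \<oplus> \<i> \<odot> g"
  have c [simp]: "w \<in> carrier A" "y \<in> carrier A" "g \<in> carrier A" "k \<in> carrier A" "u \<in> carrier A"
    using x f by (auto simp: w_def y_def g_def k_def u_def)
  have sa: "adj A y = y" "adj A k = k"
    using x f comm by (simp_all add: y_def k_def adj_mult)
  have sg: "adj A g = g" using sa x by (simp add: g_def adj_diff)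
  have kx: "k \<otimes> x = w" using x f by (simp add: k_def w_def mult_assoc)
  have xk: "x \<otimes> k = w"
    using x f comm mult_assoc by (metis k_def w_def)
  have xy: "x \<otimes> y = y \<otimes> x" using x by (simp add: y_def mult_assoc)
  have ky: "k \<otimes> y = y \<otimes> k" using x kx xk by (metis c(4) mult_assoc y_def)
  have yg: "y \<otimes> g = g \<otimes> y"
    using x xy ky by (simp add: g_def mult_diff_left mult_diff_right)
  have gg: "g \<otimes> g = (y \<oplus> (-1) \<odot> w) \<oplus> ((-1) \<odot> w \<oplus> k \<otimes> k)"
    using x kx xk
    by (simp add: g_def mult_add_left mult_add_right mult_smult_left mult_smult_right diff_eq
        scale_add_right M.a_ac flip: y_def)
  have kk: "k \<otimes> k = (f \<otimes> f) \<otimes> y"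
    using x f comm mult_assoc mult_closed by (metis k_def y_def)
  have "y \<otimes> y \<oplus> k \<otimes> k = (x \<otimes> x \<oplus> f \<otimes> f) \<otimes> y"
    using x f kk by (simp add: mult_add_left y_def)
  also have "\<dots> = (f \<oplus> f) \<otimes> y" using root by simp
  also have "\<dots> = w \<oplus> w"
    using f x by (simp add: mult_add_left w_def y_def)
  finally have yk: "y \<otimes> y \<oplus> k \<otimes> k = w \<oplus> w" .
  have "y \<otimes> y \<oplus> g \<otimes> g = y \<oplus> (((-1) \<odot> w \<oplus> (-1) \<odot> w) \<oplus> (y \<otimes> y \<oplus> k \<otimes> k))"
    unfolding gg by (simp add: M.a_ac)
  also have "\<dots> = y \<oplus> (((-1) \<odot> w \<oplus> w) \<oplus> ((-1) \<odot> w \<oplus> w))"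
    unfolding yk by (simp add: M.a_ac)
  also have "\<dots> = y"
    using scale_cancel [of w "-1" 1] by simp
  finally have yygg: "y \<otimes> y \<oplus> g \<otimes> g = y" .
  have "adj A u \<otimes> u = (y \<otimes> y \<oplus> g \<otimes> g) \<oplus> (\<i> \<odot> (y \<otimes> g) \<oplus> (- \<i>) \<odot> (y \<otimes> g))"
    using sa sg yg
    by (simp add: u_def adj_add adj_smult mult_add_left mult_add_right mult_smult_left
        mult_smult_right scale_add_right M.a_ac)
  also have "\<dots> = y" unfolding yygg by (simp add: scale_cancel)
  also have "y = adj A x \<otimes> x" using x by (simp add: y_def)
  finally have "(cnorm A u)\<^sup>2 = (cnorm A x)\<^sup>2"
    using cstar_identity x by (metis c(5))
  then have nu: "cnorm A u = cnorm A x"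
    using x by (simp add: cnorm_nonneg power2_eq_iff_nonneg)
  have "u \<oplus> adj A u = (y \<oplus> y) \<oplus> (\<i> \<odot> g \<oplus> (- \<i>) \<odot> g)"
    using sa sg by (simp add: u_def adj_add adj_smult M.a_ac)
  also have "\<dots> = 2 \<odot> y" using scale_add_left [of y 1 1] by (simp add: scale_cancel)
  finally have "cnorm A (2 \<odot> y) \<le> cnorm A u + cnorm A (adj A u)"
    using cnorm_add [of u "adj A u"] by simp
  then have "cnorm A y \<le> cnorm A x" using nu by (simp add: cnorm_smult)
  moreover have "cnorm A y = (cnorm A x)\<^sup>2"
    using cstar_identity [of x] x by (simp add: y_def)
  ultimately have "cnorm A x * cnorm A x \<le> cnorm A x * 1" by (simp add: power2_eq_square)
  then show ?thesis
    using cnorm_nonneg [OF x(1)] by (cases "cnorm A x = 0") (auto dest: mult_left_le_imp_le)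
qed

end

locale cstar_hom = A: cstar_algebra A + B: cstar_algebra B
  for A :: "('a, 'm) cstar_scheme" and B :: "('b, 'n) cstar_scheme" +
  fixes \<phi> :: "'a \<Rightarrow> 'b"
  assumes star_hom: "star_hom A B \<phi>"
begin

lemma hom_closed [simp, intro]: "x \<in> carrier A \<Longrightarrow> \<phi> x \<in> carrier B"
  and hom_add: "\<lbrakk>x \<in> carrier A; y \<in> carrier A\<rbrakk> \<Longrightarrow> \<phi> (x \<oplus>\<^bsub>A\<^esub> y) = \<phi> x \<oplus>\<^bsub>B\<^esub> \<phi> y"
  and hom_scale: "x \<in> carrier A \<Longrightarrow> \<phi> (c \<odot>\<^bsub>A\<^esub> x) = c \<odot>\<^bsub>B\<^esub> \<phi> x"
  and hom_mult: "\<lbrakk>x \<in> carrier A; y \<in> carrier A\<rbrakk> \<Longrightarrow> \<phi> (x \<otimes>\<^bsub>A\<^esub> y) = \<phi> x \<otimes>\<^bsub>B\<^esub> \<phi> y"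
  and hom_adj: "x \<in> carrier A \<Longrightarrow> \<phi> (adj A x) = adj B (\<phi> x)"
  using star_hom unfolding star_hom_def by auto

lemma hom_zero [simp]: "\<phi> \<zero>\<^bsub>A\<^esub> = \<zero>\<^bsub>B\<^esub>"
  using hom_scale [of "\<zero>\<^bsub>A\<^esub>" 0] by simp

lemma hom_diff: "\<lbrakk>x \<in> carrier A; y \<in> carrier A\<rbrakk> \<Longrightarrow> \<phi> (x \<ominus>\<^bsub>A\<^esub> y) = \<phi> x \<ominus>\<^bsub>B\<^esub> \<phi> y"
  by (simp add: A.diff_eq B.diff_eq hom_add hom_scale)

text \<open>The relations between a self-adjoint element of norm less than one and its complementary root are
  algebraic, so a homomorphism preserves them, and in the target algebra they force norm at most one.
  This replaces the usual argument with spectra.\<close>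

lemma contractive:
  assumes x: "x \<in> carrier A" shows "cnorm B (\<phi> x) \<le> cnorm A x"
proof -
  have unit: "cnorm B (\<phi> a) \<le> 1" if a: "a \<in> carrier A" "adj A a = a" "cnorm A a < 1" for a
  proof -
    obtain f where f: "f \<in> carrier A" "adj A f = f" "f \<otimes>\<^bsub>A\<^esub> a = a \<otimes>\<^bsub>A\<^esub> f"
        "f \<oplus>\<^bsub>A\<^esub> f = a \<otimes>\<^bsub>A\<^esub> a \<oplus>\<^bsub>A\<^esub> f \<otimes>\<^bsub>A\<^esub> f"
      using A.ex_complementary_root [OF a] by blast
    show ?thesis
    proof (rule B.cnorm_le_one_if_complementary_root)
      show "\<phi> f \<otimes>\<^bsub>B\<^esub> \<phi> a = \<phi> a \<otimes>\<^bsub>B\<^esub> \<phi> f"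
        using f(3) a(1) f(1) hom_mult by metis
      show "\<phi> f \<oplus>\<^bsub>B\<^esub> \<phi> f = \<phi> a \<otimes>\<^bsub>B\<^esub> \<phi> a \<oplus>\<^bsub>B\<^esub> \<phi> f \<otimes>\<^bsub>B\<^esub> \<phi> f"
        using arg_cong [OF f(4), of \<phi>] f(1) a(1) by (simp add: hom_add hom_mult)
    qed (use a f in \<open>auto simp flip: hom_adj\<close>)
  qed
  have sa: "cnorm B (\<phi> a) \<le> cnorm A a" if a: "a \<in> carrier A" "adj A a = a" for a
  proof (rule dense_ge)
    fix t assume t: "cnorm A a < t"
    then have t0: "0 < t" using A.cnorm_nonneg [OF a(1)] by simp
    define d where "d = complex_of_real (inverse t)"
    have d: "cmod d = inverse t" "cnj d = d" using t0 by (simp_all add: d_def del: of_real_inverse)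
    have "inverse t * cnorm A a < 1" using t t0 by (simp add: field_simps)
    then have "cnorm B (\<phi> (d \<odot>\<^bsub>A\<^esub> a)) \<le> 1"
      using a by (intro unit) (simp_all add: A.adj_smult A.cnorm_smult d)
    then have "inverse t * cnorm B (\<phi> a) \<le> 1"
      using a by (simp add: hom_scale B.cnorm_smult d)
    then show "cnorm B (\<phi> a) \<le> t" using t0 by (simp add: field_simps)
  qed
  have "(cnorm B (\<phi> x))\<^sup>2 = cnorm B (\<phi> (adj A x \<otimes>\<^bsub>A\<^esub> x))"
    using x B.cstar_identity by (simp add: hom_mult hom_adj)
  also have "\<dots> \<le> cnorm A (adj A x \<otimes>\<^bsub>A\<^esub> x)"
    using x by (intro sa) (auto simp: A.adj_mult)
  also have "\<dots> = (cnorm A x)\<^sup>2" using x by (rule A.cstar_identity)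
  finally show ?thesis using A.cnorm_nonneg [OF x] by (rule power2_le_imp_le)
qed

lemma hom_conv:
  assumes "A.conv \<sigma> x" shows "B.conv (\<lambda>n. \<phi> (\<sigma> n)) (\<phi> x)"
proof (rule B.convI)
  show "(\<lambda>n. cnorm A (\<sigma> n \<ominus>\<^bsub>A\<^esub> x)) \<longlonglongrightarrow> 0" using assms by (rule A.convD)
  show "cnorm B (\<phi> (\<sigma> n) \<ominus>\<^bsub>B\<^esub> \<phi> x) \<le> cnorm A (\<sigma> n \<ominus>\<^bsub>A\<^esub> x)" for n
    using assms contractive [of "\<sigma> n \<ominus>\<^bsub>A\<^esub> x"] by (simp add: A.conv_def hom_diff)
qed (use assms in \<open>auto simp: A.conv_def\<close>)

text \<open>Continuity, which makes the kernel closed, comes from contractivity.\<close>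

lemma closed_ideal_kernel: "closed_ideal A (star_kernel A B \<phi>)"
  unfolding closed_ideal_def linear_subspace_def A.norm_closed_iff
proof (intro conjI ballI allI impI)
  fix \<sigma> x assume "(\<forall>n. \<sigma> n \<in> star_kernel A B \<phi>) \<and> A.conv \<sigma> x"
  then have x: "A.conv \<sigma> x" "\<And>n. \<phi> (\<sigma> n) = \<zero>\<^bsub>B\<^esub>" by (auto simp: star_kernel_def)
  have "\<phi> x = \<zero>\<^bsub>B\<^esub>"
    using hom_conv [OF x(1)] B.conv_const [of "\<zero>\<^bsub>B\<^esub>"] B.conv_unique by (simp add: x(2))
  then show "x \<in> star_kernel A B \<phi>" using x by (simp add: star_kernel_def A.conv_def)
qed (auto simp: star_kernel_def hom_add hom_scale hom_mult)

lemma cstar_subalgebra_preimage: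
  assumes Y: "cstar_subalgebra B Y"
  shows "cstar_subalgebra A {x \<in> carrier A. \<phi> x \<in> Y}"
proof -
  have cl: "norm_closed B Y" using Y by (simp add: cstar_subalgebra_def)
  have "x \<in> {x \<in> carrier A. \<phi> x \<in> Y}"
    if "\<And>n. \<sigma> n \<in> {x \<in> carrier A. \<phi> x \<in> Y}" "A.conv \<sigma> x" for \<sigma> x
  proof -
    have "\<phi> x \<in> Y"
      using B.norm_closedD [OF cl _ hom_conv [OF that(2)]] that(1) by blast
    then show ?thesis using A.conv_closed(2) [OF that(2)] by simp
  qed
  then have "norm_closed A {x \<in> carrier A. \<phi> x \<in> Y}"
    unfolding A.norm_closed_iff by blast
  then show ?thesis
    using Y unfolding cstar_subalgebra_def linear_subspace_def
    by (simp add: hom_add hom_scale hom_mult hom_adj subset_iff)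
qed

end

lemma ideal_generated_subset_iff:
  assumes "closed_ideal A I"
  shows "ideal_generated A X \<subseteq> I \<longleftrightarrow> X \<subseteq> I"
  using assms by (auto simp: ideal_generated_def)

context cstar_algebra
begin

lemma cstar_subalgebra_carrier: "cstar_subalgebra A (carrier A)"
  by (auto simp: cstar_subalgebra_def linear_subspace_def norm_closed_iff conv_def)

lemma cstar_generated_minimal:
  "\<lbrakk>cstar_subalgebra A Y; X \<subseteq> Y\<rbrakk> \<Longrightarrow> cstar_generated A X \<subseteq> Y"
  by (auto simp: cstar_generated_def)

lemma cstar_generated_superset: "X \<subseteq> cstar_generated A X"
  by (auto simp: cstar_generated_def)

lemma cstar_generated_closed: "X \<subseteq> carrier A \<Longrightarrow> cstar_generated A X \<subseteq> carrier A"
  by (intro cstar_generated_minimal cstar_subalgebra_carrier)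

lemma cstar_subalgebra_Inter:
  assumes "\<F> \<noteq> {}" "\<And>Y. Y \<in> \<F> \<Longrightarrow> cstar_subalgebra A Y"
  shows "cstar_subalgebra A (\<Inter>\<F>)"
proof -
  have "norm_closed A (\<Inter>\<F>)"
    using assms unfolding norm_closed_def cstar_subalgebra_def by (intro closedin_Inter) auto
  moreover have "\<Inter>\<F> \<subseteq> carrier A"
    using assms unfolding cstar_subalgebra_def linear_subspace_def by blast
  ultimately show ?thesis
    using assms(2) unfolding cstar_subalgebra_def linear_subspace_def by (simp add: Ball_def)
qed

lemma cstar_subalgebra_generated:
  assumes "X \<subseteq> carrier A" shows "cstar_subalgebra A (cstar_generated A X)"
  unfolding cstar_generated_def
  using assms cstar_subalgebra_carrier by (intro cstar_subalgebra_Inter) auto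

text \<open>The subset inherits every operation; only the additive inverse, which is computed inside the
  carrier, has to be identified.\<close>

lemma cstar_algebra_subalgebra:
  assumes X: "cstar_subalgebra A X"
  shows "cstar_algebra (A\<lparr>carrier := X, one := q\<rparr>)" (is "cstar_algebra ?X")
proof -
  have XA: "X \<subseteq> carrier A" and zero: "\<zero> \<in> X"
    and ops: "\<And>x y. \<lbrakk>x \<in> X; y \<in> X\<rbrakk> \<Longrightarrow> x \<oplus> y \<in> X" "\<And>c x. x \<in> X \<Longrightarrow> c \<odot> x \<in> X"
      "\<And>x y. \<lbrakk>x \<in> X; y \<in> X\<rbrakk> \<Longrightarrow> x \<otimes> y \<in> X" "\<And>x. x \<in> X \<Longrightarrow> adj A x \<in> X"
    and cl: "norm_closed A X"
    using X unfolding cstar_subalgebra_def linear_subspace_def by auto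
  have c: "x \<in> carrier A" if "x \<in> X" for x using XA that by auto
  have "abelian_group ?X"
  proof (rule abelian_groupI)
    fix x assume x: "x \<in> carrier ?X"
    show "\<exists>y\<in>carrier ?X. y \<oplus>\<^bsub>?X\<^esub> x = \<zero>\<^bsub>?X\<^esub>"
    proof (rule bexI)
      show "(-1) \<odot> x \<oplus>\<^bsub>?X\<^esub> x = \<zero>\<^bsub>?X\<^esub>"
        using x scale_cancel [of x "-1" 1] by (simp add: c)
      show "(-1) \<odot> x \<in> carrier ?X"
        using x by (simp add: ops)
    qed
  qed (simp_all add: ops zero c M.a_ac)
  then have "module complex_ring ?X"
    using cring_complex_ring
    by (intro moduleI) (simp_all add: ops c scale_add_left scale_add_right)
  then interpret X: normed_cmodule ?X
    by (intro normed_cmodule.intro normed_cmodule_axioms.intro)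
       (simp_all add: c cnorm_nonneg cnorm_eq_0 cnorm_add cnorm_smult)
  have diff: "x \<ominus>\<^bsub>?X\<^esub> y = x \<ominus> y" if "x \<in> X" "y \<in> X" for x y
    using that X.diff_eq [of x y] diff_eq [of x y] by (simp add: c)
  have "Metric_space.mcomplete (carrier ?X) (cdist ?X)"
    unfolding X.mcomplete_iff
  proof (intro allI impI)
    fix \<sigma> assume \<sigma>: "X.cauchy \<sigma>"
    then have \<sigma>X: "\<sigma> n \<in> X" for n by (simp add: X.cauchy_def)
    have "cauchy \<sigma>"
      using \<sigma> \<sigma>X by (simp add: X.cauchy_def cauchy_def diff c)
    then obtain x where x: "conv \<sigma> x" using cauchy_conv by blast
    then have "x \<in> X" using norm_closedD [OF cl] \<sigma>X by blast
    then have "X.conv \<sigma> x" using x \<sigma>X by (simp add: X.conv_def conv_def diff)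
    then show "\<exists>x. X.conv \<sigma> x" ..
  qed
  then show ?thesis
    by (intro cstar_algebra.intro cstar_algebra_axioms.intro X.module_axioms)
       (simp_all add: ops c mult_assoc mult_add_left mult_add_right mult_smult_left
         mult_smult_right adj_add adj_smult adj_mult cnorm_nonneg cnorm_eq_0 cnorm_add cnorm_smult
         cnorm_mult cstar_identity)
qed

lemma cstar_algebra_Cstar_of:
  assumes "X \<subseteq> carrier A" shows "cstar_algebra (Cstar_of A X)"
  using cstar_algebra_subalgebra [OF cstar_subalgebra_generated [OF assms], of \<one>]
  by (simp add: Cstar_of_def)

lemma carrier_corner:
  assumes "q \<in> carrier A" "q \<otimes> q = q"
  shows "carrier (corner A q) = {x \<in> carrier A. q \<otimes> x = x \<and> x \<otimes> q = x}"
proof -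
  have "q \<otimes> (q \<otimes> a \<otimes> q) = q \<otimes> a \<otimes> q" "(q \<otimes> a \<otimes> q) \<otimes> q = q \<otimes> a \<otimes> q"
    if "a \<in> carrier A" for a
    using assms that by (metis mult_assoc mult_closed)+
  moreover have "\<exists>a. x = q \<otimes> a \<otimes> q \<and> a \<in> carrier A"
    if "x \<in> carrier A" "q \<otimes> x = x" "x \<otimes> q = x" for x
    using that by (intro exI [of _ x]) simp
  ultimately show ?thesis using assms by (auto simp: corner_def)
qed

lemma cstar_algebra_corner:
  assumes q: "q \<in> carrier A" "q \<otimes> q = q" "adj A q = q"
  shows "cstar_algebra (corner A q)"
proof -
  let ?X = "{x \<in> carrier A. q \<otimes> x = x \<and> x \<otimes> q = x}"
  have "x \<in> ?X" if "\<And>n. \<sigma> n \<in> ?X" "conv \<sigma> x" for \<sigma> x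
  proof -
    have "conv \<sigma> (q \<otimes> x)" "conv \<sigma> (x \<otimes> q)"
      using that(1) mult_conv [OF conv_const [OF q(1)] that(2)] mult_conv [OF that(2) conv_const [OF q(1)]]
      by simp_all
    then have "q \<otimes> x = x" "x \<otimes> q = x" using conv_unique that(2) by blast+
    then show ?thesis using conv_closed(2) [OF that(2)] by simp
  qed
  then have "norm_closed A ?X" unfolding norm_closed_iff by blast
  moreover have "q \<otimes> adj A x = adj A x \<and> adj A x \<otimes> q = adj A x" if "x \<in> ?X" for x
    using that q adj_mult [of x q] adj_mult [of q x] by simp
  moreover have "q \<otimes> (x \<otimes> y) = x \<otimes> y \<and> (x \<otimes> y) \<otimes> q = x \<otimes> y" if "x \<in> ?X" "y \<in> ?X" for x y
    using that q mult_assoc [of q x y] mult_assoc [of x y q] by simp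
  ultimately have "cstar_subalgebra A ?X"
    using q unfolding cstar_subalgebra_def linear_subspace_def
    by (simp add: mult_add_left mult_add_right mult_smult_left mult_smult_right subset_iff)
  moreover have "corner A q = A\<lparr>carrier := ?X, one := q\<rparr>"
    using carrier_corner [OF q(1,2)] by (simp add: corner_def)
  ultimately show ?thesis using cstar_algebra_subalgebra by simp
qed

end

lemma star_homs_agree_on_generated:
  assumes "cstar_algebra A" "cstar_algebra B" "star_hom A B \<phi>" "star_hom A B \<psi>"
    and X: "X \<subseteq> carrier A" "\<And>x. x \<in> X \<Longrightarrow> \<phi> x = \<psi> x" and x: "x \<in> cstar_generated A X"
  shows "\<phi> x = \<psi> x"
proof -
  interpret \<phi>: cstar_hom A B \<phi> using assms by (simp add: cstar_hom_def cstar_hom_axioms_def)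
  interpret \<psi>: cstar_hom A B \<psi> using assms by (simp add: cstar_hom_def cstar_hom_axioms_def)
  let ?Y = "{x \<in> carrier A. \<phi> x = \<psi> x}"
  have "x \<in> ?Y" if "\<And>n. \<sigma> n \<in> ?Y" "\<phi>.A.conv \<sigma> x" for \<sigma> x
  proof -
    have "\<phi>.B.conv (\<lambda>n. \<phi> (\<sigma> n)) (\<psi> x)"
      using \<psi>.hom_conv [OF that(2)] that(1) by simp
    then have "\<phi> x = \<psi> x"
      using \<phi>.hom_conv [OF that(2)] \<phi>.B.conv_unique by blast
    then show ?thesis using \<phi>.A.conv_closed(2) [OF that(2)] by simp
  qed
  then have "norm_closed A ?Y" unfolding \<phi>.A.norm_closed_iff by blast
  then have "cstar_subalgebra A ?Y"
    unfolding cstar_subalgebra_def linear_subspace_def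
    by (simp add: subset_iff \<phi>.hom_add \<psi>.hom_add \<phi>.hom_scale \<psi>.hom_scale \<phi>.hom_mult \<psi>.hom_mult
        \<phi>.hom_adj \<psi>.hom_adj)
  then have "cstar_generated A X \<subseteq> ?Y"
    using X by (intro \<phi>.A.cstar_generated_minimal) auto
  then show ?thesis using x by auto
qed

section \<open>Norm comparison by polynomial growth\<close>

lemma le_if_powers_le_polynomial:
  fixes x y C M :: real
  assumes x: "0 \<le> x" and y: "0 \<le> y"
    and le: "\<And>k. y ^ 2 ^ k \<le> C * (2 ^ k * M + 1)\<^sup>2 * x ^ 2 ^ k"
  shows "y \<le> x"
proof (rule ccontr)
  assume "\<not> y \<le> x"
  then have yx: "x < y" by simp
  have x0: "0 < x"
  proof (rule ccontr)
    assume "\<not> 0 < x"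
    then have "x = 0" using x by simp
    then show False using le [of 0] yx by simp
  qed
  define q where "q = sqrt (x / y)"
  have q: "0 \<le> q" "q < 1" "q\<^sup>2 = x / y"
    using x0 yx by (auto simp: q_def)
  have "(\<lambda>n. C * (M * (real n * q ^ n) + q ^ n)\<^sup>2) \<longlonglongrightarrow> C * (M * 0 + 0)\<^sup>2"
    using q by (intro tendsto_intros LIMSEQ_realpow_zero powser_times_n_limit_0) auto
  then have "\<forall>\<^sub>F n in sequentially. C * (M * (real n * q ^ n) + q ^ n)\<^sup>2 < 1"
    by (intro order_tendstoD(2)) auto
  then obtain n0 where n0: "\<And>n. n0 \<le> n \<Longrightarrow> C * (M * (real n * q ^ n) + q ^ n)\<^sup>2 < 1"
    by (auto simp: eventually_sequentially)
  define n where "n = (2::nat) ^ n0"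
  have "n0 \<le> n" unfolding n_def by (simp add: less_imp_le)
  have "(M * (real n * q ^ n) + q ^ n)\<^sup>2 = (n * M + 1)\<^sup>2 * (q ^ n)\<^sup>2"
    by (simp add: power2_eq_square algebra_simps)
  also have "(q ^ n)\<^sup>2 = (x / y) ^ n"
    using q(3) by (metis power_mult mult.commute)
  finally have "C * (n * M + 1)\<^sup>2 * (x / y) ^ n < 1"
    using n0 [OF \<open>n0 \<le> n\<close>] by (simp add: mult.assoc)
  then have "C * (n * M + 1)\<^sup>2 * x ^ n < y ^ n"
    using x0 yx by (simp add: power_divide divide_simps)
  then show False using le [of n0] by (simp add: n_def)
qed

text \<open>\<open>combo A B m n deg N c a b\<close>: the family \<open>c\<close> of coefficients, of degree at most \<open>N\<close>, evaluates
  to \<open>a\<close> on the family \<open>m\<close> and to \<open>b\<close> on the family \<open>n\<close>.\<close>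

inductive combo ::
    "('a, 'm) cstar_scheme \<Rightarrow> ('b, 'n) cstar_scheme \<Rightarrow> ('i \<Rightarrow> 'a) \<Rightarrow> ('i \<Rightarrow> 'b) \<Rightarrow> ('i \<Rightarrow> nat) \<Rightarrow>
      nat \<Rightarrow> ('i \<Rightarrow> complex) \<Rightarrow> 'a \<Rightarrow> 'b \<Rightarrow> bool"
  for A B m n deg N where
  combo_zero: "combo A B m n deg N (\<lambda>_. 0) \<zero>\<^bsub>A\<^esub> \<zero>\<^bsub>B\<^esub>"
| combo_step: "\<lbrakk>combo A B m n deg N c a b; deg i \<le> N\<rbrakk> \<Longrightarrow>
    combo A B m n deg N (c(i := c i + t)) (a \<oplus>\<^bsub>A\<^esub> t \<odot>\<^bsub>A\<^esub> m i) (b \<oplus>\<^bsub>B\<^esub> t \<odot>\<^bsub>B\<^esub> n i)"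

lemma (in cstar_algebra) cnorm_finsum_le:
  assumes "finite F" "\<And>i. i \<in> F \<Longrightarrow> f i \<in> carrier A"
  shows "cnorm A (finsum A f F) \<le> (\<Sum>i\<in>F. cnorm A (f i))"
  using assms
proof (induction F rule: finite_induct)
  case (insert i F)
  have f: "f \<in> F \<rightarrow> carrier A" using insert by auto
  then have "cnorm A (finsum A f (insert i F)) \<le> cnorm A (f i) + cnorm A (finsum A f F)"
    using insert by (simp add: M.finsum_insert cnorm_add)
  then show ?case using insert by simp
qed simp

text \<open>Two families are compared that multiply and are adjoined in the same way, the degrees being
  subadditive. If each coefficient of a combination is bounded by the norm of its value in the first
  algebra, then the norm of the value in the second is at most a polynomial in the degree times the
  norm in the first. Applied to large powers of a self-adjoint element, whose norms are powers of
  its norm, this removes the polynomial.\<close>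

locale comparable_families = A: cstar_algebra A + B: cstar_algebra B
  for A :: "('a, 'm) cstar_scheme" and B :: "('b, 'n) cstar_scheme" +
  fixes m :: "'i \<Rightarrow> 'a" and n :: "'i \<Rightarrow> 'b" and deg :: "'i \<Rightarrow> nat" and L :: real
  assumes m_closed [simp, intro]: "m i \<in> carrier A"
    and n_closed [simp, intro]: "n i \<in> carrier B"
    and n_norm: "cnorm B (n i) \<le> 1"
    and finite_deg: "finite {i. deg i \<le> N}"
    and card_deg: "card {i. deg i \<le> N} \<le> 2 * (N + 1)\<^sup>2"
    and mult_family: "\<exists>k. deg k \<le> deg i + deg j \<and> m k = m i \<otimes>\<^bsub>A\<^esub> m j \<and> n k = n i \<otimes>\<^bsub>B\<^esub> n j"
    and adj_family: "\<exists>k. deg k \<le> deg i \<and> m k = adj A (m i) \<and> n k = adj B (n i)"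
    and coefficient_bound: "combo A B m n deg N c a b \<Longrightarrow> cmod (c i) \<le> L * cnorm A a"
begin

abbreviation spans :: "nat \<Rightarrow> 'a \<Rightarrow> 'b \<Rightarrow> bool" where
  "spans N a b \<equiv> \<exists>c. combo A B m n deg N c a b"

lemma combo_closed:
  assumes "combo A B m n deg N c a b" shows "a \<in> carrier A" "b \<in> carrier B"
  using assms by (induction rule: combo.induct) auto

lemma combo_finsum:
  assumes "combo A B m n deg N c a b"
  shows "b = finsum B (\<lambda>i. c i \<odot>\<^bsub>B\<^esub> n i) {i. deg i \<le> N}"
  using assms
proof (induction rule: combo.induct)
  case combo_zero
  have "finsum B (\<lambda>i. 0 \<odot>\<^bsub>B\<^esub> n i) {i. deg i \<le> N} = finsum B (\<lambda>i. \<zero>\<^bsub>B\<^esub>) {i. deg i \<le> N}"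
    by (rule B.M.finsum_cong') auto
  then show ?case by (simp add: B.M.finsum_zero)
next
  case (combo_step c a b i t)
  let ?F = "{i. deg i \<le> N}"
  have "finsum B (\<lambda>k. (c(i := c i + t)) k \<odot>\<^bsub>B\<^esub> n k) ?F
      = finsum B (\<lambda>k. c k \<odot>\<^bsub>B\<^esub> n k \<oplus>\<^bsub>B\<^esub> (if i = k then t \<odot>\<^bsub>B\<^esub> n k else \<zero>\<^bsub>B\<^esub>)) ?F"
    by (rule B.M.finsum_cong') (auto simp: B.scale_add_left)
  also have "\<dots> = b \<oplus>\<^bsub>B\<^esub> t \<odot>\<^bsub>B\<^esub> n i"
    using combo_step finite_deg [of N]
    by (subst B.M.finsum_addf) (auto simp: B.M.finsum_singleton)
  finally show ?case by simp
qed

lemma spans_norm: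
  assumes "spans N a b"
  shows "cnorm B b \<le> 2 * (real N + 1)\<^sup>2 * \<bar>L\<bar> * cnorm A a"
proof -
  obtain c where c: "combo A B m n deg N c a b" using assms by blast
  let ?F = "{i. deg i \<le> N}"
  have "cnorm B b \<le> (\<Sum>i\<in>?F. cnorm B (c i \<odot>\<^bsub>B\<^esub> n i))"
    unfolding combo_finsum [OF c] using finite_deg by (intro B.cnorm_finsum_le) auto
  also have "\<dots> \<le> (\<Sum>i\<in>?F. \<bar>L\<bar> * cnorm A a)"
  proof (rule sum_mono)
    fix i
    have "cnorm B (c i \<odot>\<^bsub>B\<^esub> n i) \<le> cmod (c i)"
      using n_norm [of i] by (simp add: B.cnorm_smult mult_left_le)
    also have "\<dots> \<le> L * cnorm A a" using c by (rule coefficient_bound)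
    also have "\<dots> \<le> \<bar>L\<bar> * cnorm A a"
      using A.cnorm_nonneg [OF combo_closed(1) [OF c]] by (intro mult_right_mono) auto
    finally show "cnorm B (c i \<odot>\<^bsub>B\<^esub> n i) \<le> \<bar>L\<bar> * cnorm A a" .
  qed
  also have "\<dots> = real (card ?F) * (\<bar>L\<bar> * cnorm A a)" by simp
  also have "\<dots> \<le> real (2 * (N + 1)\<^sup>2) * (\<bar>L\<bar> * cnorm A a)"
    using card_deg [of N] A.cnorm_nonneg [OF combo_closed(1) [OF c]]
    by (intro mult_right_mono of_nat_mono) auto
  finally show ?thesis by (simp add: mult.assoc algebra_simps)
qed

lemma spans_closed: "spans N a b \<Longrightarrow> a \<in> carrier A" "spans N a b \<Longrightarrow> b \<in> carrier B"
  using combo_closed by blast+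

lemma spans_zero: "spans N \<zero>\<^bsub>A\<^esub> \<zero>\<^bsub>B\<^esub>"
  using combo_zero by blast

lemma spans_step:
  "\<lbrakk>spans N a b; deg i \<le> N\<rbrakk> \<Longrightarrow> spans N (a \<oplus>\<^bsub>A\<^esub> t \<odot>\<^bsub>A\<^esub> m i) (b \<oplus>\<^bsub>B\<^esub> t \<odot>\<^bsub>B\<^esub> n i)"
  using combo.combo_step [of A B m n deg N _ a b i t] by blast

lemma spans_induct [consumes 1, case_names zero step]:
  assumes "spans N a b" "P \<zero>\<^bsub>A\<^esub> \<zero>\<^bsub>B\<^esub>"
    and "\<And>a b i t. \<lbrakk>spans N a b; P a b; deg i \<le> N\<rbrakk>
      \<Longrightarrow> P (a \<oplus>\<^bsub>A\<^esub> t \<odot>\<^bsub>A\<^esub> m i) (b \<oplus>\<^bsub>B\<^esub> t \<odot>\<^bsub>B\<^esub> n i)"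
  shows "P a b"
proof -
  obtain c where "combo A B m n deg N c a b" using assms(1) by blast
  then show ?thesis by (induction rule: combo.induct) (use assms(2,3) in blast)+
qed

lemma spans_family: "deg i \<le> N \<Longrightarrow> spans N (m i) (n i)"
  using spans_step [OF spans_zero, of i N 1] by simp

lemma spans_mono: assumes "spans N a b" "N \<le> M" shows "spans M a b"
  using assms(1)
proof (induction rule: spans_induct)
  case zero show ?case by (rule spans_zero)
next
  case (step a b i t) show ?case by (rule spans_step) (use step assms(2) in auto)
qed

lemma spans_add:
  assumes "spans N a b" "spans N a' b'" shows "spans N (a \<oplus>\<^bsub>A\<^esub> a') (b \<oplus>\<^bsub>B\<^esub> b')"
  using assms(2)
proof (induction rule: spans_induct)
  case zero
  then show ?case using assms(1) spans_closed [OF assms(1)] by simp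
next
  case (step a' b' i t)
  show ?case
    using spans_step [OF step(3,2), of t] spans_closed [OF assms(1)] spans_closed [OF step(1)]
    by (simp add: A.M.a_assoc B.M.a_assoc)
qed

lemma spans_scale:
  assumes "spans N a b" shows "spans N (t \<odot>\<^bsub>A\<^esub> a) (t \<odot>\<^bsub>B\<^esub> b)"
  using assms
proof (induction rule: spans_induct)
  case zero then show ?case using spans_zero by simp
next
  case (step a b i s)
  show ?case
    using spans_step [OF step(3,2), of "t * s"] spans_closed [OF step(1)]
    by (simp add: A.scale_add_right B.scale_add_right)
qed

lemma spans_adj:
  assumes "spans N a b" shows "spans N (adj A a) (adj B b)"
  using assms
proof (induction rule: spans_induct)
  case zero then show ?case using spans_zero by simp
next
  case (step a b i t)
  obtain k where k: "deg k \<le> deg i" "m k = adj A (m i)" "n k = adj B (n i)"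
    using adj_family by blast
  show ?case
    using spans_step [OF step(3), of k "cnj t"] step(2) k spans_closed [OF step(1)]
    by (simp add: A.adj_add B.adj_add A.adj_smult B.adj_smult)
qed

lemma spans_mult:
  assumes "spans N a b" "spans M a' b'" shows "spans (N + M) (a \<otimes>\<^bsub>A\<^esub> a') (b \<otimes>\<^bsub>B\<^esub> b')"
proof -
  have one: "spans (N + M) (a \<otimes>\<^bsub>A\<^esub> m j) (b \<otimes>\<^bsub>B\<^esub> n j)" if j: "deg j \<le> M" for j
    using assms(1)
  proof (induction rule: spans_induct)
    case zero then show ?case using spans_zero by simp
  next
    case (step a b i t)
    obtain k where k: "deg k \<le> deg i + deg j" "m k = m i \<otimes>\<^bsub>A\<^esub> m j" "n k = n i \<otimes>\<^bsub>B\<^esub> n j"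
      using mult_family by blast
    show ?case
      using spans_step [OF step(3), of k t] step(2) j k spans_closed [OF step(1)]
      by (simp add: A.mult_add_left B.mult_add_left A.mult_smult_left B.mult_smult_left)
  qed
  show ?thesis
    using assms(2)
  proof (induction rule: spans_induct)
    case zero then show ?case using spans_zero spans_closed [OF assms(1)] by simp
  next
    case (step a' b' i t)
    show ?case
      using spans_add [OF step(3) spans_scale [OF one [OF step(2)], of t]]
        spans_closed [OF assms(1)] spans_closed [OF step(1)]
      by (simp add: A.mult_add_right B.mult_add_right A.mult_smult_right B.mult_smult_right)
  qed
qed

lemma spans_norm_le:
  assumes ab: "spans N a b" shows "cnorm B b \<le> cnorm A a"
proof -
  define x where "x = adj A a \<otimes>\<^bsub>A\<^esub> a"
  define y where "y = adj B b \<otimes>\<^bsub>B\<^esub> b"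
  define X where "X = rec_nat x (\<lambda>_ z. z \<otimes>\<^bsub>A\<^esub> z)"
  define Y where "Y = rec_nat y (\<lambda>_ z. z \<otimes>\<^bsub>B\<^esub> z)"
  note c = spans_closed [OF ab]
  have X: "X k \<in> carrier A \<and> adj A (X k) = X k \<and> cnorm A (X k) = cnorm A x ^ 2 ^ k" for k
  proof (induction k)
    case (Suc k)
    then have "cnorm A (X k \<otimes>\<^bsub>A\<^esub> X k) = (cnorm A (X k))\<^sup>2"
      using A.cstar_identity [of "X k"] by simp
    then show ?case using Suc by (simp add: X_def A.adj_mult power_mult [symmetric] mult.commute)
  qed (use c in \<open>simp add: X_def x_def A.adj_mult\<close>)
  have Y: "Y k \<in> carrier B \<and> adj B (Y k) = Y k \<and> cnorm B (Y k) = cnorm B y ^ 2 ^ k" for k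
  proof (induction k)
    case (Suc k)
    then have "cnorm B (Y k \<otimes>\<^bsub>B\<^esub> Y k) = (cnorm B (Y k))\<^sup>2"
      using B.cstar_identity [of "Y k"] by simp
    then show ?case using Suc by (simp add: Y_def B.adj_mult power_mult [symmetric] mult.commute)
  qed (use c in \<open>simp add: Y_def y_def B.adj_mult\<close>)
  have XY: "spans (2 ^ k * (N + N)) (X k) (Y k)" for k
  proof (induction k)
    case 0
    then show ?case using spans_mult [OF spans_adj [OF ab] ab] by (simp add: X_def Y_def x_def y_def)
  next
    case (Suc k)
    then show ?case using spans_mult [OF Suc Suc] by (simp add: X_def Y_def mult_2 distrib_right)
  qed
  have "cnorm B y \<le> cnorm A x"
  proof (rule le_if_powers_le_polynomial)
    fix k
    show "cnorm B y ^ 2 ^ k \<le> (2 * \<bar>L\<bar>) * (2 ^ k * real (N + N) + 1)\<^sup>2 * cnorm A x ^ 2 ^ k"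
      using spans_norm [OF XY [of k]] X [of k] Y [of k] by (simp add: mult_ac)
  qed (use c in \<open>auto simp: x_def y_def intro!: A.cnorm_nonneg B.cnorm_nonneg\<close>)
  then have "(cnorm B b)\<^sup>2 \<le> (cnorm A a)\<^sup>2"
    using c by (simp add: x_def y_def A.cstar_identity B.cstar_identity)
  then show ?thesis using A.cnorm_nonneg [OF c(1)] by (rule power2_le_imp_le)
qed

text \<open>The combinations are the graph of a contraction; its closure is the graph of the extension.\<close>

definition spn :: "'a \<Rightarrow> 'b \<Rightarrow> bool" where
  "spn a b \<longleftrightarrow> (\<exists>N. spans N a b)"

definition lim_spn :: "'a \<Rightarrow> 'b \<Rightarrow> bool" where
  "lim_spn a b \<longleftrightarrow> (\<exists>\<sigma> \<tau>. (\<forall>k. spn (\<sigma> k) (\<tau> k)) \<and> A.conv \<sigma> a \<and> B.conv \<tau> b)"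

lemma lim_spnI:
  "\<lbrakk>\<And>k. spn (\<sigma> k) (\<tau> k); A.conv \<sigma> a; B.conv \<tau> b\<rbrakk> \<Longrightarrow> lim_spn a b"
  unfolding lim_spn_def by blast

definition closed_span :: "'a set" where
  "closed_span = {a. \<exists>\<sigma>. A.conv \<sigma> a \<and> (\<forall>k. \<exists>b. spn (\<sigma> k) b)}"

lemma spn_ops:
  assumes "spn a b" "spn a' b'"
  shows "spn (a \<oplus>\<^bsub>A\<^esub> a') (b \<oplus>\<^bsub>B\<^esub> b')" "spn (a \<otimes>\<^bsub>A\<^esub> a') (b \<otimes>\<^bsub>B\<^esub> b')"
    "spn (t \<odot>\<^bsub>A\<^esub> a) (t \<odot>\<^bsub>B\<^esub> b)" "spn (adj A a) (adj B b)"
proof -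
  obtain N M where "spans N a b" "spans M a' b'" using assms by (auto simp: spn_def)
  then have N: "spans (N + M) a b" "spans (N + M) a' b'" by (auto intro: spans_mono)
  show "spn (a \<oplus>\<^bsub>A\<^esub> a') (b \<oplus>\<^bsub>B\<^esub> b')" "spn (a \<otimes>\<^bsub>A\<^esub> a') (b \<otimes>\<^bsub>B\<^esub> b')"
    "spn (t \<odot>\<^bsub>A\<^esub> a) (t \<odot>\<^bsub>B\<^esub> b)" "spn (adj A a) (adj B b)"
    using spans_add [OF N] spans_mult [OF N] spans_scale [OF N(1)] spans_adj [OF N(1)]
    unfolding spn_def by blast+
qed

lemma spn_closed: "spn a b \<Longrightarrow> a \<in> carrier A" "spn a b \<Longrightarrow> b \<in> carrier B"
  using spans_closed unfolding spn_def by blast+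

lemma spn_norm_le: "spn a b \<Longrightarrow> cnorm B b \<le> cnorm A a"
  using spans_norm_le unfolding spn_def by blast

lemma spn_diff:
  assumes "spn a b" "spn a' b'" shows "spn (a \<ominus>\<^bsub>A\<^esub> a') (b \<ominus>\<^bsub>B\<^esub> b')"
  using spn_ops(1) [OF assms(1) spn_ops(3) [OF assms(2,2), of "-1"]]
    spn_closed [OF assms(1)] spn_closed [OF assms(2)] by (simp add: A.diff_eq B.diff_eq)

lemma lim_spn_ops:
  assumes "lim_spn a b" "lim_spn a' b'"
  shows "lim_spn (a \<oplus>\<^bsub>A\<^esub> a') (b \<oplus>\<^bsub>B\<^esub> b')" "lim_spn (a \<otimes>\<^bsub>A\<^esub> a') (b \<otimes>\<^bsub>B\<^esub> b')"
    "lim_spn (t \<odot>\<^bsub>A\<^esub> a) (t \<odot>\<^bsub>B\<^esub> b)" "lim_spn (adj A a) (adj B b)"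
proof -
  obtain \<sigma> \<tau> where 1: "\<And>k. spn (\<sigma> k) (\<tau> k)" "A.conv \<sigma> a" "B.conv \<tau> b"
    using assms(1) by (auto simp: lim_spn_def)
  obtain \<sigma>' \<tau>' where 2: "\<And>k. spn (\<sigma>' k) (\<tau>' k)" "A.conv \<sigma>' a'" "B.conv \<tau>' b'"
    using assms(2) by (auto simp: lim_spn_def)
  show "lim_spn (a \<oplus>\<^bsub>A\<^esub> a') (b \<oplus>\<^bsub>B\<^esub> b')"
    by (rule lim_spnI [OF spn_ops(1) [OF 1(1) 2(1)] A.conv_add [OF 1(2) 2(2)] B.conv_add [OF 1(3) 2(3)]])
  show "lim_spn (a \<otimes>\<^bsub>A\<^esub> a') (b \<otimes>\<^bsub>B\<^esub> b')"
    by (rule lim_spnI [OF spn_ops(2) [OF 1(1) 2(1)] A.mult_conv [OF 1(2) 2(2)] B.mult_conv [OF 1(3) 2(3)]])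
  show "lim_spn (t \<odot>\<^bsub>A\<^esub> a) (t \<odot>\<^bsub>B\<^esub> b)"
    by (rule lim_spnI [OF spn_ops(3) [OF 1(1) 2(1)] A.conv_scale [OF 1(2)] B.conv_scale [OF 1(3)]])
  show "lim_spn (adj A a) (adj B b)"
    by (rule lim_spnI [OF spn_ops(4) [OF 1(1) 2(1)] A.adj_conv [OF 1(2)] B.adj_conv [OF 1(3)]])
qed

lemma lim_spn_norm_le: assumes "lim_spn a b" shows "cnorm B b \<le> cnorm A a"
proof -
  obtain \<sigma> \<tau> where "\<And>k. spn (\<sigma> k) (\<tau> k)" "A.conv \<sigma> a" "B.conv \<tau> b"
    using assms by (auto simp: lim_spn_def)
  then show ?thesis
    using LIMSEQ_le [OF B.conv_cnorm A.conv_cnorm] spn_norm_le by blast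
qed

lemma lim_spn_closed: "lim_spn a b \<Longrightarrow> a \<in> carrier A" "lim_spn a b \<Longrightarrow> b \<in> carrier B"
  unfolding lim_spn_def using A.conv_closed B.conv_closed by blast+

lemma lim_spn_unique: assumes "lim_spn a b" "lim_spn a b'" shows "b = b'"
proof -
  note c = lim_spn_closed [OF assms(1)] lim_spn_closed [OF assms(2)]
  have "lim_spn (a \<ominus>\<^bsub>A\<^esub> a) (b \<ominus>\<^bsub>B\<^esub> b')"
    using lim_spn_ops(1) [OF assms(1) lim_spn_ops(3) [OF assms(2,2), of "-1"]] c
    by (simp add: A.diff_eq B.diff_eq del: A.diff_self)
  then have "cnorm B (b \<ominus>\<^bsub>B\<^esub> b') \<le> 0" using lim_spn_norm_le c by fastforce
  then have "cnorm B (b \<ominus>\<^bsub>B\<^esub> b') = 0" using B.cnorm_nonneg c by (simp add: antisym)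
  then show ?thesis using c by (simp add: B.cnorm_eq_0 B.diff_eq_zero_iff)
qed

lemma closed_span_iff: "a \<in> closed_span \<longleftrightarrow> (\<exists>b. lim_spn a b)"
proof
  assume "a \<in> closed_span"
  then obtain \<sigma> where \<sigma>: "A.conv \<sigma> a" "\<And>k. \<exists>b. spn (\<sigma> k) b" by (auto simp: closed_span_def)
  then obtain \<tau> where \<tau>: "\<And>k. spn (\<sigma> k) (\<tau> k)" by metis
  have "B.cauchy \<tau>"
    unfolding B.cauchy_def
  proof (intro conjI allI impI)
    fix \<epsilon> :: real assume "0 < \<epsilon>"
    then obtain N where "\<forall>m\<ge>N. \<forall>n\<ge>N. cnorm A (\<sigma> m \<ominus>\<^bsub>A\<^esub> \<sigma> n) < \<epsilon>"
      using A.conv_imp_cauchy [OF \<sigma>(1)] unfolding A.cauchy_def by blast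
    then show "\<exists>N. \<forall>m\<ge>N. \<forall>n\<ge>N. cnorm B (\<tau> m \<ominus>\<^bsub>B\<^esub> \<tau> n) < \<epsilon>"
      using spn_norm_le [OF spn_diff [OF \<tau> \<tau>]] by (meson le_less_trans)
  qed (use spn_closed \<tau> in blast)
  then obtain b where "B.conv \<tau> b" using B.cauchy_conv by blast
  then show "\<exists>b. lim_spn a b" using \<sigma>(1) \<tau> unfolding lim_spn_def by blast
qed (auto simp: lim_spn_def closed_span_def)

lemma cstar_subalgebra_closed_span: "cstar_subalgebra A closed_span"
proof -
  have "x \<in> closed_span" if mem: "\<And>k. \<sigma> k \<in> closed_span" and x: "A.conv \<sigma> x" for \<sigma> x
  proof -
    have "\<exists>\<tau>. A.conv \<tau> (\<sigma> k) \<and> (\<forall>n. \<exists>b. spn (\<tau> n) b)" for k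
      using mem [of k] by (simp add: closed_span_def)
    then obtain \<rho> where "A.conv \<rho> x" "\<And>k. \<exists>b. spn (\<rho> k) b"
      using A.conv_diagonal [OF x, of "\<lambda>a. \<exists>b. spn a b"] by metis
    then show ?thesis by (auto simp: closed_span_def)
  qed
  then have "norm_closed A closed_span"
    unfolding A.norm_closed_iff by (auto simp: closed_span_def intro: A.conv_closed(2))
  moreover have "\<zero>\<^bsub>A\<^esub> \<in> closed_span"
    using A.conv_const [of "\<zero>\<^bsub>A\<^esub>"] spans_zero unfolding closed_span_def spn_def by blast
  moreover have "closed_span \<subseteq> carrier A"
    unfolding closed_span_iff subset_iff using lim_spn_closed by blast
  moreover have "x \<oplus>\<^bsub>A\<^esub> y \<in> closed_span" "x \<otimes>\<^bsub>A\<^esub> y \<in> closed_span"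
      "c \<odot>\<^bsub>A\<^esub> x \<in> closed_span" "adj A x \<in> closed_span"
    if xy: "x \<in> closed_span" "y \<in> closed_span" for x y c
  proof -
    obtain x' y' where l: "lim_spn x x'" "lim_spn y y'" using xy unfolding closed_span_iff by blast
    show "x \<oplus>\<^bsub>A\<^esub> y \<in> closed_span" "x \<otimes>\<^bsub>A\<^esub> y \<in> closed_span"
      "c \<odot>\<^bsub>A\<^esub> x \<in> closed_span" "adj A x \<in> closed_span"
      using lim_spn_ops(1) [OF l] lim_spn_ops(2) [OF l] lim_spn_ops(3) [OF l(1,1)] lim_spn_ops(4) [OF l]
      unfolding closed_span_iff by blast+
  qed
  ultimately show ?thesis
    unfolding cstar_subalgebra_def linear_subspace_def by simp
qed

lemma family_in_closed_span: "m i \<in> closed_span" and lim_spn_family: "lim_spn (m i) (n i)"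
proof -
  have "spn (m i) (n i)" using spans_family unfolding spn_def by blast
  then show "lim_spn (m i) (n i)"
    by (rule lim_spnI [OF _ A.conv_const [OF m_closed] B.conv_const [OF n_closed]])
  then show "m i \<in> closed_span" unfolding closed_span_iff by blast
qed

lemma closed_span_minimal:
  assumes Y: "linear_subspace A Y" "norm_closed A Y" "\<And>i. m i \<in> Y"
  shows "closed_span \<subseteq> Y"
proof
  fix a assume "a \<in> closed_span"
  then obtain \<sigma> where \<sigma>: "A.conv \<sigma> a" "\<And>k. \<exists>b. spn (\<sigma> k) b" by (auto simp: closed_span_def)
  have "x \<in> Y" if xy: "spans N x y" for N x y
    using xy by (induction rule: spans_induct) (use Y in \<open>auto simp: linear_subspace_def\<close>)
  then have "\<sigma> k \<in> Y" for k using \<sigma>(2) [of k] unfolding spn_def by blast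
  then show "a \<in> Y" using A.norm_closedD [OF Y(2) _ \<sigma>(1)] by blast
qed

text \<open>The common source of all homomorphisms constructed below: prescribing the images of a comparable family
  is enough.\<close>

lemma ex_star_hom_closed_span:
  obtains \<phi> where "star_hom (A\<lparr>carrier := closed_span\<rparr>) B \<phi>" "\<And>i. \<phi> (m i) = n i"
proof -
  define \<phi> where "\<phi> a = (THE b. lim_spn a b)" for a
  have eq: "\<phi> a = b" if "lim_spn a b" for a b
    unfolding \<phi>_def using that lim_spn_unique by blast
  have lim: "lim_spn a (\<phi> a)" if "a \<in> closed_span" for a
    using that eq unfolding closed_span_iff by metis
  have "star_hom (A\<lparr>carrier := closed_span\<rparr>) B \<phi>"
    unfolding star_hom_def
  proof (intro conjI ballI allI)
    show "\<phi> \<in> carrier (A\<lparr>carrier := closed_span\<rparr>) \<rightarrow> carrier B"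
      using lim_spn_closed(2) [OF lim] by auto
  next
    fix x y c assume "x \<in> carrier (A\<lparr>carrier := closed_span\<rparr>)" "y \<in> carrier (A\<lparr>carrier := closed_span\<rparr>)"
    then have l: "lim_spn x (\<phi> x)" "lim_spn y (\<phi> y)" using lim by auto
    show "\<phi> (x \<oplus>\<^bsub>A\<lparr>carrier := closed_span\<rparr>\<^esub> y) = \<phi> x \<oplus>\<^bsub>B\<^esub> \<phi> y"
      "\<phi> (x \<otimes>\<^bsub>A\<lparr>carrier := closed_span\<rparr>\<^esub> y) = \<phi> x \<otimes>\<^bsub>B\<^esub> \<phi> y"
      using eq [OF lim_spn_ops(1) [OF l]] eq [OF lim_spn_ops(2) [OF l]] by simp_all
  next
    fix x c assume "x \<in> carrier (A\<lparr>carrier := closed_span\<rparr>)"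
    then have l: "lim_spn x (\<phi> x)" using lim by auto
    show "\<phi> (c \<odot>\<^bsub>A\<lparr>carrier := closed_span\<rparr>\<^esub> x) = c \<odot>\<^bsub>B\<^esub> \<phi> x"
      "\<phi> (adj (A\<lparr>carrier := closed_span\<rparr>) x) = adj B (\<phi> x)"
      using eq [OF lim_spn_ops(3) [OF l l]] eq [OF lim_spn_ops(4) [OF l l]] by simp_all
  qed
  moreover have "\<phi> (m i) = n i" for i using eq lim_spn_family by blast
  ultimately show thesis using that by blast
qed

end

context cstar_algebra
begin

lemma conv_subalgebra:
  assumes X: "cstar_subalgebra A X"
  shows "normed_cmodule.conv (A\<lparr>carrier := X, one := q\<rparr>) \<sigma> x \<longleftrightarrow> (\<forall>n. \<sigma> n \<in> X) \<and> x \<in> X \<and> conv \<sigma> x"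
proof -
  interpret X: cstar_algebra "A\<lparr>carrier := X, one := q\<rparr>"
    using X by (rule cstar_algebra_subalgebra)
  have XA: "X \<subseteq> carrier A" using X by (simp add: cstar_subalgebra_def linear_subspace_def)
  have "y \<ominus>\<^bsub>A\<lparr>carrier := X, one := q\<rparr>\<^esub> z = y \<ominus> z" if "y \<in> X" "z \<in> X" for y z
    using that X.diff_eq [of y z] diff_eq [of y z] subsetD [OF XA] by simp
  then show ?thesis using XA by (auto simp: X.conv_def conv_def)
qed

lemma cstar_subalgebra_trans:
  assumes X: "cstar_subalgebra A X" and Y: "cstar_subalgebra (A\<lparr>carrier := X, one := q\<rparr>) Y"
  shows "cstar_subalgebra A Y"
proof -
  interpret X: cstar_algebra "A\<lparr>carrier := X, one := q\<rparr>"
    using X by (rule cstar_algebra_subalgebra)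
  have XA: "X \<subseteq> carrier A" and clX: "norm_closed A X"
    using X by (simp_all add: cstar_subalgebra_def linear_subspace_def)
  have YX: "Y \<subseteq> X" and clY: "norm_closed (A\<lparr>carrier := X, one := q\<rparr>) Y"
    using Y by (simp_all add: cstar_subalgebra_def linear_subspace_def)
  have "x \<in> Y" if \<sigma>: "\<And>n. \<sigma> n \<in> Y" and x: "conv \<sigma> x" for \<sigma> x
  proof -
    have \<sigma>X: "\<sigma> n \<in> X" for n using \<sigma> YX by auto
    have "x \<in> X" using norm_closedD [OF clX \<sigma>X x] .
    then have "X.conv \<sigma> x" using \<sigma>X x conv_subalgebra [OF X] by simp
    then show ?thesis using X.norm_closedD [OF clY] \<sigma> by blast
  qed
  then have "norm_closed A Y" using YX XA unfolding norm_closed_iff by blast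
  then show ?thesis
    using Y YX XA by (simp add: cstar_subalgebra_def linear_subspace_def)
qed

lemma cstar_generated_Cstar_of:
  assumes "X \<subseteq> carrier A" shows "cstar_generated (Cstar_of A X) X = carrier (Cstar_of A X)"
proof
  let ?G = "cstar_generated A X"
  interpret G: cstar_algebra "Cstar_of A X" using assms by (rule cstar_algebra_Cstar_of)
  have G: "Cstar_of A X = A\<lparr>carrier := ?G, one := \<one>\<rparr>" by (simp add: Cstar_of_def)
  have car: "carrier (Cstar_of A X) = ?G" by (simp add: Cstar_of_def)
  have XG: "X \<subseteq> carrier (Cstar_of A X)" unfolding car by (rule cstar_generated_superset)
  show "cstar_generated (Cstar_of A X) X \<subseteq> carrier (Cstar_of A X)"
    using XG by (rule G.cstar_generated_closed)
  have "cstar_subalgebra A (cstar_generated (Cstar_of A X) X)"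
    using cstar_subalgebra_trans [OF cstar_subalgebra_generated [OF assms]]
      G.cstar_subalgebra_generated [OF XG] unfolding G .
  then show "carrier (Cstar_of A X) \<subseteq> cstar_generated (Cstar_of A X) X"
    unfolding car using G.cstar_generated_superset by (intro cstar_generated_minimal)
qed

lemma star_hom_inclusion:
  assumes "X \<subseteq> carrier A" shows "star_hom (Cstar_of A X) A (\<lambda>x. x)"
  using cstar_generated_closed [OF assms] by (auto simp: star_hom_def Cstar_of_def)

lemma projection_norm_le_one:
  assumes "q \<in> carrier A" "adj A q = q" "q \<otimes> q = q" shows "cnorm A q \<le> 1"
proof -
  have "cnorm A q * cnorm A q = cnorm A q * 1"
    using cstar_identity [of q] assms by (simp add: power2_eq_square)
  then show ?thesis by (cases "cnorm A q = 0") auto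
qed

lemma projection_norm_eq_one:
  assumes "q \<in> carrier A" "adj A q = q" "q \<otimes> q = q" "q \<noteq> \<zero>" shows "cnorm A q = 1"
proof -
  have "cnorm A q * cnorm A q = cnorm A q * 1"
    using cstar_identity [of q] assms by (simp add: power2_eq_square)
  then show ?thesis using assms cnorm_eq_0 [of q] by simp
qed

end

lemma star_hom_id: "star_hom A A (\<lambda>x. x)"
  by (simp add: star_hom_def)

lemma star_hom_compose:
  "\<lbrakk>star_hom A B \<phi>; star_hom B C \<psi>\<rbrakk> \<Longrightarrow> star_hom A C (\<lambda>x. \<psi> (\<phi> x))"
  unfolding star_hom_def by (auto simp: Pi_iff)

section \<open>Coburn's theorem\<close>

text \<open>An isometry in the corner of the projection \<open>e\<close>; the ambient algebra may lack a unit.\<close>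

locale corner_isometry = cstar_algebra A for A :: "('a, 'm) cstar_scheme" (structure) +
  fixes u e :: 'a
  assumes u_closed [simp, intro]: "u \<in> carrier A"
    and adj_u_u: "adj A u \<otimes> u = e"
    and e_u: "e \<otimes> u = u"
    and u_e: "u \<otimes> e = u"
begin

lemma e_closed [simp, intro]: "e \<in> carrier A"
  using adj_u_u by (metis adj_closed mult_closed u_closed)

lemma adj_e [simp]: "adj A e = e"
  by (metis adj_adj adj_closed adj_mult adj_u_u u_closed)

lemma e_e [simp]: "e \<otimes> e = e"
proof -
  have "e \<otimes> e = adj A u \<otimes> (u \<otimes> e)" using mult_assoc [of "adj A u" u e] by (simp add: adj_u_u)
  then show ?thesis by (simp add: u_e adj_u_u)
qed

primrec pow :: "nat \<Rightarrow> 'a" where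
  "pow 0 = e"
| "pow (Suc k) = u \<otimes> pow k"

lemma pow_closed [simp, intro]: "pow k \<in> carrier A"
  by (induction k) auto

lemma e_pow [simp]: "e \<otimes> pow k = pow k"
proof (induction k)
  case (Suc k)
  then show ?case using mult_assoc [of e u "pow k"] by (simp add: e_u)
qed simp

lemma pow_e [simp]: "pow k \<otimes> e = pow k"
  by (induction k) (simp_all add: mult_assoc)

lemma pow_add: "pow (j + k) = pow j \<otimes> pow k"
  by (induction j) (simp_all add: mult_assoc)

lemma adj_pow_e [simp]: "adj A (pow k) \<otimes> e = adj A (pow k)"
  using adj_mult [of e "pow k"] by simp

lemma e_adj_pow [simp]: "e \<otimes> adj A (pow k) = adj A (pow k)"
  using adj_mult [of "pow k" e] by simp

lemma adj_pow_pow_same [simp]: "adj A (pow k) \<otimes> pow k = e"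
proof (induction k)
  case (Suc k)
  have "adj A (pow (Suc k)) \<otimes> pow (Suc k) = adj A (pow k) \<otimes> ((adj A u \<otimes> u) \<otimes> pow k)"
    by (simp add: adj_mult mult_assoc)
  then show ?case using Suc by (simp add: adj_u_u)
qed simp

lemma adj_pow_pow: "adj A (pow j) \<otimes> pow k = pow (k - j) \<otimes> adj A (pow (j - k))"
proof (cases "j \<le> k")
  case True
  then have "adj A (pow j) \<otimes> pow k = (adj A (pow j) \<otimes> pow j) \<otimes> pow (k - j)"
    using pow_add [of j "k - j"] mult_assoc [of "adj A (pow j)" "pow j" "pow (k - j)"] by simp
  then show ?thesis using True by simp
next
  case False
  have "pow j = pow k \<otimes> pow (j - k)" using False pow_add [of k "j - k"] by simp
  then have "adj A (pow j) \<otimes> pow k = adj A (pow (j - k)) \<otimes> (adj A (pow k) \<otimes> pow k)"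
    by (simp add: adj_mult mult_assoc)
  then show ?thesis using False by simp
qed

text \<open>Words in \<open>u\<close> and its adjoint reduce to \<open>word (i, j)\<close>; one of the truncated differences in the
  multiplication rule is zero.\<close>

definition word :: "nat \<times> nat \<Rightarrow> 'a" where
  "word = (\<lambda>(i, j). pow i \<otimes> adj A (pow j))"

lemma word_closed [simp, intro]: "word i \<in> carrier A"
  by (cases i) (simp add: word_def)

lemma word_mult: "word (i, j) \<otimes> word (k, l) = word (i + (k - j), l + (j - k))"
proof -
  have "word (i, j) \<otimes> word (k, l) = pow i \<otimes> ((adj A (pow j) \<otimes> pow k) \<otimes> adj A (pow l))"
    by (simp add: word_def mult_assoc)
  also have "\<dots> = (pow i \<otimes> pow (k - j)) \<otimes> (adj A (pow (j - k)) \<otimes> adj A (pow l))"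
    unfolding adj_pow_pow by (simp add: mult_assoc)
  also have "\<dots> = word (i + (k - j), l + (j - k))"
    by (simp add: word_def pow_add adj_mult)
  finally show ?thesis .
qed

lemma adj_word: "adj A (word (i, j)) = word (j, i)"
  by (simp add: word_def adj_mult)

lemma cnorm_pow_le: "cnorm A (pow k) \<le> 1"
proof -
  have "(cnorm A (pow k))\<^sup>2 \<le> 1"
    using cstar_identity [of "pow k"] projection_norm_le_one [of e] by simp
  then show ?thesis by (simp add: power_le_one_iff abs_square_le_1 cnorm_nonneg)
qed

lemma cnorm_word_le: "cnorm A (word i) \<le> 1"
proof (cases i)
  case (Pair j k)
  have "cnorm A (word i) \<le> cnorm A (pow j) * cnorm A (pow k)"
    using cnorm_mult [of "pow j" "adj A (pow k)"] by (simp add: Pair word_def)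
  also have "\<dots> \<le> 1"
    using cnorm_pow_le [of j] cnorm_pow_le [of k] by (simp add: mult_le_one cnorm_nonneg)
  finally show ?thesis .
qed

lemma word_1_0: "word (Suc 0, 0) = u"
  by (simp add: word_def u_e)

lemma word_in_generated: "word i \<in> cstar_generated A {u}"
proof -
  have sub: "cstar_subalgebra A (cstar_generated A {u})"
    by (rule cstar_subalgebra_generated) simp
  then have ops: "\<And>x y. \<lbrakk>x \<in> cstar_generated A {u}; y \<in> cstar_generated A {u}\<rbrakk> \<Longrightarrow> x \<otimes> y \<in> cstar_generated A {u}"
    "\<And>x. x \<in> cstar_generated A {u} \<Longrightarrow> adj A x \<in> cstar_generated A {u}"
    by (auto simp: cstar_subalgebra_def)
  have u: "u \<in> cstar_generated A {u}" using cstar_generated_superset [of "{u}"] by simp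
  then have "e \<in> cstar_generated A {u}" using ops adj_u_u by metis
  then have "pow k \<in> cstar_generated A {u}" for k
    by (induction k) (simp_all add: ops u)
  then show ?thesis by (cases i) (simp add: word_def ops)
qed

end

lemma finite_max_le: "finite {i :: nat \<times> nat. max (fst i) (snd i) \<le> N}"
  and card_max_le: "card {i :: nat \<times> nat. max (fst i) (snd i) \<le> N} \<le> 2 * (N + 1)\<^sup>2"
proof -
  have eq: "{i :: nat \<times> nat. max (fst i) (snd i) \<le> N} = {..N} \<times> {..N}" by auto
  show "finite {i :: nat \<times> nat. max (fst i) (snd i) \<le> N}" unfolding eq by simp
  show "card {i :: nat \<times> nat. max (fst i) (snd i) \<le> N} \<le> 2 * (N + 1)\<^sup>2"
    unfolding eq by (simp add: power2_eq_square)
qed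

locale proper_corner_isometry = corner_isometry +
  assumes proper: "u \<otimes> adj A u \<noteq> e"
begin

text \<open>The projection onto the part of \<open>e\<close> that the isometry misses. For the unilateral shift it is the
  rank-one projection onto the first basis vector.\<close>

definition defect :: 'a where "defect = e \<ominus> u \<otimes> adj A u"

lemma defect_closed [simp, intro]: "defect \<in> carrier A"
  by (auto simp: defect_def)

lemma adj_u_e: "adj A u \<otimes> e = adj A u" and e_adj_u: "e \<otimes> adj A u = adj A u"
  using adj_mult [of e u] adj_mult [of u e] by (simp_all add: e_u u_e)

lemma adj_u_defect: "adj A u \<otimes> defect = \<zero>"
proof -
  have "adj A u \<otimes> (u \<otimes> adj A u) = adj A u"
    using mult_assoc [of "adj A u" u "adj A u"] by (simp add: adj_u_u e_adj_u)
  then show ?thesis by (simp add: defect_def mult_diff_right adj_u_e)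
qed

lemma adj_defect [simp]: "adj A defect = defect"
  by (simp add: defect_def adj_diff adj_mult)

lemma e_defect: "e \<otimes> defect = defect"
proof -
  have "e \<otimes> (u \<otimes> adj A u) = u \<otimes> adj A u"
    using mult_assoc [of e u "adj A u"] by (simp add: e_u)
  then show ?thesis by (simp add: defect_def mult_diff_right)
qed

lemma defect_e: "defect \<otimes> e = defect"
  using adj_mult [of e defect] e_defect by simp

lemma defect_defect: "defect \<otimes> defect = defect"
proof -
  have "(u \<otimes> adj A u) \<otimes> defect = \<zero>" by (simp add: mult_assoc adj_u_defect)
  then have "(e \<ominus> u \<otimes> adj A u) \<otimes> defect = defect" by (simp add: mult_diff_left e_defect)
  then show ?thesis by (simp add: defect_def)
qed

lemma cnorm_defect: "cnorm A defect = 1"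
proof (rule projection_norm_eq_one)
  show "defect \<noteq> \<zero>" using proper by (simp add: defect_def diff_eq_zero_iff)
qed (auto simp: defect_defect)

lemma adj_pow_defect: "adj A (pow (Suc k)) \<otimes> defect = \<zero>"
  by (simp add: adj_mult mult_assoc adj_u_defect)

lemma defect_pow: "defect \<otimes> pow (Suc k) = \<zero>"
  using adj_pow_defect [of k] adj_mult [of "adj A (pow (Suc k))" defect] by simp

lemma defect_pow_mult_adj_pow_defect:
  assumes "\<not> (x = 0 \<and> y = 0)" "a \<in> carrier A"
  shows "(defect \<otimes> pow x) \<otimes> (a \<otimes> (adj A (pow y) \<otimes> defect)) = \<zero>"
  using assms by (cases x; cases y) (simp_all add: defect_pow adj_pow_defect del: pow.simps(2))

lemma defect_pow_adj_pow_defect: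
  "(defect \<otimes> pow x) \<otimes> (adj A (pow y) \<otimes> defect) = (if x = 0 \<and> y = 0 then defect else \<zero>)"
proof (cases "x = 0 \<and> y = 0")
  case True
  then show ?thesis by (simp add: defect_e e_defect defect_defect)
next
  case False
  have "(defect \<otimes> pow x) \<otimes> (adj A (pow y) \<otimes> defect)
      = (defect \<otimes> pow x) \<otimes> (e \<otimes> (adj A (pow y) \<otimes> defect))"
    using mult_assoc [of e "adj A (pow y)" defect] by simp
  also have "\<dots> = \<zero>" using False by (intro defect_pow_mult_adj_pow_defect) auto
  finally show ?thesis using False by (simp only: if_False)
qed

text \<open>A matrix coefficient without a Hilbert space: compressing by the translates of the defect projection.\<close>

definition entry :: "nat \<Rightarrow> nat \<Rightarrow> 'a \<Rightarrow> 'a" where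
  "entry k l a = (defect \<otimes> adj A (pow k)) \<otimes> (a \<otimes> (pow l \<otimes> defect))"

lemma entry_closed [simp, intro]: "a \<in> carrier A \<Longrightarrow> entry k l a \<in> carrier A"
  by (simp add: entry_def)

lemma entry_word:
  "entry k l (word (i, j)) = (if i \<le> k \<and> j \<le> l \<and> k - i = l - j then defect else \<zero>)"
proof -
  have "entry k l (word (i, j))
      = defect \<otimes> ((adj A (pow k) \<otimes> pow i) \<otimes> ((adj A (pow j) \<otimes> pow l) \<otimes> defect))"
    by (simp add: entry_def word_def mult_assoc)
  also have "\<dots> = (defect \<otimes> pow (i - k)) \<otimes> ((adj A (pow (k - i)) \<otimes> pow (l - j)) \<otimes> (adj A (pow (j - l)) \<otimes> defect))"
    unfolding adj_pow_pow [of k i] adj_pow_pow [of j l] by (simp add: mult_assoc)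
  also have "\<dots> = (if i \<le> k \<and> j \<le> l \<and> k - i = l - j then defect else \<zero>)"
  proof (cases "i - k = 0 \<and> j - l = 0")
    case True
    have "(defect \<otimes> pow 0) \<otimes> ((adj A (pow (k - i)) \<otimes> pow (l - j)) \<otimes> (adj A (pow 0) \<otimes> defect))
        = (defect \<otimes> pow ((l - j) - (k - i))) \<otimes> (adj A (pow ((k - i) - (l - j))) \<otimes> defect)"
      unfolding adj_pow_pow [of "k - i" "l - j"] by (simp add: defect_e e_defect mult_assoc)
    also have "\<dots> = (if (l - j) - (k - i) = 0 \<and> (k - i) - (l - j) = 0 then defect else \<zero>)"
      by (rule defect_pow_adj_pow_defect)
    also have "\<dots> = (if i \<le> k \<and> j \<le> l \<and> k - i = l - j then defect else \<zero>)"
      using True by (intro if_cong refl) linarith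
    finally show ?thesis using True by (simp only: simp_thms)
  next
    case False
    then have "\<not> (i \<le> k \<and> j \<le> l \<and> k - i = l - j)" by linarith
    then show ?thesis
      using defect_pow_mult_adj_pow_defect [OF False mult_closed [OF adj_closed [OF pow_closed] pow_closed]]
      by (simp only: if_False)
  qed
  finally show ?thesis .
qed

lemma cnorm_entry_le:
  assumes "a \<in> carrier A" shows "cnorm A (entry k l a) \<le> cnorm A a"
proof -
  have 1: "cnorm A (defect \<otimes> adj A (pow k)) \<le> 1"
    using cnorm_mult [of defect "adj A (pow k)"] cnorm_pow_le [of k] by (simp add: cnorm_defect)
  have 2: "cnorm A (pow l \<otimes> defect) \<le> 1"
    using cnorm_mult [of "pow l" defect] cnorm_pow_le [of l] by (simp add: cnorm_defect)
  have "cnorm A (entry k l a) \<le> cnorm A (defect \<otimes> adj A (pow k)) * (cnorm A a * cnorm A (pow l \<otimes> defect))"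
    unfolding entry_def using assms
    by (intro order_trans [OF cnorm_mult] mult_left_mono cnorm_mult cnorm_nonneg) auto
  also have "\<dots> \<le> 1 * (cnorm A a * 1)"
    using 1 2 assms by (intro mult_mono mult_left_mono cnorm_nonneg mult_nonneg_nonneg) auto
  finally show ?thesis by simp
qed

text \<open>The \<open>(k, l)\<close> entry is a sum of coefficients along a diagonal, so a coefficient is a difference
  of two entries.\<close>

lemma entry_combo:
  assumes "combo A B word n deg N c a b"
  shows "a \<in> carrier A \<and> entry k l a = (\<Sum>m\<le>min k l. c (k - m, l - m)) \<odot> defect"
  using assms
proof (induction rule: combo.induct)
  case combo_zero
  then show ?case by (simp add: entry_def)
next
  case (combo_step c a b x t)
  obtain i j where x: "x = (i, j)" by fastforce
  let ?hit = "i \<le> k \<and> j \<le> l \<and> k - i = l - j"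
  have "(\<Sum>m\<le>min k l. (c(x := c x + t)) (k - m, l - m))
      = (\<Sum>m\<le>min k l. c (k - m, l - m) + (if k - i = m \<and> ?hit then t else 0))"
    by (rule sum.cong) (auto simp: x)
  also have "\<dots> = (\<Sum>m\<le>min k l. c (k - m, l - m)) + (if ?hit then t else 0)"
    by (cases ?hit) (auto simp: sum.distrib)
  finally have coeff: "(\<Sum>m\<le>min k l. (c(x := c x + t)) (k - m, l - m))
      = (\<Sum>m\<le>min k l. c (k - m, l - m)) + (if ?hit then t else 0)" .
  have "entry k l (a \<oplus> t \<odot> word x) = entry k l a \<oplus> t \<odot> entry k l (word x)"
    using combo_step by (simp add: entry_def mult_add_left mult_add_right mult_smult_left mult_smult_right)
  also have "\<dots> = (\<Sum>m\<le>min k l. c (k - m, l - m)) \<odot> defect \<oplus> (if ?hit then t else 0) \<odot> defect"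
    using combo_step by (simp add: x entry_word)
  also have "\<dots> = (\<Sum>m\<le>min k l. (c(x := c x + t)) (k - m, l - m)) \<odot> defect"
    unfolding coeff by (simp add: scale_cancel)
  finally show ?case using combo_step by simp
qed

text \<open>The coefficients are seen by the matrix entries because the defect is a nonzero projection, hence
  of norm one. The factor two comes from taking the difference of two entries.\<close>

lemma coefficient_le:
  assumes c: "combo A B word n deg N c a b"
  shows "cmod (c i) \<le> 2 * cnorm A a"
proof -
  define D where "D k l = (\<Sum>m\<le>min k l. c (k - m, l - m))" for k l
  have D: "cmod (D k l) \<le> cnorm A a" for k l
    using entry_combo [OF c, of k l] cnorm_entry_le [of a k l]
    by (simp add: D_def cnorm_smult cnorm_defect)
  obtain k l where i: "i = (k, l)" by fastforce
  show ?thesis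
  proof (cases "k = 0 \<or> l = 0")
    case True
    then have "D k l = c i" by (auto simp: D_def i)
    then show ?thesis using D [of k l] cnorm_nonneg [of a] entry_combo [OF c] by auto
  next
    case False
    then obtain k' l' where k: "k = Suc k'" "l = Suc l'" by (metis not0_implies_Suc)
    have "D k l = c i + D k' l'"
      unfolding D_def k i min_Suc_Suc by (subst sum.atMost_Suc_shift) simp
    then have "c i = D k l - D k' l'" by simp
    then show ?thesis
      using D [of k l] D [of k' l'] norm_triangle_ineq4 [of "D k l" "D k' l'"] by simp
  qed
qed

lemma comparable_words:
  assumes "corner_isometry B v f"
  shows "comparable_families A B word (corner_isometry.word B v f) (\<lambda>i. max (fst i) (snd i)) 2"
proof -
  interpret v: corner_isometry B v f by fact
  show ?thesis
  proof unfold_locales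
    fix i j :: "nat \<times> nat"
    obtain i1 i2 j1 j2 where ij: "i = (i1, i2)" "j = (j1, j2)" by fastforce
    show "\<exists>k. max (fst k) (snd k) \<le> max (fst i) (snd i) + max (fst j) (snd j)
        \<and> word k = word i \<otimes> word j \<and> v.word k = v.word i \<otimes>\<^bsub>B\<^esub> v.word j"
      unfolding ij word_mult v.word_mult
      by (rule exI [of _ "(i1 + (j1 - i2), j2 + (i2 - j1))"]) auto
    show "\<exists>k. max (fst k) (snd k) \<le> max (fst i) (snd i)
        \<and> word k = adj A (word i) \<and> v.word k = adj B (v.word i)"
      unfolding ij adj_word v.adj_word by (rule exI [of _ "(i2, i1)"]) auto
  next
    fix N c a b i assume "combo A B word v.word (\<lambda>i. max (fst i) (snd i)) N c a b"
    then show "cmod (c i) \<le> 2 * cnorm A a" by (rule coefficient_le)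
  qed (rule word_closed v.word_closed v.cnorm_word_le finite_max_le card_max_le)+
qed

text \<open>The C*-algebra of a proper isometry is universal, hence any two are isomorphic.\<close>

lemma ex_star_hom_from_generated:
  assumes "corner_isometry B v f"
  obtains \<phi> where "star_hom (Cstar_of A {u}) B \<phi>" "\<phi> u = v"
proof -
  interpret v: corner_isometry B v f by fact
  interpret comparable_families A B word v.word "\<lambda>i. max (fst i) (snd i)" 2
    using assms by (rule comparable_words)
  have "closed_span \<subseteq> cstar_generated A {u}"
    using cstar_subalgebra_generated [of "{u}"] word_in_generated
    by (intro closed_span_minimal) (auto simp: cstar_subalgebra_def)
  moreover have "cstar_generated A {u} \<subseteq> closed_span"
    using family_in_closed_span [of "(Suc 0, 0)"] cstar_subalgebra_closed_span
    by (intro cstar_generated_minimal) (auto simp: word_1_0)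
  ultimately have eq: "Cstar_of A {u} = A\<lparr>carrier := closed_span\<rparr>"
    by (simp add: Cstar_of_def antisym)
  obtain \<phi> where \<phi>: "star_hom (A\<lparr>carrier := closed_span\<rparr>) B \<phi>" "\<And>i. \<phi> (word i) = v.word i"
    using ex_star_hom_closed_span by blast
  show thesis
    using that [of \<phi>] \<phi>(1) \<phi>(2) [of "(Suc 0, 0)"] unfolding eq word_1_0 v.word_1_0 .
qed

end

lemma star_hom_into_generated:
  assumes A: "cstar_algebra A" and B: "cstar_algebra B" and \<phi>: "star_hom A B \<phi>"
    and gen: "cstar_generated A X = carrier A" and X: "\<phi> ` X \<subseteq> Y" "Y \<subseteq> carrier B"
  shows "star_hom A (Cstar_of B Y) \<phi>"
proof -
  interpret cstar_hom A B \<phi> using A B \<phi> by (simp add: cstar_hom_def cstar_hom_axioms_def)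
  have XA: "X \<subseteq> carrier A" unfolding gen [symmetric] by (rule A.cstar_generated_superset)
  have "cstar_generated A X \<subseteq> {x \<in> carrier A. \<phi> x \<in> cstar_generated B Y}"
    using XA X B.cstar_generated_superset [of Y]
    by (intro A.cstar_generated_minimal cstar_subalgebra_preimage B.cstar_subalgebra_generated) auto
  then have "\<phi> \<in> carrier A \<rightarrow> cstar_generated B Y" unfolding gen by auto
  then show ?thesis using \<phi> by (simp add: star_hom_def Cstar_of_def)
qed

text \<open>Both isometries satisfy the hypothesis on comparable families with respect to each other, so the
  extensions exist in both directions and are mutually inverse on the generators.\<close>

theorem coburn:
  assumes u: "proper_corner_isometry A u e" and v: "proper_corner_isometry B v f"
  shows "\<exists>!\<psi>. \<psi> \<in> extensional (carrier (Cstar_of A {u})) \<and>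
     star_iso (Cstar_of A {u}) (Cstar_of B {v}) \<psi> \<and> \<psi> u = v"
proof -
  interpret u: proper_corner_isometry A u e by fact
  interpret v: proper_corner_isometry B v f by fact
  let ?U = "Cstar_of A {u}" and ?V = "Cstar_of B {v}"
  have U: "cstar_algebra ?U" "cstar_generated ?U {u} = carrier ?U"
    by (simp_all add: u.cstar_algebra_Cstar_of u.cstar_generated_Cstar_of)
  have V: "cstar_algebra ?V" "cstar_generated ?V {v} = carrier ?V"
    by (simp_all add: v.cstar_algebra_Cstar_of v.cstar_generated_Cstar_of)
  have uU: "u \<in> carrier ?U" and vV: "v \<in> carrier ?V"
    using u.cstar_generated_superset [of "{u}"] v.cstar_generated_superset [of "{v}"]
    by (simp_all add: Cstar_of_def)
  obtain \<phi> where \<phi>: "star_hom ?U B \<phi>" "\<phi> u = v"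
    by (rule u.ex_star_hom_from_generated [OF v.corner_isometry_axioms])
  obtain \<phi>' where \<phi>': "star_hom ?V A \<phi>'" "\<phi>' v = u"
    by (rule v.ex_star_hom_from_generated [OF u.corner_isometry_axioms])
  have h: "star_hom ?U ?V \<phi>"
    by (rule star_hom_into_generated [OF U(1) v.cstar_algebra_axioms \<phi>(1) U(2)]) (simp_all add: \<phi>(2))
  have h': "star_hom ?V ?U \<phi>'"
    by (rule star_hom_into_generated [OF V(1) u.cstar_algebra_axioms \<phi>'(1) V(2)]) (simp_all add: \<phi>'(2))
  have inv1: "\<phi>' (\<phi> x) = x" if "x \<in> carrier ?U" for x
    by (rule star_homs_agree_on_generated [OF U(1) U(1) star_hom_compose [OF h h'] star_hom_id, of "{u}"])
       (use that uU in \<open>simp_all add: \<phi>(2) \<phi>'(2) U(2)\<close>)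
  have inv2: "\<phi> (\<phi>' x) = x" if "x \<in> carrier ?V" for x
    by (rule star_homs_agree_on_generated [OF V(1) V(1) star_hom_compose [OF h' h] star_hom_id, of "{v}"])
       (use that vV in \<open>simp_all add: \<phi>(2) \<phi>'(2) V(2)\<close>)
  have maps: "\<phi> \<in> carrier ?U \<rightarrow> carrier ?V" "\<phi>' \<in> carrier ?V \<rightarrow> carrier ?U"
    using h h' unfolding star_hom_def by blast+
  have bij: "bij_betw \<phi> (carrier ?U) (carrier ?V)"
    by (rule bij_betwI [OF maps inv1 inv2])
  have closed: "x \<oplus>\<^bsub>?U\<^esub> y \<in> carrier ?U" "c \<odot>\<^bsub>?U\<^esub> x \<in> carrier ?U" "x \<otimes>\<^bsub>?U\<^esub> y \<in> carrier ?U"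
      "adj ?U x \<in> carrier ?U"
    if "x \<in> carrier ?U" "y \<in> carrier ?U" for x y c
    using u.cstar_subalgebra_generated [of "{u}"] that
    by (simp_all add: Cstar_of_def cstar_subalgebra_def linear_subspace_def)
  show ?thesis
  proof (rule ex1I [of _ "restrict \<phi> (carrier ?U)"])
    have "star_hom ?U ?V (restrict \<phi> (carrier ?U))"
      using h unfolding star_hom_def by (simp add: closed Pi_iff)
    moreover have "bij_betw (restrict \<phi> (carrier ?U)) (carrier ?U) (carrier ?V)"
      using bij by (rule bij_betw_cong [THEN iffD1, rotated]) simp
    ultimately show "restrict \<phi> (carrier ?U) \<in> extensional (carrier ?U) \<and>
        star_iso ?U ?V (restrict \<phi> (carrier ?U)) \<and> restrict \<phi> (carrier ?U) u = v"
      using uU by (simp add: star_iso_def \<phi>(2))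
  next
    fix \<psi> assume \<psi>: "\<psi> \<in> extensional (carrier ?U) \<and> star_iso ?U ?V \<psi> \<and> \<psi> u = v"
    then have \<psi>h: "star_hom ?U ?V \<psi>" "\<psi> u = v" unfolding star_iso_def by blast+
    have "\<psi> x = restrict \<phi> (carrier ?U) x" if "x \<in> carrier ?U" for x
    proof -
      have "\<psi> x = \<phi> x"
        by (rule star_homs_agree_on_generated [OF U(1) V(1) \<psi>h(1) h, of "{u}"])
           (use that uU in \<open>simp_all add: \<phi>(2) \<psi>h(2) U(2)\<close>)
      then show ?thesis using that by simp
    qed
    then show "\<psi> = restrict \<phi> (carrier ?U)"
      using \<psi> by (intro extensionalityI [of _ "carrier ?U"]) auto
  qed
qed

section \<open>Projections that sum to a projection\<close>

context cstar_algebra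
begin

text \<open>Quadratic polynomials in \<open>b\<close> with \<open>e\<close> in place of the unit.\<close>

definition quad :: "'a \<Rightarrow> 'a \<Rightarrow> complex \<Rightarrow> complex \<Rightarrow> complex \<Rightarrow> 'a" where
  "quad e b \<alpha> \<beta> \<gamma> = \<alpha> \<odot> e \<oplus> (\<beta> \<odot> b \<oplus> \<gamma> \<odot> (b \<otimes> b))"

lemma quad_closed [simp, intro]: "\<lbrakk>e \<in> carrier A; b \<in> carrier A\<rbrakk> \<Longrightarrow> quad e b \<alpha> \<beta> \<gamma> \<in> carrier A"
  by (simp add: quad_def)

lemma quad_add:
  "\<lbrakk>e \<in> carrier A; b \<in> carrier A\<rbrakk>
   \<Longrightarrow> quad e b \<alpha> \<beta> \<gamma> \<oplus> quad e b \<alpha>' \<beta>' \<gamma>' = quad e b (\<alpha> + \<alpha>') (\<beta> + \<beta>') (\<gamma> + \<gamma>')"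
  by (simp add: quad_def scale_add_left M.a_ac)

lemma quad_scale:
  "\<lbrakk>e \<in> carrier A; b \<in> carrier A\<rbrakk> \<Longrightarrow> c \<odot> quad e b \<alpha> \<beta> \<gamma> = quad e b (c * \<alpha>) (c * \<beta>) (c * \<gamma>)"
  by (simp add: quad_def scale_add_right)

lemma quad_mult:
  "\<lbrakk>e \<in> carrier A; b \<in> carrier A; e \<otimes> e = e; e \<otimes> b = b; b \<otimes> e = b\<rbrakk>
   \<Longrightarrow> quad e b \<alpha> \<beta> 0 \<otimes> quad e b \<alpha>' \<beta>' 0 = quad e b (\<alpha> * \<alpha>') (\<alpha> * \<beta>' + \<beta> * \<alpha>') (\<beta> * \<beta>')"
  by (simp add: quad_def mult_add_left mult_add_right mult_smult_left mult_smult_right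
      scale_add_left scale_add_right M.a_ac mult.commute)

lemma quad_adj:
  "\<lbrakk>e \<in> carrier A; b \<in> carrier A; adj A e = e; adj A b = b\<rbrakk>
   \<Longrightarrow> adj A (quad e b \<alpha> \<beta> \<gamma>) = quad e b (cnj \<alpha>) (cnj \<beta>) (cnj \<gamma>)"
  by (simp add: quad_def adj_add adj_smult adj_mult)

lemma quad_avg_le:
  assumes "e \<in> carrier A" "b \<in> carrier A"
    and "cnorm A (quad e b \<alpha> \<beta> \<gamma>) \<le> 1" "cnorm A (quad e b \<alpha>' \<beta>' \<gamma>') \<le> 1" "0 \<le> s" "s \<le> 1"
  shows "cnorm A (quad e b (of_real s * \<alpha> + of_real (1 - s) * \<alpha>') (of_real s * \<beta> + of_real (1 - s) * \<beta>')
    (of_real s * \<gamma> + of_real (1 - s) * \<gamma>')) \<le> 1"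
proof -
  have "cnorm A (of_real s \<odot> quad e b \<alpha> \<beta> \<gamma> \<oplus> of_real (1 - s) \<odot> quad e b \<alpha>' \<beta>' \<gamma>')
      \<le> cnorm A (of_real s \<odot> quad e b \<alpha> \<beta> \<gamma>) + cnorm A (of_real (1 - s) \<odot> quad e b \<alpha>' \<beta>' \<gamma>')"
    using assms by (intro cnorm_add scale_closed quad_closed)
  also have "\<dots> = s * cnorm A (quad e b \<alpha> \<beta> \<gamma>) + (1 - s) * cnorm A (quad e b \<alpha>' \<beta>' \<gamma>')"
    unfolding cnorm_smult [OF quad_closed [OF assms(1,2)]] norm_of_real using assms(5,6) by simp
  also have "\<dots> \<le> s * 1 + (1 - s) * 1"
    using assms by (intro add_mono mult_left_mono) auto
  finally show ?thesis using assms by (simp add: quad_scale quad_add)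
qed

lemma quad_sq_le:
  assumes "e \<in> carrier A" "b \<in> carrier A" "e \<otimes> e = e" "e \<otimes> b = b" "b \<otimes> e = b"
    and n: "cnorm A (quad e b 1 z 0) \<le> 1"
  shows "cnorm A (quad e b 1 (2 * z) (z * z)) \<le> 1"
proof -
  have "quad e b 1 z 0 \<otimes> quad e b 1 z 0 = quad e b 1 (2 * z) (z * z)"
    using quad_mult [OF assms(1-5), of 1 z 1 z] by simp
  then have "cnorm A (quad e b 1 (2 * z) (z * z)) \<le> cnorm A (quad e b 1 z 0) * cnorm A (quad e b 1 z 0)"
    using cnorm_mult [of "quad e b 1 z 0" "quad e b 1 z 0"] assms by simp
  also have "\<dots> \<le> 1" using n assms by (intro mult_le_one cnorm_nonneg quad_closed)
  finally show ?thesis .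
qed

text \<open>Averaging the squares of \<open>e + \<zeta> z b\<close> and \<open>e + \<zeta>\<^sup>-\<^sup>1 z b\<close> for a primitive eighth root of unity
  \<open>\<zeta>\<close> removes the quadratic term and enlarges \<open>b\<close> by the factor \<open>sqrt 2\<close>.\<close>

lemma zero_if_disc_in_unit_ball:
  assumes e: "e \<in> carrier A" "e \<otimes> e = e" "adj A e = e"
    and b: "b \<in> carrier A" "e \<otimes> b = b" "b \<otimes> e = b"
    and disc: "\<And>z. cmod z \<le> 1 \<Longrightarrow> cnorm A (quad e b 1 z 0) \<le> 1"
  shows "b = \<zero>"
proof -
  have grow: "\<forall>z. cmod z \<le> 1 \<longrightarrow> cnorm A (quad e b 1 (of_real (sqrt 2 ^ k) * z) 0) \<le> 1" for k
  proof (induction k)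
    case (Suc k)
    define c where "c = complex_of_real (sqrt 2 ^ k)"
    show ?case
    proof (intro allI impI)
      fix z :: complex assume z: "cmod z \<le> 1"
      have "cmod (cis (pi / 4) * z) \<le> 1" "cmod (cis (- (pi / 4)) * z) \<le> 1"
        using z by (simp_all add: norm_mult)
      then have 1: "cnorm A (quad e b 1 (c * (cis (pi / 4) * z)) 0) \<le> 1"
        "cnorm A (quad e b 1 (c * (cis (- (pi / 4)) * z)) 0) \<le> 1"
        using Suc unfolding c_def by blast+
      have "cnorm A (quad e b (of_real (1/2) * 1 + of_real (1 - 1/2) * 1)
         (of_real (1/2) * (2 * (c * (cis (pi / 4) * z))) + of_real (1 - 1/2) * (2 * (c * (cis (- (pi / 4)) * z))))
         (of_real (1/2) * ((c * (cis (pi / 4) * z)) * (c * (cis (pi / 4) * z)))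
           + of_real (1 - 1/2) * ((c * (cis (- (pi / 4)) * z)) * (c * (cis (- (pi / 4)) * z))))) \<le> 1"
        by (rule quad_avg_le [OF e(1) b(1) quad_sq_le [OF e(1) b(1) e(2) b(2,3) 1(1)]
              quad_sq_le [OF e(1) b(1) e(2) b(2,3) 1(2)]]) simp_all
      moreover have "of_real (1/2) * (2 * (c * (cis (pi / 4) * z))) + of_real (1 - 1/2) * (2 * (c * (cis (- (pi / 4)) * z)))
          = of_real (sqrt 2 ^ Suc k) * z"
      proof -
        have "cis (pi / 4) + cis (- (pi / 4)) = of_real (sqrt 2)"
          by (simp add: complex_eq_iff cos_45 sin_45)
        then have "c * ((cis (pi / 4) + cis (- (pi / 4))) * z) = c * (of_real (sqrt 2) * z)" by simp
        then show ?thesis by (simp add: c_def algebra_simps)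
      qed
      moreover have "of_real (1/2) * ((c * (cis (pi / 4) * z)) * (c * (cis (pi / 4) * z)))
           + of_real (1 - 1/2) * ((c * (cis (- (pi / 4)) * z)) * (c * (cis (- (pi / 4)) * z))) = 0"
      proof -
        have "cis (pi / 4) * cis (pi / 4) + cis (- (pi / 4)) * cis (- (pi / 4)) = 0"
          by (simp add: cis_mult complex_eq_iff)
        then have "(1/2) * (c * z) * (c * z) * (cis (pi / 4) * cis (pi / 4) + cis (- (pi / 4)) * cis (- (pi / 4))) = 0"
          by simp
        then show ?thesis by (simp add: algebra_simps)
      qed
      moreover have "of_real (1/2) * 1 + of_real (1 - 1/2) * 1 = (1 :: complex)" by simp
      ultimately show "cnorm A (quad e b 1 (of_real (sqrt 2 ^ Suc k) * z) 0) \<le> 1" by (simp only:)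
    qed
  qed (use disc in simp)
  have le: "sqrt 2 ^ k * cnorm A b \<le> 2" for k
  proof -
    have "quad e b 1 (of_real (sqrt 2 ^ k)) 0 \<ominus> e = of_real (sqrt 2 ^ k) \<odot> b"
    proof -
      have "quad e b 1 (of_real (sqrt 2 ^ k)) 0 \<oplus> quad e b (-1) 0 0 = quad e b 0 (of_real (sqrt 2 ^ k)) 0"
        using e b by (simp add: quad_add)
      then show ?thesis using e b by (simp add: quad_def diff_eq del: of_real_power)
    qed
    then have "cnorm A (of_real (sqrt 2 ^ k) \<odot> b) \<le> cnorm A (quad e b 1 (of_real (sqrt 2 ^ k)) 0) + cnorm A e"
      using cnorm_diff_le [of "quad e b 1 (of_real (sqrt 2 ^ k)) 0" e] e b by (simp del: of_real_power)
    also have "\<dots> \<le> 1 + 1"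
      using grow [of k] projection_norm_le_one [OF e(1,3,2)] by (intro add_mono) (auto dest: spec [of _ 1])
    finally show ?thesis using b by (simp add: cnorm_smult norm_power del: of_real_power)
  qed
  have "cnorm A b = 0"
  proof (rule ccontr)
    assume "cnorm A b \<noteq> 0"
    then have pos: "0 < cnorm A b" using cnorm_nonneg [OF b(1)] by linarith
    obtain k where "2 / cnorm A b < sqrt 2 ^ k"
      using real_arch_pow [of "sqrt 2" "2 / cnorm A b"] by auto
    then have "2 < sqrt 2 ^ k * cnorm A b" using pos by (simp add: pos_divide_less_eq)
    then show False using le [of k] by linarith
  qed
  then show ?thesis using b cnorm_eq_0 by blast
qed

text \<open>The unit of a corner is an extreme point of the unit ball.\<close>

lemma zero_if_unit_pm_in_unit_ball:
  assumes e: "e \<in> carrier A" "e \<otimes> e = e" "adj A e = e"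
    and b: "b \<in> carrier A" "e \<otimes> b = b" "b \<otimes> e = b" "adj A b = b"
    and pm: "cnorm A (e \<oplus> b) \<le> 1" "cnorm A (e \<ominus> b) \<le> 1"
  shows "b = \<zero>"
proof -
  have q: "cnorm A (quad e b 1 1 0) \<le> 1" "cnorm A (quad e b 1 (-1) 0) \<le> 1"
    using pm e b by (simp_all add: quad_def diff_eq)
  have re: "cnorm A (quad e b 1 (of_real x) 0) \<le> 1" if "\<bar>x\<bar> \<le> 1" for x
  proof -
    have "of_real ((1 + x) / 2) * 1 + of_real (1 - (1 + x) / 2) * 1 = (1 :: complex)"
      "of_real ((1 + x) / 2) * 1 + of_real (1 - (1 + x) / 2) * (- 1) = complex_of_real x"
      "of_real ((1 + x) / 2) * 0 + of_real (1 - (1 + x) / 2) * 0 = (0 :: complex)"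
      by (simp_all add: complex_eq_iff field_simps)
    moreover have "0 \<le> (1 + x) / 2" "(1 + x) / 2 \<le> 1" using that by auto
    ultimately show ?thesis using quad_avg_le [OF e(1) b(1) q, of "(1 + x) / 2"] by (simp only:)
  qed
  have im: "cnorm A (quad e b 1 (\<i> * of_real y) 0) \<le> 1" if y: "\<bar>y\<bar> \<le> 1" for y
  proof -
    have "adj A (quad e b 1 (\<i> * of_real y) 0) \<otimes> quad e b 1 (\<i> * of_real y) 0 = quad e b 1 0 (of_real y * of_real y)"
    proof -
      have "1 * (\<i> * of_real y) + cnj (\<i> * of_real y) * 1 = 0"
        "cnj (\<i> * of_real y) * (\<i> * of_real y) = complex_of_real y * of_real y"
        by (simp_all add: complex_eq_iff)
      then show ?thesis
        unfolding quad_adj [OF e(1) b(1) e(3) b(4)] complex_cnj_one complex_cnj_zero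
          quad_mult [OF e(1) b(1) e(2) b(2,3)] by (simp only: mult_1)
    qed
    moreover have "cnorm A (quad e b 1 0 (of_real y * of_real y)) \<le> 1"
    proof -
      have "cnorm A (quad e b 1 (2 * of_real y) (of_real y * of_real y)) \<le> 1"
        by (rule quad_sq_le [OF e(1) b(1) e(2) b(2,3) re [OF y]])
      moreover have "cnorm A (quad e b 1 (2 * of_real (- y)) (of_real (- y) * of_real (- y))) \<le> 1"
        by (rule quad_sq_le [OF e(1) b(1) e(2) b(2,3) re]) (use y in simp)
      ultimately show ?thesis
        using quad_avg_le [OF e(1) b(1), of 1 "2 * of_real y" "of_real y * of_real y" 1
            "2 * of_real (- y)" "of_real (- y) * of_real (- y)" "1/2"] by (simp add: field_simps)
    qed
    ultimately have "(cnorm A (quad e b 1 (\<i> * of_real y) 0))\<^sup>2 \<le> 1"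
      using cstar_identity [of "quad e b 1 (\<i> * of_real y) 0"] e b by simp
    then show ?thesis by (simp add: abs_square_le_1 cnorm_nonneg e b)
  qed
  have "(1/2) \<odot> b = \<zero>"
  proof (rule zero_if_disc_in_unit_ball [OF e])
    fix z :: complex assume z: "cmod z \<le> 1"
    have xy: "\<bar>Re z\<bar> \<le> 1" "\<bar>Im z\<bar> \<le> 1"
      using z abs_Re_le_cmod [of z] abs_Im_le_cmod [of z] by linarith+
    have "cnorm A (quad e b (of_real (1/2) * 1 + of_real (1 - 1/2) * 1)
        (of_real (1/2) * of_real (Re z) + of_real (1 - 1/2) * (\<i> * of_real (Im z)))
        (of_real (1/2) * 0 + of_real (1 - 1/2) * 0)) \<le> 1"
      by (rule quad_avg_le [OF e(1) b(1) re [OF xy(1)] im [OF xy(2)]]) simp_all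
    moreover have "of_real (1/2) * of_real (Re z) + of_real (1 - 1/2) * (\<i> * of_real (Im z)) = z / 2"
      by (simp add: complex_eq_iff)
    moreover have "of_real (1/2) * 1 + of_real (1 - 1/2) * 1 = (1 :: complex)"
      "of_real (1/2) * 0 + of_real (1 - 1/2) * 0 = (0 :: complex)" by simp_all
    ultimately have "cnorm A (quad e b 1 (z / 2) 0) \<le> 1" by (simp only:)
    then show "cnorm A (quad e ((1/2) \<odot> b) 1 z 0) \<le> 1"
      using e b by (simp add: quad_def)
  qed (use b e(1) in \<open>simp_all add: mult_smult_left mult_smult_right\<close>)
  then have "2 \<odot> ((1/2) \<odot> b) = \<zero>" by simp
  then show ?thesis using b by simp
qed

lemma cnorm_diff_projection_le:
  assumes q: "q \<in> carrier A" "adj A q = q" "q \<otimes> q = q" and x: "x \<in> carrier A"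
  shows "cnorm A (x \<ominus> q \<otimes> x) \<le> cnorm A x"
proof -
  let ?y = "x \<ominus> q \<otimes> x"
  have y: "?y \<in> carrier A" using q x by simp
  have "q \<otimes> (q \<otimes> x) = q \<otimes> x" using mult_assoc [OF q(1) q(1) x] q by simp
  then have qy: "q \<otimes> ?y = \<zero>" using q x by (simp add: mult_diff_right)
  have "adj A ?y \<otimes> ?y = adj A x \<otimes> ?y \<ominus> adj A x \<otimes> (q \<otimes> ?y)"
    using q x y by (simp add: adj_diff adj_mult mult_diff_left mult_assoc)
  also have "\<dots> = adj A x \<otimes> ?y" unfolding qy using x y by simp
  finally have "(cnorm A ?y)\<^sup>2 \<le> cnorm A x * cnorm A ?y"
    using cstar_identity [OF y] cnorm_mult [OF adj_closed [OF x] y] x by simp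
  then have "cnorm A ?y * cnorm A ?y \<le> cnorm A x * cnorm A ?y" by (simp only: power2_eq_square)
  moreover have "0 \<le> cnorm A ?y" "0 \<le> cnorm A x" by (rule cnorm_nonneg [OF y] cnorm_nonneg [OF x])+
  ultimately show ?thesis using mult_right_le_imp_le by (metis less_eq_real_def)
qed

text \<open>Orthogonality of projections that add up to a projection is usually derived from positivity. Here
  \<open>b = e p e - e\<close>, for one summand \<open>e\<close>, is a sum of compressions of the other summands. Hence
  \<open>e + b\<close> has norm at most one, and so has \<open>e - b / n\<close> for a suitable \<open>n\<close>, because subtracting a
  single compressed projection does not increase the norm of \<open>e\<close>. As \<open>e\<close> is an extreme point of the
  unit ball of its corner, \<open>b = 0\<close>.\<close>

lemma projection_mult_summand:
  assumes F: "finite F" and i: "i \<in> F"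
    and q: "\<And>j. j \<in> F \<Longrightarrow> q j \<in> carrier A" "\<And>j. j \<in> F \<Longrightarrow> adj A (q j) = q j"
      "\<And>j. j \<in> F \<Longrightarrow> q j \<otimes> q j = q j"
    and p: "p = finsum A q F" "p \<otimes> p = p" "adj A p = p"
  shows "p \<otimes> q i = q i"
proof -
  define e where "e = q i"
  have e: "e \<in> carrier A" "e \<otimes> e = e" "adj A e = e" by (simp_all add: e_def q [OF i])
  have pc: "p \<in> carrier A" unfolding p(1) using q(1) by (intro M.finsum_closed Pi_I)
  have part: "finsum A q G \<in> carrier A \<and>
      cnorm A (of_nat (card G) \<odot> e \<ominus> e \<otimes> (finsum A q G \<otimes> e)) \<le> of_nat (card G)"
    if "finite G" "G \<subseteq> F" for G
    using that
  proof (induction G rule: finite_induct)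
    case empty
    then show ?case using e by simp
  next
    case (insert j G)
    have jF: "j \<in> F" and GF: "G \<subseteq> F" using insert.prems by simp_all
    note qj = q [OF jF]
    have sG: "finsum A q G \<in> carrier A" using insert.IH [OF GF] by blast
    have fin: "finsum A q (insert j G) = q j \<oplus> finsum A q G"
      using insert.hyps qj(1) q(1) GF by (intro M.finsum_insert) auto
    let ?x = "of_nat (card G) \<odot> e \<ominus> e \<otimes> (finsum A q G \<otimes> e)"
    have "of_nat (card (insert j G)) \<odot> e \<ominus> e \<otimes> (finsum A q (insert j G) \<otimes> e)
        = (e \<oplus> of_nat (card G) \<odot> e) \<ominus> (e \<otimes> (q j \<otimes> e) \<oplus> e \<otimes> (finsum A q G \<otimes> e))"
      unfolding fin using insert.hyps qj(1) sG e
      by (simp add: mult_add_left mult_add_right scale_add_left)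
    also have "\<dots> = e \<otimes> (e \<ominus> q j \<otimes> e) \<oplus> ?x"
      using qj(1) sG e by (simp add: diff_add_diff mult_diff_right)
    finally have eq: "of_nat (card (insert j G)) \<odot> e \<ominus> e \<otimes> (finsum A q (insert j G) \<otimes> e)
        = e \<otimes> (e \<ominus> q j \<otimes> e) \<oplus> ?x" .
    have "cnorm A (e \<otimes> (e \<ominus> q j \<otimes> e) \<oplus> ?x) \<le> cnorm A (e \<otimes> (e \<ominus> q j \<otimes> e)) + cnorm A ?x"
      using qj(1) sG e by (intro cnorm_add) auto
    moreover have "cnorm A (e \<otimes> (e \<ominus> q j \<otimes> e)) \<le> 1"
    proof -
      have "cnorm A (e \<otimes> (e \<ominus> q j \<otimes> e)) \<le> cnorm A e * cnorm A (e \<ominus> q j \<otimes> e)"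
        using qj(1) e(1) by (intro cnorm_mult) auto
      also have "\<dots> \<le> 1"
        using projection_norm_le_one [OF e(1,3,2)] cnorm_diff_projection_le [OF qj e(1)] e(1) qj(1)
        by (intro mult_le_one cnorm_nonneg) auto
      finally show ?thesis .
    qed
    ultimately have "cnorm A (of_nat (card (insert j G)) \<odot> e \<ominus> e \<otimes> (finsum A q (insert j G) \<otimes> e))
        \<le> 1 + of_nat (card G)"
      using insert.IH [OF GF] unfolding eq by linarith
    moreover have "finsum A q (insert j G) \<in> carrier A" unfolding fin by (rule M.a_closed [OF qj(1) sG])
    ultimately show ?case using insert.hyps by simp
  qed
  define a where "a = e \<ominus> e \<otimes> (p \<otimes> e)"
  have ac: "a \<in> carrier A" using e pc by (simp add: a_def)
  have ea: "e \<otimes> a = a" "a \<otimes> e = a" "adj A a = a"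
    using e pc p(3) mult_assoc [of e e "p \<otimes> e"]
    by (simp_all add: a_def mult_diff_left mult_diff_right adj_diff adj_mult mult_assoc)
  define N where "N = real (card F)"
  have N: "1 \<le> N"
    unfolding N_def card.remove [OF F i] by simp
  \<comment> \<open>Splitting off the summand \<open>e\<close> itself turns the bound for the whole sum into one for \<open>a\<close>.\<close>
  have upper: "cnorm A (of_real N \<odot> e \<oplus> a) \<le> N"
  proof -
    let ?G = "F - {i}"
    have sG: "finsum A q ?G \<in> carrier A" using part [of ?G] F by blast
    have "p = e \<oplus> finsum A q ?G"
    proof -
      have "finsum A q (insert i ?G) = q i \<oplus> finsum A q ?G"
        using F q(1) i by (intro M.finsum_insert) auto
      then show ?thesis unfolding p(1) e_def by (simp only: insert_Diff [OF i])
    qed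
    then have "e \<otimes> (p \<otimes> e) = e \<oplus> e \<otimes> (finsum A q ?G \<otimes> e)"
      using e sG by (simp add: mult_add_left mult_add_right)
    then have a_eq: "a = (-1) \<odot> (e \<otimes> (finsum A q ?G \<otimes> e))"
      using e sG scale_cancel [of e 1 "-1"]
      by (simp add: a_def diff_eq scale_add_right M.a_assoc [symmetric])
    have card: "real (card F) = 1 + real (card ?G)"
      unfolding card.remove [OF F i] by simp
    have eq: "of_real N \<odot> e \<oplus> a = e \<oplus> (of_nat (card ?G) \<odot> e \<ominus> e \<otimes> (finsum A q ?G \<otimes> e))"
      using e sG by (simp add: N_def card a_eq scale_add_left diff_eq M.a_assoc)
    have "cnorm A (of_real N \<odot> e \<oplus> a) \<le> cnorm A e + cnorm A (of_nat (card ?G) \<odot> e \<ominus> e \<otimes> (finsum A q ?G \<otimes> e))"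
      unfolding eq using e sG by (intro cnorm_add) auto
    also have "\<dots> \<le> 1 + real (card ?G)"
      using projection_norm_le_one [OF e(1,3,2)] part [of ?G] F by (intro add_mono) auto
    finally show ?thesis unfolding N_def card .
  qed
  have lower: "cnorm A (e \<ominus> a) \<le> 1"
  proof -
    have "e \<ominus> a = e \<otimes> (p \<otimes> e)"
      using e pc scale_cancel [of e 1 "-1"]
      by (simp add: a_def diff_eq scale_add_right M.a_assoc [symmetric])
    moreover have "cnorm A (e \<otimes> (p \<otimes> e)) \<le> cnorm A e * (cnorm A p * cnorm A e)"
      using e pc by (intro order_trans [OF cnorm_mult] mult_left_mono cnorm_mult cnorm_nonneg) auto
    moreover have "cnorm A e * (cnorm A p * cnorm A e) \<le> 1"
      using projection_norm_le_one [OF e(1,3,2)] projection_norm_le_one [OF pc p(3,2)] e(1) pc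
      by (intro mult_le_one cnorm_nonneg mult_nonneg_nonneg) auto
    ultimately show ?thesis by simp
  qed
  define m where "m = inverse N"
  have m: "0 \<le> m" "m \<le> 1" "m * N = 1"
    using N unfolding m_def by (simp_all add: inverse_le_1_iff)
  have mN: "complex_of_real m * complex_of_real N = 1"
    unfolding of_real_mult [symmetric] m(3) by simp
  define b where "b = complex_of_real m \<odot> a"
  have bc: "b \<in> carrier A" using ac by (simp add: b_def)
  have "b = \<zero>"
  proof (rule zero_if_unit_pm_in_unit_ball [OF e bc])
    have "complex_of_real m \<odot> (complex_of_real N \<odot> e \<oplus> a) = e \<oplus> b"
      using e(1) ac by (simp add: b_def scale_add_right mN)
    then have "cnorm A (e \<oplus> b) = m * cnorm A (complex_of_real N \<odot> e \<oplus> a)"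
      using cnorm_smult [of "complex_of_real N \<odot> e \<oplus> a" "complex_of_real m"] e(1) ac m(1) by simp
    also have "\<dots> \<le> m * N" using upper m(1) by (rule mult_left_mono)
    finally show "cnorm A (e \<oplus> b) \<le> 1" unfolding m(3) .
    have "complex_of_real (1 - m) \<odot> e \<oplus> complex_of_real m \<odot> e = 1 \<odot> e"
      unfolding scale_cancel [OF e(1)] by simp
    then have "e \<ominus> b = (complex_of_real (1 - m) \<odot> e \<oplus> complex_of_real m \<odot> e) \<ominus> b"
      using e(1) by simp
    also have "\<dots> = complex_of_real (1 - m) \<odot> e \<oplus> complex_of_real m \<odot> (e \<ominus> a)"
      using e(1) ac by (simp only: diff_eq b_def scale_add_right scale_scale scale_closed M.a_closed M.a_assoc mult.commute)
    finally have eq: "e \<ominus> b = complex_of_real (1 - m) \<odot> e \<oplus> complex_of_real m \<odot> (e \<ominus> a)" .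
    have "cnorm A (e \<ominus> b) \<le> cnorm A (complex_of_real (1 - m) \<odot> e) + cnorm A (complex_of_real m \<odot> (e \<ominus> a))"
      unfolding eq using e(1) ac by (intro cnorm_add scale_closed diff_closed)
    also have "\<dots> = (1 - m) * cnorm A e + m * cnorm A (e \<ominus> a)"
      unfolding cnorm_smult [OF e(1)] cnorm_smult [OF diff_closed [OF e(1) ac]] norm_of_real
      using m by simp
    also have "\<dots> \<le> (1 - m) * 1 + m * 1"
      using lower projection_norm_le_one [OF e(1,3,2)] m by (intro add_mono mult_left_mono) auto
    finally show "cnorm A (e \<ominus> b) \<le> 1" by simp
    show "e \<otimes> b = b" unfolding b_def mult_smult_right [OF e(1) ac] ea(1) ..
    show "b \<otimes> e = b" unfolding b_def mult_smult_left [OF ac e(1)] ea(2) ..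
    show "adj A b = b" unfolding b_def adj_smult [OF ac] ea(3) by simp
  qed
  then have "complex_of_real N \<odot> b = \<zero>" by simp
  then have a0: "a = \<zero>" using ac mN by (simp add: b_def mult.commute)
  define y where "y = e \<ominus> p \<otimes> e"
  have y: "y \<in> carrier A" unfolding y_def by (intro diff_closed mult_closed e(1) pc)
  have "p \<otimes> (p \<otimes> e) = p \<otimes> e" using mult_assoc [OF pc pc e(1)] p(2) by simp
  then have py: "p \<otimes> y = \<zero>"
    unfolding y_def using e(1) pc by (simp add: mult_diff_right)
  have ey: "e \<otimes> y = \<zero>"
    using a0 e pc unfolding y_def a_def by (simp add: mult_diff_right)
  have "adj A y = e \<ominus> e \<otimes> p"
    unfolding y_def using e pc p(3) by (simp add: adj_diff adj_mult)
  then have "adj A y \<otimes> y = e \<otimes> y \<ominus> e \<otimes> (p \<otimes> y)"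
    using e(1) pc y by (simp add: mult_diff_left mult_assoc)
  then have "adj A y \<otimes> y = \<zero>" unfolding ey py using e(1) by simp
  then have "y = \<zero>" using y by (rule adj_mult_self_eq_zero [rotated])
  then show ?thesis
    using diff_eq_zero_iff [OF e(1) mult_closed [OF pc e(1)]] unfolding y_def e_def by simp
qed

end

section \<open>Square-summable families\<close>

abbreviation l2 :: "('i \<Rightarrow> complex) \<Rightarrow> 'i set \<Rightarrow> real" where
  "l2 \<xi> F \<equiv> L2_set (\<lambda>i. cmod (\<xi> i)) F"

lemma l2_sq: "(l2 \<xi> F)\<^sup>2 = (\<Sum>i\<in>F. (cmod (\<xi> i))\<^sup>2)"
  by (simp add: L2_set_def sum_nonneg)

lemma ell2D: "\<xi> \<in> ell2 X \<Longrightarrow> i \<notin> X \<Longrightarrow> \<xi> i = 0"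
  and ell2_summable: "\<xi> \<in> ell2 X \<Longrightarrow> (\<lambda>i. (cmod (\<xi> i))\<^sup>2) summable_on UNIV"
  by (simp_all add: ell2_def)

lemma ell2_norm_nonneg [simp]: "0 \<le> ell2_norm \<xi>"
  by (simp add: ell2_norm_def infsum_nonneg)

lemma ell2_norm_sq: "(ell2_norm \<xi>)\<^sup>2 = (\<Sum>\<^sub>\<infinity>i. (cmod (\<xi> i))\<^sup>2)"
  by (simp add: ell2_norm_def infsum_nonneg)

lemma l2_le_ell2_norm:
  assumes "\<xi> \<in> ell2 X" "finite F" shows "l2 \<xi> F \<le> ell2_norm \<xi>"
  unfolding L2_set_def ell2_norm_def
  using assms ell2_summable by (intro real_sqrt_le_mono finite_sum_le_infsum) auto

lemma ell2I:
  assumes "\<And>i. i \<notin> X \<Longrightarrow> \<xi> i = 0" and le: "\<And>F. finite F \<Longrightarrow> l2 \<xi> F \<le> K"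
  shows "\<xi> \<in> ell2 X"
proof -
  have "(\<lambda>i. (cmod (\<xi> i))\<^sup>2) summable_on UNIV"
  proof (rule nonneg_bdd_above_summable_on)
    show "bdd_above (sum (\<lambda>i. (cmod (\<xi> i))\<^sup>2) ` {F. F \<subseteq> UNIV \<and> finite F})"
    proof (rule bdd_aboveI2)
      fix F :: "'a set" assume "F \<in> {F. F \<subseteq> UNIV \<and> finite F}"
      then have "(l2 \<xi> F)\<^sup>2 \<le> K\<^sup>2" using le by (intro power_mono) auto
      then show "(\<Sum>i\<in>F. (cmod (\<xi> i))\<^sup>2) \<le> K\<^sup>2" by (simp add: l2_sq)
    qed
  qed simp
  then show ?thesis using assms(1) by (simp add: ell2_def)
qed

lemma ell2_norm_leI:
  assumes \<xi>: "\<xi> \<in> ell2 X" and le: "\<And>F. finite F \<Longrightarrow> l2 \<xi> F \<le> K"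
  shows "ell2_norm \<xi> \<le> K"
proof -
  have K: "0 \<le> K" using le [of "{}"] by simp
  have "(\<Sum>\<^sub>\<infinity>i. (cmod (\<xi> i))\<^sup>2) \<le> K\<^sup>2"
  proof (rule infsum_le_finite_sums [OF ell2_summable [OF \<xi>]])
    fix F :: "'a set" assume "finite F"
    then have "(l2 \<xi> F)\<^sup>2 \<le> K\<^sup>2" using le by (intro power_mono) auto
    then show "(\<Sum>i\<in>F. (cmod (\<xi> i))\<^sup>2) \<le> K\<^sup>2" by (simp add: l2_sq)
  qed
  then show ?thesis
    using K unfolding ell2_norm_def by (metis real_sqrt_le_mono real_sqrt_unique)
qed

lemma ell2_zero [simp, intro]: "(\<lambda>i. 0) \<in> ell2 X"
  by (rule ell2I [of _ _ 0]) (simp_all add: L2_set_def)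

lemma l2_add: "l2 (\<lambda>i. \<xi> i + \<eta> i) F \<le> l2 \<xi> F + l2 \<eta> F"
proof -
  have "l2 (\<lambda>i. \<xi> i + \<eta> i) F \<le> L2_set (\<lambda>i. cmod (\<xi> i) + cmod (\<eta> i)) F"
    by (rule L2_set_mono) (auto intro: norm_triangle_ineq)
  also have "\<dots> \<le> l2 \<xi> F + l2 \<eta> F" by (rule L2_set_triangle_ineq)
  finally show ?thesis .
qed

lemma l2_scale: "l2 (\<lambda>i. c * \<xi> i) F = cmod c * l2 \<xi> F"
  by (simp add: norm_mult L2_set_right_distrib)

lemma ell2_add [simp, intro]:
  assumes "\<xi> \<in> ell2 X" "\<eta> \<in> ell2 X" shows "(\<lambda>i. \<xi> i + \<eta> i) \<in> ell2 X"
proof (rule ell2I)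
  fix F :: "'a set" assume F: "finite F"
  show "l2 (\<lambda>i. \<xi> i + \<eta> i) F \<le> ell2_norm \<xi> + ell2_norm \<eta>"
    using l2_add [of \<xi> \<eta> F] l2_le_ell2_norm [OF assms(1) F] l2_le_ell2_norm [OF assms(2) F] by linarith
qed (simp add: ell2D [OF assms(1)] ell2D [OF assms(2)])

lemma ell2_scale [simp, intro]:
  assumes "\<xi> \<in> ell2 X" shows "(\<lambda>i. c * \<xi> i) \<in> ell2 X"
proof (rule ell2I)
  fix F :: "'a set" assume F: "finite F"
  show "l2 (\<lambda>i. c * \<xi> i) F \<le> cmod c * ell2_norm \<xi>"
    using l2_le_ell2_norm [OF assms F] by (simp add: l2_scale mult_left_mono)
qed (simp add: ell2D [OF assms])

lemma ell2_norm_add: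
  assumes "\<xi> \<in> ell2 X" "\<eta> \<in> ell2 X"
  shows "ell2_norm (\<lambda>i. \<xi> i + \<eta> i) \<le> ell2_norm \<xi> + ell2_norm \<eta>"
proof (rule ell2_norm_leI [OF ell2_add [OF assms]])
  fix F :: "'a set" assume F: "finite F"
  show "l2 (\<lambda>i. \<xi> i + \<eta> i) F \<le> ell2_norm \<xi> + ell2_norm \<eta>"
    using l2_add [of \<xi> \<eta> F] l2_le_ell2_norm [OF assms(1) F] l2_le_ell2_norm [OF assms(2) F] by linarith
qed

lemma ell2_norm_scale: "ell2_norm (\<lambda>i. c * \<xi> i) = cmod c * ell2_norm \<xi>"
proof -
  have "(\<Sum>\<^sub>\<infinity>i. (cmod (c * \<xi> i))\<^sup>2) = (cmod c)\<^sup>2 * (\<Sum>\<^sub>\<infinity>i. (cmod (\<xi> i))\<^sup>2)"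
    unfolding norm_mult power_mult_distrib by (rule infsum_cmult_right')
  then show ?thesis by (simp add: ell2_norm_def real_sqrt_mult)
qed

lemma ell2_diff [simp, intro]:
  assumes "\<xi> \<in> ell2 X" "\<eta> \<in> ell2 X" shows "(\<lambda>i. \<xi> i - \<eta> i) \<in> ell2 X"
  using ell2_add [OF assms(1) ell2_scale [OF assms(2), of "-1"]] by simp

lemma ell2_norm_eq_0:
  assumes "\<xi> \<in> ell2 X" "ell2_norm \<xi> = 0" shows "\<xi> = (\<lambda>i. 0)"
proof
  fix i
  show "\<xi> i = 0" using l2_le_ell2_norm [OF assms(1), of "{i}"] assms(2) by simp
qed

lemma ell2_norm_zero [simp]: "ell2_norm (\<lambda>i. 0) = 0"
  by (simp add: ell2_norm_def)

lemma norm_le_ell2_norm: "\<xi> \<in> ell2 X \<Longrightarrow> cmod (\<xi> i) \<le> ell2_norm \<xi>"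
  using l2_le_ell2_norm [of \<xi> X "{i}"] by simp

definition trunc :: "'i set \<Rightarrow> ('i \<Rightarrow> complex) \<Rightarrow> 'i \<Rightarrow> complex" where
  "trunc F a = (\<lambda>i. if i \<in> F then a i else 0)"

lemma l2_trunc_le: "finite G \<Longrightarrow> finite F \<Longrightarrow> l2 (trunc F a) G \<le> l2 a F"
proof -
  assume fin: "finite G" "finite F"
  have "(\<Sum>i\<in>G. (cmod (trunc F a i))\<^sup>2) = (\<Sum>i\<in>G \<inter> F. (cmod (a i))\<^sup>2)"
    using fin by (intro sum.mono_neutral_cong_right) (auto simp: trunc_def)
  also have "\<dots> \<le> (\<Sum>i\<in>F. (cmod (a i))\<^sup>2)" using fin by (intro sum_mono2) auto
  finally show ?thesis by (simp add: L2_set_def)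
qed

lemma trunc_ell2: "finite F \<Longrightarrow> F \<subseteq> X \<Longrightarrow> trunc F a \<in> ell2 X"
  by (rule ell2I [OF _ l2_trunc_le]) (auto simp: trunc_def)

lemma ell2_norm_trunc_le: "finite F \<Longrightarrow> ell2_norm (trunc F a) \<le> l2 a F"
  by (rule ell2_norm_leI [OF trunc_ell2 [OF _ subset_UNIV] l2_trunc_le])

lemma delta_ell2 [simp, intro]: "i \<in> X \<Longrightarrow> delta i \<in> ell2 X"
proof -
  have "delta i = trunc {i} (\<lambda>_. 1)" by (auto simp: delta_def trunc_def)
  then show "i \<in> X \<Longrightarrow> delta i \<in> ell2 X" using trunc_ell2 [of "{i}" X] by simp
qed

lemma ell2_approx:
  assumes \<xi>: "\<xi> \<in> ell2 X" and e: "0 < e"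
  obtains F where "finite F" "F \<subseteq> X" "ell2_norm (\<lambda>i. \<xi> i - trunc F \<xi> i) \<le> e"
proof -
  let ?q = "\<lambda>i. (cmod (\<xi> i))\<^sup>2"
  have "(?q has_sum (infsum ?q UNIV)) UNIV" using ell2_summable [OF \<xi>] by (rule has_sum_infsum)
  from has_sum_finite_approximation [OF this, of "e\<^sup>2"]
  obtain F where F: "finite F" "dist (sum ?q F) (infsum ?q UNIV) \<le> e\<^sup>2"
    using e by auto
  have d: "\<xi> i - trunc (F \<inter> X) \<xi> i = (if i \<in> F then 0 else \<xi> i)" for i
    using ell2D [OF \<xi>] by (auto simp: trunc_def)
  have "ell2_norm (\<lambda>i. \<xi> i - trunc (F \<inter> X) \<xi> i) \<le> e"
  proof (rule ell2_norm_leI)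
    show "(\<lambda>i. \<xi> i - trunc (F \<inter> X) \<xi> i) \<in> ell2 X"
      using \<xi> trunc_ell2 [of "F \<inter> X" X] F(1) by (intro ell2_diff) auto
    fix G :: "'a set" assume G: "finite G"
    have "(\<Sum>i\<in>G. (cmod (if i \<in> F then 0 else \<xi> i))\<^sup>2) = sum ?q (G - F)"
      using G by (intro sum.mono_neutral_cong_right) auto
    also have "\<dots> = sum ?q (F \<union> (G - F)) - sum ?q F"
      using G F(1) by (subst sum.union_disjoint) auto
    also have "\<dots> \<le> infsum ?q UNIV - sum ?q F"
      using G F(1) finite_sum_le_infsum [OF ell2_summable [OF \<xi>], of "F \<union> (G - F)"] by simp
    also have "\<dots> \<le> e\<^sup>2" using F(2) by (simp add: dist_real_def)
    finally show "l2 (\<lambda>i. \<xi> i - trunc (F \<inter> X) \<xi> i) G \<le> e"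
      unfolding d L2_set_def using e by (intro real_le_lsqrt) auto
  qed
  then show thesis using that [of "F \<inter> X"] F(1) by auto
qed

lemma inner_abs_summable:
  assumes "\<xi> \<in> ell2 X" "\<eta> \<in> ell2 X"
  shows "(\<lambda>i. cmod (\<xi> i * cnj (\<eta> i))) summable_on UNIV"
    and "(\<Sum>\<^sub>\<infinity>i. cmod (\<xi> i * cnj (\<eta> i))) \<le> ell2_norm \<xi> * ell2_norm \<eta>"
proof -
  have le: "(\<Sum>i\<in>F. cmod (\<xi> i * cnj (\<eta> i))) \<le> ell2_norm \<xi> * ell2_norm \<eta>" if F: "finite F" for F
  proof -
    have "(\<Sum>i\<in>F. cmod (\<xi> i * cnj (\<eta> i))) \<le> l2 \<xi> F * l2 \<eta> F"
      using L2_set_mult_ineq [of "\<lambda>i. cmod (\<xi> i)" "\<lambda>i. cmod (\<eta> i)" F] by (simp add: norm_mult)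
    also have "\<dots> \<le> ell2_norm \<xi> * ell2_norm \<eta>"
      using l2_le_ell2_norm [OF assms(1) F] l2_le_ell2_norm [OF assms(2) F] by (intro mult_mono) auto
    finally show ?thesis .
  qed
  show *: "(\<lambda>i. cmod (\<xi> i * cnj (\<eta> i))) summable_on UNIV"
    unfolding abs_summable_iff_bdd_above using le by (intro bdd_aboveI2) auto
  show "(\<Sum>\<^sub>\<infinity>i. cmod (\<xi> i * cnj (\<eta> i))) \<le> ell2_norm \<xi> * ell2_norm \<eta>"
    using le by (intro infsum_le_finite_sums [OF *]) auto
qed

lemma inner_summable:
  assumes "\<xi> \<in> ell2 X" "\<eta> \<in> ell2 X" shows "(\<lambda>i. \<xi> i * cnj (\<eta> i)) summable_on UNIV"
  using inner_abs_summable(1) [OF assms] by (rule abs_summable_summable)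

lemma inner_le:
  assumes "\<xi> \<in> ell2 X" "\<eta> \<in> ell2 X" shows "cmod (ell2_inner \<xi> \<eta>) \<le> ell2_norm \<xi> * ell2_norm \<eta>"
  unfolding ell2_inner_def
  using norm_infsum_bound [OF inner_abs_summable(1) [OF assms]] inner_abs_summable(2) [OF assms]
  by linarith

lemma inner_cnj: "cnj (ell2_inner \<xi> \<eta>) = ell2_inner \<eta> \<xi>"
  unfolding ell2_inner_def infsum_cnj [symmetric] by (simp add: mult.commute)

lemma inner_add_left:
  assumes "\<xi> \<in> ell2 X" "\<xi>' \<in> ell2 X" "\<eta> \<in> ell2 X"
  shows "ell2_inner (\<lambda>i. \<xi> i + \<xi>' i) \<eta> = ell2_inner \<xi> \<eta> + ell2_inner \<xi>' \<eta>"
  unfolding ell2_inner_def distrib_right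
  using inner_summable [OF assms(1,3)] inner_summable [OF assms(2,3)] by (rule infsum_add)

lemma inner_scale_left: "ell2_inner (\<lambda>i. c * \<xi> i) \<eta> = c * ell2_inner \<xi> \<eta>"
  unfolding ell2_inner_def mult.assoc by (rule infsum_cmult_right')

lemma inner_add_right:
  assumes "\<eta> \<in> ell2 X" "\<eta>' \<in> ell2 X" "\<xi> \<in> ell2 X"
  shows "ell2_inner \<xi> (\<lambda>i. \<eta> i + \<eta>' i) = ell2_inner \<xi> \<eta> + ell2_inner \<xi> \<eta>'"
  using inner_add_left [OF assms] by (metis complex_cnj_add inner_cnj)

lemma inner_scale_right: "ell2_inner \<xi> (\<lambda>i. c * \<eta> i) = cnj c * ell2_inner \<xi> \<eta>"
  using inner_scale_left [of c \<eta> \<xi>] by (metis complex_cnj_mult inner_cnj)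

lemma inner_zero_left [simp]: "ell2_inner (\<lambda>i. 0) \<eta> = 0"
  by (simp add: ell2_inner_def)

lemma inner_self:
  assumes "\<xi> \<in> ell2 X" shows "ell2_inner \<xi> \<xi> = of_real ((ell2_norm \<xi>)\<^sup>2)"
proof -
  have "((\<lambda>i. complex_of_real ((cmod (\<xi> i))\<^sup>2)) has_sum complex_of_real ((ell2_norm \<xi>)\<^sup>2)) UNIV"
    unfolding ell2_norm_sq using has_sum_infsum [OF ell2_summable [OF assms]] by (rule has_sum_of_real)
  then have "((\<lambda>i. \<xi> i * cnj (\<xi> i)) has_sum complex_of_real ((ell2_norm \<xi>)\<^sup>2)) UNIV"
    by (simp only: complex_norm_square)
  then show ?thesis unfolding ell2_inner_def by (rule infsumI)
qed

lemma infsum_UNIV_eq_sum: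
  assumes "finite F" "\<And>i. i \<notin> F \<Longrightarrow> f i = 0"
  shows "(\<Sum>\<^sub>\<infinity>i. f i) = (\<Sum>i\<in>F. f i)"
proof -
  have "infsum f UNIV = infsum f F" using assms by (intro infsum_cong_neutral) auto
  then show ?thesis using assms(1) by simp
qed

lemma inner_trunc: "finite F \<Longrightarrow> ell2_inner (trunc F a) \<eta> = (\<Sum>i\<in>F. a i * cnj (\<eta> i))"
  unfolding ell2_inner_def by (subst infsum_UNIV_eq_sum [of F]) (auto simp: trunc_def intro: sum.cong)

lemma inner_delta_right: "ell2_inner \<xi> (delta i) = \<xi> i"
  unfolding ell2_inner_def by (subst infsum_UNIV_eq_sum [of "{i}"]) (auto simp: delta_def)

lemma ell2_ext_inner:
  assumes "\<xi> \<in> ell2 X" "\<eta> \<in> ell2 X" "\<And>\<zeta>. \<zeta> \<in> ell2 X \<Longrightarrow> ell2_inner \<xi> \<zeta> = ell2_inner \<eta> \<zeta>"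
  shows "\<xi> = \<eta>"
proof
  fix i
  show "\<xi> i = \<eta> i"
    using assms(3) [of "delta i"] ell2D [OF assms(1), of i] ell2D [OF assms(2), of i]
    by (cases "i \<in> X") (simp_all add: inner_delta_right)
qed

text \<open>A bounded functional is the inner product with the family of its values on the basis; testing
  the bound on the truncations of that family shows that it is square-summable.\<close>

lemma ell2_riesz:
  fixes f :: "('i \<Rightarrow> complex) \<Rightarrow> complex"
  assumes add: "\<And>\<xi> \<eta>. \<lbrakk>\<xi> \<in> ell2 X; \<eta> \<in> ell2 X\<rbrakk> \<Longrightarrow> f (\<lambda>i. \<xi> i + \<eta> i) = f \<xi> + f \<eta>"
    and scale: "\<And>c \<xi>. \<xi> \<in> ell2 X \<Longrightarrow> f (\<lambda>i. c * \<xi> i) = c * f \<xi>"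
    and bound: "\<And>\<xi>. \<xi> \<in> ell2 X \<Longrightarrow> cmod (f \<xi>) \<le> K * ell2_norm \<xi>" and K: "0 \<le> K"
  defines "g \<equiv> \<lambda>i. if i \<in> X then cnj (f (delta i)) else 0"
  shows "g \<in> ell2 X" "ell2_norm g \<le> K" "\<And>\<xi>. \<xi> \<in> ell2 X \<Longrightarrow> f \<xi> = ell2_inner \<xi> g"
proof -
  have f_trunc: "f (trunc F a) = (\<Sum>i\<in>F. a i * cnj (g i))" if "finite F" "F \<subseteq> X" for F a
    using that
  proof (induction F rule: finite_induct)
    case empty
    have "trunc {} a = (\<lambda>i. 0 * 0)" by (auto simp: trunc_def)
    then show ?case using scale [of "\<lambda>i. 0" 0] by simp
  next
    case (insert j F)
    have j: "delta j \<in> ell2 X" using insert by auto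
    have "trunc (insert j F) a = (\<lambda>i. a j * delta j i + trunc F a i)"
      using insert by (auto simp: trunc_def delta_def)
    then have "f (trunc (insert j F) a) = a j * f (delta j) + f (trunc F a)"
      using add [OF ell2_scale [OF j] trunc_ell2 [of F X], of "a j" a] scale [OF j, of "a j"] insert by simp
    then show ?case using insert by (simp add: g_def)
  qed
  have g_le: "l2 g F \<le> K" if F: "finite F" for F
  proof -
    let ?F = "F \<inter> X"
    have "l2 g F = l2 g ?F"
    proof -
      have "(\<Sum>i\<in>F. (cmod (g i))\<^sup>2) = (\<Sum>i\<in>?F. (cmod (g i))\<^sup>2)"
        using F by (intro sum.mono_neutral_right) (auto simp: g_def)
      then show ?thesis by (simp add: L2_set_def)
    qed
    moreover have "l2 g ?F \<le> K"
    proof (cases "l2 g ?F = 0")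
      case False
      have "f (trunc ?F g) = (\<Sum>i\<in>?F. complex_of_real ((cmod (g i))\<^sup>2))"
        using f_trunc [of ?F g] F by (simp add: complex_norm_square [symmetric])
      then have "f (trunc ?F g) = complex_of_real ((l2 g ?F)\<^sup>2)" by (simp add: l2_sq)
      then have "(l2 g ?F)\<^sup>2 \<le> K * ell2_norm (trunc ?F g)"
        using bound [OF trunc_ell2 [of ?F X g]] F by (simp add: norm_power)
      also have "\<dots> \<le> K * l2 g ?F"
        using K F by (intro mult_left_mono ell2_norm_trunc_le) auto
      finally have "l2 g ?F * l2 g ?F \<le> K * l2 g ?F" by (simp add: power2_eq_square)
      moreover have "0 < l2 g ?F" using False L2_set_nonneg [of "\<lambda>i. cmod (g i)" ?F] by linarith
      ultimately show ?thesis by (simp add: mult_le_cancel_right)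
    qed (simp add: K)
    ultimately show ?thesis by simp
  qed
  show g: "g \<in> ell2 X" using g_le by (intro ell2I [of X g K]) (simp_all add: g_def)
  show gn: "ell2_norm g \<le> K" using ell2_norm_leI [OF g g_le] .
  fix \<xi> :: "'i \<Rightarrow> complex" assume \<xi>: "\<xi> \<in> ell2 X"
  have "cmod (f \<xi> - ell2_inner \<xi> g) \<le> 0"
  proof (rule field_le_epsilon)
    fix e :: real assume e: "0 < e"
    obtain F where F: "finite F" "F \<subseteq> X" "ell2_norm (\<lambda>i. \<xi> i - trunc F \<xi> i) \<le> e / (2 * (K + 1))"
      using ell2_approx [OF \<xi>, of "e / (2 * (K + 1))"] e K by auto
    let ?r = "\<lambda>i. \<xi> i - trunc F \<xi> i"
    have v: "trunc F \<xi> \<in> ell2 X" using F by (intro trunc_ell2)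
    have r: "?r \<in> ell2 X" using \<xi> v by (rule ell2_diff)
    have split: "\<xi> = (\<lambda>i. trunc F \<xi> i + ?r i)" by simp
    have "f \<xi> = f (trunc F \<xi>) + f ?r" using add [OF v r] by simp
    moreover have "ell2_inner \<xi> g = ell2_inner (trunc F \<xi>) g + ell2_inner ?r g"
      using inner_add_left [OF v r g] by simp
    moreover have "f (trunc F \<xi>) = ell2_inner (trunc F \<xi>) g"
      using f_trunc [OF F(1,2)] inner_trunc [OF F(1)] by simp
    ultimately have "f \<xi> - ell2_inner \<xi> g = f ?r - ell2_inner ?r g" by simp
    then have "cmod (f \<xi> - ell2_inner \<xi> g) \<le> cmod (f ?r) + cmod (ell2_inner ?r g)"
      using norm_triangle_ineq4 by metis
    also have "\<dots> \<le> K * ell2_norm ?r + ell2_norm ?r * K"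
      using bound [OF r] inner_le [OF r g] mult_left_mono [OF gn ell2_norm_nonneg [of ?r]] by linarith
    also have "\<dots> = (2 * K) * ell2_norm ?r" by simp
    also have "\<dots> \<le> (2 * (K + 1)) * (e / (2 * (K + 1)))"
      using F(3) K by (intro mult_mono) auto
    also have "\<dots> = 0 + e" using K by simp
    finally show "cmod (f \<xi> - ell2_inner \<xi> g) \<le> 0 + e" .
  qed
  then show "f \<xi> = ell2_inner \<xi> g" by simp
qed

section \<open>The C*-algebra of bounded operators\<close>

lemma bounded_operatorsD:
  assumes "R \<in> bounded_operators X"
  shows "R \<in> extensional (ell2 X)" "\<xi> \<in> ell2 X \<Longrightarrow> R \<xi> \<in> ell2 X"
    "\<lbrakk>\<xi> \<in> ell2 X; \<eta> \<in> ell2 X\<rbrakk> \<Longrightarrow> R (\<lambda>i. \<xi> i + \<eta> i) = (\<lambda>i. R \<xi> i + R \<eta> i)"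
    "\<xi> \<in> ell2 X \<Longrightarrow> R (\<lambda>i. c * \<xi> i) = (\<lambda>i. c * R \<xi> i)"
proof -
  note R = assms [unfolded bounded_operators_def, THEN CollectD]
  show "R \<in> extensional (ell2 X)" using conjunct1 [OF R] by (simp add: PiE_def)
  show "\<xi> \<in> ell2 X \<Longrightarrow> R \<xi> \<in> ell2 X" using conjunct1 [OF R] by (rule PiE_mem)
  show "\<lbrakk>\<xi> \<in> ell2 X; \<eta> \<in> ell2 X\<rbrakk> \<Longrightarrow> R (\<lambda>i. \<xi> i + \<eta> i) = (\<lambda>i. R \<xi> i + R \<eta> i)"
    by (rule bspec [OF bspec [OF conjunct1 [OF conjunct2 [OF R]]]])
  show "\<xi> \<in> ell2 X \<Longrightarrow> R (\<lambda>i. c * \<xi> i) = (\<lambda>i. c * R \<xi> i)"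
    by (rule bspec [OF spec [OF conjunct1 [OF conjunct2 [OF conjunct2 [OF R]]]]])
qed

lemma bounded_operatorsI:
  assumes "R \<in> extensional (ell2 X)" "\<And>\<xi>. \<xi> \<in> ell2 X \<Longrightarrow> R \<xi> \<in> ell2 X"
    "\<And>\<xi> \<eta>. \<lbrakk>\<xi> \<in> ell2 X; \<eta> \<in> ell2 X\<rbrakk> \<Longrightarrow> R (\<lambda>i. \<xi> i + \<eta> i) = (\<lambda>i. R \<xi> i + R \<eta> i)"
    "\<And>c \<xi>. \<xi> \<in> ell2 X \<Longrightarrow> R (\<lambda>i. c * \<xi> i) = (\<lambda>i. c * R \<xi> i)"
    "\<And>\<xi>. \<xi> \<in> ell2 X \<Longrightarrow> ell2_norm (R \<xi>) \<le> K * ell2_norm \<xi>"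
  shows "R \<in> bounded_operators X"
  unfolding bounded_operators_def
proof (intro CollectI conjI ballI allI)
  show "R \<in> ell2 X \<rightarrow>\<^sub>E ell2 X" using assms(1,2) by (simp add: PiE_def)
  show "\<exists>K. \<forall>\<xi>\<in>ell2 X. ell2_norm (R \<xi>) \<le> K * ell2_norm \<xi>" using assms(5) by blast
qed (rule assms(3,4); assumption)+

lemma bounded_operator_bound:
  assumes "R \<in> bounded_operators X"
  shows "\<exists>K. 0 \<le> K \<and> (\<forall>\<xi>\<in>ell2 X. ell2_norm (R \<xi>) \<le> K * ell2_norm \<xi>)"
proof -
  obtain K where K: "\<And>\<xi>. \<xi> \<in> ell2 X \<Longrightarrow> ell2_norm (R \<xi>) \<le> K * ell2_norm \<xi>"
    using conjunct2 [OF conjunct2 [OF conjunct2 [OF assms [unfolded bounded_operators_def, THEN CollectD]]]]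
    by blast
  have "ell2_norm (R \<xi>) \<le> \<bar>K\<bar> * ell2_norm \<xi>" if "\<xi> \<in> ell2 X" for \<xi>
    using K [OF that] mult_right_mono [OF abs_ge_self [of K] ell2_norm_nonneg [of \<xi>]] by linarith
  then show ?thesis by (intro exI [of _ "\<bar>K\<bar>"]) simp
qed

lemma bounded_operators_eqI:
  "\<lbrakk>R \<in> bounded_operators X; Q \<in> bounded_operators X; \<And>\<xi>. \<xi> \<in> ell2 X \<Longrightarrow> R \<xi> = Q \<xi>\<rbrakk> \<Longrightarrow> R = Q"
  by (rule extensionalityI [OF bounded_operatorsD(1) bounded_operatorsD(1)])

lemma B_ell2_carrier [simp]: "carrier (B_ell2 X) = bounded_operators X"
  by (simp add: B_ell2_def)

lemma B_ell2_apply: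
  assumes "\<xi> \<in> ell2 X"
  shows "(R \<otimes>\<^bsub>B_ell2 X\<^esub> Q) \<xi> = R (Q \<xi>)" "(R \<oplus>\<^bsub>B_ell2 X\<^esub> Q) \<xi> = (\<lambda>i. R \<xi> i + Q \<xi> i)"
    "(c \<odot>\<^bsub>B_ell2 X\<^esub> R) \<xi> = (\<lambda>i. c * R \<xi> i)" "\<zero>\<^bsub>B_ell2 X\<^esub> \<xi> = (\<lambda>i. 0)"
  using assms by (simp_all add: B_ell2_def compose_def)

lemma B_ell2_norm_bound:
  assumes R: "R \<in> bounded_operators X" and \<xi>: "\<xi> \<in> ell2 X"
  shows "ell2_norm (R \<xi>) \<le> cnorm (B_ell2 X) R * ell2_norm \<xi>"
proof (cases "ell2_norm \<xi> = 0")
  case True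
  obtain K where "ell2_norm (R \<xi>) \<le> K * ell2_norm \<xi>"
    using bounded_operator_bound [OF R] \<xi> by blast
  then show ?thesis using True by simp
next
  case False
  then have pos: "0 < ell2_norm \<xi>" using ell2_norm_nonneg [of \<xi>] by linarith
  have "ell2_norm (R \<xi>) / ell2_norm \<xi> \<le> Inf {K. 0 \<le> K \<and> (\<forall>\<xi>\<in>ell2 X. ell2_norm (R \<xi>) \<le> K * ell2_norm \<xi>)}"
  proof (rule cInf_greatest)
    show "{K. 0 \<le> K \<and> (\<forall>\<xi>\<in>ell2 X. ell2_norm (R \<xi>) \<le> K * ell2_norm \<xi>)} \<noteq> {}"
      using bounded_operator_bound [OF R] by blast
    fix K assume "K \<in> {K. 0 \<le> K \<and> (\<forall>\<xi>\<in>ell2 X. ell2_norm (R \<xi>) \<le> K * ell2_norm \<xi>)}"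
    then show "ell2_norm (R \<xi>) / ell2_norm \<xi> \<le> K" using \<xi> pos by (simp add: pos_divide_le_eq)
  qed
  then show ?thesis using pos by (simp add: B_ell2_def pos_divide_le_eq)
qed

lemma B_ell2_norm_le:
  assumes "0 \<le> K" "\<And>\<xi>. \<xi> \<in> ell2 X \<Longrightarrow> ell2_norm (R \<xi>) \<le> K * ell2_norm \<xi>"
  shows "cnorm (B_ell2 X) R \<le> K"
proof -
  have "Inf {K. 0 \<le> K \<and> (\<forall>\<xi>\<in>ell2 X. ell2_norm (R \<xi>) \<le> K * ell2_norm \<xi>)} \<le> K"
    using assms by (intro cInf_lower bdd_belowI [of _ 0]) auto
  then show ?thesis by (simp add: B_ell2_def)
qed

lemma B_ell2_norm_nonneg:
  assumes "R \<in> bounded_operators X" shows "0 \<le> cnorm (B_ell2 X) R"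
proof -
  have "0 \<le> Inf {K. 0 \<le> K \<and> (\<forall>\<xi>\<in>ell2 X. ell2_norm (R \<xi>) \<le> K * ell2_norm \<xi>)}"
  proof (rule cInf_greatest)
    show "{K. 0 \<le> K \<and> (\<forall>\<xi>\<in>ell2 X. ell2_norm (R \<xi>) \<le> K * ell2_norm \<xi>)} \<noteq> {}"
      using bounded_operator_bound [OF assms] by blast
  qed blast
  then show ?thesis by (simp add: B_ell2_def)
qed

lemma B_ell2_zero_closed: "\<zero>\<^bsub>B_ell2 X\<^esub> \<in> bounded_operators X"
  by (rule bounded_operatorsI [of _ _ 0]) (simp_all add: B_ell2_apply, simp_all add: B_ell2_def)

lemma B_ell2_add_closed:
  assumes R: "R \<in> bounded_operators X" and Q: "Q \<in> bounded_operators X"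
  shows "R \<oplus>\<^bsub>B_ell2 X\<^esub> Q \<in> bounded_operators X"
    and "cnorm (B_ell2 X) (R \<oplus>\<^bsub>B_ell2 X\<^esub> Q) \<le> cnorm (B_ell2 X) R + cnorm (B_ell2 X) Q"
proof -
  have bd: "ell2_norm ((R \<oplus>\<^bsub>B_ell2 X\<^esub> Q) \<xi>) \<le> (cnorm (B_ell2 X) R + cnorm (B_ell2 X) Q) * ell2_norm \<xi>"
    if \<xi>: "\<xi> \<in> ell2 X" for \<xi>
    using ell2_norm_add [OF bounded_operatorsD(2) [OF R \<xi>] bounded_operatorsD(2) [OF Q \<xi>]]
      B_ell2_norm_bound [OF R \<xi>] B_ell2_norm_bound [OF Q \<xi>] \<xi>
    by (simp add: B_ell2_apply distrib_right)
  show "R \<oplus>\<^bsub>B_ell2 X\<^esub> Q \<in> bounded_operators X"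
  proof (rule bounded_operatorsI [OF _ _ _ _ bd])
    show "R \<oplus>\<^bsub>B_ell2 X\<^esub> Q \<in> extensional (ell2 X)" by (simp add: B_ell2_def)
  qed (simp_all add: bounded_operatorsD(2-4) [OF R] bounded_operatorsD(2-4) [OF Q] B_ell2_apply algebra_simps)
  show "cnorm (B_ell2 X) (R \<oplus>\<^bsub>B_ell2 X\<^esub> Q) \<le> cnorm (B_ell2 X) R + cnorm (B_ell2 X) Q"
    using bd B_ell2_norm_nonneg [OF R] B_ell2_norm_nonneg [OF Q] by (intro B_ell2_norm_le) auto
qed

lemma B_ell2_scale_closed:
  assumes R: "R \<in> bounded_operators X"
  shows "c \<odot>\<^bsub>B_ell2 X\<^esub> R \<in> bounded_operators X"
    and "cnorm (B_ell2 X) (c \<odot>\<^bsub>B_ell2 X\<^esub> R) \<le> cmod c * cnorm (B_ell2 X) R"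
proof -
  have bd: "ell2_norm ((c \<odot>\<^bsub>B_ell2 X\<^esub> R) \<xi>) \<le> (cmod c * cnorm (B_ell2 X) R) * ell2_norm \<xi>"
    if \<xi>: "\<xi> \<in> ell2 X" for \<xi>
    using B_ell2_norm_bound [OF R \<xi>] \<xi>
    by (simp add: B_ell2_apply ell2_norm_scale mult.assoc mult_left_mono)
  show "c \<odot>\<^bsub>B_ell2 X\<^esub> R \<in> bounded_operators X"
  proof (rule bounded_operatorsI [OF _ _ _ _ bd])
    show "c \<odot>\<^bsub>B_ell2 X\<^esub> R \<in> extensional (ell2 X)" by (simp add: B_ell2_def)
  qed (simp_all add: bounded_operatorsD(2-4) [OF R] B_ell2_apply algebra_simps)
  show "cnorm (B_ell2 X) (c \<odot>\<^bsub>B_ell2 X\<^esub> R) \<le> cmod c * cnorm (B_ell2 X) R"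
    using bd B_ell2_norm_nonneg [OF R] by (intro B_ell2_norm_le) auto
qed

lemma B_ell2_mult_closed:
  assumes R: "R \<in> bounded_operators X" and Q: "Q \<in> bounded_operators X"
  shows "R \<otimes>\<^bsub>B_ell2 X\<^esub> Q \<in> bounded_operators X"
    and "cnorm (B_ell2 X) (R \<otimes>\<^bsub>B_ell2 X\<^esub> Q) \<le> cnorm (B_ell2 X) R * cnorm (B_ell2 X) Q"
proof -
  have bd: "ell2_norm ((R \<otimes>\<^bsub>B_ell2 X\<^esub> Q) \<xi>) \<le> (cnorm (B_ell2 X) R * cnorm (B_ell2 X) Q) * ell2_norm \<xi>"
    if \<xi>: "\<xi> \<in> ell2 X" for \<xi>
    using order_trans [OF B_ell2_norm_bound [OF R bounded_operatorsD(2) [OF Q \<xi>]]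
        mult_left_mono [OF B_ell2_norm_bound [OF Q \<xi>] B_ell2_norm_nonneg [OF R]]] \<xi>
    by (simp add: B_ell2_apply mult.assoc)
  show "R \<otimes>\<^bsub>B_ell2 X\<^esub> Q \<in> bounded_operators X"
  proof (rule bounded_operatorsI [OF _ _ _ _ bd])
    show "R \<otimes>\<^bsub>B_ell2 X\<^esub> Q \<in> extensional (ell2 X)" by (simp add: B_ell2_def compose_def)
  qed (simp_all add: bounded_operatorsD(2-4) [OF R] bounded_operatorsD(2-4) [OF Q] B_ell2_apply)
  show "cnorm (B_ell2 X) (R \<otimes>\<^bsub>B_ell2 X\<^esub> Q) \<le> cnorm (B_ell2 X) R * cnorm (B_ell2 X) Q"
    using bd B_ell2_norm_nonneg [OF R] B_ell2_norm_nonneg [OF Q] by (intro B_ell2_norm_le) auto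
qed

definition is_adjoint :: "'i set \<Rightarrow> 'i operator \<Rightarrow> 'i operator \<Rightarrow> bool" where
  "is_adjoint X R Q \<longleftrightarrow> Q \<in> bounded_operators X \<and>
     (\<forall>\<xi>\<in>ell2 X. \<forall>\<eta>\<in>ell2 X. ell2_inner (R \<xi>) \<eta> = ell2_inner \<xi> (Q \<eta>))"

lemma is_adjoint_unique:
  assumes "is_adjoint X R Q" "is_adjoint X R Q'" shows "Q = Q'"
proof (rule bounded_operators_eqI)
  show Q: "Q \<in> bounded_operators X" "Q' \<in> bounded_operators X"
    using assms by (simp_all add: is_adjoint_def)
  fix \<eta> :: "'a \<Rightarrow> complex" assume \<eta>: "\<eta> \<in> ell2 X"
  show "Q \<eta> = Q' \<eta>"
  proof (rule ell2_ext_inner [OF bounded_operatorsD(2) [OF Q(1) \<eta>] bounded_operatorsD(2) [OF Q(2) \<eta>]])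
    fix \<zeta> :: "'a \<Rightarrow> complex" assume "\<zeta> \<in> ell2 X"
    then have "ell2_inner (R \<zeta>) \<eta> = ell2_inner \<zeta> (Q \<eta>)" "ell2_inner (R \<zeta>) \<eta> = ell2_inner \<zeta> (Q' \<eta>)"
      using assms \<eta> unfolding is_adjoint_def by blast+
    then have "cnj (ell2_inner \<zeta> (Q \<eta>)) = cnj (ell2_inner \<zeta> (Q' \<eta>))" by simp
    then show "ell2_inner (Q \<eta>) \<zeta> = ell2_inner (Q' \<eta>) \<zeta>" unfolding inner_cnj .
  qed
qed

lemma B_ell2_adj_eqI: "is_adjoint X R Q \<Longrightarrow> adj (B_ell2 X) R = Q"
proof -
  assume Q: "is_adjoint X R Q"
  have "(THE Q. is_adjoint X R Q) = Q"
    by (rule the_equality [of "is_adjoint X R", OF Q]) (rule is_adjoint_unique [OF _ Q])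
  then show "adj (B_ell2 X) R = Q" by (simp add: B_ell2_def is_adjoint_def)
qed

lemma ex_is_adjoint:
  assumes R: "R \<in> bounded_operators X" shows "\<exists>Q. is_adjoint X R Q"
proof -
  define Q where "Q = (\<lambda>\<eta>\<in>ell2 X. \<lambda>i. if i \<in> X then cnj (ell2_inner (R (delta i)) \<eta>) else 0)"
  let ?K = "cnorm (B_ell2 X) R"
  note RD = bounded_operatorsD [OF R]
  have main: "Q \<eta> \<in> ell2 X \<and> ell2_norm (Q \<eta>) \<le> ?K * ell2_norm \<eta> \<and>
      (\<forall>\<xi>\<in>ell2 X. ell2_inner (R \<xi>) \<eta> = ell2_inner \<xi> (Q \<eta>))" if \<eta>: "\<eta> \<in> ell2 X" for \<eta>
  proof -
    have 1: "ell2_inner (R (\<lambda>i. \<xi> i + \<zeta> i)) \<eta> = ell2_inner (R \<xi>) \<eta> + ell2_inner (R \<zeta>) \<eta>"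
      if "\<xi> \<in> ell2 X" "\<zeta> \<in> ell2 X" for \<xi> \<zeta>
      using that \<eta> by (simp add: RD(2,3) inner_add_left [of _ X])
    have 2: "ell2_inner (R (\<lambda>i. c * \<xi> i)) \<eta> = c * ell2_inner (R \<xi>) \<eta>" if "\<xi> \<in> ell2 X" for c \<xi>
      using that by (simp add: RD(4) inner_scale_left)
    have 3: "cmod (ell2_inner (R \<xi>) \<eta>) \<le> (?K * ell2_norm \<eta>) * ell2_norm \<xi>" if \<xi>: "\<xi> \<in> ell2 X" for \<xi>
      using order_trans [OF inner_le [OF RD(2) [OF \<xi>] \<eta>]
          mult_right_mono [OF B_ell2_norm_bound [OF R \<xi>] ell2_norm_nonneg [of \<eta>]]]
      by (simp add: mult_ac)
    have 4: "0 \<le> ?K * ell2_norm \<eta>" using B_ell2_norm_nonneg [OF R] by simp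
    have eq: "Q \<eta> = (\<lambda>i. if i \<in> X then cnj (ell2_inner (R (delta i)) \<eta>) else 0)"
      using \<eta> by (simp add: Q_def)
    show ?thesis
      unfolding eq using ell2_riesz [OF 1 2 3 4] by blast
  qed
  have "Q \<in> bounded_operators X"
  proof (rule bounded_operatorsI)
    show "Q \<in> extensional (ell2 X)" by (simp add: Q_def)
    fix \<eta> \<zeta> :: "'a \<Rightarrow> complex" and c assume \<eta>: "\<eta> \<in> ell2 X"
    show "Q \<eta> \<in> ell2 X" "ell2_norm (Q \<eta>) \<le> ?K * ell2_norm \<eta>" using main [OF \<eta>] by blast+
    show "Q (\<lambda>i. c * \<eta> i) = (\<lambda>i. c * Q \<eta> i)"
      using \<eta> by (auto simp: Q_def inner_scale_right)
    assume \<zeta>: "\<zeta> \<in> ell2 X"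
    have "ell2_inner (R (delta i)) (\<lambda>i. \<eta> i + \<zeta> i) = ell2_inner (R (delta i)) \<eta> + ell2_inner (R (delta i)) \<zeta>"
      if "i \<in> X" for i
      using \<eta> \<zeta> RD(2) [OF delta_ell2 [OF that]] by (rule inner_add_right)
    then show "Q (\<lambda>i. \<eta> i + \<zeta> i) = (\<lambda>i. Q \<eta> i + Q \<zeta> i)"
      using \<eta> \<zeta> by (auto simp: Q_def)
  qed
  then show ?thesis using main unfolding is_adjoint_def by blast
qed

lemma is_adjoint_adj: "R \<in> bounded_operators X \<Longrightarrow> is_adjoint X R (adj (B_ell2 X) R)"
proof -
  assume "R \<in> bounded_operators X"
  then obtain Q where Q: "is_adjoint X R Q" using ex_is_adjoint by blast
  then show ?thesis unfolding B_ell2_adj_eqI [OF Q] .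
qed

lemma B_ell2_adj_closed: "R \<in> bounded_operators X \<Longrightarrow> adj (B_ell2 X) R \<in> bounded_operators X"
  using is_adjoint_adj unfolding is_adjoint_def by blast

lemma inner_adj:
  "\<lbrakk>R \<in> bounded_operators X; \<xi> \<in> ell2 X; \<eta> \<in> ell2 X\<rbrakk>
   \<Longrightarrow> ell2_inner (R \<xi>) \<eta> = ell2_inner \<xi> (adj (B_ell2 X) R \<eta>)"
  using is_adjoint_adj unfolding is_adjoint_def by blast

lemma inner_adj_left:
  "\<lbrakk>R \<in> bounded_operators X; \<xi> \<in> ell2 X; \<eta> \<in> ell2 X\<rbrakk>
   \<Longrightarrow> ell2_inner (adj (B_ell2 X) R \<xi>) \<eta> = ell2_inner \<xi> (R \<eta>)"
proof -
  assume "R \<in> bounded_operators X" "\<xi> \<in> ell2 X" "\<eta> \<in> ell2 X"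
  then have "cnj (ell2_inner (R \<eta>) \<xi>) = cnj (ell2_inner \<eta> (adj (B_ell2 X) R \<xi>))"
    by (simp only: inner_adj)
  then show ?thesis unfolding inner_cnj by (rule sym)
qed

lemma B_ell2_cstar_le:
  assumes R: "R \<in> bounded_operators X"
  shows "(cnorm (B_ell2 X) R)\<^sup>2 \<le> cnorm (B_ell2 X) (adj (B_ell2 X) R \<otimes>\<^bsub>B_ell2 X\<^esub> R)"
proof -
  let ?S = "adj (B_ell2 X) R \<otimes>\<^bsub>B_ell2 X\<^esub> R"
  have S: "?S \<in> bounded_operators X" using B_ell2_mult_closed(1) [OF B_ell2_adj_closed [OF R] R] .
  have "cnorm (B_ell2 X) R \<le> sqrt (cnorm (B_ell2 X) ?S)"
  proof (rule B_ell2_norm_le)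
    fix \<xi> :: "'a \<Rightarrow> complex" assume \<xi>: "\<xi> \<in> ell2 X"
    note R\<xi> = bounded_operatorsD(2) [OF R \<xi>]
    have eq: "ell2_inner (R \<xi>) (R \<xi>) = ell2_inner (?S \<xi>) \<xi>"
      unfolding B_ell2_apply(1) [OF \<xi>] inner_adj_left [OF R R\<xi> \<xi>] ..
    have "(ell2_norm (R \<xi>))\<^sup>2 = cmod (ell2_inner (?S \<xi>) \<xi>)"
      unfolding eq [symmetric] inner_self [OF R\<xi>] by (simp add: norm_power)
    also have "\<dots> \<le> ell2_norm (?S \<xi>) * ell2_norm \<xi>"
      using bounded_operatorsD(2) [OF S \<xi>] \<xi> by (rule inner_le)
    also have "\<dots> \<le> (cnorm (B_ell2 X) ?S * ell2_norm \<xi>) * ell2_norm \<xi>"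
      using B_ell2_norm_bound [OF S \<xi>] by (intro mult_right_mono) auto
    also have "\<dots> = (sqrt (cnorm (B_ell2 X) ?S) * ell2_norm \<xi>)\<^sup>2"
      unfolding power_mult_distrib real_sqrt_pow2 [OF B_ell2_norm_nonneg [OF S]]
      by (simp only: power2_eq_square mult.assoc)
    finally show "ell2_norm (R \<xi>) \<le> sqrt (cnorm (B_ell2 X) ?S) * ell2_norm \<xi>"
      by (rule power2_le_imp_le) (simp add: B_ell2_norm_nonneg [OF S])
  qed (use B_ell2_norm_nonneg [OF S] in simp)
  then have "(cnorm (B_ell2 X) R)\<^sup>2 \<le> (sqrt (cnorm (B_ell2 X) ?S))\<^sup>2"
    using B_ell2_norm_nonneg [OF R] by (rule power_mono)
  then show ?thesis using B_ell2_norm_nonneg [OF S] by simp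
qed

lemma normed_cmodule_B_ell2: "normed_cmodule (B_ell2 X)"
proof -
  have neg: "(-1) \<odot>\<^bsub>B_ell2 X\<^esub> R \<oplus>\<^bsub>B_ell2 X\<^esub> R = \<zero>\<^bsub>B_ell2 X\<^esub>" if R: "R \<in> bounded_operators X" for R
    by (rule bounded_operators_eqI [OF B_ell2_add_closed(1) [OF B_ell2_scale_closed(1) [OF R] R] B_ell2_zero_closed])
       (simp add: B_ell2_apply)
  have ab: "abelian_group (B_ell2 X)"
  proof (rule abelian_groupI, unfold B_ell2_carrier)
    fix R Q P assume R: "R \<in> bounded_operators X"
    show "\<exists>Q\<in>bounded_operators X. Q \<oplus>\<^bsub>B_ell2 X\<^esub> R = \<zero>\<^bsub>B_ell2 X\<^esub>"
      using neg [OF R] B_ell2_scale_closed(1) [OF R] by blast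
    show "\<zero>\<^bsub>B_ell2 X\<^esub> \<oplus>\<^bsub>B_ell2 X\<^esub> R = R"
      by (rule bounded_operators_eqI [OF B_ell2_add_closed(1) [OF B_ell2_zero_closed R] R])
         (simp add: B_ell2_apply)
    assume Q: "Q \<in> bounded_operators X"
    show "R \<oplus>\<^bsub>B_ell2 X\<^esub> Q = Q \<oplus>\<^bsub>B_ell2 X\<^esub> R"
      by (rule bounded_operators_eqI [OF B_ell2_add_closed(1) [OF R Q] B_ell2_add_closed(1) [OF Q R]])
         (simp add: B_ell2_apply add.commute)
    assume P: "P \<in> bounded_operators X"
    show "(R \<oplus>\<^bsub>B_ell2 X\<^esub> Q) \<oplus>\<^bsub>B_ell2 X\<^esub> P = R \<oplus>\<^bsub>B_ell2 X\<^esub> (Q \<oplus>\<^bsub>B_ell2 X\<^esub> P)"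
      by (rule bounded_operators_eqI [OF B_ell2_add_closed(1) [OF B_ell2_add_closed(1) [OF R Q] P]
            B_ell2_add_closed(1) [OF R B_ell2_add_closed(1) [OF Q P]]])
         (simp add: B_ell2_apply add.assoc)
  qed (rule B_ell2_zero_closed B_ell2_add_closed(1); assumption)+
  have md: "module complex_ring (B_ell2 X)"
  proof (rule moduleI [OF cring_complex_ring ab], unfold B_ell2_carrier complex_ring_simps)
    fix a b R Q assume R: "R \<in> bounded_operators X"
    show "a \<odot>\<^bsub>B_ell2 X\<^esub> R \<in> bounded_operators X" by (rule B_ell2_scale_closed(1) [OF R])
    show "1 \<odot>\<^bsub>B_ell2 X\<^esub> R = R"
      by (rule bounded_operators_eqI [OF B_ell2_scale_closed(1) [OF R] R]) (simp add: B_ell2_apply)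
    show "(a + b) \<odot>\<^bsub>B_ell2 X\<^esub> R = a \<odot>\<^bsub>B_ell2 X\<^esub> R \<oplus>\<^bsub>B_ell2 X\<^esub> b \<odot>\<^bsub>B_ell2 X\<^esub> R"
      by (rule bounded_operators_eqI [OF B_ell2_scale_closed(1) [OF R]
            B_ell2_add_closed(1) [OF B_ell2_scale_closed(1) [OF R] B_ell2_scale_closed(1) [OF R]]])
         (simp add: B_ell2_apply algebra_simps)
    show "(a * b) \<odot>\<^bsub>B_ell2 X\<^esub> R = a \<odot>\<^bsub>B_ell2 X\<^esub> (b \<odot>\<^bsub>B_ell2 X\<^esub> R)"
      by (rule bounded_operators_eqI [OF B_ell2_scale_closed(1) [OF R]
            B_ell2_scale_closed(1) [OF B_ell2_scale_closed(1) [OF R]]])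
         (simp add: B_ell2_apply algebra_simps)
    assume Q: "Q \<in> bounded_operators X"
    show "a \<odot>\<^bsub>B_ell2 X\<^esub> (R \<oplus>\<^bsub>B_ell2 X\<^esub> Q) = a \<odot>\<^bsub>B_ell2 X\<^esub> R \<oplus>\<^bsub>B_ell2 X\<^esub> a \<odot>\<^bsub>B_ell2 X\<^esub> Q"
      by (rule bounded_operators_eqI [OF B_ell2_scale_closed(1) [OF B_ell2_add_closed(1) [OF R Q]]
            B_ell2_add_closed(1) [OF B_ell2_scale_closed(1) [OF R] B_ell2_scale_closed(1) [OF Q]]])
         (simp add: B_ell2_apply algebra_simps)
  qed
  show ?thesis
  proof (intro normed_cmodule.intro md normed_cmodule_axioms.intro, unfold B_ell2_carrier)
    fix R Q c assume R: "R \<in> bounded_operators X"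
    show nonneg: "0 \<le> cnorm (B_ell2 X) R" by (rule B_ell2_norm_nonneg [OF R])
    show "cnorm (B_ell2 X) R = 0 \<longleftrightarrow> R = \<zero>\<^bsub>B_ell2 X\<^esub>"
    proof
      assume n0: "cnorm (B_ell2 X) R = 0"
      have "ell2_norm (R \<xi>) = 0" if \<xi>: "\<xi> \<in> ell2 X" for \<xi>
        using B_ell2_norm_bound [OF R \<xi>] ell2_norm_nonneg [of "R \<xi>"] unfolding n0 by linarith
      then have "R \<xi> = (\<lambda>i. 0)" if \<xi>: "\<xi> \<in> ell2 X" for \<xi>
        using ell2_norm_eq_0 [OF bounded_operatorsD(2) [OF R \<xi>]] \<xi> by blast
      then show "R = \<zero>\<^bsub>B_ell2 X\<^esub>"
        by (intro bounded_operators_eqI [OF R B_ell2_zero_closed]) (simp add: B_ell2_apply)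
    next
      assume R0: "R = \<zero>\<^bsub>B_ell2 X\<^esub>"
      have "cnorm (B_ell2 X) R \<le> 0"
        by (rule B_ell2_norm_le) (simp_all add: R0 B_ell2_apply)
      then show "cnorm (B_ell2 X) R = 0" using nonneg by linarith
    qed
    show "cnorm (B_ell2 X) (c \<odot>\<^bsub>B_ell2 X\<^esub> R) = cmod c * cnorm (B_ell2 X) R"
    proof (cases "c = 0")
      case True
      then show ?thesis
        using B_ell2_scale_closed(2) [OF R, of c] B_ell2_norm_nonneg [OF B_ell2_scale_closed(1) [OF R, of c]]
        by simp
    next
      case False
      have "inverse c \<odot>\<^bsub>B_ell2 X\<^esub> (c \<odot>\<^bsub>B_ell2 X\<^esub> R) = R"
        by (rule bounded_operators_eqI [OF B_ell2_scale_closed(1) [OF B_ell2_scale_closed(1) [OF R]] R])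
           (simp add: B_ell2_apply False mult.assoc [symmetric])
      then have "cnorm (B_ell2 X) R \<le> cmod (inverse c) * cnorm (B_ell2 X) (c \<odot>\<^bsub>B_ell2 X\<^esub> R)"
        using B_ell2_scale_closed(2) [OF B_ell2_scale_closed(1) [OF R], of "inverse c" c] by simp
      then have "cmod c * cnorm (B_ell2 X) R \<le> cnorm (B_ell2 X) (c \<odot>\<^bsub>B_ell2 X\<^esub> R)"
        using False by (simp add: norm_inverse norm_divide field_simps)
      then show ?thesis using B_ell2_scale_closed(2) [OF R, of c] by linarith
    qed
    assume Q: "Q \<in> bounded_operators X"
    show "cnorm (B_ell2 X) (R \<oplus>\<^bsub>B_ell2 X\<^esub> Q) \<le> cnorm (B_ell2 X) R + cnorm (B_ell2 X) Q"
      by (rule B_ell2_add_closed(2) [OF R Q])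
  qed
qed

text \<open>The limit of a Cauchy sequence of operators is formed coordinatewise.\<close>

lemma mcomplete_B_ell2: "Metric_space.mcomplete (carrier (B_ell2 X)) (cdist (B_ell2 X))"
proof -
  interpret N: normed_cmodule "B_ell2 X" by (rule normed_cmodule_B_ell2)
  have diff: "(R \<ominus>\<^bsub>B_ell2 X\<^esub> Q) \<xi> = (\<lambda>i. R \<xi> i - Q \<xi> i)"
    if "R \<in> bounded_operators X" "Q \<in> bounded_operators X" "\<xi> \<in> ell2 X" for R Q \<xi>
    using that by (simp add: N.diff_eq B_ell2_apply)
  show ?thesis
    unfolding N.mcomplete_iff
  proof (intro allI impI)
    fix \<sigma> assume \<sigma>: "N.cauchy \<sigma>"
    then have c: "\<sigma> n \<in> bounded_operators X" for n by (simp add: N.cauchy_def)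
    note cD = bounded_operatorsD [OF c]
    have close: "\<exists>N. \<forall>m\<ge>N. \<forall>n\<ge>N. \<forall>\<xi>\<in>ell2 X. ell2_norm (\<lambda>i. \<sigma> m \<xi> i - \<sigma> n \<xi> i) \<le> e * ell2_norm \<xi>"
      if e: "0 < e" for e
    proof -
      obtain N where N: "\<And>m n. \<lbrakk>N \<le> m; N \<le> n\<rbrakk> \<Longrightarrow> cnorm (B_ell2 X) (\<sigma> m \<ominus>\<^bsub>B_ell2 X\<^esub> \<sigma> n) < e"
        using \<sigma> e unfolding N.cauchy_def by blast
      have "ell2_norm (\<lambda>i. \<sigma> m \<xi> i - \<sigma> n \<xi> i) \<le> e * ell2_norm \<xi>"
        if "N \<le> m" "N \<le> n" and \<xi>: "\<xi> \<in> ell2 X" for m n \<xi>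
      proof -
        have mn: "\<sigma> m \<ominus>\<^bsub>B_ell2 X\<^esub> \<sigma> n \<in> bounded_operators X"
          using N.diff_closed [of "\<sigma> m" "\<sigma> n"] c by simp
        have "ell2_norm (\<lambda>i. \<sigma> m \<xi> i - \<sigma> n \<xi> i) \<le> cnorm (B_ell2 X) (\<sigma> m \<ominus>\<^bsub>B_ell2 X\<^esub> \<sigma> n) * ell2_norm \<xi>"
          using B_ell2_norm_bound [OF mn \<xi>] unfolding diff [OF c c \<xi>] .
        also have "\<dots> \<le> e * ell2_norm \<xi>"
          using N [OF that(1,2)] by (intro mult_right_mono) auto
        finally show ?thesis .
      qed
      then show ?thesis by blast
    qed
    define R where "R = (\<lambda>\<xi>\<in>ell2 X. \<lambda>i. lim (\<lambda>n. \<sigma> n \<xi> i))"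
    have lim: "(\<lambda>n. \<sigma> n \<xi> i) \<longlonglongrightarrow> R \<xi> i" if \<xi>: "\<xi> \<in> ell2 X" for \<xi> i
    proof -
      have "Cauchy (\<lambda>n. \<sigma> n \<xi> i)"
      proof (rule CauchyI)
        fix e :: real assume e: "0 < e"
        have e': "0 < e / (ell2_norm \<xi> + 1)" using e by (simp add: add_nonneg_pos)
        obtain N where N: "\<And>m n. \<lbrakk>N \<le> m; N \<le> n\<rbrakk> \<Longrightarrow>
            ell2_norm (\<lambda>i. \<sigma> m \<xi> i - \<sigma> n \<xi> i) \<le> e / (ell2_norm \<xi> + 1) * ell2_norm \<xi>"
          using close [OF e'] \<xi> by blast
        have "e / (ell2_norm \<xi> + 1) * ell2_norm \<xi> < e / (ell2_norm \<xi> + 1) * (ell2_norm \<xi> + 1)"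
          using e' by (intro mult_strict_left_mono) auto
        also have "\<dots> = e" using add_nonneg_pos [OF ell2_norm_nonneg zero_less_one, of \<xi>] by simp
        finally have lt: "e / (ell2_norm \<xi> + 1) * ell2_norm \<xi> < e" .
        have "cmod (\<sigma> m \<xi> i - \<sigma> n \<xi> i) < e" if mn: "N \<le> m" "N \<le> n" for m n
        proof -
          have d: "(\<lambda>i. \<sigma> m \<xi> i - \<sigma> n \<xi> i) \<in> ell2 X" by (rule ell2_diff [OF cD(2) [OF \<xi>] cD(2) [OF \<xi>]])
          show ?thesis using norm_le_ell2_norm [OF d, of i] N [OF mn] lt by linarith
        qed
        then show "\<exists>M. \<forall>m\<ge>M. \<forall>n\<ge>M. cmod (\<sigma> m \<xi> i - \<sigma> n \<xi> i) < e" by blast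
      qed
      then show ?thesis using \<xi> by (simp add: R_def Cauchy_convergent_iff convergent_LIMSEQ_iff)
    qed
    have l2_close: "l2 (\<lambda>i. \<sigma> m \<xi> i - R \<xi> i) F \<le> e * ell2_norm \<xi>"
      if N: "\<And>n. N \<le> n \<Longrightarrow> ell2_norm (\<lambda>i. \<sigma> m \<xi> i - \<sigma> n \<xi> i) \<le> e * ell2_norm \<xi>"
        and \<xi>: "\<xi> \<in> ell2 X" and F: "finite F" for m e \<xi> F N
    proof (rule LIMSEQ_le_const2)
      show "(\<lambda>n. l2 (\<lambda>i. \<sigma> m \<xi> i - \<sigma> n \<xi> i) F) \<longlonglongrightarrow> l2 (\<lambda>i. \<sigma> m \<xi> i - R \<xi> i) F"
        unfolding L2_set_def by (intro tendsto_intros lim [OF \<xi>])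
      have "l2 (\<lambda>i. \<sigma> m \<xi> i - \<sigma> n \<xi> i) F \<le> e * ell2_norm \<xi>" if "N \<le> n" for n
        using l2_le_ell2_norm [OF ell2_diff [OF cD(2) [OF \<xi>] cD(2) [OF \<xi>]] F, of m n] N [OF that] by linarith
      then show "\<exists>N. \<forall>n\<ge>N. l2 (\<lambda>i. \<sigma> m \<xi> i - \<sigma> n \<xi> i) F \<le> e * ell2_norm \<xi>" by blast
    qed
    have R_close: "(\<lambda>i. \<sigma> m \<xi> i - R \<xi> i) \<in> ell2 X \<and> ell2_norm (\<lambda>i. \<sigma> m \<xi> i - R \<xi> i) \<le> e * ell2_norm \<xi>"
      if N: "\<And>n. N \<le> n \<Longrightarrow> ell2_norm (\<lambda>i. \<sigma> m \<xi> i - \<sigma> n \<xi> i) \<le> e * ell2_norm \<xi>"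
        and \<xi>: "\<xi> \<in> ell2 X" for m e \<xi> N
    proof
      show mem: "(\<lambda>i. \<sigma> m \<xi> i - R \<xi> i) \<in> ell2 X"
      proof (rule ell2I [OF _ l2_close [OF N \<xi>]])
        fix i assume i: "i \<notin> X"
        have "\<sigma> n \<xi> i = 0" for n using ell2D [OF cD(2) [OF \<xi>] i] .
        then have "R \<xi> i = 0" using lim [OF \<xi>, of i] by (simp add: LIMSEQ_const_iff)
        then show "\<sigma> m \<xi> i - R \<xi> i = 0" using ell2D [OF cD(2) [OF \<xi>] i] by simp
      qed
      show "ell2_norm (\<lambda>i. \<sigma> m \<xi> i - R \<xi> i) \<le> e * ell2_norm \<xi>"
        using ell2_norm_leI [OF mem l2_close [OF N \<xi>]] .
    qed
    obtain N1 where N1: "\<And>m n \<xi>. \<lbrakk>N1 \<le> m; N1 \<le> n; \<xi> \<in> ell2 X\<rbrakk> \<Longrightarrow>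
        ell2_norm (\<lambda>i. \<sigma> m \<xi> i - \<sigma> n \<xi> i) \<le> 1 * ell2_norm \<xi>"
      using close [of 1] by (meson zero_less_one)
    have R: "R \<in> bounded_operators X"
    proof (rule bounded_operatorsI)
      show "R \<in> extensional (ell2 X)" by (simp add: R_def)
      fix \<xi> \<eta> :: "'a \<Rightarrow> complex" and a assume \<xi>: "\<xi> \<in> ell2 X"
      have 1: "(\<lambda>i. \<sigma> N1 \<xi> i - R \<xi> i) \<in> ell2 X \<and> ell2_norm (\<lambda>i. \<sigma> N1 \<xi> i - R \<xi> i) \<le> 1 * ell2_norm \<xi>"
        by (rule R_close [of N1, OF N1 [OF order_refl _ \<xi>] \<xi>])
      have eq: "R \<xi> = (\<lambda>i. \<sigma> N1 \<xi> i + (-1) * (\<sigma> N1 \<xi> i - R \<xi> i))" by simp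
      show "R \<xi> \<in> ell2 X"
        by (subst eq) (intro ell2_add ell2_scale cD(2) \<xi> conjunct1 [OF 1])
      have "ell2_norm (R \<xi>) \<le> ell2_norm (\<sigma> N1 \<xi>) + ell2_norm (\<lambda>i. (-1) * (\<sigma> N1 \<xi> i - R \<xi> i))"
        by (subst eq) (intro ell2_norm_add [of _ X] ell2_scale cD(2) \<xi> conjunct1 [OF 1])
      also have "\<dots> \<le> cnorm (B_ell2 X) (\<sigma> N1) * ell2_norm \<xi> + 1 * ell2_norm \<xi>"
        unfolding ell2_norm_scale using B_ell2_norm_bound [OF c \<xi>, of N1] 1 by simp
      finally show "ell2_norm (R \<xi>) \<le> (cnorm (B_ell2 X) (\<sigma> N1) + 1) * ell2_norm \<xi>"
        by (simp add: distrib_right)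
      show "R (\<lambda>i. a * \<xi> i) = (\<lambda>i. a * R \<xi> i)"
      proof
        fix i
        have "(\<lambda>n. a * \<sigma> n \<xi> i) \<longlonglongrightarrow> a * R \<xi> i" by (intro tendsto_intros lim \<xi>)
        then have "(\<lambda>n. \<sigma> n (\<lambda>i. a * \<xi> i) i) \<longlonglongrightarrow> a * R \<xi> i" unfolding cD(4) [OF \<xi>] .
        then show "R (\<lambda>i. a * \<xi> i) i = a * R \<xi> i"
          using LIMSEQ_unique [OF lim [OF ell2_scale [OF \<xi>]]] by blast
      qed
      assume \<eta>: "\<eta> \<in> ell2 X"
      show "R (\<lambda>i. \<xi> i + \<eta> i) = (\<lambda>i. R \<xi> i + R \<eta> i)"
      proof
        fix i
        have "(\<lambda>n. \<sigma> n \<xi> i + \<sigma> n \<eta> i) \<longlonglongrightarrow> R \<xi> i + R \<eta> i" by (intro tendsto_intros lim \<xi> \<eta>)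
        then have "(\<lambda>n. \<sigma> n (\<lambda>i. \<xi> i + \<eta> i) i) \<longlonglongrightarrow> R \<xi> i + R \<eta> i" unfolding cD(3) [OF \<xi> \<eta>] .
        then show "R (\<lambda>i. \<xi> i + \<eta> i) i = R \<xi> i + R \<eta> i"
          using LIMSEQ_unique [OF lim [OF ell2_add [OF \<xi> \<eta>]]] by blast
      qed
    qed
    have "N.conv \<sigma> R"
      unfolding N.conv_def B_ell2_carrier
    proof (intro conjI allI c R LIMSEQ_I)
      fix e :: real assume e: "0 < e"
      obtain N where N: "\<And>m n \<xi>. \<lbrakk>N \<le> m; N \<le> n; \<xi> \<in> ell2 X\<rbrakk> \<Longrightarrow>
          ell2_norm (\<lambda>i. \<sigma> m \<xi> i - \<sigma> n \<xi> i) \<le> e / 2 * ell2_norm \<xi>"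
        using close [of "e / 2"] e by (meson half_gt_zero)
      have "norm (cnorm (B_ell2 X) (\<sigma> m \<ominus>\<^bsub>B_ell2 X\<^esub> R) - 0) < e" if m: "N \<le> m" for m
      proof -
        have "cnorm (B_ell2 X) (\<sigma> m \<ominus>\<^bsub>B_ell2 X\<^esub> R) \<le> e / 2"
        proof (rule B_ell2_norm_le)
          fix \<xi> :: "'a \<Rightarrow> complex" assume \<xi>: "\<xi> \<in> ell2 X"
          show "ell2_norm ((\<sigma> m \<ominus>\<^bsub>B_ell2 X\<^esub> R) \<xi>) \<le> e / 2 * ell2_norm \<xi>"
            unfolding diff [OF c R \<xi>] using R_close [OF N [OF m _ \<xi>] \<xi>] by blast
        qed (use e in simp)
        moreover have "0 \<le> cnorm (B_ell2 X) (\<sigma> m \<ominus>\<^bsub>B_ell2 X\<^esub> R)"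
          using N.cnorm_ge_zero [OF N.diff_closed, of "\<sigma> m" R] c R by simp
        ultimately show ?thesis using e by simp
      qed
      then show "\<exists>N. \<forall>n\<ge>N. norm (cnorm (B_ell2 X) (\<sigma> n \<ominus>\<^bsub>B_ell2 X\<^esub> R) - 0) < e" by blast
    qed
    then show "\<exists>R. N.conv \<sigma> R" by blast
  qed
qed

text \<open>The C*-identity is the Cauchy--Schwarz inequality for \<open>R\<close> and its adjoint.\<close>

lemma cstar_algebra_B_ell2: "cstar_algebra (B_ell2 X)"
proof -
  interpret N: normed_cmodule "B_ell2 X" by (rule normed_cmodule_B_ell2)
  let ?B = "B_ell2 X"
  have adj_adj: "adj ?B (adj ?B R) = R" if R: "R \<in> bounded_operators X" for R
    by (rule B_ell2_adj_eqI) (simp add: is_adjoint_def R inner_adj_left)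
  have adj_le: "cnorm ?B (adj ?B R) \<le> cnorm ?B R" if R: "R \<in> bounded_operators X" for R
  proof (cases "cnorm ?B (adj ?B R) = 0")
    case True
    then show ?thesis using B_ell2_norm_nonneg [OF R] by simp
  next
    case False
    note S = B_ell2_adj_closed [OF R]
    have "(cnorm ?B (adj ?B R))\<^sup>2 \<le> cnorm ?B (R \<otimes>\<^bsub>?B\<^esub> adj ?B R)"
      using B_ell2_cstar_le [OF S] unfolding adj_adj [OF R] .
    also have "\<dots> \<le> cnorm ?B R * cnorm ?B (adj ?B R)" by (rule B_ell2_mult_closed(2) [OF R S])
    finally show ?thesis
      using False B_ell2_norm_nonneg [OF S] by (simp add: power2_eq_square mult_le_cancel_right)
  qed
  show ?thesis
  proof (intro cstar_algebra.intro N.module_axioms cstar_algebra_axioms.intro, unfold B_ell2_carrier)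
    fix R Q P c assume R: "R \<in> bounded_operators X"
    note RD = bounded_operatorsD [OF R]
    show "adj ?B R \<in> bounded_operators X" by (rule B_ell2_adj_closed [OF R])
    show "adj ?B (adj ?B R) = R" by (rule adj_adj [OF R])
    show "0 \<le> cnorm ?B R" by (rule B_ell2_norm_nonneg [OF R])
    show "cnorm ?B R = 0 \<longleftrightarrow> R = \<zero>\<^bsub>?B\<^esub>" using N.cnorm_eq_zero [of R] R by simp
    show "cnorm ?B (c \<odot>\<^bsub>?B\<^esub> R) = cmod c * cnorm ?B R" using N.cnorm_scale [of R c] R by simp
    show "adj ?B (c \<odot>\<^bsub>?B\<^esub> R) = cnj c \<odot>\<^bsub>?B\<^esub> adj ?B R"
      by (rule B_ell2_adj_eqI)
         (simp add: is_adjoint_def B_ell2_scale_closed(1) B_ell2_adj_closed R B_ell2_apply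
           inner_scale_left inner_scale_right inner_adj)
    show "cnorm ?B (adj ?B R \<otimes>\<^bsub>?B\<^esub> R) = (cnorm ?B R)\<^sup>2"
    proof (rule antisym)
      have "cnorm ?B (adj ?B R \<otimes>\<^bsub>?B\<^esub> R) \<le> cnorm ?B (adj ?B R) * cnorm ?B R"
        by (rule B_ell2_mult_closed(2) [OF B_ell2_adj_closed [OF R] R])
      also have "\<dots> \<le> cnorm ?B R * cnorm ?B R"
        using adj_le [OF R] B_ell2_norm_nonneg [OF R] by (rule mult_right_mono)
      finally show "cnorm ?B (adj ?B R \<otimes>\<^bsub>?B\<^esub> R) \<le> (cnorm ?B R)\<^sup>2" by (simp add: power2_eq_square)
    qed (rule B_ell2_cstar_le [OF R])
    assume Q: "Q \<in> bounded_operators X"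
    note QD = bounded_operatorsD [OF Q]
    show "R \<otimes>\<^bsub>?B\<^esub> Q \<in> bounded_operators X" by (rule B_ell2_mult_closed(1) [OF R Q])
    show "cnorm ?B (R \<otimes>\<^bsub>?B\<^esub> Q) \<le> cnorm ?B R * cnorm ?B Q" by (rule B_ell2_mult_closed(2) [OF R Q])
    show "cnorm ?B (R \<oplus>\<^bsub>?B\<^esub> Q) \<le> cnorm ?B R + cnorm ?B Q" by (rule B_ell2_add_closed(2) [OF R Q])
    show "(c \<odot>\<^bsub>?B\<^esub> R) \<otimes>\<^bsub>?B\<^esub> Q = c \<odot>\<^bsub>?B\<^esub> (R \<otimes>\<^bsub>?B\<^esub> Q)"
      by (rule bounded_operators_eqI [of _ X])
         (simp_all add: B_ell2_mult_closed(1) B_ell2_scale_closed(1) R Q B_ell2_apply QD(2))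
    show "R \<otimes>\<^bsub>?B\<^esub> (c \<odot>\<^bsub>?B\<^esub> Q) = c \<odot>\<^bsub>?B\<^esub> (R \<otimes>\<^bsub>?B\<^esub> Q)"
      by (rule bounded_operators_eqI [of _ X])
         (simp_all add: B_ell2_mult_closed(1) B_ell2_scale_closed(1) R Q B_ell2_apply QD(2) RD(4))
    show "adj ?B (R \<oplus>\<^bsub>?B\<^esub> Q) = adj ?B R \<oplus>\<^bsub>?B\<^esub> adj ?B Q"
    proof (rule B_ell2_adj_eqI, unfold is_adjoint_def, intro conjI ballI)
      show "adj ?B R \<oplus>\<^bsub>?B\<^esub> adj ?B Q \<in> bounded_operators X"
        by (rule B_ell2_add_closed(1) [OF B_ell2_adj_closed [OF R] B_ell2_adj_closed [OF Q]])
      fix \<xi> \<eta> :: "'a \<Rightarrow> complex" assume \<xi>: "\<xi> \<in> ell2 X" and \<eta>: "\<eta> \<in> ell2 X"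
      show "ell2_inner ((R \<oplus>\<^bsub>?B\<^esub> Q) \<xi>) \<eta> = ell2_inner \<xi> ((adj ?B R \<oplus>\<^bsub>?B\<^esub> adj ?B Q) \<eta>)"
        unfolding B_ell2_apply(2) [OF \<xi>] B_ell2_apply(2) [OF \<eta>]
          inner_add_left [OF RD(2) [OF \<xi>] QD(2) [OF \<xi>] \<eta>]
          inner_add_right [OF bounded_operatorsD(2) [OF B_ell2_adj_closed [OF R] \<eta>]
            bounded_operatorsD(2) [OF B_ell2_adj_closed [OF Q] \<eta>] \<xi>]
          inner_adj [OF R \<xi> \<eta>] inner_adj [OF Q \<xi> \<eta>] ..
    qed
    show "adj ?B (R \<otimes>\<^bsub>?B\<^esub> Q) = adj ?B Q \<otimes>\<^bsub>?B\<^esub> adj ?B R"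
    proof (rule B_ell2_adj_eqI, unfold is_adjoint_def, intro conjI ballI)
      show "adj ?B Q \<otimes>\<^bsub>?B\<^esub> adj ?B R \<in> bounded_operators X"
        by (rule B_ell2_mult_closed(1) [OF B_ell2_adj_closed [OF Q] B_ell2_adj_closed [OF R]])
      fix \<xi> \<eta> :: "'a \<Rightarrow> complex" assume \<xi>: "\<xi> \<in> ell2 X" and \<eta>: "\<eta> \<in> ell2 X"
      show "ell2_inner ((R \<otimes>\<^bsub>?B\<^esub> Q) \<xi>) \<eta> = ell2_inner \<xi> ((adj ?B Q \<otimes>\<^bsub>?B\<^esub> adj ?B R) \<eta>)"
        unfolding B_ell2_apply(1) [OF \<xi>] B_ell2_apply(1) [OF \<eta>] inner_adj [OF R QD(2) [OF \<xi>] \<eta>]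
          inner_adj [OF Q \<xi> bounded_operatorsD(2) [OF B_ell2_adj_closed [OF R] \<eta>]] ..
    qed
    assume P: "P \<in> bounded_operators X"
    note PD = bounded_operatorsD [OF P]
    show "(R \<otimes>\<^bsub>?B\<^esub> Q) \<otimes>\<^bsub>?B\<^esub> P = R \<otimes>\<^bsub>?B\<^esub> (Q \<otimes>\<^bsub>?B\<^esub> P)"
      by (rule bounded_operators_eqI [of _ X])
         (simp_all add: B_ell2_mult_closed(1) R Q P B_ell2_apply PD(2))
    show "(R \<oplus>\<^bsub>?B\<^esub> Q) \<otimes>\<^bsub>?B\<^esub> P = R \<otimes>\<^bsub>?B\<^esub> P \<oplus>\<^bsub>?B\<^esub> Q \<otimes>\<^bsub>?B\<^esub> P"
      by (rule bounded_operators_eqI [of _ X])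
         (simp_all add: B_ell2_mult_closed(1) B_ell2_add_closed(1) R Q P B_ell2_apply PD(2))
    show "R \<otimes>\<^bsub>?B\<^esub> (Q \<oplus>\<^bsub>?B\<^esub> P) = R \<otimes>\<^bsub>?B\<^esub> Q \<oplus>\<^bsub>?B\<^esub> R \<otimes>\<^bsub>?B\<^esub> P"
      by (rule bounded_operators_eqI [of _ X])
         (simp_all add: B_ell2_mult_closed(1) B_ell2_add_closed(1) R Q P B_ell2_apply PD(2) QD(2) RD(3))
  qed (use mcomplete_B_ell2 [of X] in simp)
qed

section \<open>Shifts and Toeplitz operators\<close>

text \<open>All concrete operators below have this form: a scalar times the composition with an injection
  between sets of indices. Both shifts and the generators of the path representations are examples, and
  products and adjoints are computed on the injections.\<close>

definition pinj_op :: "'i set \<Rightarrow> 'i set \<Rightarrow> ('i \<Rightarrow> 'i) \<Rightarrow> complex \<Rightarrow> 'i operator" where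
  "pinj_op X D g w = (\<lambda>\<xi>\<in>ell2 X. \<lambda>y. if y \<in> D then w * \<xi> (g y) else 0)"

lemma pinj_op_apply: "\<xi> \<in> ell2 X \<Longrightarrow> pinj_op X D g w \<xi> = (\<lambda>y. if y \<in> D then w * \<xi> (g y) else 0)"
  by (simp add: pinj_op_def)

lemma l2_pinj_op:
  assumes inj: "inj_on g D" and F: "finite F"
  shows "l2 (\<lambda>y. if y \<in> D then w * \<xi> (g y) else 0) F = cmod w * l2 \<xi> (g ` (F \<inter> D))"
proof -
  have "(\<Sum>y\<in>F. (cmod (if y \<in> D then w * \<xi> (g y) else 0))\<^sup>2) = (\<Sum>y\<in>F \<inter> D. (cmod (w * \<xi> (g y)))\<^sup>2)"
    using F by (intro sum.mono_neutral_cong_right) auto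
  also have "\<dots> = (cmod w)\<^sup>2 * (\<Sum>y\<in>F \<inter> D. (cmod (\<xi> (g y)))\<^sup>2)"
    by (simp add: norm_mult power_mult_distrib sum_distrib_left)
  also have "(\<Sum>y\<in>F \<inter> D. (cmod (\<xi> (g y)))\<^sup>2) = (\<Sum>y\<in>g ` (F \<inter> D). (cmod (\<xi> y))\<^sup>2)"
    using inj by (subst sum.reindex) (auto intro: inj_on_subset)
  finally show ?thesis by (simp add: L2_set_def real_sqrt_mult)
qed

lemma pinj_op_ell2:
  assumes "D \<subseteq> X" "inj_on g D" and \<xi>: "\<xi> \<in> ell2 X"
  shows "pinj_op X D g w \<xi> \<in> ell2 X" "ell2_norm (pinj_op X D g w \<xi>) \<le> cmod w * ell2_norm \<xi>"
proof -
  have le: "l2 (pinj_op X D g w \<xi>) F \<le> cmod w * ell2_norm \<xi>" if F: "finite F" for F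
    unfolding pinj_op_apply [OF \<xi>] l2_pinj_op [OF assms(2) F]
    using l2_le_ell2_norm [OF \<xi>, of "g ` (F \<inter> D)"] F by (intro mult_left_mono) auto
  show mem: "pinj_op X D g w \<xi> \<in> ell2 X"
    by (rule ell2I [OF _ le]) (use assms in \<open>auto simp: pinj_op_apply [OF \<xi>]\<close>)
  show "ell2_norm (pinj_op X D g w \<xi>) \<le> cmod w * ell2_norm \<xi>"
    by (rule ell2_norm_leI [OF mem le])
qed

lemma pinj_op_bounded:
  assumes "D \<subseteq> X" "inj_on g D" shows "pinj_op X D g w \<in> bounded_operators X"
proof (rule bounded_operatorsI [OF _ pinj_op_ell2(1) [OF assms] _ _ pinj_op_ell2(2) [OF assms]])
  show "pinj_op X D g w \<in> extensional (ell2 X)" by (simp add: pinj_op_def)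
  fix \<xi> \<eta> :: "'a \<Rightarrow> complex" and c assume \<xi>: "\<xi> \<in> ell2 X"
  show "pinj_op X D g w (\<lambda>i. c * \<xi> i) = (\<lambda>i. c * pinj_op X D g w \<xi> i)"
    by (auto simp: pinj_op_apply \<xi> ell2_scale)
  assume \<eta>: "\<eta> \<in> ell2 X"
  show "pinj_op X D g w (\<lambda>i. \<xi> i + \<eta> i) = (\<lambda>i. pinj_op X D g w \<xi> i + pinj_op X D g w \<eta> i)"
    by (auto simp: pinj_op_apply \<xi> \<eta> ell2_add distrib_left)
qed

lemma adj_pinj_op:
  assumes D: "D \<subseteq> X" "D' \<subseteq> X" and bij: "bij_betw g D D'" and inv: "\<And>y. y \<in> D \<Longrightarrow> h (g y) = y"
  shows "adj (B_ell2 X) (pinj_op X D g w) = pinj_op X D' h (cnj w)"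
proof (rule B_ell2_adj_eqI, unfold is_adjoint_def, intro conjI ballI)
  have im: "g ` D = D'" and inj: "inj_on g D" using bij by (auto simp: bij_betw_def)
  have "inj_on h D'" unfolding im [symmetric] by (rule inj_onI) (auto simp: inv)
  then show "pinj_op X D' h (cnj w) \<in> bounded_operators X" using D by (intro pinj_op_bounded)
  fix \<xi> \<eta> :: "'a \<Rightarrow> complex" assume \<xi>: "\<xi> \<in> ell2 X" and \<eta>: "\<eta> \<in> ell2 X"
  have "ell2_inner (pinj_op X D g w \<xi>) \<eta> = infsum (\<lambda>y. w * \<xi> (g y) * cnj (\<eta> y)) D"
    unfolding ell2_inner_def pinj_op_apply [OF \<xi>] by (rule infsum_cong_neutral) auto
  also have "\<dots> = infsum ((\<lambda>x. \<xi> x * cnj (cnj w * \<eta> (h x))) \<circ> g) D"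
    by (rule infsum_cong) (simp add: inv)
  also have "\<dots> = infsum (\<lambda>x. \<xi> x * cnj (cnj w * \<eta> (h x))) D'"
    unfolding im [symmetric] by (rule infsum_reindex [OF inj, symmetric])
  also have "\<dots> = ell2_inner \<xi> (pinj_op X D' h (cnj w) \<eta>)"
    unfolding ell2_inner_def pinj_op_apply [OF \<eta>] by (rule infsum_cong_neutral) auto
  finally show "ell2_inner (pinj_op X D g w \<xi>) \<eta> = ell2_inner \<xi> (pinj_op X D' h (cnj w) \<eta>)" .
qed

lemma pinj_op_mult:
  assumes "D \<subseteq> X" "inj_on g D" "D' \<subseteq> X" "inj_on g' D'" "D'' \<subseteq> X" "inj_on g'' D''"
    and "\<And>y. y \<in> D'' \<longleftrightarrow> y \<in> D \<and> g y \<in> D'" "\<And>y. y \<in> D'' \<Longrightarrow> g'' y = g' (g y)" "w'' = w * w'"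
  shows "pinj_op X D g w \<otimes>\<^bsub>B_ell2 X\<^esub> pinj_op X D' g' w' = pinj_op X D'' g'' w''"
proof (rule bounded_operators_eqI)
  fix \<xi> :: "'a \<Rightarrow> complex" assume \<xi>: "\<xi> \<in> ell2 X"
  show "(pinj_op X D g w \<otimes>\<^bsub>B_ell2 X\<^esub> pinj_op X D' g' w') \<xi> = pinj_op X D'' g'' w'' \<xi>"
    unfolding B_ell2_apply(1) [OF \<xi>] pinj_op_apply [OF pinj_op_ell2(1) [OF assms(3,4) \<xi>]]
    unfolding pinj_op_apply [OF \<xi>] using assms(7-9) by auto
qed (intro B_ell2_mult_closed pinj_op_bounded assms)+

section \<open>Infinite paths and maximal tails\<close>

context row_finite_no_sources
begin

lemma in_arcs_verts: "e \<in> in_arcs E v \<Longrightarrow> v \<in> verts E" "e \<in> in_arcs E v \<Longrightarrow> tail E e \<in> verts E"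
  by auto

lemma is_path_verts: "is_path E v \<mu> w \<Longrightarrow> v \<in> verts E" "is_path E v \<mu> w \<Longrightarrow> w \<in> verts E"
proof -
  show "is_path E v \<mu> w \<Longrightarrow> v \<in> verts E" by (cases \<mu>) auto
  show "is_path E v \<mu> w \<Longrightarrow> w \<in> verts E" by (induction \<mu> arbitrary: v) auto
qed

lemma is_path_append:
  "is_path E v (\<mu> @ \<nu>) w \<longleftrightarrow> (\<exists>u. is_path E v \<mu> u \<and> is_path E u \<nu> w)"
proof (induction \<mu> arbitrary: v)
  case Nil
  show ?case using is_path_verts(1) [of v \<nu> w] by auto
qed simp

lemma is_path_nth:
  assumes "is_path E v \<mu> w" "i < length \<mu>"
  shows "\<mu> ! i \<in> arcs E" "tail E (\<mu> ! i) = (if Suc i < length \<mu> then head E (\<mu> ! Suc i) else w)"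
proof -
  have "\<mu> ! i \<in> arcs E \<and> tail E (\<mu> ! i) = (if Suc i < length \<mu> then head E (\<mu> ! Suc i) else w)"
    using assms
  proof (induction \<mu> arbitrary: v i)
    case (Cons e \<mu>)
    show ?case
    proof (cases i)
      case 0
      then show ?thesis using Cons.prems by (cases \<mu>) simp_all
    next
      case (Suc j)
      then show ?thesis using Cons.IH [of "tail E e" j] Cons.prems by simp
    qed
  qed simp
  then show "\<mu> ! i \<in> arcs E" "tail E (\<mu> ! i) = (if Suc i < length \<mu> then head E (\<mu> ! Suc i) else w)"
    by blast+
qed

lemma is_path_hd: "is_path E v \<mu> w \<Longrightarrow> \<mu> \<noteq> [] \<Longrightarrow> head E (\<mu> ! 0) = v"
  by (cases \<mu>) auto

text \<open>Closure under ranges propagates membership from the source of a path to all its vertices.\<close>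

lemma is_path_backward:
  assumes T1: "\<And>e. e \<in> arcs E \<Longrightarrow> tail E e \<in> T \<Longrightarrow> head E e \<in> T"
    and "is_path E v \<mu> w" "w \<in> T"
  shows "v \<in> T \<and> (\<forall>e\<in>set \<mu>. head E e \<in> T)"
  using assms(2)
proof (induction \<mu> arbitrary: v)
  case (Cons e \<mu>)
  then have e: "e \<in> arcs E" "head E e = v" by simp_all
  have "is_path E (tail E e) \<mu> w" using Cons.prems by simp
  then have "tail E e \<in> T \<and> (\<forall>e\<in>set \<mu>. head E e \<in> T)" by (rule Cons.IH)
  then show ?case using T1 [OF e(1)] e(2) by simp
qed (simp add: assms(3))

lemma infinite_pathD:
  "y \<in> infinite_paths E \<Longrightarrow> y i \<in> arcs E" "y \<in> infinite_paths E \<Longrightarrow> tail E (y i) = head E (y (Suc i))"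
  by (simp_all add: infinite_paths_def)

lemma infinite_path_verts: "y \<in> infinite_paths E \<Longrightarrow> head E (y i) \<in> verts E"
  using infinite_pathD(1) [of y i] by (rule head_in_verts)

lemma infinite_path_shift: "y \<in> infinite_paths E \<Longrightarrow> (\<lambda>i. y (i + n)) \<in> infinite_paths E"
  by (simp add: infinite_paths_def)

lemma infinite_path_Cons:
  assumes "y \<in> infinite_paths E" "e \<in> arcs E" "tail E e = head E (y 0)"
  shows "case_nat e y \<in> infinite_paths E"
proof -
  have "case_nat e y i \<in> arcs E \<and> tail E (case_nat e y i) = head E (case_nat e y (Suc i))" for i
    using assms infinite_pathD by (cases i) simp_all
  then show ?thesis unfolding infinite_paths_def by blast
qed

lemma is_path_prefix:
  assumes "y \<in> infinite_paths E" shows "is_path E (head E (y 0)) (map y [0..<n]) (head E (y n))"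
  using assms
proof (induction n arbitrary: y)
  case 0
  then show ?case using infinite_path_verts by simp
next
  case (Suc n)
  have "is_path E (head E (y (Suc 0))) (map (\<lambda>i. y (Suc i)) [0..<n]) (head E (y (Suc n)))"
    using Suc.IH [OF infinite_path_shift [OF Suc.prems, of 1]] by simp
  then show ?case
    using infinite_pathD [OF Suc.prems, of 0] by (simp add: map_upt_Suc del: upt_Suc)
qed

lemma tail_class_infinite: "y \<in> tail_class E x \<Longrightarrow> y \<in> infinite_paths E"
  by (simp add: tail_class_def)

lemma tail_class_refl: "x \<in> infinite_paths E \<Longrightarrow> x \<in> tail_class E x"
  unfolding tail_class_def by blast

lemma tail_class_Cons:
  assumes "y \<in> tail_class E x" "e \<in> arcs E" "tail E e = head E (y 0)"
  shows "case_nat e y \<in> tail_class E x"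
proof -
  obtain m n where "\<forall>i. x (i + m) = y (i + n)" using assms(1) by (auto simp: tail_class_def)
  then have "\<forall>i. x (i + m) = case_nat e y (i + Suc n)" by simp
  then show ?thesis
    using infinite_path_Cons [OF tail_class_infinite [OF assms(1)] assms(2,3)]
    unfolding tail_class_def by blast
qed

lemma tail_class_shift:
  assumes "y \<in> tail_class E x" shows "(\<lambda>i. y (i + k)) \<in> tail_class E x"
proof -
  obtain m n where mn: "\<forall>i. x (i + m) = y (i + n)" using assms by (auto simp: tail_class_def)
  have "\<forall>i. x (i + (k + m)) = y ((i + n) + k)"
    using spec [OF mn, of "i + k" for i] by (simp add: add_ac)
  then show ?thesis
    using infinite_path_shift [OF tail_class_infinite [OF assms]] unfolding tail_class_def by blast
qed

lemma tail_class_common: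
  assumes "y \<in> tail_class E x" "y' \<in> tail_class E x"
  shows "\<exists>m n. \<forall>i. y (i + m) = y' (i + n)"
proof -
  obtain m n where 1: "\<And>i. x (i + m) = y (i + n)" using assms(1) by (auto simp: tail_class_def)
  obtain m' n' where 2: "\<And>i. x (i + m') = y' (i + n')" using assms(2) by (auto simp: tail_class_def)
  have "y (i + (m' + n)) = y' (i + (m + n'))" for i
    using 1 [of "i + m'"] 2 [of "i + m"] by (simp add: add_ac)
  then show ?thesis by blast
qed

lemma tail_class_subset:
  assumes y: "y \<in> tail_class E x" and x: "x \<in> infinite_paths E"
  shows "tail_class E y = tail_class E x"
proof (intro equalityI subsetI)
    fix z assume z: "z \<in> tail_class E y"
    obtain m n where 1: "\<And>i. x (i + m) = y (i + n)" using y by (auto simp: tail_class_def)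
    obtain m' n' where 2: "\<And>i. y (i + m') = z (i + n')" using z by (auto simp: tail_class_def)
    have "x (i + (m' + m)) = z (i + (n + n'))" for i
      using 1 [of "i + m'"] 2 [of "i + n"] by (simp add: add_ac)
    then show "z \<in> tail_class E x" using tail_class_infinite [OF z] unfolding tail_class_def by blast
next
  fix z assume z: "z \<in> tail_class E x"
  show "z \<in> tail_class E y"
    using tail_class_common [OF y z] tail_class_infinite [OF z] unfolding tail_class_def by blast
qed

lemma class_verts_iff: "v \<in> class_verts E x \<longleftrightarrow> (\<exists>y\<in>tail_class E x. head E (y 0) = v)"
  unfolding class_verts_def by blast

lemma class_verts_head: "y \<in> tail_class E x \<Longrightarrow> head E (y i) \<in> class_verts E x"
  unfolding class_verts_iff using tail_class_shift [of y x i] by (intro bexI [of _ "\<lambda>j. y (j + i)"]) simp_all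

lemma tail_class_prepend:
  assumes "is_path E v \<nu> u" "y \<in> tail_class E x" "head E (y 0) = u"
  shows "\<exists>y'\<in>tail_class E x. head E (y' 0) = v"
  using assms
proof (induction \<nu> arbitrary: v)
  case Nil
  then show ?case by auto
next
  case (Cons e \<nu>)
  then obtain y' where y': "y' \<in> tail_class E x" "head E (y' 0) = tail E e" by auto
  then have "case_nat e y' \<in> tail_class E x" using Cons.prems by (intro tail_class_Cons) auto
  then show ?case using Cons.prems by (intro bexI [of _ "case_nat e y'"]) auto
qed

lemma maximal_tailD:
  assumes "maximal_tail E T"
  shows "T \<subseteq> verts E" "T \<noteq> {}" "\<And>e. e \<in> arcs E \<Longrightarrow> tail E e \<in> T \<Longrightarrow> head E e \<in> T"
    "\<And>v. v \<in> T \<Longrightarrow> \<exists>e\<in>in_arcs E v. tail E e \<in> T"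
    "\<And>v w. v \<in> T \<Longrightarrow> w \<in> T \<Longrightarrow> \<exists>\<mu> \<nu>. \<exists>u\<in>T. is_path E v \<mu> u \<and> is_path E w \<nu> u"
  using assms unfolding maximal_tail_def by blast+

lemma maximal_tail_class_verts:
  assumes x: "x \<in> infinite_paths E" shows "maximal_tail E (class_verts E x)"
  unfolding maximal_tail_def
proof (intro conjI ballI impI)
  show "class_verts E x \<subseteq> verts E"
    using infinite_path_verts [OF tail_class_infinite] unfolding class_verts_iff subset_iff by blast
  show "class_verts E x \<noteq> {}"
    using tail_class_refl [OF x] class_verts_head by blast
next
  fix e assume e: "e \<in> arcs E" "tail E e \<in> class_verts E x"
  then obtain y where y: "y \<in> tail_class E x" "head E (y 0) = tail E e" unfolding class_verts_iff by blast
  have "case_nat e y \<in> tail_class E x" using y e by (intro tail_class_Cons) auto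
  then show "head E e \<in> class_verts E x" using class_verts_head [of "case_nat e y" x 0] by simp
next
  fix v assume "v \<in> class_verts E x"
  then obtain y where y: "y \<in> tail_class E x" "head E (y 0) = v" unfolding class_verts_iff by blast
  note p = infinite_pathD [OF tail_class_infinite [OF y(1)], of 0]
  have "y 0 \<in> in_arcs E v" using p(1) y(2) by simp
  moreover have "tail E (y 0) \<in> class_verts E x" using class_verts_head [OF y(1), of 1] p(2) by simp
  ultimately show "\<exists>e\<in>in_arcs E v. tail E e \<in> class_verts E x" by blast
next
  fix v w assume "v \<in> class_verts E x" "w \<in> class_verts E x"
  then obtain y y' where y: "y \<in> tail_class E x" "head E (y 0) = v"
    and y': "y' \<in> tail_class E x" "head E (y' 0) = w" unfolding class_verts_iff by blast
  obtain m n where mn: "\<And>i. y (i + m) = y' (i + n)" using tail_class_common [OF y(1) y'(1)] by blast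
  have "is_path E v (map y [0..<m]) (head E (y m))"
    using is_path_prefix [OF tail_class_infinite [OF y(1)], of m] y(2) by simp
  moreover have "is_path E w (map y' [0..<n]) (head E (y m))"
    using is_path_prefix [OF tail_class_infinite [OF y'(1)], of n] y'(2) mn [of 0] by simp
  ultimately show "\<exists>\<mu> \<nu>. \<exists>u\<in>class_verts E x. is_path E v \<mu> u \<and> is_path E w \<nu> u"
    using class_verts_head [OF y(1)] by blast
qed

text \<open>The vertices of \<open>T\<close> are visited one after the other: the path is extended so that its source is
  reached from the next vertex as well.\<close>

lemma maximal_tail_eq_class_verts:
  assumes T: "maximal_tail E T"
  obtains x where "x \<in> infinite_paths E" "class_verts E x = T"
proof -
  note TD = maximal_tailD [OF T]
  define t where "t = from_nat_into T"
  have "countable T" using countable_subset [OF TD(1) countable_verts] .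
  then have ranget: "range t = T" unfolding t_def using TD(2) by (intro range_from_nat_into)
  have "\<exists>\<mu> u'. u' \<in> T \<and> \<mu> \<noteq> [] \<and> is_path E u \<mu> u' \<and> (\<exists>\<nu>. is_path E (t n) \<nu> u')" if u: "u \<in> T" for u n
  proof -
    have "t n \<in> T" using ranget by blast
    then obtain \<mu> \<nu> w where w: "w \<in> T" "is_path E u \<mu> w" "is_path E (t n) \<nu> w" using TD(5) [OF u] by blast
    obtain e where e: "e \<in> in_arcs E w" "tail E e \<in> T" using TD(4) [OF w(1)] by blast
    have "is_path E w [e] (tail E e)" using e in_arcs_verts(2) [OF e(1)] by simp
    then have "is_path E u (\<mu> @ [e]) (tail E e)" "is_path E (t n) (\<nu> @ [e]) (tail E e)"
      using w unfolding is_path_append by blast+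
    then show ?thesis using e(2) by blast
  qed
  then obtain F G where FG: "\<And>u n. u \<in> T \<Longrightarrow>
      G u n \<in> T \<and> F u n \<noteq> [] \<and> is_path E u (F u n) (G u n) \<and> (\<exists>\<nu>. is_path E (t n) \<nu> (G u n))"
    by metis
  define st where "st = rec_nat ([], t 0) (\<lambda>n (L, u). (L @ F u n, G u n))"
  define L where "L n = fst (st n)" for n
  define v where "v n = snd (st n)" for n
  have st0: "L 0 = []" "v 0 = t 0" by (simp_all add: L_def v_def st_def)
  have stS: "L (Suc n) = L n @ F (v n) n" "v (Suc n) = G (v n) n" for n
    by (simp_all add: L_def v_def st_def case_prod_beta)
  have vT: "v n \<in> T" for n
  proof (induction n)
    case 0
    show ?case using ranget unfolding st0 by blast
  next
    case (Suc n)
    show ?case using FG [OF Suc, of n] unfolding stS by blast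
  qed
  have path: "is_path E (t 0) (L n) (v n)" for n
  proof (induction n)
    case 0
    show ?case using vT [of 0] TD(1) by (auto simp: st0)
  next
    case (Suc n)
    then show ?case using FG [OF vT [of n], of n] unfolding stS is_path_append by blast
  qed
  have len: "length (L n) < length (L (Suc n))" for n
    using FG [OF vT [of n], of n] by (simp add: stS)
  have lenge: "n \<le> length (L n)" for n
  proof (induction n)
    case (Suc n)
    then show ?case using len [of n] by linarith
  qed simp
  have prefix: "L (n + k) ! i = L n ! i" if "i < length (L n)" for n k i
  proof (induction k)
    case (Suc k)
    have "length (L n) \<le> length (L (n + k))"
    proof (induction k)
      case (Suc k)
      then show ?case using len [of "n + k"] by simp
    qed simp
    then show ?case using Suc that by (simp add: stS nth_append)
  qed simp
  define x where "x i = L (Suc i) ! i" for i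
  have x_eq: "L n ! i = x i" if "i < length (L n)" for n i
  proof (cases "n \<le> Suc i")
    case True
    then obtain k where "Suc i = n + k" using le_Suc_ex by blast
    then show ?thesis using prefix [OF that, of k] by (simp add: x_def)
  next
    case False
    then obtain k where k: "n = Suc i + k" using le_Suc_ex [of "Suc i" n] by auto
    have "i < length (L (Suc i))" using lenge [of "Suc i"] by simp
    then show ?thesis using prefix [of i "Suc i" k] by (simp add: x_def k)
  qed
  have "x i \<in> arcs E \<and> tail E (x i) = head E (x (Suc i))" for i
  proof -
    have l: "Suc i < length (L (Suc (Suc i)))" using lenge [of "Suc (Suc i)"] by simp
    then show ?thesis
      using is_path_nth [OF path, of i "Suc (Suc i)"] x_eq [of i "Suc (Suc i)"] x_eq [OF l] by simp
  qed
  then have x: "x \<in> infinite_paths E" unfolding infinite_paths_def by blast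
  have x_len: "head E (x (length (L n))) = v n" for n
  proof -
    have "x (length (L n)) = F (v n) n ! 0"
      using x_eq [OF len [of n]] FG [OF vT [of n], of n] by (simp add: stS nth_append)
    then show ?thesis
      using is_path_hd [of "v n" "F (v n) n" "G (v n) n"] FG [OF vT [of n], of n] by simp
  qed
  have x_T: "head E (x i) \<in> T" for i
  proof -
    have l: "i < length (L (Suc i))" using lenge [of "Suc i"] by simp
    have "L (Suc i) ! i \<in> set (L (Suc i))" using l by (rule nth_mem)
    then show ?thesis using is_path_backward [OF TD(3) path vT] x_eq [OF l] by metis
  qed
  have "class_verts E x = T"
  proof
    show "class_verts E x \<subseteq> T"
    proof
      fix w assume "w \<in> class_verts E x"
      then obtain y where y: "y \<in> tail_class E x" "head E (y 0) = w" unfolding class_verts_iff by blast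
      obtain m n where mn: "\<And>i. x (i + m) = y (i + n)" using y(1) by (auto simp: tail_class_def)
      have "head E (y n) \<in> T" using x_T [of m] mn [of 0] by simp
      then show "w \<in> T"
        using is_path_backward [OF TD(3) is_path_prefix [OF tail_class_infinite [OF y(1)], of n]] y(2) by blast
    qed
    show "T \<subseteq> class_verts E x"
    proof
      fix w assume "w \<in> T"
      then obtain n where n: "w = t n" using ranget by blast
      obtain \<nu> where \<nu>: "is_path E w \<nu> (v (Suc n))" using FG [OF vT [of n], of n] n by (auto simp: stS)
      have "(\<lambda>i. x (i + length (L (Suc n)))) \<in> tail_class E x"
        by (rule tail_class_shift [OF tail_class_refl [OF x]])
      then show "w \<in> class_verts E x"
        unfolding class_verts_iff using tail_class_prepend [OF \<nu>] x_len [of "Suc n"] by simp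
    qed
  qed
  then show thesis using that x by blast
qed

text \<open>Saturation is what allows a path outside \<open>H\<close> to be continued outside \<open>H\<close>.\<close>

lemma infinite_path_avoiding:
  assumes sat: "saturated E H" and v: "v \<in> verts E" "v \<notin> H"
  obtains x where "x \<in> infinite_paths E" "head E (x 0) = v" "\<forall>i. head E (x i) \<notin> H"
proof -
  have "\<exists>e. e \<in> in_arcs E w \<and> tail E e \<notin> H" if "w \<in> verts E" "w \<notin> H" for w
    using sat that unfolding saturated_def by blast
  then obtain f where f: "\<And>w. w \<in> verts E \<Longrightarrow> w \<notin> H \<Longrightarrow> f w \<in> in_arcs E w \<and> tail E (f w) \<notin> H" by metis
  define u where "u = rec_nat v (\<lambda>_ w. tail E (f w))"
  have u: "u 0 = v" "u (Suc n) = tail E (f (u n))" for n by (simp_all add: u_def)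
  have uv: "u n \<in> verts E \<and> u n \<notin> H" for n
  proof (induction n)
    case (Suc n)
    then have "f (u n) \<in> in_arcs E (u n)" "tail E (f (u n)) \<notin> H" using f [of "u n"] by simp_all
    then show ?case using in_arcs_verts(2) unfolding u(2) by blast
  qed (simp add: u v)
  have h: "head E (f (u n)) = u n" "f (u n) \<in> arcs E" for n
    using f [of "u n"] uv [of n] by auto
  have "(\<lambda>n. f (u n)) \<in> infinite_paths E"
    unfolding infinite_paths_def
  proof (intro CollectI allI conjI)
    fix i
    show "f (u i) \<in> arcs E" by (rule h(2))
    show "tail E (f (u i)) = head E (f (u (Suc i)))"
      unfolding h(1) [of "Suc i"] by (rule u(2) [symmetric])
  qed
  moreover have "head E (f (u 0)) = v" using h(1) [of 0] u(1) by (rule trans)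
  moreover have "\<forall>i. head E (f (u i)) \<notin> H"
  proof
    fix i show "head E (f (u i)) \<notin> H" using h(1) [of i] uv [of i] by simp
  qed
  ultimately show thesis by (rule that)
qed

text \<open>A path that enters a hereditary set stays there, so its tail cannot agree with a tail outside.\<close>

lemma class_verts_avoiding:
  assumes her: "hereditary E H" and x: "\<And>i. head E (x i) \<notin> H"
  shows "class_verts E x \<inter> H = {}"
proof -
  have "head E (y 0) \<notin> H" if y: "y \<in> tail_class E x" for y
  proof
    assume y0: "head E (y 0) \<in> H"
    have "head E (y i) \<in> H" for i
    proof (induction i)
      case (Suc i)
      then show ?case
        using her infinite_pathD [OF tail_class_infinite [OF y], of i] unfolding hereditary_def by metis
    qed (rule y0)
    moreover obtain m n where mn: "\<And>i. x (i + m) = y (i + n)" using y by (auto simp: tail_class_def)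
    ultimately show False using x [of m] mn [of 0] by simp
  qed
  then show ?thesis unfolding disjoint_iff class_verts_iff by blast
qed

section \<open>Cycles without entrance\<close>

lemma cycleD:
  assumes "is_cycle E \<mu>"
  shows "\<mu> \<noteq> []" "is_path E (head E (hd \<mu>)) \<mu> (head E (hd \<mu>))" "distinct \<mu>"
  using assms by (auto simp: is_cycle_def distinct_map)

lemma cycle_power_infinite:
  assumes "is_cycle E \<mu>" shows "cycle_power \<mu> \<in> infinite_paths E"
proof -
  note c = cycleD [OF assms]
  have "\<mu> ! (i mod length \<mu>) \<in> arcs E
      \<and> tail E (\<mu> ! (i mod length \<mu>)) = head E (\<mu> ! (Suc i mod length \<mu>))" for i
  proof -
    have l: "i mod length \<mu> < length \<mu>" using c(1) by simp
    show ?thesis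
    proof (cases "Suc (i mod length \<mu>) = length \<mu>")
      case True
      then show ?thesis using is_path_nth [OF c(2) l] c(1) by (simp add: mod_Suc hd_conv_nth)
    next
      case False
      then have "Suc (i mod length \<mu>) < length \<mu>" using l by linarith
      then show ?thesis using is_path_nth [OF c(2) l] False by (simp add: mod_Suc)
    qed
  qed
  then show ?thesis by (simp add: infinite_paths_def cycle_power_def)
qed

lemma cycle_power_0: "\<mu> \<noteq> [] \<Longrightarrow> cycle_power \<mu> 0 = hd \<mu>"
  by (simp add: cycle_power_def hd_conv_nth)

lemma cycle_power_eq_iff:
  assumes "is_cycle E \<mu>"
  shows "cycle_power \<mu> i = cycle_power \<mu> j \<longleftrightarrow> i mod length \<mu> = j mod length \<mu>"
  using cycleD [OF assms] by (simp add: cycle_power_def nth_eq_iff_index_eq)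

text \<open>At each vertex of the cycle there is only one edge to follow inside \<open>T\<close>.\<close>

lemma no_entrance_path_unique:
  assumes \<mu>: "cycle_no_entrance E T \<mu>" and y: "y \<in> infinite_paths E" "\<And>i. head E (y i) \<in> T"
    "head E (y 0) = head E (hd \<mu>)"
  shows "y = cycle_power \<mu>"
proof -
  have cyc: "is_cycle E \<mu>" using \<mu> by (simp add: cycle_no_entrance_def)
  note inf = infinite_pathD [OF cycle_power_infinite [OF cyc]]
  have step: "y i = cycle_power \<mu> i" if "head E (y i) = head E (cycle_power \<mu> i)" for i
  proof -
    have "cycle_power \<mu> i \<in> set \<mu>" using cycleD(1) [OF cyc] by (simp add: cycle_power_def)
    then have "{f \<in> in_arcs E (head E (cycle_power \<mu> i)). tail E f \<in> T} = {cycle_power \<mu> i}"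
      using \<mu> unfolding cycle_no_entrance_def by blast
    moreover have "y i \<in> {f \<in> in_arcs E (head E (cycle_power \<mu> i)). tail E f \<in> T}"
      using that infinite_pathD [OF y(1), of i] y(2) [of "Suc i"] by simp
    ultimately show ?thesis by blast
  qed
  have "head E (y i) = head E (cycle_power \<mu> i)" for i
  proof (induction i)
    case 0
    then show ?case using y(3) cycle_power_0 [OF cycleD(1) [OF cyc]] by simp
  next
    case (Suc i)
    then show ?case using step [OF Suc] infinite_pathD(2) [OF y(1), of i] inf(2) [of i] by simp
  qed
  then show ?thesis using step by blast
qed

lemma no_entrance_class:
  assumes \<mu>: "cycle_no_entrance E (class_verts E x) \<mu>"
  shows "y \<in> tail_class E x \<Longrightarrow> head E (y 0) = head E (hd \<mu>) \<Longrightarrow> y = cycle_power \<mu>"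
    and "cycle_power \<mu> \<in> tail_class E x"
proof -
  show u: "y = cycle_power \<mu>" if "y \<in> tail_class E x" "head E (y 0) = head E (hd \<mu>)" for y
    using no_entrance_path_unique [OF \<mu> tail_class_infinite [OF that(1)] class_verts_head [OF that(1)] that(2)] .
  have "hd \<mu> \<in> set \<mu>" using \<mu> by (simp add: cycle_no_entrance_def is_cycle_def)
  then have "head E (hd \<mu>) \<in> class_verts E x" using \<mu> unfolding cycle_no_entrance_def by blast
  then obtain y where "y \<in> tail_class E x" "head E (y 0) = head E (hd \<mu>)" unfolding class_verts_iff by blast
  then show "cycle_power \<mu> \<in> tail_class E x" using u by blast
qed

lemma no_entrance_length_unique:
  assumes \<mu>: "cycle_no_entrance E (class_verts E x) \<mu>" and \<nu>: "cycle_no_entrance E (class_verts E x) \<nu>"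
  shows "length \<mu> = length \<nu>"
proof -
  have dvd: "length \<alpha> dvd length \<beta>"
    if \<alpha>: "cycle_no_entrance E (class_verts E x) \<alpha>" and \<beta>: "cycle_no_entrance E (class_verts E x) \<beta>" for \<alpha> \<beta>
  proof -
    have c: "is_cycle E \<alpha>" "is_cycle E \<beta>" using \<alpha> \<beta> by (simp_all add: cycle_no_entrance_def)
    obtain a b where ab: "\<And>i. cycle_power \<alpha> (i + a) = cycle_power \<beta> (i + b)"
      using tail_class_common [OF no_entrance_class(2) [OF \<alpha>] no_entrance_class(2) [OF \<beta>]] by blast
    have "cycle_power \<beta> (length \<beta> + b) = cycle_power \<beta> (0 + b)" by (simp add: cycle_power_def)
    then have "cycle_power \<alpha> (length \<beta> + a) = cycle_power \<alpha> (0 + a)"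
      by (simp only: ab [of "length \<beta>"] ab [of 0])
    then have "(length \<beta> + a) mod length \<alpha> = (0 + a) mod length \<alpha>"
      unfolding cycle_power_eq_iff [OF c(1)] .
    then show ?thesis using mod_eq_dvd_iff_nat [of "0 + a" "length \<beta> + a" "length \<alpha>"] by simp
  qed
  show ?thesis using dvd [OF \<mu> \<nu>] dvd [OF \<nu> \<mu>] by (rule dvd_antisym)
qed

lemma Per_no_entrance:
  assumes \<mu>: "cycle_no_entrance E (class_verts E x) \<mu>" shows "Per E (class_verts E x) = length \<mu>"
proof -
  have "cycle_no_entrance E (class_verts E x) (SOME \<mu>. cycle_no_entrance E (class_verts E x) \<mu>)"
    using \<mu> by (rule someI)
  then have "length (SOME \<mu>. cycle_no_entrance E (class_verts E x) \<mu>) = length \<mu>"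
    using \<mu> by (rule no_entrance_length_unique)
  moreover have "cyclic_tail E (class_verts E x)" unfolding cyclic_tail_def using \<mu> by (rule exI)
  ultimately show ?thesis by (simp only: Per_def if_True)
qed

text \<open>Inside a tail disjoint from \<open>H\<close> there are fewer edges than off \<open>H\<close>, so no entrance can appear; the
  edge of the cycle itself survives because every vertex of the tail has a successor in the tail.\<close>

lemma cycles_off_no_entrance:
  assumes T: "maximal_tail E T" and TH: "T \<inter> H = {}" and \<mu>: "\<mu> \<in> cycles_off E H"
    and r: "head E (hd \<mu>) \<in> T"
  shows "cycle_no_entrance E T \<mu>"
proof -
  note TD = maximal_tailD [OF T]
  have \<mu>: "cycle_no_entrance E (verts E - H) \<mu>" using \<mu> by (simp add: cycles_off_def)
  then have c: "is_cycle E \<mu>" by (simp add: cycle_no_entrance_def)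
  have heads: "\<forall>e\<in>set \<mu>. head E e \<in> T"
    using is_path_backward [OF TD(3) cycleD(2) [OF c] r] by blast
  have "{f \<in> in_arcs E (head E e). tail E f \<in> T} = {e}" if e: "e \<in> set \<mu>" for e
  proof -
    have "{f \<in> in_arcs E (head E e). tail E f \<in> verts E - H} = {e}"
      using conjunct2 [OF bspec [OF conjunct2 [OF \<mu> [unfolded cycle_no_entrance_def]] e]] .
    moreover have sub: "f \<in> verts E - H" if "f \<in> T" for f using that TD(1) TH by blast
    ultimately have eq: "f = e" if "f \<in> in_arcs E (head E e)" "tail E f \<in> T" for f
      using that sub [OF that(2)] by blast
    have "head E e \<in> T" using heads e by (rule bspec)
    then obtain f where f: "f \<in> in_arcs E (head E e)" "tail E f \<in> T" using TD(4) [of "head E e"] by blast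
    show ?thesis
    proof (intro equalityI subsetI)
      fix g assume "g \<in> {f \<in> in_arcs E (head E e). tail E f \<in> T}"
      then have "g = e" by (intro eq) simp_all
      then show "g \<in> {e}" by simp
    next
      fix g assume "g \<in> {e}"
      then show "g \<in> {f \<in> in_arcs E (head E e). tail E f \<in> T}" using f eq [OF f] by simp
    qed
  qed
  then show ?thesis using c heads unfolding cycle_no_entrance_def by blast
qed

end

section \<open>The representations on infinite paths\<close>

text \<open>The values on basis vectors are matrix coefficients. They determine the adjoints on basis vectors, and
  these determine the operators.\<close>

lemma bounded_operators_delta_eqI:
  assumes R: "R \<in> bounded_operators X" and S: "S \<in> bounded_operators X"
    and eq: "\<And>i. i \<in> X \<Longrightarrow> R (delta i) = S (delta i)"
  shows "R = S"
proof (rule bounded_operators_eqI [OF R S])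
  have zero: "\<zeta> i = 0" if "\<zeta> \<in> ell2 X" "i \<notin> X" for \<zeta> i
    using that by (simp add: ell2_def)
  have adj: "adj (B_ell2 X) R (delta i) = adj (B_ell2 X) S (delta i)" if i: "i \<in> X" for i
  proof
    fix j
    note d = delta_ell2 [OF i]
    show "adj (B_ell2 X) R (delta i) j = adj (B_ell2 X) S (delta i) j"
    proof (cases "j \<in> X")
      case True
      note dj = delta_ell2 [OF True]
      have "ell2_inner (adj (B_ell2 X) R (delta i)) (delta j) = ell2_inner (adj (B_ell2 X) S (delta i)) (delta j)"
        by (simp only: inner_adj_left [OF R d dj] inner_adj_left [OF S d dj] eq [OF True])
      then show ?thesis by (simp only: inner_delta_right)
    next
      case False
      then show ?thesis
        using zero [OF bounded_operatorsD(2) [OF B_ell2_adj_closed [OF R] d]]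
          zero [OF bounded_operatorsD(2) [OF B_ell2_adj_closed [OF S] d]] by simp
    qed
  qed
  fix \<xi> :: "'a \<Rightarrow> complex" assume \<xi>: "\<xi> \<in> ell2 X"
  show "R \<xi> = S \<xi>"
  proof
    fix i
    show "R \<xi> i = S \<xi> i"
    proof (cases "i \<in> X")
      case True
      note d = delta_ell2 [OF True]
      have "ell2_inner (R \<xi>) (delta i) = ell2_inner (S \<xi>) (delta i)"
        by (simp only: inner_adj [OF R \<xi> d] inner_adj [OF S \<xi> d] adj [OF True])
      then show ?thesis by (simp only: inner_delta_right)
    next
      case False
      then show ?thesis
        using zero [OF bounded_operatorsD(2) [OF R \<xi>]] zero [OF bounded_operatorsD(2) [OF S \<xi>]] by simp
    qed
  qed
qed

text \<open>The representation of a tail-equivalence class twisted by a scalar of modulus one: \<open>Q v\<close> and \<open>V e\<close>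
  are the images of the vertex projections and of the edge isometries.\<close>

locale path_class = row_finite_no_sources E for E :: "('v, 'e) pre_digraph" +
  fixes x :: "nat \<Rightarrow> 'e" and w :: complex
  assumes x: "x \<in> infinite_paths E" and w: "w \<in> circle"
begin

definition X :: "(nat \<Rightarrow> 'e) set" where "X = tail_class E x"

definition Q :: "'v \<Rightarrow> (nat \<Rightarrow> 'e) operator" where
  "Q v = pinj_op X {y \<in> X. head E (y 0) = v} (\<lambda>y. y) 1"

definition V :: "'e \<Rightarrow> (nat \<Rightarrow> 'e) operator" where
  "V e = pinj_op X {y \<in> X. y 0 = e} (\<lambda>y i. y (Suc i)) w"

lemma ww: "w * cnj w = 1" "cnj w * w = 1"
  using w by (simp_all add: complex_norm_square [symmetric] mult.commute [of "cnj w"])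

lemma X_shift:
  assumes "y \<in> X" shows "(\<lambda>i. y (Suc i)) \<in> X" "head E (y (Suc 0)) = tail E (y 0)"
  using tail_class_shift [of y x 1] infinite_pathD(2) [OF tail_class_infinite, of y x 0] assms
  by (simp_all add: X_def)

lemma X_Cons: "\<lbrakk>y \<in> X; e \<in> arcs E; head E (y 0) = tail E e\<rbrakk> \<Longrightarrow> case_nat e y \<in> X"
  unfolding X_def by (rule tail_class_Cons) simp_all

lemma case_nat_shift: "case_nat (y 0) (\<lambda>i. y (Suc i)) = y"
proof
  fix i show "case_nat (y 0) (\<lambda>i. y (Suc i)) i = y i" by (cases i) simp_all
qed

lemma Q_bounded: "Q v \<in> bounded_operators X"
  unfolding Q_def by (rule pinj_op_bounded [OF Collect_subset]) (simp add: inj_on_def)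

lemma inj_shift: "inj_on (\<lambda>y i. y (Suc i)) {y \<in> X. y 0 = e}"
proof (rule inj_onI)
  fix y z assume y: "y \<in> {y \<in> X. y 0 = e}" "z \<in> {y \<in> X. y 0 = e}"
    and eq: "(\<lambda>i. y (Suc i)) = (\<lambda>i. z (Suc i))"
  have "case_nat (y 0) (\<lambda>i. y (Suc i)) = case_nat (z 0) (\<lambda>i. z (Suc i))"
    using y by (simp only: eq) simp
  then show "y = z" by (simp only: case_nat_shift)
qed

lemma V_bounded: "V e \<in> bounded_operators X"
  unfolding V_def by (rule pinj_op_bounded [OF Collect_subset inj_shift])

lemma Q_apply: "\<xi> \<in> ell2 X \<Longrightarrow> Q v \<xi> y = (if y \<in> X \<and> head E (y 0) = v then \<xi> y else 0)"
  by (simp add: Q_def pinj_op_apply)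

lemma V_apply: "\<xi> \<in> ell2 X \<Longrightarrow> V e \<xi> y = (if y \<in> X \<and> y 0 = e then w * \<xi> (\<lambda>i. y (Suc i)) else 0)"
  by (simp add: V_def pinj_op_apply)

lemma adj_V:
  assumes e: "e \<in> arcs E"
  shows "adj (B_ell2 X) (V e) = pinj_op X {y \<in> X. head E (y 0) = tail E e} (case_nat e) (cnj w)"
  unfolding V_def
proof (rule adj_pinj_op [OF Collect_subset Collect_subset])
  show "bij_betw (\<lambda>y i. y (Suc i)) {y \<in> X. y 0 = e} {y \<in> X. head E (y 0) = tail E e}"
  proof (rule bij_betwI [where g = "case_nat e"])
    show "(\<lambda>y i. y (Suc i)) \<in> {y \<in> X. y 0 = e} \<rightarrow> {y \<in> X. head E (y 0) = tail E e}"
    proof (rule Pi_I)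
      fix y assume "y \<in> {y \<in> X. y 0 = e}"
      then show "(\<lambda>i. y (Suc i)) \<in> {y \<in> X. head E (y 0) = tail E e}"
        using X_shift [of y] by simp
    qed
    show "case_nat e \<in> {y \<in> X. head E (y 0) = tail E e} \<rightarrow> {y \<in> X. y 0 = e}"
    proof (rule Pi_I)
      fix y assume "y \<in> {y \<in> X. head E (y 0) = tail E e}"
      then show "case_nat e y \<in> {y \<in> X. y 0 = e}" using X_Cons [of y e] e by simp
    qed
    show "case_nat e (\<lambda>i. y (Suc i)) = y" if "y \<in> {y \<in> X. y 0 = e}" for y
      using that case_nat_shift [of y] by simp
  qed simp
  show "case_nat e (\<lambda>i. y (Suc i)) = y" if "y \<in> {y \<in> X. y 0 = e}" for y
    using that case_nat_shift [of y] by simp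
qed

lemma adj_V_apply:
  "\<lbrakk>e \<in> arcs E; \<xi> \<in> ell2 X\<rbrakk> \<Longrightarrow>
   adj (B_ell2 X) (V e) \<xi> y = (if y \<in> X \<and> head E (y 0) = tail E e then cnj w * \<xi> (case_nat e y) else 0)"
  by (simp add: adj_V pinj_op_apply)

lemma adj_Q: "adj (B_ell2 X) (Q v) = Q v"
proof -
  have "adj (B_ell2 X) (Q v) = pinj_op X {y \<in> X. head E (y 0) = v} (\<lambda>y. y) (cnj 1)"
    unfolding Q_def by (rule adj_pinj_op [OF Collect_subset Collect_subset bij_betw_id [unfolded id_def]]) simp
  then show ?thesis unfolding Q_def by simp
qed

lemma Q_mult: "Q v \<otimes>\<^bsub>B_ell2 X\<^esub> Q v' = (if v = v' then Q v else \<zero>\<^bsub>B_ell2 X\<^esub>)"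
proof (rule bounded_operators_eqI [OF B_ell2_mult_closed(1) [OF Q_bounded Q_bounded]])
  show "(if v = v' then Q v else \<zero>\<^bsub>B_ell2 X\<^esub>) \<in> bounded_operators X"
    using Q_bounded [of v] B_ell2_zero_closed [of X] by (cases "v = v'") simp_all
  fix \<xi> :: "(nat \<Rightarrow> 'e) \<Rightarrow> complex" assume \<xi>: "\<xi> \<in> ell2 X"
  note Q\<xi> = bounded_operatorsD(2) [OF Q_bounded \<xi>]
  show "(Q v \<otimes>\<^bsub>B_ell2 X\<^esub> Q v') \<xi> = (if v = v' then Q v else \<zero>\<^bsub>B_ell2 X\<^esub>) \<xi>"
    by (rule ext) (simp add: B_ell2_apply \<xi> Q_apply Q\<xi>)
qed

lemma V_Q: "V e \<otimes>\<^bsub>B_ell2 X\<^esub> Q (tail E e) = V e"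
proof (rule bounded_operators_eqI [OF B_ell2_mult_closed(1) [OF V_bounded Q_bounded] V_bounded])
  fix \<xi> :: "(nat \<Rightarrow> 'e) \<Rightarrow> complex" assume \<xi>: "\<xi> \<in> ell2 X"
  note Q\<xi> = bounded_operatorsD(2) [OF Q_bounded \<xi>]
  show "(V e \<otimes>\<^bsub>B_ell2 X\<^esub> Q (tail E e)) \<xi> = V e \<xi>"
  proof
    fix y show "(V e \<otimes>\<^bsub>B_ell2 X\<^esub> Q (tail E e)) \<xi> y = V e \<xi> y"
      using X_shift [of y] by (simp add: B_ell2_apply \<xi> Q_apply Q\<xi> V_apply)
  qed
qed

lemma adj_V_V:
  assumes e: "e \<in> arcs E" shows "adj (B_ell2 X) (V e) \<otimes>\<^bsub>B_ell2 X\<^esub> V e = Q (tail E e)"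
proof (rule bounded_operators_eqI [OF B_ell2_mult_closed(1) [OF B_ell2_adj_closed [OF V_bounded] V_bounded] Q_bounded])
  fix \<xi> :: "(nat \<Rightarrow> 'e) \<Rightarrow> complex" assume \<xi>: "\<xi> \<in> ell2 X"
  note V\<xi> = bounded_operatorsD(2) [OF V_bounded \<xi>]
  show "(adj (B_ell2 X) (V e) \<otimes>\<^bsub>B_ell2 X\<^esub> V e) \<xi> = Q (tail E e) \<xi>"
  proof
    fix y show "(adj (B_ell2 X) (V e) \<otimes>\<^bsub>B_ell2 X\<^esub> V e) \<xi> y = Q (tail E e) \<xi> y"
      using X_Cons [OF _ e, of y] ww
      by (simp add: B_ell2_apply \<xi> Q_apply V\<xi> V_apply adj_V_apply e mult.assoc [symmetric])
  qed
qed

lemma V_adj_V_apply: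
  assumes e: "e \<in> arcs E" and \<xi>: "\<xi> \<in> ell2 X"
  shows "(V e \<otimes>\<^bsub>B_ell2 X\<^esub> adj (B_ell2 X) (V e)) \<xi> y = (if y \<in> X \<and> y 0 = e then \<xi> y else 0)"
proof -
  note V\<xi> = bounded_operatorsD(2) [OF B_ell2_adj_closed [OF V_bounded] \<xi>]
  have "case_nat e (\<lambda>i. y (Suc i)) = y" if "y 0 = e"
    using case_nat_shift [of y] that by simp
  then show ?thesis
    using X_shift [of y] ww
    by (simp add: B_ell2_apply \<xi> V\<xi> V_apply adj_V_apply e mult.assoc [symmetric])
qed

text \<open>The range projection of \<open>V e\<close> is the projection onto the paths that begin with \<open>e\<close>. Each path
  with range \<open>v\<close> begins with exactly one edge with range \<open>v\<close>, which is the summation relation.\<close>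

lemma ck_family_path_class: "ck_family E (B_ell2 X) Q V"
proof -
  interpret B: cstar_algebra "B_ell2 X" by (rule cstar_algebra_B_ell2)
  have VV: "V e \<otimes>\<^bsub>B_ell2 X\<^esub> adj (B_ell2 X) (V e) \<in> bounded_operators X" for e
    by (rule B_ell2_mult_closed(1) [OF V_bounded B_ell2_adj_closed [OF V_bounded]])
  have sum: "finsum (B_ell2 X) (\<lambda>e. V e \<otimes>\<^bsub>B_ell2 X\<^esub> adj (B_ell2 X) (V e)) F \<in> bounded_operators X \<and>
      (\<forall>\<xi>\<in>ell2 X. finsum (B_ell2 X) (\<lambda>e. V e \<otimes>\<^bsub>B_ell2 X\<^esub> adj (B_ell2 X) (V e)) F \<xi>
        = (\<lambda>y. if y \<in> X \<and> y 0 \<in> F then \<xi> y else 0))" if "finite F" "F \<subseteq> arcs E" for F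
    using that
  proof (induction F)
    case empty
    show ?case by (simp add: B_ell2_apply B_ell2_zero_closed)
  next
    case (insert e F)
    have e: "e \<in> arcs E" using insert.prems by simp
    have F: "finsum (B_ell2 X) (\<lambda>e. V e \<otimes>\<^bsub>B_ell2 X\<^esub> adj (B_ell2 X) (V e)) F \<in> bounded_operators X"
      and IH: "\<And>\<xi>. \<xi> \<in> ell2 X \<Longrightarrow> finsum (B_ell2 X) (\<lambda>e. V e \<otimes>\<^bsub>B_ell2 X\<^esub> adj (B_ell2 X) (V e)) F \<xi>
        = (\<lambda>y. if y \<in> X \<and> y 0 \<in> F then \<xi> y else 0)"
      using insert.IH insert.prems by simp_all
    have eq: "finsum (B_ell2 X) (\<lambda>e. V e \<otimes>\<^bsub>B_ell2 X\<^esub> adj (B_ell2 X) (V e)) (insert e F)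
      = V e \<otimes>\<^bsub>B_ell2 X\<^esub> adj (B_ell2 X) (V e) \<oplus>\<^bsub>B_ell2 X\<^esub>
        finsum (B_ell2 X) (\<lambda>e. V e \<otimes>\<^bsub>B_ell2 X\<^esub> adj (B_ell2 X) (V e)) F"
      by (rule B.M.finsum_insert [OF insert.hyps]) (simp_all add: VV)
    have "(V e \<otimes>\<^bsub>B_ell2 X\<^esub> adj (B_ell2 X) (V e) \<oplus>\<^bsub>B_ell2 X\<^esub>
        finsum (B_ell2 X) (\<lambda>e. V e \<otimes>\<^bsub>B_ell2 X\<^esub> adj (B_ell2 X) (V e)) F) \<xi> y
      = (if y \<in> X \<and> y 0 \<in> insert e F then \<xi> y else 0)" if \<xi>: "\<xi> \<in> ell2 X" for \<xi> y
      unfolding B_ell2_apply(2) [OF \<xi>] V_adj_V_apply [OF e \<xi>] IH [OF \<xi>]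
      using insert.hyps(2) by auto
    then show ?case unfolding eq using B_ell2_add_closed(1) [OF VV F] by blast
  qed
  have Qsum: "Q v = finsum (B_ell2 X) (\<lambda>e. V e \<otimes>\<^bsub>B_ell2 X\<^esub> adj (B_ell2 X) (V e)) (in_arcs E v)"
    if v: "v \<in> verts E" for v
  proof (rule bounded_operators_eqI [OF Q_bounded])
    have "in_arcs E v \<subseteq> arcs E" by (simp add: subset_iff)
    note s = sum [OF row_finite [OF v] this]
    show "finsum (B_ell2 X) (\<lambda>e. V e \<otimes>\<^bsub>B_ell2 X\<^esub> adj (B_ell2 X) (V e)) (in_arcs E v) \<in> bounded_operators X"
      using s by (rule conjunct1)
    fix \<xi> :: "(nat \<Rightarrow> 'e) \<Rightarrow> complex" assume \<xi>: "\<xi> \<in> ell2 X"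
    have "y 0 \<in> arcs E" if "y \<in> X" for y
      using infinite_pathD(1) [OF tail_class_infinite, of y x 0] that by (simp add: X_def)
    then show "Q v \<xi> = finsum (B_ell2 X) (\<lambda>e. V e \<otimes>\<^bsub>B_ell2 X\<^esub> adj (B_ell2 X) (V e)) (in_arcs E v) \<xi>"
      unfolding bspec [OF conjunct2 [OF s] \<xi>] by (intro ext) (auto simp: Q_apply \<xi>)
  qed
  have VVV: "V e \<otimes>\<^bsub>B_ell2 X\<^esub> adj (B_ell2 X) (V e) \<otimes>\<^bsub>B_ell2 X\<^esub> V e = V e" if e: "e \<in> arcs E" for e
    using B.mult_assoc [of "V e" "adj (B_ell2 X) (V e)" "V e"]
    by (simp add: V_bounded B_ell2_adj_closed adj_V_V e V_Q)
  show ?thesis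
    unfolding ck_family_def
    by (intro conjI ballI impI Qsum VVV adj_V_V adj_Q)
       (simp_all add: Q_bounded V_bounded Q_mult)
qed

lemma Q_delta: "y \<in> X \<Longrightarrow> Q v (delta y) = (if head E (y 0) = v then delta y else (\<lambda>_. 0))"
  by (rule ext) (simp add: Q_apply, simp add: delta_def)

lemma V_delta:
  assumes y: "y \<in> X" and e: "e \<in> arcs E"
  shows "V e (delta y) = (if head E (y 0) = tail E e then (\<lambda>i. w * delta (case_nat e y) i) else (\<lambda>_. 0))"
proof
  fix z
  have 1: "(\<lambda>i. z (Suc i)) = y \<longleftrightarrow> z = case_nat e y" if "z 0 = e"
  proof
    have z: "z = case_nat e (\<lambda>i. z (Suc i))" using case_nat_shift [of z] that by simp
    show "z = case_nat e y" if "(\<lambda>i. z (Suc i)) = y" using z unfolding that .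
    show "(\<lambda>i. z (Suc i)) = y" if "z = case_nat e y" unfolding that by simp
  qed
  have 2: "case_nat e y \<in> X" if "head E (y 0) = tail E e" using X_Cons [OF y e that] .
  have 3: "head E (y 0) = tail E e" if "z \<in> X" "z 0 = e" "(\<lambda>i. z (Suc i)) = y"
    using X_shift(2) [OF that(1)] that(2) fun_cong [OF that(3), of 0] by simp
  have 4: "case_nat e y 0 = e" by simp
  show "V e (delta y) z = (if head E (y 0) = tail E e then (\<lambda>i. w * delta (case_nat e y) i) else (\<lambda>_. 0)) z"
    unfolding V_apply [OF delta_ell2 [OF y]] unfolding delta_def using 1 2 3 4 by (cases "z = case_nat e y") auto
qed

lemma Q_eq_zero_iff: "Q v = \<zero>\<^bsub>B_ell2 X\<^esub> \<longleftrightarrow> v \<notin> class_verts E x"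
proof
  assume Q: "Q v = \<zero>\<^bsub>B_ell2 X\<^esub>"
  show "v \<notin> class_verts E x"
  proof
    assume "v \<in> class_verts E x"
    then obtain y where y: "y \<in> X" "head E (y 0) = v" unfolding class_verts_iff X_def by blast
    have "Q v (delta y) y = 1" using Q_delta [OF y(1), of v] y(2) by (simp add: delta_def)
    moreover have "Q v (delta y) y = 0" unfolding Q B_ell2_apply(4) [OF delta_ell2 [OF y(1)]] ..
    ultimately show False by simp
  qed
next
  assume "v \<notin> class_verts E x"
  then have v: "head E (y 0) \<noteq> v" if "y \<in> X" for y using that unfolding class_verts_iff X_def by blast
  show "Q v = \<zero>\<^bsub>B_ell2 X\<^esub>"
  proof (rule bounded_operators_eqI [OF Q_bounded B_ell2_zero_closed])
    fix \<xi> :: "(nat \<Rightarrow> 'e) \<Rightarrow> complex" assume \<xi>: "\<xi> \<in> ell2 X"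
    show "Q v \<xi> = \<zero>\<^bsub>B_ell2 X\<^esub> \<xi>" unfolding B_ell2_apply(4) [OF \<xi>]
      by (rule ext) (use v in \<open>auto simp: Q_apply \<xi>\<close>)
  qed
qed

text \<open>Existence is the universal property applied to the family on the class. Uniqueness holds because a
  representation with the prescribed action on basis vectors has the prescribed values on the generators.\<close>

lemma path_rep_props:
  fixes A :: "('a, 'm) cstar_scheme"
  assumes G: "graph_cstar_algebra E A p s"
  defines "\<pi> \<equiv> path_rep E A p s x w"
  shows "star_hom A (B_ell2 X) \<pi>" "\<And>v. v \<in> verts E \<Longrightarrow> \<pi> (p v) = Q v" "\<And>e. e \<in> arcs E \<Longrightarrow> \<pi> (s e) = V e"
proof -
  have A: "cstar_algebra A" and ck: "ck_family E A p s"
    and gen: "cstar_generated A (p ` verts E \<union> s ` arcs E) = carrier A"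
    using G by (simp_all add: graph_cstar_algebra_def)
  interpret A: cstar_algebra A by (rule A)
  have pc: "\<And>v. v \<in> verts E \<Longrightarrow> p v \<in> carrier A" and sc: "\<And>e. e \<in> arcs E \<Longrightarrow> s e \<in> carrier A"
    using ck by (simp_all add: ck_family_def)
  define P where "P \<psi> \<longleftrightarrow> \<psi> \<in> extensional (carrier A) \<and>
     star_hom A (B_ell2 X) \<psi> \<and>
     (\<forall>v\<in>verts E. \<forall>y\<in>X. \<psi> (p v) (delta y) = (if head E (y 0) = v then delta y else (\<lambda>_. 0))) \<and>
     (\<forall>e\<in>arcs E. \<forall>y\<in>X. \<psi> (s e) (delta y) =
          (if head E (y 0) = tail E e then (\<lambda>i. w * delta (case_nat e y) i) else (\<lambda>_. 0)))" for \<psi>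
  have \<pi>: "\<pi> = (THE \<psi>. P \<psi>)"
    unfolding \<pi>_def path_rep_def P_def X_def ..
  have PD: "\<psi> \<in> extensional (carrier A)" "star_hom A (B_ell2 X) \<psi>"
    "\<And>v. v \<in> verts E \<Longrightarrow> \<psi> (p v) = Q v" "\<And>e. e \<in> arcs E \<Longrightarrow> \<psi> (s e) = V e" if "P \<psi>" for \<psi>
  proof -
    show "\<psi> \<in> extensional (carrier A)" and hom: "star_hom A (B_ell2 X) \<psi>"
      using that by (simp_all add: P_def)
    have maps: "\<psi> a \<in> bounded_operators X" if "a \<in> carrier A" for a
      using hom that unfolding star_hom_def by (simp add: Pi_iff)
    show "\<psi> (p v) = Q v" if v: "v \<in> verts E" for v
      using \<open>P \<psi>\<close> v by (intro bounded_operators_delta_eqI [OF maps [OF pc [OF v]] Q_bounded]) (simp add: P_def Q_delta)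
    show "\<psi> (s e) = V e" if e: "e \<in> arcs E" for e
      using \<open>P \<psi>\<close> e by (intro bounded_operators_delta_eqI [OF maps [OF sc [OF e]] V_bounded]) (simp add: P_def V_delta)
  qed
  obtain \<phi> where \<phi>: "star_hom A (B_ell2 X) \<phi>" "\<And>v. v \<in> verts E \<Longrightarrow> \<phi> (p v) = Q v"
      "\<And>e. e \<in> arcs E \<Longrightarrow> \<phi> (s e) = V e"
    using G cstar_algebra_B_ell2 [of X] ck_family_path_class unfolding graph_cstar_algebra_def by blast
  have "P (restrict \<phi> (carrier A))"
    unfolding P_def
  proof (intro conjI ballI)
    show "star_hom A (B_ell2 X) (restrict \<phi> (carrier A))"
      using \<phi>(1) by (simp add: star_hom_def Pi_iff A.mult_closed A.adj_closed)
  qed (simp_all add: \<phi>(2,3) pc sc Q_delta V_delta)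
  moreover have "\<psi> = restrict \<phi> (carrier A)" if "P \<psi>" for \<psi>
  proof (rule extensionalityI [OF PD(1) [OF that]])
    fix a assume a: "a \<in> carrier A"
    have "\<psi> a = \<phi> a"
    proof (rule star_homs_agree_on_generated [OF A cstar_algebra_B_ell2 PD(2) [OF that] \<phi>(1)])
      show "a \<in> cstar_generated A (p ` verts E \<union> s ` arcs E)" using a by (simp only: gen)
      show "p ` verts E \<union> s ` arcs E \<subseteq> carrier A" using pc sc by blast
      show "\<psi> b = \<phi> b" if "b \<in> p ` verts E \<union> s ` arcs E" for b
        using that PD(3,4) [OF \<open>P \<psi>\<close>] \<phi>(2,3) by (elim UnE imageE) simp_all
    qed
    then show "\<psi> a = restrict \<phi> (carrier A) a" using a by simp
  qed simp
  ultimately have "P \<pi>" unfolding \<pi> by (rule theI)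
  note PD = PD [OF this]
  show "star_hom A (B_ell2 X) \<pi>" by (rule PD(2))
  show "\<pi> (p v) = Q v" if "v \<in> verts E" for v using that by (rule PD(3))
  show "\<pi> (s e) = V e" if "e \<in> arcs E" for e using that by (rule PD(4))
qed

end

section \<open>Partial isometries of paths\<close>

lemma path_elem_Cons: "\<mu> \<noteq> [] \<Longrightarrow> path_elem A s (e # \<mu>) = s e \<otimes>\<^bsub>A\<^esub> path_elem A s \<mu>"
  by (cases \<mu>) simp_all

locale ck_graph = G: row_finite_no_sources E + cstar_algebra A
  for E :: "('v, 'e) pre_digraph" and A :: "('a, 'm) cstar_scheme" (structure) +
  fixes p :: "'v \<Rightarrow> 'a" and s :: "'e \<Rightarrow> 'a"
  assumes ck: "ck_family E A p s"
begin

lemma p_props: "v \<in> verts E \<Longrightarrow> p v \<in> carrier A" "v \<in> verts E \<Longrightarrow> p v \<otimes> p v = p v"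
    "v \<in> verts E \<Longrightarrow> adj A (p v) = p v"
  and s_closed: "e \<in> arcs E \<Longrightarrow> s e \<in> carrier A"
  and s_adj_s_s: "e \<in> arcs E \<Longrightarrow> s e \<otimes> adj A (s e) \<otimes> s e = s e"
  and adj_s_s: "e \<in> arcs E \<Longrightarrow> adj A (s e) \<otimes> s e = p (tail E e)"
  and p_sum: "v \<in> verts E \<Longrightarrow> p v = finsum A (\<lambda>e. s e \<otimes> adj A (s e)) (in_arcs E v)"
proof -
  note ckD = ck [unfolded ck_family_def]
  note p = bspec [OF conjunct1 [OF ckD]]
    and s = bspec [OF conjunct1 [OF conjunct2 [OF conjunct2 [OF ckD]]]]
    and sum = bspec [OF conjunct2 [OF conjunct2 [OF conjunct2 [OF ckD]]]]
  show "v \<in> verts E \<Longrightarrow> p v \<in> carrier A" by (rule conjunct1 [OF p])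
  show "v \<in> verts E \<Longrightarrow> p v \<otimes> p v = p v" by (rule conjunct1 [OF conjunct2 [OF p]])
  show "v \<in> verts E \<Longrightarrow> adj A (p v) = p v" by (rule conjunct2 [OF conjunct2 [OF p]])
  show "e \<in> arcs E \<Longrightarrow> s e \<in> carrier A" by (rule conjunct1 [OF s])
  show "e \<in> arcs E \<Longrightarrow> s e \<otimes> adj A (s e) \<otimes> s e = s e" by (rule conjunct1 [OF conjunct2 [OF s]])
  show "e \<in> arcs E \<Longrightarrow> adj A (s e) \<otimes> s e = p (tail E e)" by (rule conjunct2 [OF conjunct2 [OF s]])
  show "v \<in> verts E \<Longrightarrow> p v = finsum A (\<lambda>e. s e \<otimes> adj A (s e)) (in_arcs E v)" by (rule sum)
qed

lemma s_p: "e \<in> arcs E \<Longrightarrow> s e \<otimes> p (tail E e) = s e"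
  using s_adj_s_s [of e] mult_assoc [of "s e" "adj A (s e)" "s e"]
  by (simp add: s_closed adj_closed adj_s_s)

text \<open>The range projection of \<open>s e\<close> is a summand of the vertex projection at the range of \<open>e\<close>.\<close>

lemma p_s:
  assumes e: "e \<in> arcs E" shows "p (head E e) \<otimes> s e = s e"
proof -
  define q where "q f = s f \<otimes> adj A (s f)" for f
  have v: "head E e \<in> verts E" using e by (rule G.head_in_verts)
  have q: "q f \<in> carrier A" "adj A (q f) = q f" "q f \<otimes> q f = q f" "q f \<otimes> s f = s f" if f: "f \<in> arcs E" for f
  proof -
    note c = s_closed [OF f] adj_closed [OF s_closed [OF f]]
    show qc: "q f \<in> carrier A" unfolding q_def by (intro mult_closed c)
    show "adj A (q f) = q f" unfolding q_def by (simp only: adj_mult c adj_adj)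
    show qs: "q f \<otimes> s f = s f" unfolding q_def by (rule s_adj_s_s [OF f])
    have "q f \<otimes> q f = q f \<otimes> s f \<otimes> adj A (s f)"
      unfolding q_def [of f] by (rule mult_assoc [symmetric]) (intro mult_closed c)+
    then show "q f \<otimes> q f = q f" unfolding qs unfolding q_def .
  qed
  have "p (head E e) \<otimes> q e = q e"
  proof (rule projection_mult_summand [where F = "in_arcs E (head E e)"])
    show "finite (in_arcs E (head E e))" by (rule G.row_finite [OF v])
    show "p (head E e) = finsum A q (in_arcs E (head E e))"
      unfolding q_def [abs_def] by (rule p_sum [OF v])
  qed (use e in \<open>simp_all add: q p_props v\<close>)
  then have "p (head E e) \<otimes> q e \<otimes> s e = s e" by (simp only: q(4) [OF e])
  then show ?thesis
    unfolding mult_assoc [OF p_props(1) [OF v] q(1) [OF e] s_closed [OF e]] q(4) [OF e] .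
qed

lemma path_elem_props:
  assumes "is_path E v \<mu> u" "\<mu> \<noteq> []"
  shows "path_elem A s \<mu> \<in> carrier A \<and> adj A (path_elem A s \<mu>) \<otimes> path_elem A s \<mu> = p u \<and>
    p v \<otimes> path_elem A s \<mu> = path_elem A s \<mu> \<and> path_elem A s \<mu> \<otimes> p u = path_elem A s \<mu>"
  using assms(2,1)
proof (induction \<mu> arbitrary: v rule: list_nonempty_induct)
  case (single e)
  then have e: "e \<in> arcs E" "head E e = v" "tail E e = u" by simp_all
  then show ?case using s_closed [OF e(1)] adj_s_s [OF e(1)] s_p [OF e(1)] p_s [OF e(1)] by simp
next
  case (cons e \<mu>)
  then have e: "e \<in> arcs E" "head E e = v" and \<mu>: "is_path E (tail E e) \<mu> u" by simp_all
  define m where "m = path_elem A s \<mu>"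
  have m: "m \<in> carrier A" "adj A m \<otimes> m = p u" "p (tail E e) \<otimes> m = m" "m \<otimes> p u = m"
    using cons.IH [OF \<mu>] by (simp_all add: m_def)
  have pu: "p u \<in> carrier A" "p v \<in> carrier A"
    using G.is_path_verts(2) [OF \<mu>] G.head_in_verts [OF e(1)] e(2) by (auto intro: p_props(1))
  note c = s_closed [OF e(1)] adj_closed [OF s_closed [OF e(1)]] m(1) adj_closed [OF m(1)] pu
  have eq: "path_elem A s (e # \<mu>) = s e \<otimes> m" unfolding m_def by (rule path_elem_Cons [OF cons.hyps(1)])
  have sm: "adj A (s e) \<otimes> (s e \<otimes> m) = m"
    using mult_assoc [OF c(2,1,3)] unfolding adj_s_s [OF e(1)] m(3) by (rule sym)
  have "adj A m \<otimes> adj A (s e) \<otimes> (s e \<otimes> m) = adj A m \<otimes> (adj A (s e) \<otimes> (s e \<otimes> m))"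
    by (rule mult_assoc [OF c(4,2) mult_closed [OF c(1,3)]])
  then have 1: "adj A (s e \<otimes> m) \<otimes> (s e \<otimes> m) = p u"
    unfolding sm m(2) adj_mult [OF c(1,3)] .
  have 2: "p v \<otimes> (s e \<otimes> m) = s e \<otimes> m"
    using mult_assoc [OF pu(2) c(1) m(1)] unfolding p_s [OF e(1), unfolded e(2)] by (rule sym)
  have 3: "s e \<otimes> m \<otimes> p u = s e \<otimes> m"
    using mult_assoc [OF c(1) m(1) pu(1)] unfolding m(4) .
  show ?case unfolding eq by (intro conjI 1 2 3 mult_closed c)
qed

text \<open>Along a path without branching each edge isometry has full range.\<close>

lemma path_elem_coisometry:
  assumes "is_path E v \<mu> u" "\<mu> \<noteq> []" "\<And>e. e \<in> set \<mu> \<Longrightarrow> s e \<otimes> adj A (s e) = p (head E e)"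
  shows "path_elem A s \<mu> \<otimes> adj A (path_elem A s \<mu>) = p v"
  using assms(2,1,3)
proof (induction \<mu> arbitrary: v rule: list_nonempty_induct)
  case (single e)
  have "s e \<otimes> adj A (s e) = p (head E e)" by (rule single.prems(2)) simp
  then show ?case using single.prems(1) by simp
next
  case (cons e \<mu>)
  then have e: "e \<in> arcs E" "head E e = v" and \<mu>: "is_path E (tail E e) \<mu> u" by simp_all
  define m where "m = path_elem A s \<mu>"
  have "s f \<otimes> adj A (s f) = p (head E f)" if "f \<in> set \<mu>" for f
    by (rule cons.prems(2)) (simp add: that)
  note IH = cons.IH [OF \<mu> this]
  have m: "m \<in> carrier A" "m \<otimes> adj A m = p (tail E e)"
    unfolding m_def by (rule conjunct1 [OF path_elem_props [OF \<mu> cons.hyps(1)]], rule IH)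
  note c = s_closed [OF e(1)] adj_closed [OF s_closed [OF e(1)]] m(1) adj_closed [OF m(1)]
  have eq: "path_elem A s (e # \<mu>) = s e \<otimes> m" unfolding m_def by (rule path_elem_Cons [OF cons.hyps(1)])
  have "adj A (s e \<otimes> p (tail E e)) = p (tail E e) \<otimes> adj A (s e)"
    unfolding adj_mult [OF c(1) p_props(1) [OF G.tail_in_verts [OF e(1)]]] p_props(3) [OF G.tail_in_verts [OF e(1)]] ..
  then have ps: "p (tail E e) \<otimes> adj A (s e) = adj A (s e)" unfolding s_p [OF e(1)] by (rule sym)
  have mm: "m \<otimes> (adj A m \<otimes> adj A (s e)) = adj A (s e)"
    using mult_assoc [OF c(3,4,2)] unfolding m(2) ps by (rule sym)
  have "s e \<otimes> m \<otimes> (adj A m \<otimes> adj A (s e)) = s e \<otimes> (m \<otimes> (adj A m \<otimes> adj A (s e)))"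
    by (rule mult_assoc [OF c(1,3) mult_closed [OF c(4,2)]])
  then have "s e \<otimes> m \<otimes> adj A (s e \<otimes> m) = s e \<otimes> adj A (s e)"
    unfolding mm adj_mult [OF c(1,3)] .
  moreover have "s e \<otimes> adj A (s e) = p v" using cons.prems(2) [of e] e(2) by simp
  ultimately show ?case unfolding eq by (rule trans)
qed

lemma cycle_corner_isometry:
  assumes "is_cycle E \<mu>" shows "corner_isometry A (path_elem A s \<mu>) (p (head E (hd \<mu>)))"
proof -
  note c = G.cycleD [OF assms]
  note pe = path_elem_props [OF c(2,1)]
  show ?thesis
  proof (rule corner_isometry.intro [OF cstar_algebra_axioms corner_isometry_axioms.intro])
    show "path_elem A s \<mu> \<in> carrier A" by (rule conjunct1 [OF pe])
    show "adj A (path_elem A s \<mu>) \<otimes> path_elem A s \<mu> = p (head E (hd \<mu>))"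
      by (rule conjunct1 [OF conjunct2 [OF pe]])
    show "p (head E (hd \<mu>)) \<otimes> path_elem A s \<mu> = path_elem A s \<mu>"
      by (rule conjunct1 [OF conjunct2 [OF conjunct2 [OF pe]]])
    show "path_elem A s \<mu> \<otimes> p (head E (hd \<mu>)) = path_elem A s \<mu>"
      by (rule conjunct2 [OF conjunct2 [OF conjunct2 [OF pe]]])
  qed
qed

lemma cycle_no_entrance_unitary:
  assumes \<mu>: "cycle_no_entrance E (verts E) \<mu>"
  shows "path_elem A s \<mu> \<otimes> adj A (path_elem A s \<mu>) = p (head E (hd \<mu>))"
proof -
  have cyc: "is_cycle E \<mu>" using \<mu> by (simp add: cycle_no_entrance_def)
  note c = G.cycleD [OF cyc]
  show ?thesis
  proof (rule path_elem_coisometry [OF c(2,1)])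
    fix e assume e: "e \<in> set \<mu>"
    have 1: "{f \<in> in_arcs E (head E e). tail E f \<in> verts E} = {e}"
      and v: "head E e \<in> verts E"
      using bspec [OF conjunct2 [OF \<mu> [unfolded cycle_no_entrance_def]] e] by (rule conjunct2, rule conjunct1)
    have "in_arcs E (head E e) = {e}"
      unfolding 1 [symmetric] using G.in_arcs_verts(2) by blast
    then have eq: "p (head E e) = finsum A (\<lambda>e. s e \<otimes> adj A (s e)) {e}"
      using p_sum [OF v] by simp
    have "e \<in> {f \<in> in_arcs E (head E e). tail E f \<in> verts E}" unfolding 1 by simp
    then have ea: "e \<in> arcs E" by simp
    have c': "s e \<otimes> adj A (s e) \<in> carrier A" by (intro mult_closed adj_closed s_closed ea)
    have "finsum A (\<lambda>e. s e \<otimes> adj A (s e)) {e} = s e \<otimes> adj A (s e)"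
      using M.finsum_insert [of "{}" e "\<lambda>e. s e \<otimes> adj A (s e)"] c' by simp
    then show "s e \<otimes> adj A (s e) = p (head E e)" unfolding eq by (rule sym)
  qed
qed

end

lemma (in row_finite_no_sources) ck_graphI:
  assumes "graph_cstar_algebra E A p s" shows "ck_graph E A p s"
  using assms unfolding graph_cstar_algebra_def
  by (intro ck_graph.intro [OF row_finite_no_sources_axioms _ ck_graph_axioms.intro]) (elim conjE, assumption)+

context path_class
begin

lemma ck_graph_path_class: "ck_graph E (B_ell2 X) Q V"
  by (rule ck_graph.intro [OF row_finite_no_sources_axioms cstar_algebra_B_ell2 ck_graph_axioms.intro [OF ck_family_path_class]])

text \<open>The operator of a path prefixes the path; read on coordinates, it deletes the path from those
  sequences that begin with it.\<close>

lemma path_elem_apply: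
  assumes "is_path E v \<mu> u" "\<mu> \<noteq> []" "\<xi> \<in> ell2 X"
  shows "path_elem (B_ell2 X) V \<mu> \<xi> y
    = (if y \<in> X \<and> (\<forall>i<length \<mu>. y i = \<mu> ! i) then w ^ length \<mu> * \<xi> (\<lambda>i. y (i + length \<mu>)) else 0)"
  using assms(2,1,3)
proof (induction \<mu> arbitrary: v y rule: list_nonempty_induct)
  case (single e)
  then show ?case by (simp add: V_apply)
next
  case (cons e \<mu>)
  have \<mu>: "is_path E (tail E e) \<mu> u" using cons.prems(1) by simp
  have m: "path_elem (B_ell2 X) V \<mu> \<in> bounded_operators X"
    using conjunct1 [OF ck_graph.path_elem_props [OF ck_graph_path_class \<mu> cons.hyps(1)]]
    unfolding B_ell2_carrier .
  note m\<xi> = bounded_operatorsD(2) [OF m cons.prems(2)]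
  have all: "(\<forall>i<length (e # \<mu>). y i = (e # \<mu>) ! i) \<longleftrightarrow> y 0 = e \<and> (\<forall>i<length \<mu>. y (Suc i) = \<mu> ! i)"
    by (auto simp: less_Suc_eq_0_disj)
  show ?case
    unfolding path_elem_Cons [OF cons.hyps(1)] B_ell2_apply(1) [OF cons.prems(2)] V_apply [OF m\<xi>]
      cons.IH [OF \<mu> cons.prems(2)] all
    using X_shift(1) [of y] by auto
qed

lemma path_rep_path_elem:
  assumes G: "graph_cstar_algebra E A p s" and "is_path E v \<mu> u" "\<mu> \<noteq> []"
  shows "path_rep E A p s x w (path_elem A s \<mu>) = path_elem (B_ell2 X) V \<mu>"
  using assms(3,2)
proof (induction \<mu> arbitrary: v rule: list_nonempty_induct)
  case (single e)
  then show ?case using path_rep_props(3) [OF G] by simp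
next
  case (cons e \<mu>)
  note ckA = ck_graphI [OF G]
  have e: "e \<in> arcs E" and \<mu>: "is_path E (tail E e) \<mu> u" using cons.prems by simp_all
  have se: "s e \<in> carrier A" by (rule ck_graph.s_closed [OF ckA e])
  have m: "path_elem A s \<mu> \<in> carrier A"
    by (rule conjunct1 [OF ck_graph.path_elem_props [OF ckA \<mu> cons.hyps(1)]])
  have "path_rep E A p s x w (s e \<otimes>\<^bsub>A\<^esub> path_elem A s \<mu>)
    = path_rep E A p s x w (s e) \<otimes>\<^bsub>B_ell2 X\<^esub> path_rep E A p s x w (path_elem A s \<mu>)"
    using path_rep_props(1) [OF G] se m unfolding star_hom_def by blast
  then show ?case
    unfolding path_elem_Cons [OF cons.hyps(1)] path_rep_props(3) [OF G e] cons.IH [OF \<mu>] .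
qed

text \<open>If the only path of the class that starts at the vertex of the cycle runs around the cycle, then one
  turn does not move it and only multiplies it by the scalar.\<close>

lemma path_rep_cycle:
  assumes G: "graph_cstar_algebra E A p s" and cyc: "is_cycle E \<mu>"
    and uniq: "\<And>y. y \<in> X \<Longrightarrow> head E (y 0) = head E (hd \<mu>) \<Longrightarrow> y = cycle_power \<mu>"
  shows "path_rep E A p s x w (path_elem A s \<mu>) = w ^ length \<mu> \<odot>\<^bsub>B_ell2 X\<^esub> Q (head E (hd \<mu>))"
proof -
  note c = cycleD [OF cyc]
  have m: "path_elem (B_ell2 X) V \<mu> \<in> bounded_operators X"
    using conjunct1 [OF ck_graph.path_elem_props [OF ck_graph_path_class c(2,1)]] unfolding B_ell2_carrier .
  have "path_elem (B_ell2 X) V \<mu> = w ^ length \<mu> \<odot>\<^bsub>B_ell2 X\<^esub> Q (head E (hd \<mu>))"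
  proof (rule bounded_operators_eqI [OF m B_ell2_scale_closed(1) [OF Q_bounded]])
    fix \<xi> :: "(nat \<Rightarrow> 'e) \<Rightarrow> complex" assume \<xi>: "\<xi> \<in> ell2 X"
    show "path_elem (B_ell2 X) V \<mu> \<xi> = (w ^ length \<mu> \<odot>\<^bsub>B_ell2 X\<^esub> Q (head E (hd \<mu>))) \<xi>"
    proof
      fix y
      show "path_elem (B_ell2 X) V \<mu> \<xi> y = (w ^ length \<mu> \<odot>\<^bsub>B_ell2 X\<^esub> Q (head E (hd \<mu>))) \<xi> y"
      proof (cases "y \<in> X \<and> head E (y 0) = head E (hd \<mu>)")
        case True
        then have y: "y = cycle_power \<mu>" by (intro uniq) simp_all
        have "(\<lambda>i. y (i + length \<mu>)) = y" "\<forall>i<length \<mu>. y i = \<mu> ! i"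
          unfolding y by (simp_all add: cycle_power_def)
        then show ?thesis
          unfolding path_elem_apply [OF c(2,1) \<xi>] B_ell2_apply(3) [OF \<xi>] Q_apply [OF \<xi>] using True by simp
      next
        case False
        have "0 < length \<mu>" "\<mu> ! 0 = hd \<mu>" using c(1) by (simp_all add: hd_conv_nth)
        then have "\<not> (y \<in> X \<and> (\<forall>i<length \<mu>. y i = \<mu> ! i))" using False by metis
        then show ?thesis
          unfolding path_elem_apply [OF c(2,1) \<xi>] B_ell2_apply(3) [OF \<xi>] Q_apply [OF \<xi>] using False by auto
      qed
    qed
  qed
  then show ?thesis using path_rep_path_elem [OF G c(2,1)] by (rule trans [rotated])
qed

end

text \<open>Without sources every finite path can be continued forever.\<close>

lemma (in row_finite_no_sources) infinite_path_extending:
  assumes "is_path E v \<nu> u"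
  obtains x where "x \<in> infinite_paths E" "head E (x 0) = v" "\<forall>i<length \<nu>. x i = \<nu> ! i"
proof -
  have "\<exists>x\<in>infinite_paths E. head E (x 0) = v \<and> (\<forall>i<length \<nu>. x i = \<nu> ! i)"
    using assms
  proof (induction \<nu> arbitrary: v)
    case Nil
    then have v: "v \<in> verts E" by auto
    have "saturated E {}"
      unfolding saturated_def using no_sources by force
    then obtain x where "x \<in> infinite_paths E" "head E (x 0) = v"
      by (rule infinite_path_avoiding [OF _ v]) simp_all
    then show ?case by auto
  next
    case (Cons e \<nu>)
    then have e: "e \<in> arcs E" "head E e = v" and \<nu>: "is_path E (tail E e) \<nu> u" by simp_all
    obtain x where x: "x \<in> infinite_paths E" "head E (x 0) = tail E e" "\<forall>i<length \<nu>. x i = \<nu> ! i"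
      using Cons.IH [OF \<nu>] by blast
    have "case_nat e x \<in> infinite_paths E" using x e by (intro infinite_path_Cons) simp_all
    moreover have "\<forall>i<length (e # \<nu>). case_nat e x i = (e # \<nu>) ! i"
      using x(3) by (simp add: less_Suc_eq_0_disj all_conj_distrib) (metis nat.case nth_Cons_0 nth_Cons_Suc)?
    ultimately show ?case using e(2) by (intro bexI [of _ "case_nat e x"] conjI) simp_all
  qed
  then show thesis using that by blast
qed

text \<open>An entrance to the cycle gives an infinite path that starts at the vertex of the cycle but does
  not follow it; on the corresponding basis vector the range projection of the cycle vanishes.\<close>

lemma (in ck_graph) cycle_entrance_proper:
  assumes G: "graph_cstar_algebra E A p s" and cyc: "is_cycle E \<mu>"
    and ent: "\<not> cycle_no_entrance E (verts E) \<mu>"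
  shows "path_elem A s \<mu> \<otimes> adj A (path_elem A s \<mu>) \<noteq> p (head E (hd \<mu>))"
proof
  assume eq: "path_elem A s \<mu> \<otimes> adj A (path_elem A s \<mu>) = p (head E (hd \<mu>))"
  note c = G.cycleD [OF cyc]
  have arcs: "e \<in> arcs E" if "e \<in> set \<mu>" for e
    using G.is_path_nth(1) [OF c(2)] that by (metis in_set_conv_nth)
  obtain e where e: "e \<in> set \<mu>" "{f \<in> in_arcs E (head E e). tail E f \<in> verts E} \<noteq> {e}"
    using ent cyc arcs G.head_in_verts unfolding cycle_no_entrance_def by blast
  have "e \<in> {f \<in> in_arcs E (head E e). tail E f \<in> verts E}" using arcs [OF e(1)] by simp
  then obtain f where f: "f \<in> in_arcs E (head E e)" "f \<noteq> e" using e(2) by blast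
  obtain \<alpha> \<beta> where \<mu>: "\<mu> = \<alpha> @ e # \<beta>" using split_list [OF e(1)] by blast
  have "is_path E (head E (hd \<mu>)) \<alpha> (head E e)"
    using c(2) unfolding \<mu> G.is_path_append by auto
  moreover have "is_path E (head E e) [f] (tail E f)" using f G.in_arcs_verts(2) [OF f(1)] by simp
  ultimately have "is_path E (head E (hd \<mu>)) (\<alpha> @ [f]) (tail E f)"
    unfolding G.is_path_append by blast
  then obtain x where x: "x \<in> infinite_paths E" "head E (x 0) = head E (hd \<mu>)"
      "\<forall>i<length (\<alpha> @ [f]). x i = (\<alpha> @ [f]) ! i"
    by (rule G.infinite_path_extending)
  interpret R: path_class E x 1
    by (rule path_class.intro [OF G.row_finite_no_sources_axioms path_class_axioms.intro [OF x(1)]]) simp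
  have hom: "path_rep E A p s x 1 a \<in> bounded_operators R.X"
    "path_rep E A p s x 1 (a \<otimes> b) = path_rep E A p s x 1 a \<otimes>\<^bsub>B_ell2 R.X\<^esub> path_rep E A p s x 1 b"
    if "a \<in> carrier A" "b \<in> carrier A" for a b
    using R.path_rep_props(1) [OF G] that unfolding star_hom_def Pi_iff B_ell2_carrier by blast+
  let ?\<pi> = "path_rep E A p s x 1" and ?m = "path_elem A s \<mu>"
  have m: "?m \<in> carrier A" using path_elem_props [OF c(2,1)] by blast
  have xX: "x \<in> R.X" unfolding R.X_def by (rule G.tail_class_refl [OF x(1)])
  note d = delta_ell2 [OF xX]
  have v: "head E (hd \<mu>) \<in> verts E" using G.is_path_verts(1) [OF c(2)] .
  have am: "?\<pi> (adj A ?m) \<in> bounded_operators R.X" by (rule hom(1) [OF adj_closed [OF m] m])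
  have "R.Q (head E (hd \<mu>)) = ?\<pi> ?m \<otimes>\<^bsub>B_ell2 R.X\<^esub> ?\<pi> (adj A ?m)"
    using hom(2) [OF m adj_closed [OF m]] R.path_rep_props(2) [OF G v] unfolding eq by (simp only:)
  then have "R.Q (head E (hd \<mu>)) (delta x) x = ?\<pi> ?m (?\<pi> (adj A ?m) (delta x)) x"
    unfolding B_ell2_apply(1) [OF d, symmetric] by (simp only:)
  also have "\<dots> = 0"
  proof -
    have "x (length \<alpha>) = f" "\<mu> ! length \<alpha> = e" "length \<alpha> < length \<mu>"
      using x(3) [rule_format, of "length \<alpha>"] by (simp_all add: \<mu>)
    then have "\<not> (\<forall>i<length \<mu>. x i = \<mu> ! i)" using f(2) by blast
    then show ?thesis
      unfolding R.path_rep_path_elem [OF G c(2,1)] R.path_elem_apply [OF c(2,1) bounded_operatorsD(2) [OF am d]]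
      by auto
  qed
  finally show False using R.Q_delta [OF xX, of "head E (hd \<mu>)"] x(2) by (simp add: delta_def)
qed

section \<open>Continuous functions on the circle\<close>

lemma has_integral_cis:
  fixes m :: int
  shows "((\<lambda>t. cis (of_int m * t)) has_integral (if m = 0 then complex_of_real (2 * pi) else 0)) {0..2 * pi}"
proof (cases "m = 0")
  case True
  then show ?thesis
    using has_integral_const_real [of "1 :: complex" 0 "2 * pi"] by (simp add: scaleR_conv_of_real)
next
  case False
  define F where "F z = exp (\<i> * of_int m * z) / (\<i> * of_int m)" for z :: complex
  have "((\<lambda>t. F (complex_of_real t)) has_vector_derivative cis (of_int m * t)) (at t within {0..2 * pi})" for t
  proof (rule has_vector_derivative_real_field)
    have "(F has_field_derivative exp (\<i> * of_int m * of_real t)) (at (of_real t))"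
      unfolding F_def using False by (auto intro!: derivative_eq_intros)
    then show "(F has_field_derivative cis (of_int m * t)) (at (complex_of_real t))"
      by (simp add: cis_conv_exp mult.assoc)
  qed
  then have "((\<lambda>t. cis (of_int m * t)) has_integral F (complex_of_real (2 * pi)) - F (complex_of_real 0)) {0..2 * pi}"
    by (intro fundamental_theorem_of_calculus) auto
  moreover have "F (complex_of_real (2 * pi)) = F (complex_of_real 0)"
  proof -
    have "exp (\<i> * of_int m * complex_of_real (2 * pi)) = cis (2 * pi * of_int m)"
      by (simp add: cis_conv_exp mult_ac)
    then show ?thesis by (simp add: F_def)
  qed
  ultimately show ?thesis using False by simp
qed

lemma C_circle_simps [simp]:
  "f \<otimes>\<^bsub>C_circle\<^esub> g = (\<lambda>z\<in>circle. f z * g z)"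
  "\<zero>\<^bsub>C_circle\<^esub> = (\<lambda>z\<in>circle. 0)" "f \<oplus>\<^bsub>C_circle\<^esub> g = (\<lambda>z\<in>circle. f z + g z)"
  "c \<odot>\<^bsub>C_circle\<^esub> f = (\<lambda>z\<in>circle. c * f z)" "adj C_circle f = (\<lambda>z\<in>circle. cnj (f z))"
  by (simp_all add: C_circle_def)

lemma carrier_C_circle: "carrier C_circle = {f \<in> extensional circle. continuous_on circle f}"
  by (simp add: C_circle_def)

lemma cnorm_C_circle: "cnorm C_circle f = (SUP z\<in>circle. cmod (f z))"
  by (simp add: C_circle_def)

lemma C_circle_restrict: "continuous_on circle f \<Longrightarrow> restrict f circle \<in> carrier C_circle"
  by (simp add: carrier_C_circle cong: continuous_on_cong_simp)

lemma C_circle_continuous: "f \<in> carrier C_circle \<Longrightarrow> continuous_on circle f"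
  by (simp add: carrier_C_circle)

lemma C_circle_eqI:
  "\<lbrakk>f \<in> carrier C_circle; g \<in> carrier C_circle; \<And>z. z \<in> circle \<Longrightarrow> f z = g z\<rbrakk> \<Longrightarrow> f = g"
  by (rule extensionalityI [of _ circle]) (simp_all add: carrier_C_circle)

lemma C_circle_norm_bound:
  assumes "f \<in> carrier C_circle" "z \<in> circle" shows "cmod (f z) \<le> cnorm C_circle f"
proof -
  have "compact ((\<lambda>z. cmod (f z)) ` circle)"
    using C_circle_continuous [OF assms(1)] by (intro compact_continuous_image continuous_intros) auto
  then have "bdd_above ((\<lambda>z. cmod (f z)) ` circle)"
    by (rule bounded_imp_bdd_above [OF compact_imp_bounded])
  then show ?thesis unfolding cnorm_C_circle using assms(2) by (rule cSUP_upper [rotated])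
qed

lemma C_circle_norm_le:
  assumes "\<And>z. z \<in> circle \<Longrightarrow> cmod (f z) \<le> K" shows "cnorm C_circle f \<le> K"
proof -
  have "circle \<noteq> ({} :: complex set)" by simp
  then show ?thesis unfolding cnorm_C_circle using assms by (rule cSUP_least)
qed

lemma C_circle_ops_closed:
  assumes "f \<in> carrier C_circle" "g \<in> carrier C_circle"
  shows "f \<otimes>\<^bsub>C_circle\<^esub> g \<in> carrier C_circle" "f \<oplus>\<^bsub>C_circle\<^esub> g \<in> carrier C_circle"
    "c \<odot>\<^bsub>C_circle\<^esub> f \<in> carrier C_circle" "adj C_circle f \<in> carrier C_circle"
    "\<zero>\<^bsub>C_circle\<^esub> \<in> carrier C_circle"
proof -
  note c = C_circle_continuous [OF assms(1)] C_circle_continuous [OF assms(2)]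
  show "f \<otimes>\<^bsub>C_circle\<^esub> g \<in> carrier C_circle"
    unfolding C_circle_simps by (intro C_circle_restrict continuous_intros c)
  show "f \<oplus>\<^bsub>C_circle\<^esub> g \<in> carrier C_circle"
    unfolding C_circle_simps by (intro C_circle_restrict continuous_intros c)
  show "c \<odot>\<^bsub>C_circle\<^esub> f \<in> carrier C_circle"
    unfolding C_circle_simps by (intro C_circle_restrict continuous_intros c)
  show "adj C_circle f \<in> carrier C_circle"
    unfolding C_circle_simps by (intro C_circle_restrict continuous_intros c)
  show "\<zero>\<^bsub>C_circle\<^esub> \<in> carrier C_circle"
    unfolding C_circle_simps by (intro C_circle_restrict continuous_intros)
qed

lemma C_circle_zero_closed: "\<zero>\<^bsub>C_circle\<^esub> \<in> carrier C_circle"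
  unfolding C_circle_simps by (intro C_circle_restrict continuous_intros)

lemma normed_cmodule_C_circle: "normed_cmodule C_circle"
proof -
  have ab: "abelian_group C_circle"
  proof (rule abelian_groupI)
    fix f :: "complex \<Rightarrow> complex" assume f: "f \<in> carrier C_circle"
    show "\<exists>g\<in>carrier C_circle. g \<oplus>\<^bsub>C_circle\<^esub> f = \<zero>\<^bsub>C_circle\<^esub>"
    proof (rule bexI)
      show "((-1) \<odot>\<^bsub>C_circle\<^esub> f) \<oplus>\<^bsub>C_circle\<^esub> f = \<zero>\<^bsub>C_circle\<^esub>" by auto
    qed (rule C_circle_ops_closed(3) [OF f f])
    show "\<zero>\<^bsub>C_circle\<^esub> \<oplus>\<^bsub>C_circle\<^esub> f = f"
      by (rule extensionalityI [of _ circle]) (use f in \<open>auto simp: carrier_C_circle\<close>)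
  next
    fix f g k :: "complex \<Rightarrow> complex"
    show "(f \<oplus>\<^bsub>C_circle\<^esub> g) \<oplus>\<^bsub>C_circle\<^esub> k = f \<oplus>\<^bsub>C_circle\<^esub> (g \<oplus>\<^bsub>C_circle\<^esub> k)"
      by (rule extensionalityI [of _ circle]) (auto simp: add.assoc)
    show "f \<oplus>\<^bsub>C_circle\<^esub> g = g \<oplus>\<^bsub>C_circle\<^esub> f"
      by (rule extensionalityI [of _ circle]) (auto simp: add.commute)
  qed (rule C_circle_zero_closed C_circle_ops_closed(2); assumption)+
  have md: "module complex_ring C_circle"
  proof (rule moduleI [OF cring_complex_ring ab])
    fix a b :: complex and f g :: "complex \<Rightarrow> complex"
    assume f: "f \<in> carrier C_circle"
    show "a \<odot>\<^bsub>C_circle\<^esub> f \<in> carrier C_circle" using C_circle_ops_closed(3) [OF f f] .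
    show "\<one>\<^bsub>complex_ring\<^esub> \<odot>\<^bsub>C_circle\<^esub> f = f"
      by (rule extensionalityI [of _ circle]) (use f in \<open>auto simp: carrier_C_circle\<close>)
    show "(a \<oplus>\<^bsub>complex_ring\<^esub> b) \<odot>\<^bsub>C_circle\<^esub> f = a \<odot>\<^bsub>C_circle\<^esub> f \<oplus>\<^bsub>C_circle\<^esub> b \<odot>\<^bsub>C_circle\<^esub> f"
      "(a \<otimes>\<^bsub>complex_ring\<^esub> b) \<odot>\<^bsub>C_circle\<^esub> f = a \<odot>\<^bsub>C_circle\<^esub> (b \<odot>\<^bsub>C_circle\<^esub> f)"
      "a \<odot>\<^bsub>C_circle\<^esub> (f \<oplus>\<^bsub>C_circle\<^esub> g) = a \<odot>\<^bsub>C_circle\<^esub> f \<oplus>\<^bsub>C_circle\<^esub> a \<odot>\<^bsub>C_circle\<^esub> g"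
      by (rule extensionalityI [of _ circle]; auto simp: algebra_simps)+
  qed
  have one: "1 \<in> (circle :: complex set)" by simp
  show ?thesis
  proof (intro normed_cmodule.intro md normed_cmodule_axioms.intro)
    fix f g :: "complex \<Rightarrow> complex" and c :: complex
    assume f: "f \<in> carrier C_circle"
    show nonneg: "0 \<le> cnorm C_circle f"
      using C_circle_norm_bound [OF f one] norm_ge_zero [of "f 1"] by linarith
    show "cnorm C_circle f = 0 \<longleftrightarrow> f = \<zero>\<^bsub>C_circle\<^esub>"
    proof
      assume n0: "cnorm C_circle f = 0"
      have "f z = 0" if "z \<in> circle" for z
        using C_circle_norm_bound [OF f that] n0 by simp
      then show "f = \<zero>\<^bsub>C_circle\<^esub>"
        by (intro C_circle_eqI [OF f C_circle_ops_closed(5) [OF f f]]) simp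
    next
      assume f0: "f = \<zero>\<^bsub>C_circle\<^esub>"
      have "cnorm C_circle f \<le> 0" by (rule C_circle_norm_le) (simp add: f0)
      then show "cnorm C_circle f = 0" using nonneg by linarith
    qed
    have scale_le: "cnorm C_circle (d \<odot>\<^bsub>C_circle\<^esub> k) \<le> cmod d * cnorm C_circle k"
      if "k \<in> carrier C_circle" for d k
      using C_circle_norm_bound [OF that]
      by (intro C_circle_norm_le) (simp add: norm_mult mult_left_mono)
    show "cnorm C_circle (c \<odot>\<^bsub>C_circle\<^esub> f) = cmod c * cnorm C_circle f"
    proof (cases "c = 0")
      case True
      have "cnorm C_circle (c \<odot>\<^bsub>C_circle\<^esub> f) \<le> 0"
        by (rule C_circle_norm_le) (simp add: True)
      moreover have "0 \<le> cnorm C_circle (c \<odot>\<^bsub>C_circle\<^esub> f)"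
        using C_circle_norm_bound [OF C_circle_ops_closed(3) [OF f f] one, of c]
          norm_ge_zero [of "(c \<odot>\<^bsub>C_circle\<^esub> f) 1"] by linarith
      ultimately show ?thesis using True by simp
    next
      case False
      have "inverse c \<odot>\<^bsub>C_circle\<^esub> (c \<odot>\<^bsub>C_circle\<^esub> f) = f"
        by (rule extensionalityI [of _ circle]) (use f False in \<open>auto simp: carrier_C_circle\<close>)
      then have "cnorm C_circle f \<le> cmod (inverse c) * cnorm C_circle (c \<odot>\<^bsub>C_circle\<^esub> f)"
        using scale_le [OF C_circle_ops_closed(3) [OF f f], of "inverse c" c] by simp
      then have "cmod c * cnorm C_circle f \<le> cnorm C_circle (c \<odot>\<^bsub>C_circle\<^esub> f)"
        using False by (simp add: norm_inverse norm_divide field_simps)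
      then show ?thesis using scale_le [OF f, of c] by simp
    qed
    assume g: "g \<in> carrier C_circle"
    show "cnorm C_circle (f \<oplus>\<^bsub>C_circle\<^esub> g) \<le> cnorm C_circle f + cnorm C_circle g"
    proof (rule C_circle_norm_le)
      fix z assume z: "z \<in> circle"
      then show "cmod ((f \<oplus>\<^bsub>C_circle\<^esub> g) z) \<le> cnorm C_circle f + cnorm C_circle g"
        using C_circle_norm_bound [OF f z] C_circle_norm_bound [OF g z] norm_triangle_ineq [of "f z" "g z"]
        by simp
    qed
  qed
qed

lemma cstar_algebra_C_circle: "cstar_algebra C_circle"
proof -
  interpret normed_cmodule C_circle by (rule normed_cmodule_C_circle)
  have diff: "(f \<ominus>\<^bsub>C_circle\<^esub> g) z = f z - g z"
    if "f \<in> carrier C_circle" "g \<in> carrier C_circle" "z \<in> circle" for f g z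
    using that by (simp add: diff_eq)
  have "metric.mcomplete"
    unfolding mcomplete_iff
  proof (intro allI impI)
    fix \<sigma> assume \<sigma>: "cauchy \<sigma>"
    then have c: "\<sigma> n \<in> carrier C_circle" for n by (simp add: cauchy_def)
    have "\<exists>N. \<forall>m n x. N \<le> m \<and> N \<le> n \<and> x \<in> circle \<longrightarrow> dist (\<sigma> m x) (\<sigma> n x) < e"
      if e: "0 < e" for e
    proof -
      obtain N where N: "\<And>m n. \<lbrakk>N \<le> m; N \<le> n\<rbrakk> \<Longrightarrow> cnorm C_circle (\<sigma> m \<ominus>\<^bsub>C_circle\<^esub> \<sigma> n) < e"
        using \<sigma> e unfolding cauchy_def by blast
      have "dist (\<sigma> m x) (\<sigma> n x) < e" if "N \<le> m" "N \<le> n" "x \<in> circle" for m n x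
        using C_circle_norm_bound [OF diff_closed [OF c c] that(3), of m n] N [OF that(1,2)]
          diff [OF c c that(3), of m n] by (simp add: dist_norm)
      then show ?thesis by blast
    qed
    then obtain l where l: "\<And>e. 0 < e \<Longrightarrow> \<exists>N. \<forall>n x. N \<le> n \<and> x \<in> circle \<longrightarrow> dist (\<sigma> n x) (l x) < e"
      using uniformly_convergent_eq_cauchy [of "\<lambda>x. x \<in> circle" \<sigma>] by blast
    then have "uniform_limit circle \<sigma> l sequentially"
      unfolding uniform_limit_iff eventually_sequentially by (meson le_refl)
    then have "continuous_on circle l"
      using C_circle_continuous [OF c] by (intro uniform_limit_theorem) auto
    then have lc: "restrict l circle \<in> carrier C_circle" by (rule C_circle_restrict)
    have "conv \<sigma> (restrict l circle)"
      unfolding conv_def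
    proof (intro conjI allI c lc)
      show "(\<lambda>n. cnorm C_circle (\<sigma> n \<ominus>\<^bsub>C_circle\<^esub> restrict l circle)) \<longlonglongrightarrow> 0"
      proof (rule LIMSEQ_I)
        fix e :: real assume e: "0 < e"
        then obtain N where N: "\<And>n x. N \<le> n \<Longrightarrow> x \<in> circle \<Longrightarrow> dist (\<sigma> n x) (l x) < e / 2"
          using l [of "e / 2"] by auto
        have "norm (cnorm C_circle (\<sigma> n \<ominus>\<^bsub>C_circle\<^esub> restrict l circle) - 0) < e" if n: "N \<le> n" for n
        proof -
          have "cnorm C_circle (\<sigma> n \<ominus>\<^bsub>C_circle\<^esub> restrict l circle) \<le> e / 2"
          proof (rule C_circle_norm_le)
            fix z assume z: "z \<in> circle"
            show "cmod ((\<sigma> n \<ominus>\<^bsub>C_circle\<^esub> restrict l circle) z) \<le> e / 2"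
              using N [OF n z] diff [OF c lc z, of n] z by (simp add: dist_norm)
          qed
          then show ?thesis using e cnorm_ge_zero [OF diff_closed [OF c lc], of n] by simp
        qed
        then show "\<exists>N. \<forall>n\<ge>N. norm (cnorm C_circle (\<sigma> n \<ominus>\<^bsub>C_circle\<^esub> restrict l circle) - 0) < e"
          by blast
      qed
    qed
    then show "\<exists>x. conv \<sigma> x" by blast
  qed
  moreover have "cstar_algebra_axioms C_circle" if cmp: "metric.mcomplete"
  proof
    fix f g k :: "complex \<Rightarrow> complex" and c :: complex
    show "(f \<otimes>\<^bsub>C_circle\<^esub> g) \<otimes>\<^bsub>C_circle\<^esub> k = f \<otimes>\<^bsub>C_circle\<^esub> (g \<otimes>\<^bsub>C_circle\<^esub> k)"
      "(f \<oplus>\<^bsub>C_circle\<^esub> g) \<otimes>\<^bsub>C_circle\<^esub> k = f \<otimes>\<^bsub>C_circle\<^esub> k \<oplus>\<^bsub>C_circle\<^esub> g \<otimes>\<^bsub>C_circle\<^esub> k"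
      "f \<otimes>\<^bsub>C_circle\<^esub> (g \<oplus>\<^bsub>C_circle\<^esub> k) = f \<otimes>\<^bsub>C_circle\<^esub> g \<oplus>\<^bsub>C_circle\<^esub> f \<otimes>\<^bsub>C_circle\<^esub> k"
      "(c \<odot>\<^bsub>C_circle\<^esub> f) \<otimes>\<^bsub>C_circle\<^esub> g = c \<odot>\<^bsub>C_circle\<^esub> (f \<otimes>\<^bsub>C_circle\<^esub> g)"
      "f \<otimes>\<^bsub>C_circle\<^esub> (c \<odot>\<^bsub>C_circle\<^esub> g) = c \<odot>\<^bsub>C_circle\<^esub> (f \<otimes>\<^bsub>C_circle\<^esub> g)"
      "adj C_circle (f \<oplus>\<^bsub>C_circle\<^esub> g) = adj C_circle f \<oplus>\<^bsub>C_circle\<^esub> adj C_circle g"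
      "adj C_circle (c \<odot>\<^bsub>C_circle\<^esub> f) = cnj c \<odot>\<^bsub>C_circle\<^esub> adj C_circle f"
      "adj C_circle (f \<otimes>\<^bsub>C_circle\<^esub> g) = adj C_circle g \<otimes>\<^bsub>C_circle\<^esub> adj C_circle f"
      by (rule extensionalityI [of _ circle]; auto simp: algebra_simps)+
  next
    fix f g :: "complex \<Rightarrow> complex" and c :: complex assume f: "f \<in> carrier C_circle"
    show "adj C_circle f \<in> carrier C_circle" using C_circle_ops_closed(4) [OF f f] .
    show "adj C_circle (adj C_circle f) = f"
      by (rule extensionalityI [of _ circle]) (use f in \<open>auto simp: carrier_C_circle\<close>)
    show "cnorm C_circle (adj C_circle f \<otimes>\<^bsub>C_circle\<^esub> f) = (cnorm C_circle f)\<^sup>2"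
    proof (rule antisym)
      show "cnorm C_circle (adj C_circle f \<otimes>\<^bsub>C_circle\<^esub> f) \<le> (cnorm C_circle f)\<^sup>2"
      proof (rule C_circle_norm_le)
        fix z assume z: "z \<in> circle"
        have "cmod (f z) * cmod (f z) \<le> cnorm C_circle f * cnorm C_circle f"
          using C_circle_norm_bound [OF f z] by (intro mult_mono cnorm_ge_zero f) auto
        then show "cmod ((adj C_circle f \<otimes>\<^bsub>C_circle\<^esub> f) z) \<le> (cnorm C_circle f)\<^sup>2"
          using z by (simp add: norm_mult power2_eq_square)
      qed
      let ?s = "cnorm C_circle (adj C_circle f \<otimes>\<^bsub>C_circle\<^esub> f)"
      have ff: "adj C_circle f \<otimes>\<^bsub>C_circle\<^esub> f \<in> carrier C_circle"
        using C_circle_ops_closed(1) [OF C_circle_ops_closed(4) [OF f f] f] .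
      have "cnorm C_circle f \<le> sqrt ?s"
      proof (rule C_circle_norm_le)
        fix z assume z: "z \<in> circle"
        have "(cmod (f z))\<^sup>2 \<le> ?s"
          using C_circle_norm_bound [OF ff z] z by (simp add: norm_mult power2_eq_square)
        then show "cmod (f z) \<le> sqrt ?s" by (rule real_le_rsqrt)
      qed
      then show "(cnorm C_circle f)\<^sup>2 \<le> ?s"
        using cnorm_ge_zero [OF f] cnorm_ge_zero [OF ff] by (simp add: sqrt_ge_absD)
    qed
    assume g: "g \<in> carrier C_circle"
    show "f \<otimes>\<^bsub>C_circle\<^esub> g \<in> carrier C_circle" using C_circle_ops_closed(1) [OF f g] .
    show "cnorm C_circle (f \<otimes>\<^bsub>C_circle\<^esub> g) \<le> cnorm C_circle f * cnorm C_circle g"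
    proof (rule C_circle_norm_le)
      fix z assume z: "z \<in> circle"
      have "cmod (f z) * cmod (g z) \<le> cnorm C_circle f * cnorm C_circle g"
        using C_circle_norm_bound [OF f z] C_circle_norm_bound [OF g z]
        by (intro mult_mono cnorm_ge_zero f) auto
      then show "cmod ((f \<otimes>\<^bsub>C_circle\<^esub> g) z) \<le> cnorm C_circle f * cnorm C_circle g"
        using z by (simp add: norm_mult)
    qed
  qed (use cmp cnorm_ge_zero cnorm_eq_zero cnorm_triangle cnorm_scale in blast)+
  ultimately show ?thesis using cstar_algebra.intro [OF module_axioms] by blast
qed

interpretation C_circle: cstar_algebra C_circle
  by (rule cstar_algebra_C_circle)

definition circle_id :: "complex \<Rightarrow> complex" where "circle_id = (\<lambda>z\<in>circle. z)"

lemma circle_id_closed [simp, intro]: "circle_id \<in> carrier C_circle"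
  unfolding circle_id_def by (intro C_circle_restrict continuous_intros)

lemma circle_mult_cnj [simp]: "z \<in> circle \<Longrightarrow> z * cnj z = 1" "z \<in> circle \<Longrightarrow> cnj z * z = 1"
  by (simp_all add: complex_norm_square [symmetric] mult.commute [of "cnj z"])

text \<open>Stone--Weierstrass: real polynomials in the coordinates are combinations of \<open>z\<close> and \<open>cnj z\<close>.\<close>

lemma C_circle_generated: 
  assumes Y: "cstar_subalgebra C_circle Y" "circle_id \<in> Y" shows "carrier C_circle \<subseteq> Y"
proof
  have ops: "\<And>f g. \<lbrakk>f \<in> Y; g \<in> Y\<rbrakk> \<Longrightarrow> f \<oplus>\<^bsub>C_circle\<^esub> g \<in> Y" "\<And>c f. f \<in> Y \<Longrightarrow> c \<odot>\<^bsub>C_circle\<^esub> f \<in> Y"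
      "\<And>f g. \<lbrakk>f \<in> Y; g \<in> Y\<rbrakk> \<Longrightarrow> f \<otimes>\<^bsub>C_circle\<^esub> g \<in> Y" "\<And>f. f \<in> Y \<Longrightarrow> adj C_circle f \<in> Y"
    and cl: "norm_closed C_circle Y" and sub: "Y \<subseteq> carrier C_circle"
    using Y(1) unfolding cstar_subalgebra_def linear_subspace_def by blast+
  have poly: "(\<lambda>z\<in>circle. complex_of_real (p z)) \<in> Y" if "real_polynomial_function p"
    for p :: "complex \<Rightarrow> real"
    using that
  proof induction
    case (linear p)
    define a where "a = complex_of_real (p 1) / 2 + complex_of_real (p \<i>) / (2 * \<i>)"
    define b where "b = complex_of_real (p 1) / 2 - complex_of_real (p \<i>) / (2 * \<i>)"
    have "complex_of_real (p z) = a * z + b * cnj z" for z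
    proof -
      interpret bounded_linear p by fact
      have "z = Re z *\<^sub>R 1 + Im z *\<^sub>R \<i>" by (simp add: complex_eq_iff)
      then have "p z = Re z * p 1 + Im z * p \<i>"
        by (metis add scaleR real_scaleR_def)
      then show ?thesis
        by (simp add: complex_eq_iff a_def b_def Re_divide Im_divide algebra_simps)
    qed
    then have "(\<lambda>z\<in>circle. complex_of_real (p z)) = a \<odot>\<^bsub>C_circle\<^esub> circle_id \<oplus>\<^bsub>C_circle\<^esub> b \<odot>\<^bsub>C_circle\<^esub> adj C_circle circle_id"
      by (auto simp: circle_id_def)
    then show ?case using ops Y(2) by metis
  next
    case (const c)
    have "(\<lambda>z\<in>circle. complex_of_real c) = complex_of_real c \<odot>\<^bsub>C_circle\<^esub> (circle_id \<otimes>\<^bsub>C_circle\<^esub> adj C_circle circle_id)"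
      by (rule extensionalityI [of _ circle]) (auto simp: circle_id_def circle_mult_cnj simp del: mem_sphere)
    then show ?case using ops Y(2) by metis
  next
    case (add p q)
    have "(\<lambda>z\<in>circle. complex_of_real (p z + q z))
        = (\<lambda>z\<in>circle. complex_of_real (p z)) \<oplus>\<^bsub>C_circle\<^esub> (\<lambda>z\<in>circle. complex_of_real (q z))"
      by auto
    then show ?case using ops(1) add by metis
  next
    case (mult p q)
    have "(\<lambda>z\<in>circle. complex_of_real (p z * q z))
        = (\<lambda>z\<in>circle. complex_of_real (p z)) \<otimes>\<^bsub>C_circle\<^esub> (\<lambda>z\<in>circle. complex_of_real (q z))"
      by auto
    then show ?case using ops(3) mult by metis
  qed
  fix f assume f: "f \<in> carrier C_circle"
  have "\<exists>g\<in>Y. cnorm C_circle (g \<ominus>\<^bsub>C_circle\<^esub> f) \<le> inverse (real (Suc n))" for n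
  proof -
    define e where "e = inverse (real (Suc n))"
    have e: "0 < e / 2" by (simp add: e_def)
    have cont: "continuous_on circle (\<lambda>z. Re (f z))" "continuous_on circle (\<lambda>z. Im (f z))"
      using C_circle_continuous [OF f] by (intro continuous_intros; assumption)+
    obtain p where p: "real_polynomial_function p" "\<And>z. z \<in> circle \<Longrightarrow> \<bar>Re (f z) - p z\<bar> < e / 2"
      using Stone_Weierstrass_real_polynomial_function [OF compact_sphere cont(1) e] by metis
    obtain q where q: "real_polynomial_function q" "\<And>z. z \<in> circle \<Longrightarrow> \<bar>Im (f z) - q z\<bar> < e / 2"
      using Stone_Weierstrass_real_polynomial_function [OF compact_sphere cont(2) e] by metis
    define g where "g = (\<lambda>z\<in>circle. complex_of_real (p z)) \<oplus>\<^bsub>C_circle\<^esub> \<i> \<odot>\<^bsub>C_circle\<^esub> (\<lambda>z\<in>circle. complex_of_real (q z))"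
    have gY: "g \<in> Y" unfolding g_def by (intro ops poly p q)
    have "cnorm C_circle (g \<ominus>\<^bsub>C_circle\<^esub> f) \<le> e"
    proof (rule C_circle_norm_le)
      fix z assume z: "z \<in> circle"
      have "cmod (g z - f z) \<le> \<bar>Re (g z - f z)\<bar> + \<bar>Im (g z - f z)\<bar>" by (rule cmod_le)
      also have "\<dots> \<le> e"
        using p(2) [OF z] q(2) [OF z] z by (simp add: g_def abs_minus_commute)
      finally show "cmod ((g \<ominus>\<^bsub>C_circle\<^esub> f) z) \<le> e"
        using gY sub f z by (simp add: C_circle.diff_eq subset_iff)
    qed
    then show ?thesis using gY unfolding e_def by blast
  qed
  then obtain \<sigma> where \<sigma>: "\<And>n. \<sigma> n \<in> Y" "\<And>n. cnorm C_circle (\<sigma> n \<ominus>\<^bsub>C_circle\<^esub> f) \<le> inverse (real (Suc n))"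
    by metis
  have "C_circle.conv \<sigma> f"
    using \<sigma>(1) sub f by (intro C_circle.convI [OF _ _ \<sigma>(2) LIMSEQ_inverse_real_of_nat]) auto
  then show "f \<in> Y" using C_circle.norm_closedD [OF cl] \<sigma>(1) by blast
qed

section \<open>Functional calculus of a unitary\<close>

locale corner_unitary = corner_isometry +
  assumes u_adj_u: "u \<otimes> adj A u = e"
begin

lemma word_Suc_Suc: "word (Suc i, Suc j) = word (i, j)"
proof -
  have "pow (Suc i) = pow i \<otimes> u" "pow (Suc j) = pow j \<otimes> u" for i j
    using pow_add [of i 1] pow_add [of j 1] u_e by simp_all
  then have "word (Suc i, Suc j) = pow i \<otimes> ((u \<otimes> adj A u) \<otimes> adj A (pow j))"
    by (simp add: word_def adj_mult mult_assoc)
  then show ?thesis by (simp add: u_adj_u word_def)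
qed

lemma word_add_add: "word (i + m, j + m) = word (i, j)"
  by (induction m) (simp_all add: word_Suc_Suc)

lemma word_cong: "i + l = k + j \<Longrightarrow> word (i, j) = word (k, l)"
proof (cases "i \<le> k")
  case True
  assume eq: "i + l = k + j"
  then have "k = i + (k - i)" "l = j + (k - i)" using True by auto
  then show ?thesis using word_add_add [of i "k - i" j] by simp
next
  case False
  assume eq: "i + l = k + j"
  then have "i = k + (i - k)" "j = l + (i - k)" using False by auto
  then show ?thesis using word_add_add [of k "i - k" l] by simp
qed

definition upow :: "int \<Rightarrow> 'a" where
  "upow k = word (nat k, nat (- k))"

lemma upow_mult: "upow j \<otimes> upow k = upow (j + k)"
  unfolding upow_def word_mult by (rule word_cong) linarith

lemma adj_upow: "adj A (upow k) = upow (- k)"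
  by (simp add: upow_def adj_word)

lemma upow_1: "upow 1 = u"
  using word_1_0 by (simp add: upow_def)

end

lemma circle_id_apply: "z \<in> circle \<Longrightarrow> circle_id z = z"
  by (simp add: circle_id_def)

interpretation circle: corner_unitary C_circle circle_id "\<lambda>z\<in>circle. 1"
proof
  show "circle_id \<in> carrier C_circle" ..
  show "adj C_circle circle_id \<otimes>\<^bsub>C_circle\<^esub> circle_id = (\<lambda>z\<in>circle. 1)"
    by (rule extensionalityI [of _ circle]) (auto simp: circle_id_def circle_mult_cnj simp del: mem_sphere)
  show "circle_id \<otimes>\<^bsub>C_circle\<^esub> adj C_circle circle_id = (\<lambda>z\<in>circle. 1)"
    by (rule extensionalityI [of _ circle]) (auto simp: circle_id_def circle_mult_cnj simp del: mem_sphere)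
  show "(\<lambda>z\<in>circle. 1) \<otimes>\<^bsub>C_circle\<^esub> circle_id = circle_id"
    by (rule extensionalityI [of _ circle]) (auto simp: circle_id_def)
  show "circle_id \<otimes>\<^bsub>C_circle\<^esub> (\<lambda>z\<in>circle. 1) = circle_id"
    by (rule extensionalityI [of _ circle]) (auto simp: circle_id_def)
qed

lemma circle_pow: "z \<in> circle \<Longrightarrow> circle.pow k z = z ^ k"
  by (induction k) (simp_all add: circle_id_apply)

lemma circle_upow: "z \<in> circle \<Longrightarrow> circle.upow k z = z powi k"
proof -
  assume z: "z \<in> circle"
  have inv: "cnj z = inverse z"
    using z by (intro inverse_unique [symmetric]) (rule circle_mult_cnj)
  show ?thesis
    using z by (cases "0 \<le> k") (simp_all add: circle.upow_def circle.word_def circle_pow power_int_def inv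
      del: C_circle_simps(5) add: C_circle_simps)
qed

text \<open>The coefficients of a Laurent polynomial are its Fourier coefficients.\<close>

lemma laurent_coefficient_le:
  assumes "combo C_circle B circle.upow n deg N c f b"
  shows "cmod (c k) \<le> 1 * cnorm C_circle f"
proof -
  have f: "f \<in> carrier C_circle \<and>
      ((\<lambda>t. f (cis t) * cis (- of_int k * t)) has_integral of_real (2 * pi) * c k) {0..2 * pi}"
    using assms
  proof (induction rule: combo.induct)
    case combo_zero
    have eq: "(\<lambda>t. \<zero>\<^bsub>C_circle\<^esub> (cis t) * cis (- of_int k * t)) = (\<lambda>t. 0)" by auto
    show ?case unfolding eq by (intro conjI C_circle_zero_closed) simp
  next
    case (combo_step c f b i s)
    let ?a = "\<lambda>t. f (cis t) * cis (- of_int k * t)"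
    have "(\<lambda>t. (f \<oplus>\<^bsub>C_circle\<^esub> s \<odot>\<^bsub>C_circle\<^esub> circle.upow i) (cis t) * cis (- of_int k * t))
        = (\<lambda>t. ?a t + s * cis (of_int (i - k) * t))"
    proof
      fix t
      have "cis (of_int i * t) * cis (- of_int k * t) = cis (of_int (i - k) * t)"
        by (simp add: cis_mult algebra_simps)
      then show "(f \<oplus>\<^bsub>C_circle\<^esub> s \<odot>\<^bsub>C_circle\<^esub> circle.upow i) (cis t) * cis (- of_int k * t)
          = ?a t + s * cis (of_int (i - k) * t)"
        by (simp add: circle_upow cis_power_int distrib_right mult.assoc)
    qed
    moreover have "((\<lambda>t. ?a t + s * cis (of_int (i - k) * t)) has_integral
        of_real (2 * pi) * c k + s * (if i - k = 0 then complex_of_real (2 * pi) else 0)) {0..2 * pi}"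
      using combo_step.IH by (intro has_integral_add has_integral_mult_right has_integral_cis) blast
    moreover have "of_real (2 * pi) * c k + s * (if i - k = 0 then complex_of_real (2 * pi) else 0)
        = of_real (2 * pi) * (c(i := c i + s)) k"
      by (simp add: algebra_simps)
    moreover have "f \<oplus>\<^bsub>C_circle\<^esub> s \<odot>\<^bsub>C_circle\<^esub> circle.upow i \<in> carrier C_circle"
      using combo_step.IH unfolding circle.upow_def
      by (intro C_circle.M.a_closed C_circle.scale_closed circle.word_closed) blast
    ultimately show ?case by (simp only: simp_thms)
  qed
  have "cmod (of_real (2 * pi) * c k) \<le> cnorm C_circle f * measure lborel {0..2 * pi}"
  proof (rule has_integral_bound_real)
    show "((\<lambda>t. f (cis t) * cis (- of_int k * t)) has_integral of_real (2 * pi) * c k) {0..2 * pi}"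
      using f by blast
    show "0 \<le> cnorm C_circle f" using f C_circle.cnorm_nonneg by blast
    show "cmod (f (cis t) * cis (- of_int k * t)) \<le> cnorm C_circle f" if "t \<in> {0..2 * pi} - {}" for t
      using C_circle_norm_bound [of f "cis t"] f by (simp add: norm_mult)
  qed simp
  then have "2 * pi * cmod (c k) \<le> 2 * pi * cnorm C_circle f"
    by (simp add: norm_mult mult.commute)
  then show ?thesis by simp
qed

lemma finite_abs_le: "finite {k :: int. nat \<bar>k\<bar> \<le> N}"
  and card_abs_le: "card {k :: int. nat \<bar>k\<bar> \<le> N} \<le> 2 * (N + 1)\<^sup>2"
proof -
  have eq: "{k :: int. nat \<bar>k\<bar> \<le> N} = {- int N..int N}" by auto
  show "finite {k :: int. nat \<bar>k\<bar> \<le> N}" unfolding eq by simp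
  have "card {- int N..int N} = 2 * N + 1" by simp
  also have "\<dots> \<le> 2 * (N + 1)\<^sup>2" by (simp add: power2_eq_square algebra_simps)
  finally show "card {k :: int. nat \<bar>k\<bar> \<le> N} \<le> 2 * (N + 1)\<^sup>2" unfolding eq .
qed

context corner_unitary
begin

lemma comparable_laurent:
  "comparable_families C_circle A circle.upow upow (\<lambda>k. nat \<bar>k\<bar>) 1"
proof unfold_locales
  fix i j :: int
  show "\<exists>k. nat \<bar>k\<bar> \<le> nat \<bar>i\<bar> + nat \<bar>j\<bar> \<and> circle.upow k = circle.upow i \<otimes>\<^bsub>C_circle\<^esub> circle.upow j
      \<and> upow k = upow i \<otimes> upow j"
    unfolding circle.upow_mult upow_mult by (rule exI [of _ "i + j"]) auto
  show "\<exists>k. nat \<bar>k\<bar> \<le> nat \<bar>i\<bar> \<and> circle.upow k = adj C_circle (circle.upow i) \<and> upow k = adj A (upow i)"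
    unfolding circle.adj_upow adj_upow by (rule exI [of _ "- i"]) auto
next
  fix N c a b i assume "combo C_circle A circle.upow upow (\<lambda>k. nat \<bar>k\<bar>) N c a b"
  then show "cmod (c i) \<le> 1 * cnorm C_circle a" by (rule laurent_coefficient_le)
next
  show "circle.upow i \<in> carrier C_circle" for i unfolding circle.upow_def by (rule circle.word_closed)
  show "upow i \<in> carrier A" "cnorm A (upow i) \<le> 1" for i
    unfolding upow_def by (rule word_closed cnorm_word_le)+
qed (rule finite_abs_le card_abs_le)+

lemma ex_star_hom_C_circle:
  obtains \<phi> where "star_hom C_circle A \<phi>" "\<phi> circle_id = u"
proof -
  interpret F: comparable_families C_circle A circle.upow upow "\<lambda>k. nat \<bar>k\<bar>" 1
    by (rule comparable_laurent)
  have "circle_id \<in> F.closed_span"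
    using F.family_in_closed_span [of 1] unfolding circle.upow_1 .
  then have "carrier C_circle \<subseteq> F.closed_span"
    by (rule C_circle_generated [OF F.cstar_subalgebra_closed_span])
  moreover have "F.closed_span \<subseteq> carrier C_circle"
    using F.cstar_subalgebra_closed_span by (simp add: cstar_subalgebra_def linear_subspace_def)
  ultimately have "F.closed_span = carrier C_circle" by (rule antisym [rotated])
  then have eq: "C_circle\<lparr>carrier := F.closed_span\<rparr> = C_circle" by simp
  obtain \<phi> where \<phi>: "star_hom (C_circle\<lparr>carrier := F.closed_span\<rparr>) A \<phi>" "\<And>i. \<phi> (circle.upow i) = upow i"
    using F.ex_star_hom_closed_span by blast
  show thesis
  proof (rule that [of \<phi>])
    show "star_hom C_circle A \<phi>" using \<phi>(1) unfolding eq .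
    show "\<phi> circle_id = u" using \<phi>(2) [of 1] unfolding upow_1 circle.upow_1 .
  qed
qed

end

lemma laurent_polynomials_dense:
  assumes "linear_subspace C_circle Y" "norm_closed C_circle Y" "\<And>k. circle.upow k \<in> Y"
  shows "carrier C_circle \<subseteq> Y"
proof -
  interpret F: comparable_families C_circle C_circle circle.upow circle.upow "\<lambda>k. nat \<bar>k\<bar>" 1
    by (rule circle.comparable_laurent)
  have "circle_id \<in> F.closed_span"
    using F.family_in_closed_span [of 1] unfolding circle.upow_1 .
  then have "carrier C_circle \<subseteq> F.closed_span"
    by (rule C_circle_generated [OF F.cstar_subalgebra_closed_span])
  then show ?thesis using F.closed_span_minimal [OF assms] by (rule subset_trans)
qed

text \<open>By Stone--Weierstrass the identity function generates.\<close>

lemma star_homs_C_circle_agree: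
  assumes B: "cstar_algebra B" and \<phi>: "star_hom C_circle B \<phi>" and \<psi>: "star_hom C_circle B \<psi>"
    and eq: "\<phi> circle_id = \<psi> circle_id" and f: "f \<in> carrier C_circle"
  shows "\<phi> f = \<psi> f"
proof -
  have "carrier C_circle \<subseteq> cstar_generated C_circle {circle_id}"
    by (rule C_circle_generated [OF C_circle.cstar_subalgebra_generated])
       (use C_circle.cstar_generated_superset [of "{circle_id}"] in simp_all)
  then have "f \<in> cstar_generated C_circle {circle_id}" using f by blast
  then show ?thesis
    by (rule star_homs_agree_on_generated [OF cstar_algebra_C_circle B \<phi> \<psi>, rotated 2]) (simp_all add: eq)
qed

lemma circle_calculus_props:
  assumes "corner_unitary B u e"
  shows "star_hom C_circle B (circle_calculus B u) \<and> circle_calculus B u circle_id = u"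
proof -
  interpret corner_unitary B u e by fact
  obtain \<phi> where \<phi>: "star_hom C_circle B \<phi>" "\<phi> circle_id = u"
    by (rule ex_star_hom_C_circle)
  let ?P = "\<lambda>\<phi>. \<phi> \<in> extensional (carrier C_circle) \<and> star_hom C_circle B \<phi> \<and> \<phi> circle_id = u"
  have "?P (circle_calculus B u)"
    unfolding circle_calculus_def circle_id_def [symmetric]
  proof (rule theI [of ?P "restrict \<phi> (carrier C_circle)"])
    have "star_hom C_circle B (restrict \<phi> (carrier C_circle))"
      using \<phi>(1) unfolding star_hom_def
      by (simp add: C_circle.mult_closed C_circle.adj_closed C_circle.scale_closed C_circle.M.a_closed Pi_iff
          del: C_circle_simps)
    then show "?P (restrict \<phi> (carrier C_circle))" by (simp add: \<phi>(2))
  next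
    fix \<psi> assume \<psi>: "?P \<psi>"
    have "\<psi> f = \<phi> f" if "f \<in> carrier C_circle" for f
    proof (rule star_homs_C_circle_agree [OF cstar_algebra_axioms _ \<phi>(1) _ that])
      show "star_hom C_circle B \<psi>" using \<psi> by blast
      show "\<psi> circle_id = \<phi> circle_id" using \<psi> \<phi>(2) by simp
    qed
    then show "\<psi> = restrict \<phi> (carrier C_circle)"
      using \<psi> by (intro extensionalityI [of _ "carrier C_circle"]) simp_all
  qed
  then show ?thesis by blast
qed

lemma (in corner_isometry) hom_word:
  assumes \<phi>: "star_hom A B \<phi>" and v: "corner_isometry B v f" and uv: "\<phi> u = v"
  shows "\<phi> (word i) = corner_isometry.word B v f i"
proof -
  interpret v: corner_isometry B v f by fact
  interpret h: cstar_hom A B \<phi> using \<phi> by unfold_locales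
  have e: "\<phi> e = f"
    unfolding adj_u_u [symmetric] v.adj_u_u [symmetric] by (simp add: h.hom_mult h.hom_adj uv)
  have p: "\<phi> (pow k) = v.pow k" for k
    by (induction k) (simp_all add: e uv h.hom_mult)
  show ?thesis
    by (cases i) (simp add: word_def v.word_def h.hom_mult h.hom_adj p)
qed

text \<open>A bounded linear map is controlled by its values on the powers of the identity function. It is used for maps that are
  not multiplicative, such as the passage from a symbol to its Toeplitz operator.\<close>

lemma contraction_on_C_circle_range:
  assumes B: "cstar_algebra B" and Y: "linear_subspace B Y" "norm_closed B Y"
    and L: "\<And>f. f \<in> carrier C_circle \<Longrightarrow> L f \<in> carrier B"
      "\<And>f g. \<lbrakk>f \<in> carrier C_circle; g \<in> carrier C_circle\<rbrakk> \<Longrightarrow> L (f \<oplus>\<^bsub>C_circle\<^esub> g) = L f \<oplus>\<^bsub>B\<^esub> L g"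
      "\<And>c f. f \<in> carrier C_circle \<Longrightarrow> L (c \<odot>\<^bsub>C_circle\<^esub> f) = c \<odot>\<^bsub>B\<^esub> L f"
      "\<And>f. f \<in> carrier C_circle \<Longrightarrow> cnorm B (L f) \<le> K * cnorm C_circle f"
    and gen: "\<And>k. L (circle.upow k) \<in> Y" and f: "f \<in> carrier C_circle"
  shows "L f \<in> Y"
proof -
  interpret B: cstar_algebra B by fact
  have YB: "Y \<subseteq> carrier B" and ops: "\<zero>\<^bsub>B\<^esub> \<in> Y" "\<And>x y. \<lbrakk>x \<in> Y; y \<in> Y\<rbrakk> \<Longrightarrow> x \<oplus>\<^bsub>B\<^esub> y \<in> Y"
      "\<And>c x. x \<in> Y \<Longrightarrow> c \<odot>\<^bsub>B\<^esub> x \<in> Y"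
    using Y(1) by (simp_all add: linear_subspace_def)
  let ?Z = "{f \<in> carrier C_circle. L f \<in> Y}"
  have diff: "L (f \<ominus>\<^bsub>C_circle\<^esub> g) = L f \<ominus>\<^bsub>B\<^esub> L g" if "f \<in> carrier C_circle" "g \<in> carrier C_circle" for f g
    unfolding C_circle.diff_eq [OF that] B.diff_eq [OF L(1) [OF that(1)] L(1) [OF that(2)]]
      L(2) [OF that(1) C_circle.scale_closed [OF that(2)]] L(3) [OF that(2)] ..
  have "x \<in> ?Z" if \<sigma>: "\<And>n. \<sigma> n \<in> ?Z" and x: "C_circle.conv \<sigma> x" for \<sigma> x
  proof -
    have c: "\<sigma> n \<in> carrier C_circle" "x \<in> carrier C_circle" for n
      using C_circle.conv_closed [OF x] by blast+
    have "B.conv (\<lambda>n. L (\<sigma> n)) (L x)"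
    proof (rule B.convI)
      show "(\<lambda>n. K * cnorm C_circle (\<sigma> n \<ominus>\<^bsub>C_circle\<^esub> x)) \<longlonglongrightarrow> 0"
        using tendsto_mult_left [OF C_circle.convD [OF x], of K] by simp
      show "cnorm B (L (\<sigma> n) \<ominus>\<^bsub>B\<^esub> L x) \<le> K * cnorm C_circle (\<sigma> n \<ominus>\<^bsub>C_circle\<^esub> x)" for n
        using L(4) [OF C_circle.diff_closed [OF c]] unfolding diff [OF c] .
    qed (rule L(1) c)+
    moreover have "L (\<sigma> n) \<in> Y" for n using \<sigma> by blast
    ultimately have "L x \<in> Y" by (rule B.norm_closedD [OF Y(2), rotated])
    then show ?thesis using c by blast
  qed
  then have "norm_closed C_circle ?Z" unfolding C_circle.norm_closed_iff by blast
  moreover have "linear_subspace C_circle ?Z"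
  proof -
    have "L \<zero>\<^bsub>C_circle\<^esub> = \<zero>\<^bsub>B\<^esub>"
      using L(3) [OF C_circle_zero_closed, of 0] L(1) [OF C_circle_zero_closed]
      by (simp del: C_circle_simps add: C_circle.scale_zero B.scale_0)
    then show ?thesis
      unfolding linear_subspace_def
      using ops by (auto simp: L(2,3) C_circle_zero_closed C_circle.scale_closed C_circle.M.a_closed
          simp del: C_circle_simps)
  qed
  moreover have "circle.upow k \<in> ?Z" for k
    using gen [of k] by (simp add: circle.upow_def circle.word_closed)
  ultimately have "carrier C_circle \<subseteq> ?Z" by (intro laurent_polynomials_dense)
  then show ?thesis using f by blast
qed

interpretation bil: corner_unitary "B_ell2 UNIV" bilateral_shift "pinj_op UNIV UNIV (\<lambda>k. k) 1"
  rewrites "carrier (B_ell2 (UNIV :: int set)) = bounded_operators UNIV"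
proof -
  interpret cstar_algebra "B_ell2 (UNIV :: int set)" by (rule cstar_algebra_B_ell2)
  have sh: "bilateral_shift = pinj_op UNIV UNIV (\<lambda>k. k - 1) 1"
    by (simp add: bilateral_shift_def pinj_op_def)
  have ad: "adj (B_ell2 UNIV) bilateral_shift = pinj_op UNIV UNIV (\<lambda>k :: int. k + 1) 1"
    unfolding sh by (subst adj_pinj_op [of UNIV UNIV UNIV _ "\<lambda>k. k + 1"])
      (auto intro!: bij_betwI [of _ _ _ "\<lambda>k. k + 1"])
  show "corner_unitary (B_ell2 UNIV) bilateral_shift (pinj_op UNIV UNIV (\<lambda>k. k) 1)"
  proof
    show "bilateral_shift \<in> carrier (B_ell2 UNIV)"
      unfolding sh B_ell2_carrier by (rule pinj_op_bounded) (auto simp: inj_on_def)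
  qed (unfold ad, unfold sh, (rule pinj_op_mult; auto simp: inj_on_def)+)
qed simp

interpretation unil: proper_corner_isometry "B_ell2 UNIV" unilateral_shift "pinj_op UNIV UNIV (\<lambda>k. k) 1"
  rewrites "carrier (B_ell2 (UNIV :: nat set)) = bounded_operators UNIV"
proof -
  interpret cstar_algebra "B_ell2 (UNIV :: nat set)" by (rule cstar_algebra_B_ell2)
  have sh: "unilateral_shift = pinj_op UNIV {k. k \<noteq> 0} (\<lambda>k. k - 1) 1"
    by (simp add: unilateral_shift_def pinj_op_def fun_eq_iff restrict_def)
  have ad: "adj (B_ell2 UNIV) unilateral_shift = pinj_op UNIV UNIV Suc 1"
    unfolding sh by (subst adj_pinj_op [of _ UNIV UNIV _ Suc])
      (auto intro!: bij_betwI [of _ _ _ Suc])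
  have inj: "inj_on (\<lambda>k. k - 1) {k :: nat. k \<noteq> 0}" by (auto simp: inj_on_def)
  show "proper_corner_isometry (B_ell2 UNIV) unilateral_shift (pinj_op UNIV UNIV (\<lambda>k. k) 1)"
  proof
    show "unilateral_shift \<in> carrier (B_ell2 UNIV)"
      unfolding sh B_ell2_carrier by (rule pinj_op_bounded [OF _ inj]) simp
    show "adj (B_ell2 UNIV) unilateral_shift \<otimes>\<^bsub>B_ell2 UNIV\<^esub> unilateral_shift = pinj_op UNIV UNIV (\<lambda>k. k) 1"
      unfolding ad unfolding sh by (rule pinj_op_mult [OF _ _ _ inj]) auto
    show "pinj_op UNIV UNIV (\<lambda>k. k) 1 \<otimes>\<^bsub>B_ell2 UNIV\<^esub> unilateral_shift = unilateral_shift"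
      unfolding sh by (rule pinj_op_mult [OF _ _ _ inj _ inj]) auto
    show "unilateral_shift \<otimes>\<^bsub>B_ell2 UNIV\<^esub> pinj_op UNIV UNIV (\<lambda>k. k) 1 = unilateral_shift"
      unfolding sh by (rule pinj_op_mult [OF _ inj _ _ _ inj]) auto
    have d: "delta 0 \<in> ell2 (UNIV :: nat set)" by simp
    have "(unilateral_shift \<otimes>\<^bsub>B_ell2 UNIV\<^esub> adj (B_ell2 UNIV) unilateral_shift) (delta 0) 0 = 0"
      unfolding ad B_ell2_apply(1) [OF d]
      using pinj_op_ell2(1) [OF _ _ d, of UNIV Suc 1] by (simp add: unilateral_shift_def)
    moreover have "pinj_op UNIV UNIV (\<lambda>k. k) 1 (delta (0 :: nat)) 0 = 1"
      unfolding pinj_op_apply [OF d] by (simp add: delta_def)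
    ultimately show "unilateral_shift \<otimes>\<^bsub>B_ell2 UNIV\<^esub> adj (B_ell2 UNIV) unilateral_shift
        \<noteq> pinj_op UNIV UNIV (\<lambda>k. k) 1"
      by (metis zero_neq_one)
  qed
qed simp

lemma bil_pow: "bil.pow k = pinj_op UNIV UNIV (\<lambda>j. j - int k) 1"
proof (induction k)
  case (Suc k)
  have sh: "bilateral_shift = pinj_op UNIV UNIV (\<lambda>k. k - 1) 1"
    by (simp add: bilateral_shift_def pinj_op_def)
  show ?case
    unfolding bil.pow.simps(2) Suc unfolding sh by (rule pinj_op_mult) (auto simp: inj_on_def)
qed simp

lemma adj_bil_pow: "adj (B_ell2 UNIV) (bil.pow k) = pinj_op UNIV UNIV (\<lambda>j. j + int k) 1"
  unfolding bil_pow by (subst adj_pinj_op [of UNIV UNIV UNIV _ "\<lambda>j. j + int k"])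
    (auto intro!: bij_betwI [of _ _ _ "\<lambda>j. j + int k"])

lemma unil_pow: "unil.pow k = pinj_op UNIV {n. k \<le> n} (\<lambda>n. n - k) 1"
proof (induction k)
  case (Suc k)
  have sh: "unilateral_shift = pinj_op UNIV {k. k \<noteq> 0} (\<lambda>k. k - 1) 1"
    by (simp add: unilateral_shift_def pinj_op_def fun_eq_iff restrict_def)
  show ?case
    unfolding unil.pow.simps(2) Suc unfolding sh by (rule pinj_op_mult) (auto simp: inj_on_def)
qed simp

lemma adj_unil_pow: "adj (B_ell2 UNIV) (unil.pow k) = pinj_op UNIV UNIV (\<lambda>n. n + k) 1"
  unfolding unil_pow by (subst adj_pinj_op [of _ UNIV UNIV _ "\<lambda>n. n + k"])
    (auto intro!: bij_betwI [of _ _ _ "\<lambda>n. n + k"])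

definition extend_by_zero :: "(nat \<Rightarrow> complex) \<Rightarrow> int \<Rightarrow> complex" where
  "extend_by_zero \<xi> = (\<lambda>k. if 0 \<le> k then \<xi> (nat k) else 0)"

definition compression :: "int operator \<Rightarrow> nat operator" where
  "compression R = (\<lambda>\<xi>\<in>ell2 UNIV. \<lambda>n. R (extend_by_zero \<xi>) (int n))"

lemma extend_by_zero_ell2:
  assumes \<xi>: "\<xi> \<in> ell2 UNIV"
  shows "extend_by_zero \<xi> \<in> ell2 UNIV" "ell2_norm (extend_by_zero \<xi>) \<le> ell2_norm \<xi>"
proof -
  have le: "l2 (extend_by_zero \<xi>) F \<le> ell2_norm \<xi>" if F: "finite F" for F
  proof -
    have inj: "inj_on nat {k. 0 \<le> k}" by (auto simp: inj_on_def)
    have "(\<Sum>k\<in>F. (cmod (extend_by_zero \<xi> k))\<^sup>2) = (\<Sum>k\<in>F \<inter> {k. 0 \<le> k}. (cmod (\<xi> (nat k)))\<^sup>2)"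
      using F by (intro sum.mono_neutral_cong_right) (auto simp: extend_by_zero_def)
    also have "\<dots> = (\<Sum>k\<in>nat ` (F \<inter> {k. 0 \<le> k}). (cmod (\<xi> k))\<^sup>2)"
      using inj by (subst sum.reindex) (auto intro: inj_on_subset)
    finally have "l2 (extend_by_zero \<xi>) F = l2 \<xi> (nat ` (F \<inter> {k. 0 \<le> k}))"
      by (simp add: L2_set_def)
    also have "\<dots> \<le> ell2_norm \<xi>" using F by (intro l2_le_ell2_norm [OF \<xi>]) simp
    finally show ?thesis .
  qed
  show mem: "extend_by_zero \<xi> \<in> ell2 UNIV" by (rule ell2I [OF _ le]) simp_all
  show "ell2_norm (extend_by_zero \<xi>) \<le> ell2_norm \<xi>" by (rule ell2_norm_leI [OF mem le])
qed

lemma restrict_nat_ell2: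
  assumes \<zeta>: "\<zeta> \<in> ell2 UNIV"
  shows "(\<lambda>n. \<zeta> (int n)) \<in> ell2 UNIV" "ell2_norm (\<lambda>n. \<zeta> (int n)) \<le> ell2_norm \<zeta>"
proof -
  have le: "l2 (\<lambda>n. \<zeta> (int n)) F \<le> ell2_norm \<zeta>" if F: "finite F" for F
  proof -
    have "l2 (\<lambda>n. \<zeta> (int n)) F = l2 \<zeta> (int ` F)"
      by (simp add: L2_set_def sum.reindex)
    then show ?thesis using l2_le_ell2_norm [OF \<zeta>, of "int ` F"] F by simp
  qed
  show mem: "(\<lambda>n. \<zeta> (int n)) \<in> ell2 UNIV" by (rule ell2I [OF _ le]) simp_all
  show "ell2_norm (\<lambda>n. \<zeta> (int n)) \<le> ell2_norm \<zeta>" by (rule ell2_norm_leI [OF mem le])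
qed

lemma compression_apply: "\<xi> \<in> ell2 UNIV \<Longrightarrow> compression R \<xi> = (\<lambda>n. R (extend_by_zero \<xi>) (int n))"
  by (simp add: compression_def)

lemma compression_bounded:
  assumes R: "R \<in> bounded_operators UNIV"
  shows "compression R \<in> bounded_operators UNIV"
    and "cnorm (B_ell2 UNIV) (compression R) \<le> cnorm (B_ell2 UNIV) R"
proof -
  note RD = bounded_operatorsD [OF R]
  have bd: "ell2_norm (compression R \<xi>) \<le> cnorm (B_ell2 UNIV) R * ell2_norm \<xi>" if \<xi>: "\<xi> \<in> ell2 UNIV" for \<xi>
  proof -
    note e = extend_by_zero_ell2 [OF \<xi>]
    have "ell2_norm (compression R \<xi>) \<le> ell2_norm (R (extend_by_zero \<xi>))"
      unfolding compression_apply [OF \<xi>] by (rule restrict_nat_ell2(2) [OF RD(2) [OF e(1)]])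
    also have "\<dots> \<le> cnorm (B_ell2 UNIV) R * ell2_norm (extend_by_zero \<xi>)"
      by (rule B_ell2_norm_bound [OF R e(1)])
    also have "\<dots> \<le> cnorm (B_ell2 UNIV) R * ell2_norm \<xi>"
      by (rule mult_left_mono [OF e(2) B_ell2_norm_nonneg [OF R]])
    finally show ?thesis .
  qed
  show "compression R \<in> bounded_operators UNIV"
  proof (rule bounded_operatorsI [OF _ _ _ _ bd])
    show "compression R \<in> extensional (ell2 UNIV)" by (simp add: compression_def)
    fix \<xi> \<eta> :: "nat \<Rightarrow> complex" and c assume \<xi>: "\<xi> \<in> ell2 UNIV"
    note e = extend_by_zero_ell2(1) [OF \<xi>]
    show "compression R \<xi> \<in> ell2 UNIV"
      unfolding compression_apply [OF \<xi>] by (rule restrict_nat_ell2(1) [OF RD(2) [OF e]])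
    have "extend_by_zero (\<lambda>i. c * \<xi> i) = (\<lambda>k. c * extend_by_zero \<xi> k)"
      by (auto simp: extend_by_zero_def)
    then show "compression R (\<lambda>i. c * \<xi> i) = (\<lambda>i. c * compression R \<xi> i)"
      by (simp add: compression_apply \<xi> ell2_scale RD(4) e)
    assume \<eta>: "\<eta> \<in> ell2 UNIV"
    have "extend_by_zero (\<lambda>i. \<xi> i + \<eta> i) = (\<lambda>k. extend_by_zero \<xi> k + extend_by_zero \<eta> k)"
      by (auto simp: extend_by_zero_def)
    then show "compression R (\<lambda>i. \<xi> i + \<eta> i) = (\<lambda>i. compression R \<xi> i + compression R \<eta> i)"
      by (simp add: compression_apply \<xi> \<eta> ell2_add RD(3) e extend_by_zero_ell2(1))
  qed
  show "cnorm (B_ell2 UNIV) (compression R) \<le> cnorm (B_ell2 UNIV) R"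
    by (rule B_ell2_norm_le [OF B_ell2_norm_nonneg [OF R] bd])
qed

lemma compression_add:
  assumes R: "R \<in> bounded_operators UNIV" and Q: "Q \<in> bounded_operators UNIV"
  shows "compression (R \<oplus>\<^bsub>B_ell2 UNIV\<^esub> Q) = compression R \<oplus>\<^bsub>B_ell2 UNIV\<^esub> compression Q"
  by (rule bounded_operators_eqI [OF compression_bounded(1) [OF B_ell2_add_closed(1) [OF R Q]]
        B_ell2_add_closed(1) [OF compression_bounded(1) [OF R] compression_bounded(1) [OF Q]]])
     (simp add: B_ell2_apply compression_apply extend_by_zero_ell2(1))

lemma compression_scale:
  assumes R: "R \<in> bounded_operators UNIV"
  shows "compression (c \<odot>\<^bsub>B_ell2 UNIV\<^esub> R) = c \<odot>\<^bsub>B_ell2 UNIV\<^esub> compression R"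
  by (rule bounded_operators_eqI [OF compression_bounded(1) [OF B_ell2_scale_closed(1) [OF R]]
        B_ell2_scale_closed(1) [OF compression_bounded(1) [OF R]]])
     (simp add: B_ell2_apply compression_apply extend_by_zero_ell2(1))

text \<open>The compression of a power of the bilateral shift is a power of the unilateral shift or of its
  adjoint; it is this fact that places Toeplitz operators in the Toeplitz algebra.\<close>

lemma compression_bil_upow: "compression (bil.upow k) = unil.word (nat k, nat (- k))"
proof -
  have fst: "compression (bil.pow i) = unil.pow i" for i
  proof (rule bounded_operators_eqI)
    fix \<xi> :: "nat \<Rightarrow> complex" assume \<xi>: "\<xi> \<in> ell2 UNIV"
    show "compression (bil.pow i) \<xi> = unil.pow i \<xi>"
      unfolding compression_apply [OF \<xi>] bil_pow unil_pow pinj_op_apply [OF \<xi>]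
        pinj_op_apply [OF extend_by_zero_ell2(1) [OF \<xi>]]
      by (auto simp: extend_by_zero_def fun_eq_iff nat_diff_distrib)
  qed (use compression_bounded(1) [OF bil.pow_closed] unil.pow_closed in simp_all)
  have snd: "compression (adj (B_ell2 UNIV) (bil.pow i)) = adj (B_ell2 UNIV) (unil.pow i)" for i
  proof (rule bounded_operators_eqI)
    fix \<xi> :: "nat \<Rightarrow> complex" assume \<xi>: "\<xi> \<in> ell2 UNIV"
    show "compression (adj (B_ell2 UNIV) (bil.pow i)) \<xi> = adj (B_ell2 UNIV) (unil.pow i) \<xi>"
      unfolding compression_apply [OF \<xi>] adj_bil_pow adj_unil_pow pinj_op_apply [OF \<xi>]
        pinj_op_apply [OF extend_by_zero_ell2(1) [OF \<xi>]]
      by (auto simp: extend_by_zero_def fun_eq_iff nat_add_distrib)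
  qed (use compression_bounded(1) [OF B_ell2_adj_closed [OF bil.pow_closed]]
      B_ell2_adj_closed [OF unil.pow_closed] in simp_all)
  show ?thesis
  proof (cases "0 \<le> k")
    case True
    then show ?thesis by (simp add: bil.upow_def bil.word_def unil.word_def fst)
  next
    case False
    then show ?thesis by (simp add: bil.upow_def bil.word_def unil.word_def snd)
  qed
qed

definition toeplitz :: "(complex \<Rightarrow> complex) \<Rightarrow> nat operator" where
  "toeplitz f = compression (circle_calculus (B_ell2 UNIV) bilateral_shift f)"

lemma toeplitz_operator_eq: "toeplitz_operator f = toeplitz (restrict f circle)"
  by (simp add: toeplitz_operator_def toeplitz_def compression_def functional_calculus_def
      extend_by_zero_def)

lemma toeplitz_props:
  shows "f \<in> carrier C_circle \<Longrightarrow> toeplitz f \<in> bounded_operators UNIV"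
    and "\<lbrakk>f \<in> carrier C_circle; g \<in> carrier C_circle\<rbrakk>
      \<Longrightarrow> toeplitz (f \<oplus>\<^bsub>C_circle\<^esub> g) = toeplitz f \<oplus>\<^bsub>B_ell2 UNIV\<^esub> toeplitz g"
    and "f \<in> carrier C_circle \<Longrightarrow> toeplitz (c \<odot>\<^bsub>C_circle\<^esub> f) = c \<odot>\<^bsub>B_ell2 UNIV\<^esub> toeplitz f"
    and "f \<in> carrier C_circle \<Longrightarrow> cnorm (B_ell2 UNIV) (toeplitz f) \<le> cnorm C_circle f"
    and "toeplitz (circle.upow k) = unil.word (nat k, nat (- k))"
proof -
  let ?\<Phi> = "circle_calculus (B_ell2 UNIV) bilateral_shift"
  have \<Phi>: "star_hom C_circle (B_ell2 UNIV) ?\<Phi>" "?\<Phi> circle_id = bilateral_shift"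
    using circle_calculus_props [OF bil.corner_unitary_axioms] by blast+
  interpret \<Phi>: cstar_hom C_circle "B_ell2 UNIV" ?\<Phi>
    by (intro cstar_hom.intro cstar_hom_axioms.intro cstar_algebra_C_circle cstar_algebra_B_ell2 \<Phi>)
  have bd: "?\<Phi> f \<in> bounded_operators UNIV" if "f \<in> carrier C_circle" for f
    using \<Phi>.hom_closed [OF that] by simp
  show "toeplitz f \<in> bounded_operators UNIV" if "f \<in> carrier C_circle"
    unfolding toeplitz_def by (rule compression_bounded(1) [OF bd [OF that]])
  show "toeplitz (f \<oplus>\<^bsub>C_circle\<^esub> g) = toeplitz f \<oplus>\<^bsub>B_ell2 UNIV\<^esub> toeplitz g"
    if "f \<in> carrier C_circle" "g \<in> carrier C_circle"
    unfolding toeplitz_def \<Phi>.hom_add [OF that] by (rule compression_add [OF bd [OF that(1)] bd [OF that(2)]])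
  show "toeplitz (c \<odot>\<^bsub>C_circle\<^esub> f) = c \<odot>\<^bsub>B_ell2 UNIV\<^esub> toeplitz f" if "f \<in> carrier C_circle"
    unfolding toeplitz_def \<Phi>.hom_scale [OF that] by (rule compression_scale [OF bd [OF that]])
  show "cnorm (B_ell2 UNIV) (toeplitz f) \<le> cnorm C_circle f" if "f \<in> carrier C_circle"
    unfolding toeplitz_def
    using compression_bounded(2) [OF bd [OF that]] \<Phi>.contractive [OF that] by linarith
  have "?\<Phi> (circle.upow k) = bil.upow k"
    unfolding circle.upow_def bil.upow_def
    by (rule circle.hom_word [OF \<Phi>(1) bil.corner_isometry_axioms \<Phi>(2)])
  then show "toeplitz (circle.upow k) = unil.word (nat k, nat (- k))"
    unfolding toeplitz_def by (simp only: compression_bil_upow)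
qed

lemma toeplitz_mem_toeplitz_algebra:
  assumes "f \<in> carrier C_circle" shows "toeplitz f \<in> carrier toeplitz_algebra"
proof -
  have "cstar_subalgebra (B_ell2 UNIV) (cstar_generated (B_ell2 UNIV) {unilateral_shift})"
    by (rule unil.cstar_subalgebra_generated) (use unil.u_closed in simp)
  then have Y: "linear_subspace (B_ell2 UNIV) (cstar_generated (B_ell2 UNIV) {unilateral_shift})"
      "norm_closed (B_ell2 UNIV) (cstar_generated (B_ell2 UNIV) {unilateral_shift})"
    by (simp_all add: cstar_subalgebra_def)
  have "toeplitz f \<in> cstar_generated (B_ell2 UNIV) {unilateral_shift}"
  proof (rule contraction_on_C_circle_range [OF cstar_algebra_B_ell2 Y, where K = 1, OF _ _ _ _ _ assms])
    show "toeplitz (circle.upow k) \<in> cstar_generated (B_ell2 UNIV) {unilateral_shift}" for k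
      unfolding toeplitz_props(5) by (rule unil.word_in_generated)
    show "toeplitz g \<in> carrier (B_ell2 UNIV)" if "g \<in> carrier C_circle" for g
      using toeplitz_props(1) [OF that] by simp
    show "cnorm (B_ell2 UNIV) (toeplitz g) \<le> 1 * cnorm C_circle g" if "g \<in> carrier C_circle" for g
      using toeplitz_props(4) [OF that] by simp
  qed (rule toeplitz_props(2,3); assumption)+
  then show ?thesis by (simp add: toeplitz_algebra_def Cstar_of_def)
qed

lemma coburn_iso_props:
  assumes "proper_corner_isometry A u e"
  shows "star_iso toeplitz_algebra (Cstar_of A {u}) (coburn_iso A u) \<and> coburn_iso A u unilateral_shift = u"
  unfolding coburn_iso_def
  using theI' [OF coburn [OF unil.proper_corner_isometry_axioms assms]]
  unfolding toeplitz_algebra_def [symmetric] by blast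

text \<open>In a representation of the Toeplitz algebra that sends the shift to a scalar of modulus one,
  Toeplitz operators act by the value of the symbol.\<close>

lemma star_hom_toeplitz_eval:
  assumes B: "cstar_algebra B" and \<rho>: "star_hom toeplitz_algebra B \<rho>"
    and shift: "\<rho> unilateral_shift = z \<odot>\<^bsub>B\<^esub> P" and z: "z \<in> circle"
    and P: "P \<in> carrier B" "adj B P = P" "P \<otimes>\<^bsub>B\<^esub> P = P"
    and f: "f \<in> carrier C_circle"
  shows "\<rho> (toeplitz f) = f z \<odot>\<^bsub>B\<^esub> P"
proof -
  interpret B: cstar_algebra B by fact
  have uc: "{unilateral_shift} \<subseteq> bounded_operators UNIV" using unil.u_closed by simp
  have T: "cstar_algebra toeplitz_algebra"
    unfolding toeplitz_algebra_def by (rule unil.cstar_algebra_Cstar_of [OF uc])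
  interpret \<rho>: cstar_hom toeplitz_algebra B \<rho>
    by (intro cstar_hom.intro cstar_hom_axioms.intro T B \<rho>)
  have car: "carrier toeplitz_algebra = cstar_generated (B_ell2 UNIV) {unilateral_shift}"
    and ops: "\<And>x y. x \<otimes>\<^bsub>toeplitz_algebra\<^esub> y = x \<otimes>\<^bsub>B_ell2 UNIV\<^esub> y"
      "\<And>x y. x \<oplus>\<^bsub>toeplitz_algebra\<^esub> y = x \<oplus>\<^bsub>B_ell2 UNIV\<^esub> y"
      "\<And>c x. c \<odot>\<^bsub>toeplitz_algebra\<^esub> x = c \<odot>\<^bsub>B_ell2 UNIV\<^esub> x"
      "\<And>x. adj toeplitz_algebra x = adj (B_ell2 UNIV) x" "\<And>x. cnorm toeplitz_algebra x = cnorm (B_ell2 UNIV) x"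
    by (simp_all add: toeplitz_algebra_def Cstar_of_def)
  have word_c: "unil.word i \<in> carrier toeplitz_algebra" for i
    unfolding car by (rule unil.word_in_generated)
  have w00: "unil.word (0, 0) = pinj_op UNIV UNIV (\<lambda>k. k) 1"
    using unil.e_e unil.adj_e by (simp add: unil.word_def)
  have pow: "unil.pow k = unil.word (k, 0)" for k
    using unil.pow_e unil.adj_e by (simp add: unil.word_def)
  have pow_c: "unil.pow k \<in> carrier toeplitz_algebra" for k
    unfolding pow by (rule word_c)
  have u_c: "unilateral_shift \<in> carrier toeplitz_algebra"
    using word_c [of "(Suc 0, 0)"] unfolding unil.word_1_0 .
  have zz: "cnj z * z = 1" "z * cnj z = 1" using circle_mult_cnj [OF z] by blast+
  have \<rho>_pow: "\<rho> (unil.pow k) = z ^ k \<odot>\<^bsub>B\<^esub> P" for k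
  proof (induction k)
    case 0
    have "\<rho> (unil.pow 0) = \<rho> (adj toeplitz_algebra unilateral_shift \<otimes>\<^bsub>toeplitz_algebra\<^esub> unilateral_shift)"
      unfolding ops unil.adj_u_u by simp
    also have "\<dots> = adj B (z \<odot>\<^bsub>B\<^esub> P) \<otimes>\<^bsub>B\<^esub> (z \<odot>\<^bsub>B\<^esub> P)"
      unfolding \<rho>.hom_mult [OF \<rho>.A.adj_closed [OF u_c] u_c] \<rho>.hom_adj [OF u_c] shift ..
    also have "\<dots> = P"
      using P zz by (simp add: B.adj_smult B.mult_smult_left B.mult_smult_right)
    finally show ?case using P by simp
  next
    case (Suc k)
    have "\<rho> (unil.pow (Suc k)) = \<rho> (unilateral_shift \<otimes>\<^bsub>toeplitz_algebra\<^esub> unil.pow k)"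
      unfolding ops by simp
    also have "\<dots> = (z \<odot>\<^bsub>B\<^esub> P) \<otimes>\<^bsub>B\<^esub> (z ^ k \<odot>\<^bsub>B\<^esub> P)"
      unfolding \<rho>.hom_mult [OF u_c pow_c] shift Suc ..
    also have "\<dots> = z ^ Suc k \<odot>\<^bsub>B\<^esub> P"
      using P by (simp add: B.mult_smult_left B.mult_smult_right mult.commute)
    finally show ?case .
  qed
  have \<rho>_word: "\<rho> (unil.word (i, j)) = (z ^ i * cnj (z ^ j)) \<odot>\<^bsub>B\<^esub> P" for i j
  proof -
    have "\<rho> (unil.word (i, j)) = \<rho> (unil.pow i \<otimes>\<^bsub>toeplitz_algebra\<^esub> adj toeplitz_algebra (unil.pow j))"
      unfolding ops unil.word_def by simp
    also have "\<dots> = (z ^ i \<odot>\<^bsub>B\<^esub> P) \<otimes>\<^bsub>B\<^esub> adj B (z ^ j \<odot>\<^bsub>B\<^esub> P)"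
      unfolding \<rho>.hom_mult [OF pow_c \<rho>.A.adj_closed [OF pow_c]] \<rho>.hom_adj [OF pow_c] \<rho>_pow ..
    also have "\<dots> = (z ^ i * cnj (z ^ j)) \<odot>\<^bsub>B\<^esub> P"
      using P by (simp add: B.adj_smult B.mult_smult_left B.mult_smult_right mult.commute)
    finally show ?thesis .
  qed
  define L where "L g = \<rho> (toeplitz g) \<ominus>\<^bsub>B\<^esub> g z \<odot>\<^bsub>B\<^esub> P" for g
  note tm = toeplitz_mem_toeplitz_algebra
  have \<rho>c: "\<rho> (toeplitz g) \<in> carrier B" if "g \<in> carrier C_circle" for g
    using tm [OF that] by (rule \<rho>.hom_closed)
  have "L f \<in> {\<zero>\<^bsub>B\<^esub>}"
  proof (rule contraction_on_C_circle_range [OF B, where K = 2, OF _ _ _ _ _ _ _ f])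
    show "linear_subspace B {\<zero>\<^bsub>B\<^esub>}" by (simp add: linear_subspace_def)
    have "x = \<zero>\<^bsub>B\<^esub>" if "\<forall>n. \<sigma> n \<in> {\<zero>\<^bsub>B\<^esub>}" "B.conv \<sigma> x" for \<sigma> x
    proof -
      have "\<sigma> = (\<lambda>n. \<zero>\<^bsub>B\<^esub>)" using that(1) by auto
      then show ?thesis using B.conv_unique [OF that(2)] B.conv_const [OF B.M.zero_closed] by simp
    qed
    then show "norm_closed B {\<zero>\<^bsub>B\<^esub>}"
      unfolding B.norm_closed_iff by blast
    fix g assume g: "g \<in> carrier C_circle"
    note tg = tm [OF g]
    show "L g \<in> carrier B" unfolding L_def by (intro B.diff_closed \<rho>c g B.scale_closed P)
    show "L (c \<odot>\<^bsub>C_circle\<^esub> g) = c \<odot>\<^bsub>B\<^esub> L g" for c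
      unfolding L_def toeplitz_props(3) [OF g]
      using \<rho>.hom_scale [OF tg, of c] \<rho>c [OF g] P z
      by (simp add: ops B.scale_diff)
    have "cnorm B (L g) \<le> cnorm B (\<rho> (toeplitz g)) + cnorm B (g z \<odot>\<^bsub>B\<^esub> P)"
      unfolding L_def by (intro B.cnorm_diff_le \<rho>c g B.scale_closed P)
    also have "cnorm B (\<rho> (toeplitz g)) \<le> cnorm C_circle g"
      using \<rho>.contractive [OF tg] toeplitz_props(4) [OF g] unfolding ops by linarith
    also have "cnorm B (g z \<odot>\<^bsub>B\<^esub> P) \<le> cnorm C_circle g"
    proof -
      have "cmod (g z) * cnorm B P \<le> cmod (g z) * 1"
        by (intro mult_left_mono B.projection_norm_le_one P) simp
      then show ?thesis using C_circle_norm_bound [OF g z] P by (simp add: B.cnorm_smult)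
    qed
    finally show "cnorm B (L g) \<le> 2 * cnorm C_circle g" by simp
    fix g' assume g': "g' \<in> carrier C_circle"
    note tg' = tm [OF g']
    show "L (g \<oplus>\<^bsub>C_circle\<^esub> g') = L g \<oplus>\<^bsub>B\<^esub> L g'"
      unfolding L_def toeplitz_props(2) [OF g g']
      using \<rho>.hom_add [OF tg tg'] \<rho>c [OF g] \<rho>c [OF g'] P z
      by (simp add: ops B.scale_add_left B.diff_add_diff)
  next
    fix k
    have "circle.upow k z = z ^ nat k * cnj (z ^ nat (- k))"
      using z by (simp add: circle.upow_def circle.word_def circle_pow)
    then show "L (circle.upow k) \<in> {\<zero>\<^bsub>B\<^esub>}"
      using P unfolding L_def toeplitz_props(5) \<rho>_word by simp
  qed
  then show ?thesis
    using B.diff_eq_zero_iff [OF \<rho>c [OF f] B.scale_closed [OF P(1)]] unfolding L_def by simp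
qed

text \<open>Evaluation at \<open>z\<close> times \<open>P\<close> is a homomorphism with the same value on the identity function.\<close>

lemma star_hom_C_circle_eval:
  assumes B: "cstar_algebra B" and \<rho>: "star_hom C_circle B \<rho>"
    and id: "\<rho> circle_id = z \<odot>\<^bsub>B\<^esub> P" and z: "z \<in> circle"
    and P: "P \<in> carrier B" "adj B P = P" "P \<otimes>\<^bsub>B\<^esub> P = P"
    and f: "f \<in> carrier C_circle"
  shows "\<rho> f = f z \<odot>\<^bsub>B\<^esub> P"
proof (rule star_homs_C_circle_agree [OF B \<rho> _ _ f])
  interpret B: cstar_algebra B by fact
  show "star_hom C_circle B (\<lambda>f. f z \<odot>\<^bsub>B\<^esub> P)"
    unfolding star_hom_def
  proof (intro conjI ballI allI)
    show "(\<lambda>f. f z \<odot>\<^bsub>B\<^esub> P) \<in> carrier C_circle \<rightarrow> carrier B"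
      by (intro Pi_I B.scale_closed P)
  next
    fix f g :: "complex \<Rightarrow> complex"
    have "(f \<oplus>\<^bsub>C_circle\<^esub> g) z = f z + g z" "(f \<otimes>\<^bsub>C_circle\<^esub> g) z = f z * g z"
      using z by simp_all
    then show "(f \<oplus>\<^bsub>C_circle\<^esub> g) z \<odot>\<^bsub>B\<^esub> P = f z \<odot>\<^bsub>B\<^esub> P \<oplus>\<^bsub>B\<^esub> g z \<odot>\<^bsub>B\<^esub> P"
      "(f \<otimes>\<^bsub>C_circle\<^esub> g) z \<odot>\<^bsub>B\<^esub> P = (f z \<odot>\<^bsub>B\<^esub> P) \<otimes>\<^bsub>B\<^esub> (g z \<odot>\<^bsub>B\<^esub> P)"
      unfolding B.mult_smult_left [OF P(1) B.scale_closed [OF P(1)]] B.mult_smult_right [OF P(1) P(1)] P(3)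
        B.scale_scale [OF P(1)]
      by (simp_all only: B.scale_add_left [OF P(1)])
  next
    fix f :: "complex \<Rightarrow> complex" and c
    have "(c \<odot>\<^bsub>C_circle\<^esub> f) z = c * f z" "adj C_circle f z = cnj (f z)" using z by simp_all
    then show "(c \<odot>\<^bsub>C_circle\<^esub> f) z \<odot>\<^bsub>B\<^esub> P = c \<odot>\<^bsub>B\<^esub> (f z \<odot>\<^bsub>B\<^esub> P)"
      "adj C_circle f z \<odot>\<^bsub>B\<^esub> P = adj B (f z \<odot>\<^bsub>B\<^esub> P)"
      by (simp_all only: B.scale_scale [OF P(1)] B.adj_smult [OF P(1)] P(2))
  qed
  show "\<rho> circle_id = circle_id z \<odot>\<^bsub>B\<^esub> P" by (simp only: id circle_id_apply [OF z])
qed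

context corner_isometry
begin

lemma corner_unitary_corner:
  assumes "u \<otimes> adj A u = e" shows "corner_unitary (corner A e) u e"
proof -
  show ?thesis
  proof (intro corner_unitary.intro corner_isometry.intro corner_isometry_axioms.intro
      corner_unitary_axioms.intro)
    show "cstar_algebra (corner A e)" by (rule cstar_algebra_corner [OF e_closed e_e adj_e])
    show "u \<in> carrier (corner A e)"
      unfolding carrier_corner [OF e_closed e_e] using e_u u_e u_closed by simp
  qed (simp_all add: corner_def adj_u_u e_u u_e assms)
qed

lemma unitary_calculus_eval:
  assumes un: "u \<otimes> adj A u = e" and \<pi>: "star_hom A B \<pi>" and B: "cstar_algebra B"
    and id: "\<pi> u = z \<odot>\<^bsub>B\<^esub> P" and z: "z \<in> circle"
    and P: "P \<in> carrier B" "adj B P = P" "P \<otimes>\<^bsub>B\<^esub> P = P" and f: "continuous_on circle f"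
  shows "functional_calculus (corner A e) u f \<in> carrier A"
    and "\<pi> (functional_calculus (corner A e) u f) = f z \<odot>\<^bsub>B\<^esub> P"
proof -
  let ?\<phi> = "circle_calculus (corner A e) u"
  have \<phi>: "star_hom C_circle (corner A e) ?\<phi>" "?\<phi> circle_id = u"
    using circle_calculus_props [OF corner_unitary_corner [OF un]] by blast+
  have "star_hom (corner A e) A (\<lambda>x. x)"
    using carrier_corner [OF e_closed e_e] by (simp add: star_hom_def corner_def)
  then have \<phi>A: "star_hom C_circle A ?\<phi>" using star_hom_compose [OF \<phi>(1)] by blast
  note fc = C_circle_restrict [OF f]
  show "functional_calculus (corner A e) u f \<in> carrier A"
    using \<phi>A fc unfolding functional_calculus_def star_hom_def by blast
  have "\<pi> (?\<phi> (restrict f circle)) = restrict f circle z \<odot>\<^bsub>B\<^esub> P"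
    by (rule star_hom_C_circle_eval [OF B star_hom_compose [OF \<phi>A \<pi>] _ z P fc])
       (simp only: \<phi>(2) id)
  then show "\<pi> (functional_calculus (corner A e) u f) = f z \<odot>\<^bsub>B\<^esub> P"
    unfolding functional_calculus_def restrict_apply' [OF z] .
qed

end

lemma toeplitz_calculus_eval:
  assumes u: "proper_corner_isometry A u e" and \<pi>: "star_hom A B \<pi>" and B: "cstar_algebra B"
    and id: "\<pi> u = z \<odot>\<^bsub>B\<^esub> P" and z: "z \<in> circle"
    and P: "P \<in> carrier B" "adj B P = P" "P \<otimes>\<^bsub>B\<^esub> P = P" and f: "continuous_on circle f"
  shows "coburn_iso A u (toeplitz_operator f) \<in> carrier A"
    and "\<pi> (coburn_iso A u (toeplitz_operator f)) = f z \<odot>\<^bsub>B\<^esub> P"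
proof -
  interpret proper_corner_isometry A u e by (rule u)
  note props = coburn_iso_props [OF u, unfolded star_iso_def]
  have \<psi>: "star_hom toeplitz_algebra (Cstar_of A {u}) (coburn_iso A u)" "coburn_iso A u unilateral_shift = u"
    by (rule conjunct1 [OF conjunct1 [OF props]], rule conjunct2 [OF props])
  have uc: "{u} \<subseteq> carrier A" by simp
  have \<psi>A: "star_hom toeplitz_algebra A (coburn_iso A u)"
    by (rule star_hom_compose [OF \<psi>(1) star_hom_inclusion [OF uc]])
  have maps: "coburn_iso A u \<in> carrier toeplitz_algebra \<rightarrow> carrier A"
    using \<psi>A unfolding star_hom_def by (rule conjunct1)
  note fc = C_circle_restrict [OF f]
  show "coburn_iso A u (toeplitz_operator f) \<in> carrier A"
    unfolding toeplitz_operator_eq by (rule funcset_mem [OF maps toeplitz_mem_toeplitz_algebra [OF fc]])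
  have shift: "\<pi> (coburn_iso A u unilateral_shift) = z \<odot>\<^bsub>B\<^esub> P" by (simp only: \<psi>(2) id)
  have "\<pi> (coburn_iso A u (toeplitz (restrict f circle))) = restrict f circle z \<odot>\<^bsub>B\<^esub> P"
    by (rule star_hom_toeplitz_eval [OF B star_hom_compose [OF \<psi>A \<pi>] shift z P fc])
  then show "\<pi> (coburn_iso A u (toeplitz_operator f)) = f z \<odot>\<^bsub>B\<^esub> P"
    by (simp only: toeplitz_operator_eq restrict_apply' [OF z])
qed

section \<open>Containment in the kernels\<close>

context path_class
begin

text \<open>With and without an entrance the representation sends the element \<open>s\<^sub>\<mu>\<close> of the cycle to a scalar
  multiple of a projection, and then both forms of calculus evaluate the function at the scalar. The projection
  is zero if the class does not visit the cycle, in which case the condition on the class is void.\<close>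

lemma tau_elem_rep:
  assumes G: "graph_cstar_algebra E A p s" and h: "continuous_on circle (h (U \<mu>))" and cyc: "is_cycle E \<mu>"
    and uniq: "\<And>y. y \<in> X \<Longrightarrow> head E (y 0) = head E (hd \<mu>) \<Longrightarrow> y = cycle_power \<mu>"
  shows "tau_elem E A p s h U \<mu> \<in> carrier A"
    and "path_rep E A p s x w (tau_elem E A p s h U \<mu>)
      = h (U \<mu>) (w ^ length \<mu>) \<odot>\<^bsub>B_ell2 X\<^esub> Q (head E (hd \<mu>))"
proof -
  note ckA = ck_graphI [OF G]
  let ?u = "path_elem A s \<mu>" and ?P = "Q (head E (hd \<mu>))" and ?z = "w ^ length \<mu>"
  note iso = ck_graph.cycle_corner_isometry [OF ckA cyc]
  note \<pi> = path_rep_props(1) [OF G]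
  note id = path_rep_cycle [OF G cyc uniq]
  have z: "?z \<in> circle" using w by (simp add: norm_power)
  have P: "?P \<in> carrier (B_ell2 X)" "adj (B_ell2 X) ?P = ?P" "?P \<otimes>\<^bsub>B_ell2 X\<^esub> ?P = ?P"
    using Q_mult [of "head E (hd \<mu>)" "head E (hd \<mu>)"] by (simp_all only: B_ell2_carrier Q_bounded adj_Q simp_thms if_True)
  have "tau_elem E A p s h U \<mu> \<in> carrier A \<and>
      path_rep E A p s x w (tau_elem E A p s h U \<mu>) = h (U \<mu>) ?z \<odot>\<^bsub>B_ell2 X\<^esub> ?P"
  proof (cases "cycle_no_entrance E (verts E) \<mu>")
    case True
    note ev = corner_isometry.unitary_calculus_eval [OF iso ck_graph.cycle_no_entrance_unitary [OF ckA True] \<pi>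
        cstar_algebra_B_ell2 id z P h]
    show ?thesis unfolding tau_elem_def if_P [OF True] by (intro conjI ev)
  next
    case False
    have "proper_corner_isometry A ?u (p (head E (hd \<mu>)))"
      by (intro proper_corner_isometry.intro proper_corner_isometry_axioms.intro iso
          ck_graph.cycle_entrance_proper [OF ckA G cyc False])
    note ev = toeplitz_calculus_eval [OF this \<pi> cstar_algebra_B_ell2 id z P h]
    show ?thesis unfolding tau_elem_def if_not_P [OF False] by (intro conjI ev)
  qed
  then show "tau_elem E A p s h U \<mu> \<in> carrier A"
    "path_rep E A p s x w (tau_elem E A p s h U \<mu>) = h (U \<mu>) ?z \<odot>\<^bsub>B_ell2 X\<^esub> ?P" by (rule conjunct1, rule conjunct2)
qed

lemma scale_Q_eq_zero_iff: "c \<odot>\<^bsub>B_ell2 X\<^esub> Q v = \<zero>\<^bsub>B_ell2 X\<^esub> \<longleftrightarrow> c = 0 \<or> v \<notin> class_verts E x"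
proof -
  interpret B: cstar_algebra "B_ell2 X" by (rule cstar_algebra_B_ell2)
  have Q: "Q v \<in> carrier (B_ell2 X)" using Q_bounded by (simp only: B_ell2_carrier)
  have "c \<odot>\<^bsub>B_ell2 X\<^esub> Q v = \<zero>\<^bsub>B_ell2 X\<^esub> \<longleftrightarrow> cmod c * cnorm (B_ell2 X) (Q v) = 0"
    using B.cnorm_eq_0 [OF B.scale_closed [OF Q], of c] B.cnorm_smult [OF Q, of c] by simp
  also have "\<dots> \<longleftrightarrow> c = 0 \<or> Q v = \<zero>\<^bsub>B_ell2 X\<^esub>"
    using B.cnorm_eq_0 [OF Q] by simp
  finally show ?thesis by (simp only: Q_eq_zero_iff)
qed

definition ker where "ker A p s = star_kernel A (B_ell2 X) (path_rep E A p s x w)"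

lemma p_in_ker_iff:
  assumes G: "graph_cstar_algebra E A p s" and v: "v \<in> verts E"
  shows "p v \<in> ker A p s \<longleftrightarrow> v \<notin> class_verts E x"
proof -
  have "p v \<in> carrier A" by (rule ck_graph.p_props(1) [OF ck_graphI [OF G] v])
  then show ?thesis unfolding ker_def star_kernel_def
    by (simp add: path_rep_props(2) [OF G v] Q_eq_zero_iff)
qed

text \<open>If the vertex of the cycle lies in the tail, then the cycle has no entrance in the tail, the image of the
  generator is the value of the function at \<open>z\<close> times a nonzero projection, and the zeros of the function
  are the points off \<open>U \<mu>\<close>. Otherwise the image is zero.\<close>

lemma tau_in_ker_iff:
  assumes G: "graph_cstar_algebra E A p s"
    and h: "continuous_on circle (h (U \<mu>))" "{z \<in> circle. h (U \<mu>) z \<noteq> 0} = U \<mu>"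
    and \<mu>: "\<mu> \<in> cycles_off E H" and disj: "class_verts E x \<inter> H = {}"
  shows "tau_elem E A p s h U \<mu> \<in> ker A p s \<longleftrightarrow>
    (cycle_no_entrance E (class_verts E x) \<mu> \<longrightarrow> w ^ Per E (class_verts E x) \<notin> U \<mu>)"
proof (cases "head E (hd \<mu>) \<in> class_verts E x")
  case True
  have ne: "cycle_no_entrance E (class_verts E x) \<mu>"
    by (rule cycles_off_no_entrance [OF maximal_tail_class_verts [OF x] disj \<mu> True])
  have cyc: "is_cycle E \<mu>" using ne by (simp add: cycle_no_entrance_def)
  have uniq: "y = cycle_power \<mu>" if "y \<in> X" "head E (y 0) = head E (hd \<mu>)" for y
    by (rule no_entrance_class(1) [OF ne that(1) [unfolded X_def] that(2)])
  note t = tau_elem_rep [where h = h and U = U, OF G h(1) cyc uniq]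
  have z: "w ^ length \<mu> \<in> circle" using w by (simp add: norm_power)
  have "tau_elem E A p s h U \<mu> \<in> ker A p s \<longleftrightarrow> h (U \<mu>) (w ^ length \<mu>) = 0"
    unfolding ker_def star_kernel_def using t True by (simp add: scale_Q_eq_zero_iff)
  also have "\<dots> \<longleftrightarrow> w ^ length \<mu> \<notin> U \<mu>"
    using h(2) z by blast
  finally show ?thesis using ne by (simp add: Per_no_entrance [OF ne])
next
  case False
  have cyc: "is_cycle E \<mu>" using \<mu> by (simp add: cycles_off_def cycle_no_entrance_def)
  have ne: "\<not> cycle_no_entrance E (class_verts E x) \<mu>"
  proof
    assume "cycle_no_entrance E (class_verts E x) \<mu>"
    moreover have "hd \<mu> \<in> set \<mu>" using cycleD(1) [OF cyc] by simp
    ultimately show False using False unfolding cycle_no_entrance_def by blast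
  qed
  have uniq: "y = cycle_power \<mu>" if "y \<in> X" "head E (y 0) = head E (hd \<mu>)" for y
    using class_verts_head [of y x 0] that False by (simp add: X_def)
  note t = tau_elem_rep [where h = h and U = U, OF G h(1) cyc uniq]
  show ?thesis
    unfolding ker_def star_kernel_def using t False ne by (simp add: scale_Q_eq_zero_iff)
qed

text \<open>A kernel is a closed ideal, so it suffices to look at generators.\<close>

lemma pair_ideal_subset_ker_iff:
  assumes G: "graph_cstar_algebra E A p s"
    and h: "\<And>V. openin (top_of_set circle) V \<Longrightarrow> V \<noteq> circle \<Longrightarrow>
           continuous_on circle (h V) \<and> {z \<in> circle. h V z \<noteq> 0} = V"
    and HU: "ideal_pair E H U"
  shows "pair_ideal E A p s h H U \<subseteq> ker A p s \<longleftrightarrow> H \<subseteq> verts E - class_verts E x \<and>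
    (\<forall>\<mu>. cycle_no_entrance E (class_verts E x) \<mu> \<and> \<mu> \<in> cycles_off E H \<longrightarrow> w ^ Per E (class_verts E x) \<notin> U \<mu>)"
proof -
  have HV: "H \<subseteq> verts E" and U: "\<And>\<mu>. \<mu> \<in> cycles_off E H \<Longrightarrow> openin (top_of_set circle) (U \<mu>)"
    "\<And>\<mu>. \<mu> \<in> cycles_off E H \<Longrightarrow> U \<mu> \<noteq> circle"
    using HU unfolding ideal_pair_def by blast+
  have A: "cstar_algebra A" using G unfolding graph_cstar_algebra_def by blast
  interpret h: cstar_hom A "B_ell2 X" "path_rep E A p s x w"
    by (intro cstar_hom.intro cstar_hom_axioms.intro A cstar_algebra_B_ell2 path_rep_props(1) [OF G])
  have "pair_ideal E A p s h H U \<subseteq> ker A p s \<longleftrightarrow>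
      p ` H \<union> tau_elem E A p s h U ` cycles_off E H \<subseteq> ker A p s"
    unfolding pair_ideal_def ker_def by (rule ideal_generated_subset_iff [OF h.closed_ideal_kernel])
  also have "\<dots> \<longleftrightarrow> (\<forall>v\<in>H. p v \<in> ker A p s) \<and> (\<forall>\<mu>\<in>cycles_off E H. tau_elem E A p s h U \<mu> \<in> ker A p s)"
    by blast
  also have "(\<forall>v\<in>H. p v \<in> ker A p s) \<longleftrightarrow> class_verts E x \<inter> H = {}"
    using p_in_ker_iff [OF G] HV by blast
  also have "(class_verts E x \<inter> H = {} \<and> (\<forall>\<mu>\<in>cycles_off E H. tau_elem E A p s h U \<mu> \<in> ker A p s)) \<longleftrightarrow>
      class_verts E x \<inter> H = {} \<and> (\<forall>\<mu>\<in>cycles_off E H. cycle_no_entrance E (class_verts E x) \<mu> \<longrightarrow>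
        w ^ Per E (class_verts E x) \<notin> U \<mu>)"
  proof (rule conj_cong [OF refl], rule ball_cong [OF refl])
    fix \<mu> assume disj: "class_verts E x \<inter> H = {}" and \<mu>: "\<mu> \<in> cycles_off E H"
    note hU = h [OF U [OF \<mu>]]
    show "tau_elem E A p s h U \<mu> \<in> ker A p s \<longleftrightarrow>
      (cycle_no_entrance E (class_verts E x) \<mu> \<longrightarrow> w ^ Per E (class_verts E x) \<notin> U \<mu>)"
      by (rule tau_in_ker_iff [where h = h and U = U, OF G conjunct1 [OF hU] conjunct2 [OF hU] \<mu> disj])
  qed
  also have "class_verts E x \<inter> H = {} \<longleftrightarrow> H \<subseteq> verts E - class_verts E x" using HV by blast
  finally show ?thesis by blast
qed

end

lemma circle_root:
  assumes z: "z \<in> circle" and n: "0 < n" shows "\<exists>w\<in>circle. w ^ n = z"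
proof -
  have "cis (Arg z / n) ^ n = cis (Arg z)" using n by (simp add: Complex.DeMoivre)
  also have "cis (Arg z) = z" using z rcis_cmod_Arg [of z] by (simp add: rcis_def)
  finally show ?thesis by (intro bexI [of _ "cis (Arg z / n)"]) simp_all
qed

context row_finite_no_sources
begin

text \<open>The choice in the definition of the ideal is not empty: every maximal tail comes from an infinite path.\<close>

lemma tail_ideal_cases:
  fixes A :: "('a, 'm) cstar_scheme"
  assumes T: "maximal_tail E T" and z: "\<exists>w\<in>circle. z = w ^ Per E T"
  obtains x w where "path_class E x w" "class_verts E x = T" "w ^ Per E T = z"
    "tail_ideal E A p s T z = path_class.ker E x w A p s"
proof -
  define P where "P = (\<lambda>(x, w). x \<in> infinite_paths E \<and> w \<in> circle \<and> class_verts E x = T \<and> w ^ Per E T = z)"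
  obtain x w where xw: "(SOME xw. P xw) = (x, w)" by (cases "SOME xw. P xw")
  obtain x' where x': "x' \<in> infinite_paths E" "class_verts E x' = T"
    by (rule maximal_tail_eq_class_verts [OF T])
  obtain w' where "w' \<in> circle" "z = w' ^ Per E T" using z by blast
  then have "P (x', w')" using x' by (simp add: P_def)
  then have "P (x, w)" unfolding xw [symmetric] by (rule someI)
  then have D: "x \<in> infinite_paths E" "w \<in> circle" "class_verts E x = T" "w ^ Per E T = z"
    by (simp_all add: P_def)
  have pc: "path_class E x w"
    by (rule path_class.intro [OF row_finite_no_sources_axioms path_class_axioms.intro [OF D(1,2)]])
  have "tail_ideal E A p s T z = path_class.ker E x w A p s"
    unfolding tail_ideal_def P_def [symmetric] xw Let_def path_class.ker_def [OF pc] path_class.X_def [OF pc]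
    by simp
  then show thesis by (rule that [OF pc D(3,4)])
qed

text \<open>Off \<open>H\<close> there is always a path representation that kills the ideal: all cycles without
  entrance in a tail share one proper open set, and a point off this set can be used.\<close>

lemma ex_path_class_avoiding:
  assumes HU: "ideal_pair E H U" and v: "v \<in> verts E" "v \<notin> H"
  shows "\<exists>x w. path_class E x w \<and> v \<in> class_verts E x \<and> class_verts E x \<inter> H = {} \<and>
    (\<forall>\<mu>. cycle_no_entrance E (class_verts E x) \<mu> \<and> \<mu> \<in> cycles_off E H \<longrightarrow> w ^ Per E (class_verts E x) \<notin> U \<mu>)"
proof -
  have sat: "saturated E H" and her: "hereditary E H" using HU unfolding ideal_pair_def by blast+
  obtain x where x: "x \<in> infinite_paths E" "head E (x 0) = v" "\<forall>i. head E (x i) \<notin> H"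
    by (rule infinite_path_avoiding [OF sat v])
  define T where "T = class_verts E x"
  have TH: "T \<inter> H = {}" unfolding T_def by (rule class_verts_avoiding [OF her spec [OF x(3)]])
  have vT: "v \<in> T" using class_verts_head [OF tail_class_refl [OF x(1)], of 0] x(2) by (simp add: T_def)
  have pc: "path_class E x w" if "w \<in> circle" for w
    by (rule path_class.intro [OF row_finite_no_sources_axioms path_class_axioms.intro [OF x(1) that]])
  have "\<exists>w\<in>circle. \<forall>\<mu>. cycle_no_entrance E T \<mu> \<and> \<mu> \<in> cycles_off E H \<longrightarrow> w ^ Per E T \<notin> U \<mu>"
  proof (cases "\<exists>\<nu>. cycle_no_entrance E T \<nu> \<and> \<nu> \<in> cycles_off E H")
    case True
    then obtain \<nu> where \<nu>: "cycle_no_entrance E T \<nu>" "\<nu> \<in> cycles_off E H" by blast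
    have open\<nu>: "openin (top_of_set circle) (U \<nu>)" "U \<nu> \<noteq> circle"
      and same: "\<And>\<mu>. \<mu> \<in> cycles_off E H \<Longrightarrow> tail_class E (cycle_power \<mu>) = tail_class E (cycle_power \<nu>) \<Longrightarrow> U \<mu> = U \<nu>"
      using HU \<nu>(2) unfolding ideal_pair_def by blast+
    have "U \<nu> \<subseteq> circle" using openin_imp_subset [OF open\<nu>(1)] .
    then obtain z where z: "z \<in> circle" "z \<notin> U \<nu>" using open\<nu>(2) by blast
    have "0 < length \<nu>" using \<nu>(1) by (simp add: cycle_no_entrance_def is_cycle_def)
    then have "0 < Per E T" using Per_no_entrance [OF \<nu>(1) [unfolded T_def]] by (simp add: T_def)
    then obtain w where w: "w \<in> circle" "w ^ Per E T = z" using circle_root [OF z(1)] by blast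
    have same_class: "tail_class E (cycle_power \<mu>) = tail_class E x" if "cycle_no_entrance E T \<mu>" for \<mu>
      by (rule tail_class_subset [OF no_entrance_class(2) [OF that [unfolded T_def]] x(1)])
    have "U \<mu> = U \<nu>" if "cycle_no_entrance E T \<mu>" "\<mu> \<in> cycles_off E H" for \<mu>
      using same [OF that(2)] same_class [OF that(1)] same_class [OF \<nu>(1)] by simp
    then show ?thesis using w z(2) by (intro bexI [OF _ w(1)]) simp
  next
    case False
    then show ?thesis by (intro bexI [of _ 1]) auto
  qed
  then show ?thesis using pc vT TH unfolding T_def by blast
qed

end

theorem lemma5p2:
  fixes E :: "('v, 'e) pre_digraph"
    and A :: "'a cstar"
    and p :: "'v \<Rightarrow> 'a"
    and s :: "'e \<Rightarrow> 'a"
    and h :: "complex set \<Rightarrow> complex \<Rightarrow> complex"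
    and H :: "'v set"
    and U :: "'e list \<Rightarrow> complex set"
  assumes "row_finite_no_sources E"
    and "graph_cstar_algebra E A p s"
    and "\<And>V. openin (top_of_set circle) V \<Longrightarrow> V \<noteq> circle \<Longrightarrow>
           continuous_on circle (h V) \<and> {z \<in> circle. h V z \<noteq> 0} = V"
    and "ideal_pair E H U"
  shows "(\<forall>T z. maximal_tail E T \<and> z \<in> {w ^ Per E T | w. w \<in> circle} \<longrightarrow>
            (pair_ideal E A p s h H U \<subseteq> tail_ideal E A p s T z \<longleftrightarrow>
              H \<subseteq> verts E - T \<and>
              (cyclic_tail E T \<longrightarrow>
                (\<forall>\<mu>. cycle_no_entrance E T \<mu> \<and> \<mu> \<in> cycles_off E H \<longrightarrow> z \<notin> U \<mu>))))
         \<and> {v \<in> verts E. p v \<in> pair_ideal E A p s h H U} = H"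
proof -
  interpret E: row_finite_no_sources E by fact
  note subset_iff = path_class.pair_ideal_subset_ker_iff [where h = h, OF _ assms(2-4)]
  have tails: "pair_ideal E A p s h H U \<subseteq> tail_ideal E A p s T z \<longleftrightarrow>
      H \<subseteq> verts E - T \<and>
      (cyclic_tail E T \<longrightarrow> (\<forall>\<mu>. cycle_no_entrance E T \<mu> \<and> \<mu> \<in> cycles_off E H \<longrightarrow> z \<notin> U \<mu>))"
    if T: "maximal_tail E T" and z: "z \<in> {w ^ Per E T | w. w \<in> circle}" for T z
  proof -
    have "\<exists>w\<in>circle. z = w ^ Per E T" using z by blast
    then obtain x w where xw: "path_class E x w" "class_verts E x = T" "w ^ Per E T = z"
        "tail_ideal E A p s T z = path_class.ker E x w A p s"
      by (rule E.tail_ideal_cases [OF T])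
    have cyc: "cyclic_tail E T" if "cycle_no_entrance E T \<mu>" for \<mu>
      unfolding cyclic_tail_def using that by (rule exI)
    show ?thesis
      using subset_iff [OF xw(1)] cyc unfolding xw(2-4) by blast
  qed
  have "v \<in> H" if v: "v \<in> verts E" and J: "p v \<in> pair_ideal E A p s h H U" for v
  proof (rule ccontr)
    assume "v \<notin> H"
    then obtain x w where xw: "path_class E x w" "v \<in> class_verts E x" "class_verts E x \<inter> H = {}"
        "\<forall>\<mu>. cycle_no_entrance E (class_verts E x) \<mu> \<and> \<mu> \<in> cycles_off E H \<longrightarrow> w ^ Per E (class_verts E x) \<notin> U \<mu>"
      using E.ex_path_class_avoiding [OF assms(4) v] by blast
    have "H \<subseteq> verts E - class_verts E x" using xw(3) assms(4) unfolding ideal_pair_def by blast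
    then have "pair_ideal E A p s h H U \<subseteq> path_class.ker E x w A p s"
      using subset_iff [OF xw(1)] xw(4) by blast
    then show False using J xw(2) path_class.p_in_ker_iff [OF xw(1) assms(2) v] by blast
  qed
  moreover have "p v \<in> pair_ideal E A p s h H U" if "v \<in> H" for v
    using that unfolding pair_ideal_def ideal_generated_def by blast
  moreover have "H \<subseteq> verts E" using assms(4) unfolding ideal_pair_def by blast
  ultimately have "{v \<in> verts E. p v \<in> pair_ideal E A p s h H U} = H" by blast
  then show ?thesis using tails by blast
qed

end
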